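(* Let $\psi_0:S^2\to G_{k_0}(\mathbb{C}^n)$ be a linearly full holomorphic map, with harmonic sequence $\psi_0,\ldots,\psi_p$, and let $k_j$ be the rank of $\psi_j$. Suppose that the primitive lift $\Psi=(\psi_0,\ldots,\psi_p):S^2\to F_{k_0,\ldots,k_p}$ is an immersion and that there exists at least one $\mathrm{U}(n)$-invariant Riemannian metric $g$ on $F_{k_0,\ldots,k_p}$ with respect to which $\Psi$ has constant curvature (that is, the induced metric $\Psi^*g$ on $S^2$ has constant Gaussian curvature). Then $\Psi$ has constant curvature with respect to all $\mathrm{U}(n)$-invariant Riemannian metrics on $F_{k_0,\ldots,k_p}$. Moreover, each $\psi_j:S^2\to G_{k_j}(\mathbb{C}^n)$, $j\in\{0,\ldots,p\}$, is a minimal immersion of constant curvature and constant Kähler angle.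
   Context: $\mathbb{C}^n$ carries its standard Hermitian inner product, and $S^2=\mathbb{C}\cup\{\infty\}$ is the Riemann sphere. Grassmannian: $G_k(\mathbb{C}^n)$ is the Grassmannian of $k$-dimensional complex subspaces of $\mathbb{C}^n$, with complex structure given by $T_L^{1,0}G_k(\mathbb{C}^n)\cong \mathrm{Hom}(L,L^\perp)$, $T_L^{0,1}G_k(\mathbb{C}^n)\cong \mathrm{Hom}(L^\perp,L)$, and with its $\mathrm{U}(n)$-invariant Kähler metric $h$ (unique up to a positive factor), normalized by $h(\xi,\eta)=\frac12\mathrm{tr}(\xi\eta)$, which for $k=1$ is the Fubini–Study metric of constant holomorphic sectional curvature $4$ on $\mathbb{C}P^{n-1}$. Minimality and curvature of a map into $G_k(\mathbb{C}^n)$ refer to $h$ and to the metric induced from $h$. A smooth map $\psi:M\to G_k(\mathbb{C}^n)$ from a Riemann surface is identified with the rank-$k$ subbundle of the trivial bundle $M\times\mathbb{C}^n$ with fibre $\psi(z)$ at $z$. It is linearly full if it is not contained in any constant proper complex subspace of $\mathbb{C}^n$. Harmonic sequence: for a local complex coordinate $z$, set $A'_\psi(s)=\pi_{\psi^\perp}\big(\frac{\partial s}{\partial z}\big)$ for local sections $s$ of $\psi$, where $\pi_{\psi^\perp}$ is orthogonal projection onto $\psi^\perp$. If $\psi$ is harmonic, the first $\partial'$-Gauss bundle of $\psi$ is the unique vector subbundle of $\psi^\perp$ which coincides with the image of $A'_\psi$ almost everywhere (off a discrete set); it is again harmonic (or zero). For a holomorphic map $\psi_0$, the harmonic sequence $\psi_0,\psi_1,\ldots,\psi_p$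 is obtained by letting $\psi_{j+1}$ be the first $\partial'$-Gauss bundle of $\psi_j$, with $\psi_p$ the last nonzero bundle ($\psi_{p+1}=\{0\}$). The $\psi_j$ are mutually orthogonal, and when $\psi_0$ is linearly full, $\mathbb{C}^n=\psi_0\oplus\cdots\oplus\psi_p$. Flag manifold: $F_{k_0,\ldots,k_p}=\mathrm{U}(n)/(\mathrm{U}(k_0)\times\cdots\times\mathrm{U}(k_p))$ is the manifold of $(p+1)$-tuples $(L_0,\ldots,L_p)$ of mutually orthogonal complex subspaces of $\mathbb{C}^n$ with $\dim L_j=k_j$ and $L_0\oplus\cdots\oplus L_p=\mathbb{C}^n$; $\mathrm{U}(n)$ acts by $g(L_0,\ldots,L_p)=(gL_0,\ldots,gL_p)$. Its complexified tangent space at $(L_0,\ldots,L_p)$ is $\sum_{i\ne j}\mathrm{Hom}(L_i,L_j)$, and its $\mathrm{U}(n)$-invariant metrics are those of the form $g(\xi,\eta)=\sum_{i\neq j}\lambda_{ij}\,\mathrm{tr}\,\xi_{ij}\eta_{ij}^*$ with positive constants $\lambda_{ij}=\lambda_{ji}$. The map $\Psi=(\psi_0,\ldots,\psi_p)$ is called the primitive lift. Kähler angle: for a conformal immersion $\psi$ into a Kähler manifold with complex structure $J$, the Kähler angle $\theta\in[0,\pi]$ at a point is the angle between $J\,d\psi(\partial_x)$ and $d\psi(\partial_y)$, $z=x+iy$ being a local complex coordinate (so $\theta=0$ for holomorphic immersions). For $\psi_j$ in the harmonic sequence it satisfies $\tan^2(\theta_j/2)=\gamma_{j-1}/\gamma_j$,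 where $\gamma_j=\mathrm{tr}\,A'_{\psi_j}(A'_{\psi_j})^*$ and $\gamma_{-1}=\gamma_p=0$. *)

theory Defs
  imports "HOL-Analysis.Analysis"
begin

section \<open>The Riemann sphere and calculus in a local coordinate\<close>

datatype riemann_sphere = Point complex | Infinity

definition chart_0 :: "complex \<Rightarrow> riemann_sphere" where
  "chart_0 z = Point z"

definition chart_inf :: "complex \<Rightarrow> riemann_sphere" where
  "chart_inf w = (if w = 0 then Infinity else Point (1 / w))"

text \<open>Inverses of the two standard holomorphic coordinates of the sphere; each has domain
  all of \<^typ>\<open>complex\<close>.  A local, coordinate-invariant notion for a map \<open>\<psi>\<close> on the
  sphere is expressed below by imposing it on \<open>\<psi> \<circ> c\<close> for both parametrizations \<open>c\<close>.\<close>

definition charts :: "(complex \<Rightarrow> riemann_sphere) set" where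
  "charts = {chart_0, chart_inf}"

text \<open>Directional derivatives along \<open>\<partial>\<^sub>1 = \<partial>/\<partial>x\<close> and \<open>\<partial>\<^sub>2 = \<partial>/\<partial>y\<close>, where \<open>z = x + iy\<close>.\<close>

definition pd :: "2 \<Rightarrow> (complex \<Rightarrow> 'b::real_normed_vector) \<Rightarrow> complex \<Rightarrow> 'b" where
  "pd a f z = frechet_derivative f (at z) (if a = 1 then 1 else \<i>)"

primrec Ck_on :: "nat \<Rightarrow> (complex \<Rightarrow> 'b::real_normed_vector) \<Rightarrow> complex set \<Rightarrow> bool" where
  "Ck_on 0 f U = continuous_on U f"
| "Ck_on (Suc k) f U = ((\<forall>z\<in>U. f differentiable (at z)) \<and> (\<forall>a. Ck_on k (pd a f) U))"

definition smooth_on :: "(complex \<Rightarrow> 'b::real_normed_vector) \<Rightarrow> complex set \<Rightarrow> bool" where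
  "smooth_on f U \<longleftrightarrow> (\<forall>k. Ck_on k f U)"

text \<open>The operator \<open>\<partial>/\<partial>z = (\<partial>/\<partial>x - i \<partial>/\<partial>y) / 2\<close>.\<close>

definition dz :: "(complex \<Rightarrow> complex^'n) \<Rightarrow> complex \<Rightarrow> complex^'n" where
  "dz s z = (1 / 2) *s (pd 1 s z - \<i> *s pd 2 s z)"


section \<open>Hermitian linear algebra\<close>

definition herm :: "complex^'n \<Rightarrow> complex^'n \<Rightarrow> complex" where
  "herm x y = (\<Sum>i\<in>UNIV. x $ i * cnj (y $ i))"

definition adj :: "complex^'n^'n \<Rightarrow> complex^'n^'n" where
  "adj A = (\<chi> i j. cnj (A $ j $ i))"

definition unitary_group :: "(complex^'n^'n) set" where
  "unitary_group = {u. u ** adj u = mat 1 \<and> adj u ** u = mat 1}"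

definition orth :: "(complex^'n) set \<Rightarrow> (complex^'n) set" where
  "orth L = {y. \<forall>x\<in>L. herm x y = 0}"

text \<open>The matrix of the orthogonal projection onto a complex subspace.\<close>

definition proj :: "(complex^'n) set \<Rightarrow> complex^'n^'n" where
  "proj L = (THE P. P ** P = P \<and> adj P = P \<and> range ((*v) P) = L)"


section \<open>Gaussian curvature of a metric in a local coordinate\<close>

text \<open>A Riemannian metric on the coordinate plane is given by its matrix \<open>m z\<close> with respect to
  \<open>\<partial>\<^sub>1, \<partial>\<^sub>2\<close>; no conformality is presupposed.\<close>

definition christoffel :: "(complex \<Rightarrow> real^2^2) \<Rightarrow> 2 \<Rightarrow> 2 \<Rightarrow> 2 \<Rightarrow> complex \<Rightarrow> real" where
  "christoffel m l a b z = (\<Sum>c\<in>UNIV. matrix_inv (m z) $ l $ c *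
     (pd a (\<lambda>w. m w $ b $ c) z + pd b (\<lambda>w. m w $ a $ c) z - pd c (\<lambda>w. m w $ a $ b) z)) / 2"

text \<open>The component along \<open>\<partial>\<^sub>l\<close> of \<open>R(\<partial>\<^sub>a, \<partial>\<^sub>b) \<partial>\<^sub>c\<close>, where
  \<open>R(X, Y) = [\<nabla>\<^sub>X, \<nabla>\<^sub>Y] - \<nabla>\<^bsub>[X, Y]\<^esub>\<close>.\<close>

definition riemann_tensor ::
    "(complex \<Rightarrow> real^2^2) \<Rightarrow> 2 \<Rightarrow> 2 \<Rightarrow> 2 \<Rightarrow> 2 \<Rightarrow> complex \<Rightarrow> real" where
  "riemann_tensor m l a b c z =
     pd a (christoffel m l b c) z - pd b (christoffel m l a c) z
     + (\<Sum>d\<in>UNIV. christoffel m l a d z * christoffel m d b c z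
               - christoffel m l b d z * christoffel m d a c z)"

definition gauss_curvature :: "(complex \<Rightarrow> real^2^2) \<Rightarrow> complex \<Rightarrow> real" where
  "gauss_curvature m z = (\<Sum>l\<in>UNIV. riemann_tensor m l 1 2 2 z * m z $ l $ 1) / det (m z)"


section \<open>Maps into Grassmannians\<close>

definition grassmannian :: "nat \<Rightarrow> (complex^'n) set set" where
  "grassmannian k = {L. vec.subspace L \<and> vec.dim L = k}"

text \<open>The Grassmannian is embedded in the Hermitian matrices by \<open>L \<mapsto> proj L\<close>.  A real tangent
  vector at \<open>L\<close> becomes a Hermitian matrix \<open>\<xi> = A + A\<^sup>*\<close>, where \<open>A = (1 - proj L) \<xi> proj L\<close>
  is its component in \<open>T\<^sup>1\<^sup>,\<^sup>0 = Hom(L, L\<^sup>\<bottom>)\<close>; for a curve \<open>L(t)\<close>, \<open>A\<close> sends \<open>s\<close> to the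
  component of \<open>ds/dt\<close> in \<open>L\<^sup>\<bottom>\<close> for sections \<open>s\<close> of \<open>L(t)\<close>.\<close>

definition grass_J :: "(complex^'n) set \<Rightarrow> complex^'n^'n \<Rightarrow> complex^'n^'n" where
  "grass_J L \<xi> = mat \<i> ** ((mat 1 - proj L) ** \<xi> ** proj L)
               - mat \<i> ** (proj L ** \<xi> ** (mat 1 - proj L))"

definition grass_h :: "complex^'n^'n \<Rightarrow> complex^'n^'n \<Rightarrow> real" where
  "grass_h \<xi> \<eta> = Re (trace (\<xi> ** \<eta>)) / 2"

definition grass_pd :: "2 \<Rightarrow> (complex \<Rightarrow> (complex^'n) set) \<Rightarrow> complex \<Rightarrow> complex^'n^'n" where
  "grass_pd a f z = pd a (\<lambda>w. proj (f w)) z"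

definition smooth_grass_map :: "nat \<Rightarrow> (riemann_sphere \<Rightarrow> (complex^'n) set) \<Rightarrow> bool" where
  "smooth_grass_map k \<psi> \<longleftrightarrow>
     (\<forall>x. \<psi> x \<in> grassmannian k) \<and> (\<forall>c\<in>charts. smooth_on (\<lambda>z. proj (\<psi> (c z))) UNIV)"

text \<open>Complex linearity of the differential, \<open>d\<psi> \<circ> i = J \<circ> d\<psi>\<close>.\<close>

definition holomorphic_grass_map :: "nat \<Rightarrow> (riemann_sphere \<Rightarrow> (complex^'n) set) \<Rightarrow> bool" where
  "holomorphic_grass_map k \<psi> \<longleftrightarrow> smooth_grass_map k \<psi> \<and>
     (\<forall>c\<in>charts. \<forall>z. grass_pd 2 (\<psi> \<circ> c) z = grass_J (\<psi> (c z)) (grass_pd 1 (\<psi> \<circ> c) z))"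

definition linearly_full :: "(riemann_sphere \<Rightarrow> (complex^'n) set) \<Rightarrow> bool" where
  "linearly_full \<psi> \<longleftrightarrow> (\<forall>V. vec.subspace V \<and> (\<forall>x. \<psi> x \<subseteq> V) \<longrightarrow> V = UNIV)"

definition grass_immersion :: "(riemann_sphere \<Rightarrow> (complex^'n) set) \<Rightarrow> bool" where
  "grass_immersion \<psi> \<longleftrightarrow>
     (\<forall>c\<in>charts. \<forall>z. inj (frechet_derivative (\<lambda>w. proj (\<psi> (c w))) (at z)))"

definition grass_induced :: "(complex \<Rightarrow> (complex^'n) set) \<Rightarrow> complex \<Rightarrow> real^2^2" where
  "grass_induced f z = (\<chi> a b. grass_h (grass_pd a f z) (grass_pd b f z))"

definition grass_constant_curvature :: "(riemann_sphere \<Rightarrow> (complex^'n) set) \<Rightarrow> bool" where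
  "grass_constant_curvature \<psi> \<longleftrightarrow>
     (\<exists>K. \<forall>c\<in>charts. \<forall>z. gauss_curvature (grass_induced (\<psi> \<circ> c)) z = K)"

text \<open>Under the embedding \<open>proj\<close> the metric \<open>h\<close> is the restriction of the Euclidean inner product
  \<open>tr(\<xi>\<eta>) / 2\<close> on Hermitian matrices, so covariant differentiation in the Grassmannian is
  ordinary differentiation followed by orthogonal projection onto its tangent space.\<close>

definition grass_tangent_part :: "(complex^'n) set \<Rightarrow> complex^'n^'n \<Rightarrow> complex^'n^'n" where
  "grass_tangent_part L \<xi> =
     (mat 1 - proj L) ** \<xi> ** proj L + proj L ** \<xi> ** (mat 1 - proj L)"

definition covariant_hessian ::
    "(complex \<Rightarrow> (complex^'n) set) \<Rightarrow> 2 \<Rightarrow> 2 \<Rightarrow> complex \<Rightarrow> complex^'n^'n" where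
  "covariant_hessian f a b z = grass_tangent_part (f z) (pd a (grass_pd b f) z)"

definition normal_part ::
    "(complex \<Rightarrow> (complex^'n) set) \<Rightarrow> complex \<Rightarrow> complex^'n^'n \<Rightarrow> complex^'n^'n" where
  "normal_part f z \<xi> = \<xi> - (\<Sum>a\<in>UNIV. \<Sum>b\<in>UNIV.
     (matrix_inv (grass_induced f z) $ a $ b * grass_h \<xi> (grass_pd a f z)) *\<^sub>R grass_pd b f z)"

definition second_fundamental_form ::
    "(complex \<Rightarrow> (complex^'n) set) \<Rightarrow> 2 \<Rightarrow> 2 \<Rightarrow> complex \<Rightarrow> complex^'n^'n" where
  "second_fundamental_form f a b z = normal_part f z (covariant_hessian f a b z)"

definition mean_curvature_vector ::
    "(complex \<Rightarrow> (complex^'n) set) \<Rightarrow> complex \<Rightarrow> complex^'n^'n" where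
  "mean_curvature_vector f z = (1 / 2) *\<^sub>R (\<Sum>a\<in>UNIV. \<Sum>b\<in>UNIV.
     matrix_inv (grass_induced f z) $ a $ b *\<^sub>R second_fundamental_form f a b z)"

definition minimal_immersion :: "(riemann_sphere \<Rightarrow> (complex^'n) set) \<Rightarrow> bool" where
  "minimal_immersion \<psi> \<longleftrightarrow>
     grass_immersion \<psi> \<and> (\<forall>c\<in>charts. \<forall>z. mean_curvature_vector (\<psi> \<circ> c) z = 0)"

definition conformal_immersion :: "(riemann_sphere \<Rightarrow> (complex^'n) set) \<Rightarrow> bool" where
  "conformal_immersion \<psi> \<longleftrightarrow> grass_immersion \<psi> \<and>
     (\<forall>c\<in>charts. \<forall>z. \<exists>r. grass_induced (\<psi> \<circ> c) z = mat r)"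

definition grass_angle :: "complex^'n^'n \<Rightarrow> complex^'n^'n \<Rightarrow> real" where
  "grass_angle \<xi> \<eta> = arccos (grass_h \<xi> \<eta> / (sqrt (grass_h \<xi> \<xi>) * sqrt (grass_h \<eta> \<eta>)))"

definition kahler_angle :: "(complex \<Rightarrow> (complex^'n) set) \<Rightarrow> complex \<Rightarrow> real" where
  "kahler_angle f z = grass_angle (grass_J (f z) (grass_pd 1 f z)) (grass_pd 2 f z)"

text \<open>The angle is independent of the coordinate only for conformal immersions, to which the
  notion is therefore restricted.\<close>

definition constant_kahler_angle :: "(riemann_sphere \<Rightarrow> (complex^'n) set) \<Rightarrow> bool" where
  "constant_kahler_angle \<psi> \<longleftrightarrow> conformal_immersion \<psi> \<and>
     (\<exists>\<theta>. \<forall>c\<in>charts. \<forall>z. kahler_angle (\<psi> \<circ> c) z = \<theta>)"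


section \<open>Harmonic sequences\<close>

text \<open>\<open>A' f s z\<close> is the component of \<open>\<partial>s/\<partial>z\<close> in \<open>(f z)\<^sup>\<bottom>\<close>, for a local section \<open>s\<close> of \<open>f\<close>.\<close>

definition A' :: "(complex \<Rightarrow> (complex^'n) set) \<Rightarrow> (complex \<Rightarrow> complex^'n) \<Rightarrow> complex \<Rightarrow> complex^'n"
  where "A' f s z = proj (orth (f z)) *v dz s z"

definition local_section ::
    "(complex \<Rightarrow> (complex^'n) set) \<Rightarrow> complex set \<Rightarrow> (complex \<Rightarrow> complex^'n) \<Rightarrow> bool" where
  "local_section f U s \<longleftrightarrow> open U \<and> smooth_on s U \<and> (\<forall>w\<in>U. s w \<in> f w)"

definition A'_image :: "(complex \<Rightarrow> (complex^'n) set) \<Rightarrow> complex \<Rightarrow> (complex^'n) set" where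
  "A'_image f z = {A' f s z | s U. local_section f U s \<and> z \<in> U}"

text \<open>\<open>\<phi>\<close> is a smooth subbundle of \<open>\<psi>\<^sup>\<bottom>\<close> (possibly of rank \<open>0\<close>) that coincides with the
  image of \<open>A'\<close> off a discrete set; these conditions determine \<open>\<phi>\<close>.\<close>

definition first_gauss_bundle ::
    "(riemann_sphere \<Rightarrow> (complex^'n) set) \<Rightarrow> (riemann_sphere \<Rightarrow> (complex^'n) set) \<Rightarrow> bool" where
  "first_gauss_bundle \<psi> \<phi> \<longleftrightarrow>
     (\<exists>k. smooth_grass_map k \<phi>) \<and> (\<forall>x. \<phi> x \<subseteq> orth (\<psi> x)) \<and>
     (\<forall>c\<in>charts. {z. \<phi> (c z) \<noteq> A'_image (\<psi> \<circ> c) z} sparse_in UNIV)"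

text \<open>\<open>\<psi> 0, \<dots>, \<psi> p\<close> is the harmonic sequence of \<open>\<psi> 0\<close>, with \<open>\<psi> p\<close> its last nonzero bundle,
  and \<open>k j\<close> is the rank of \<open>\<psi> j\<close>.\<close>

definition harmonic_sequence ::
    "nat \<Rightarrow> (nat \<Rightarrow> nat) \<Rightarrow> (nat \<Rightarrow> riemann_sphere \<Rightarrow> (complex^'n) set) \<Rightarrow> bool" where
  "harmonic_sequence p k \<psi> \<longleftrightarrow>
     holomorphic_grass_map (k 0) (\<psi> 0) \<and>
     (\<forall>j\<le>p. smooth_grass_map (k j) (\<psi> j) \<and> 0 < k j) \<and>
     (\<forall>j<p. first_gauss_bundle (\<psi> j) (\<psi> (Suc j))) \<and>
     first_gauss_bundle (\<psi> p) (\<lambda>x. {0})"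


section \<open>Flag manifolds and the primitive lift\<close>

definition flag_manifold :: "nat \<Rightarrow> (nat \<Rightarrow> nat) \<Rightarrow> (nat \<Rightarrow> (complex^'n) set) set" where
  "flag_manifold p k = {L \<in> Pi\<^sub>E {..p} (\<lambda>j. grassmannian (k j)).
     (\<forall>i\<le>p. \<forall>j\<le>p. i \<noteq> j \<longrightarrow> L i \<subseteq> orth (L j)) \<and> vec.span (\<Union>j\<le>p. L j) = UNIV}"

definition flag_action ::
    "nat \<Rightarrow> complex^'n^'n \<Rightarrow> (nat \<Rightarrow> (complex^'n) set) \<Rightarrow> nat \<Rightarrow> (complex^'n) set" where
  "flag_action p u L = (\<lambda>j\<in>{..p}. (*v) u ` L j)"

text \<open>A tangent vector at \<open>L\<close> is an element \<open>\<xi>\<close> of the sum of the \<open>Hom(L\<^sub>i, L\<^sub>j)\<close>, \<open>i \<noteq> j\<close>, written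
  as a single matrix with vanishing diagonal blocks; it is real iff it is skew-Hermitian, this
  being \<open>\<uu>(n) / (\<uu>(k\<^sub>0) \<oplus> \<dots> \<oplus> \<uu>(k\<^sub>p))\<close>.  For a curve \<open>L(t)\<close>, the component in
  \<open>Hom(L\<^sub>i, L\<^sub>j)\<close> sends \<open>s\<close> to the component of \<open>ds/dt\<close> in \<open>L\<^sub>j\<close> for sections \<open>s\<close> of \<open>L\<^sub>i(t)\<close>,
  that is, it equals \<open>P\<^sub>j (dP\<^sub>i/dt) P\<^sub>i\<close> where \<open>P\<^sub>i = proj L\<^sub>i\<close>.  The differential of the action of
  a unitary matrix \<open>u\<close> is \<open>\<xi> \<mapsto> u \<xi> u\<^sup>*\<close>.\<close>

definition flag_tangent :: "nat \<Rightarrow> (nat \<Rightarrow> (complex^'n) set) \<Rightarrow> (complex^'n^'n) set" where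
  "flag_tangent p L = {\<xi>. adj \<xi> = - \<xi> \<and> (\<forall>j\<le>p. proj (L j) ** \<xi> ** proj (L j) = 0)}"

text \<open>Smoothness of the metric need not be required, since invariance under the transitive action
  of the unitary group implies it.\<close>

definition invariant_flag_metric ::
    "nat \<Rightarrow> (nat \<Rightarrow> nat) \<Rightarrow>
     ((nat \<Rightarrow> (complex^'n) set) \<Rightarrow> complex^'n^'n \<Rightarrow> complex^'n^'n \<Rightarrow> real) \<Rightarrow> bool" where
  "invariant_flag_metric p k g \<longleftrightarrow>
     (\<forall>L\<in>flag_manifold p k. \<forall>\<xi>\<in>flag_tangent p L. \<forall>\<eta>\<in>flag_tangent p L.
        g L \<xi> \<eta> = g L \<eta> \<xi> \<and>
        (\<forall>\<zeta>\<in>flag_tangent p L. \<forall>a b. g L (a *\<^sub>R \<xi> + b *\<^sub>R \<eta>) \<zeta> = a * g L \<xi> \<zeta> + b * g L \<eta> \<zeta>) \<and>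
        (\<xi> \<noteq> 0 \<longrightarrow> 0 < g L \<xi> \<xi>) \<and>
        (\<forall>u\<in>unitary_group.
           g (flag_action p u L) (u ** \<xi> ** adj u) (u ** \<eta> ** adj u) = g L \<xi> \<eta>))"

definition primitive_lift ::
    "nat \<Rightarrow> (nat \<Rightarrow> riemann_sphere \<Rightarrow> (complex^'n) set) \<Rightarrow>
     riemann_sphere \<Rightarrow> nat \<Rightarrow> (complex^'n) set" where
  "primitive_lift p \<psi> x = (\<lambda>j\<in>{..p}. \<psi> j x)"

definition flag_differential ::
    "nat \<Rightarrow> (complex \<Rightarrow> nat \<Rightarrow> (complex^'n) set) \<Rightarrow> complex \<Rightarrow> complex \<Rightarrow> complex^'n^'n" where
  "flag_differential p F z v = (\<Sum>i\<in>{..p}. \<Sum>j\<in>{..p} - {i}.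
     proj (F z j) ** frechet_derivative (\<lambda>w. proj (F w i)) (at z) v ** proj (F z i))"

definition flag_immersion ::
    "nat \<Rightarrow> (riemann_sphere \<Rightarrow> nat \<Rightarrow> (complex^'n) set) \<Rightarrow> bool" where
  "flag_immersion p \<Psi> \<longleftrightarrow> (\<forall>c\<in>charts. \<forall>z. inj (flag_differential p (\<Psi> \<circ> c) z))"

definition flag_induced ::
    "((nat \<Rightarrow> (complex^'n) set) \<Rightarrow> complex^'n^'n \<Rightarrow> complex^'n^'n \<Rightarrow> real) \<Rightarrow>
     nat \<Rightarrow> (complex \<Rightarrow> nat \<Rightarrow> (complex^'n) set) \<Rightarrow> complex \<Rightarrow> real^2^2" where
  "flag_induced g p F z = (\<chi> a b.
     g (F z) (flag_differential p F z (if a = 1 then 1 else \<i>))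
             (flag_differential p F z (if b = 1 then 1 else \<i>)))"

definition flag_constant_curvature ::
    "((nat \<Rightarrow> (complex^'n) set) \<Rightarrow> complex^'n^'n \<Rightarrow> complex^'n^'n \<Rightarrow> real) \<Rightarrow>
     nat \<Rightarrow> (riemann_sphere \<Rightarrow> nat \<Rightarrow> (complex^'n) set) \<Rightarrow> bool" where
  "flag_constant_curvature g p \<Psi> \<longleftrightarrow>
     (\<exists>K. \<forall>c\<in>charts. \<forall>z. gauss_curvature (flag_induced g p (\<Psi> \<circ> c)) z = K)"

end

theory Submission
  imports Defs "HOL-Complex_Analysis.Complex_Analysis"
begin

unbundle no fps_syntax

text \<open>
  Work in a coordinate \<open>z\<close> of the sphere, write \<open>\<partial>\<close> and \<open>\<partial>'\<close> for the derivatives by \<open>z\<close> and by its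
  conjugate, and describe each bundle \<open>\<psi>\<^sub>j\<close> by its orthogonal projection \<open>P\<^sub>j(z)\<close>. The osculating
  bundles, with projections \<open>R\<^sub>j = P\<^sub>0 + \<dots> + P\<^sub>j\<close>, are holomorphic, and \<open>A\<^sub>j = \<partial>R\<^sub>j = \<partial>P\<^sub>j P\<^sub>j\<close>
  maps \<open>\<psi>\<^sub>j\<close> to \<open>\<psi>\<^sub>j\<^sub>+\<^sub>1\<close> and vanishes on the other summands (\<open>harmonic_sequence_frame\<close>). All the
  geometry is carried by the densities \<open>\<gamma>\<^sub>j = |A\<^sub>j|\<^sup>2\<close>. The derivative of the primitive lift has
  components in \<open>Hom(\<psi>\<^sub>j, \<psi>\<^sub>j\<^sub>+\<^sub>1)\<close> and their adjoints only, so that an invariant metric induces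
  \<open>(\<mu>\<^sub>0 \<gamma>\<^sub>0 + \<dots> + \<mu>\<^sub>p\<^sub>-\<^sub>1 \<gamma>\<^sub>p\<^sub>-\<^sub>1) |dz|\<^sup>2\<close> with positive constants \<open>\<mu>\<^sub>j\<close> (\<open>invariant_metric_form\<close>,
  \<open>flag_induced_frame\<close>), while \<open>\<psi>\<^sub>j\<close> induces \<open>(\<gamma>\<^sub>j\<^sub>-\<^sub>1 + \<gamma>\<^sub>j) |dz|\<^sup>2\<close> and has Kaehler angle with
  cosine \<open>(\<gamma>\<^sub>j - \<gamma>\<^sub>j\<^sub>-\<^sub>1) / (\<gamma>\<^sub>j + \<gamma>\<^sub>j\<^sub>-\<^sub>1)\<close>. Hence it suffices to show that constant curvature of
  one positive combination of the \<open>\<gamma>\<^sub>j\<close> forces each \<open>\<gamma>\<^sub>j\<close> to be a constant multiple of it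
  (\<open>density_rigidity\<close>). Minimality is the harmonicity of the projections: \<open>\<partial>'\<partial>P\<^sub>j\<close> preserves \<open>\<psi>\<^sub>j\<close>
  and its complement, hence has no tangential part.

  A metric of constant curvature on the sphere is \<open>|dz|\<^sup>2 / v\<^sup>2\<close> with \<open>v = c |z - e|\<^sup>2 + b\<close>,
  because the quadratic differential \<open>(\<partial>\<partial>v / v) dz\<^sup>2\<close> is holomorphic on the sphere and thus zero
  (\<open>constant_curvature_quadratic\<close>).

  The rigidity of the densities is an argument in the style of Calabi. The overlap \<open>D\<^sub>j(a, z) =
  det(1 - R\<^sub>j(a) + R\<^sub>j(a) R\<^sub>j(z) R\<^sub>j(a))\<close> is the squared modulus of the normalised Hermitian
  product of the Pluecker vectors at \<open>a\<close> and \<open>z\<close>; as a function of \<open>z\<close> its negative logarithm is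
  the potential of \<open>\<gamma>\<^sub>j\<close> all of whose pure \<open>z\<close>-derivatives vanish at \<open>a\<close>. A potential is
  determined by that normalisation. Writing the explicit normalised potential of \<open>1/v\<^sup>2\<close> by means
  of the polarisation \<open>V\<close> of \<open>v\<close>, one obtains \<open>\<Prod>\<^sub>j D\<^sub>j(a, z)^\<mu>\<^sub>j = (|V(a, z)|\<^sup>2 / (v(a) v(z)))^\<kappa>\<close>;
  since every \<open>D\<^sub>j\<close> is at most \<open>1\<close>, each is bounded below by a power of the right-hand side
  (\<open>overlap_lower_bound\<close>). Taken relative to the centre \<open>e\<close>, the Hermitian product of Pluecker
  vectors is therefore a polynomial in \<open>z\<close> that vanishes only where \<open>V(a, \<cdot>)\<close> does, at a single
  point, so it is a power of \<open>V(a, \<cdot>) / b\<close>. Its diagonal values give \<open>D\<^sub>j(e, \<cdot>) = (b/v)\<^sup>d\<close>, and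
  hence \<open>\<gamma>\<^sub>j = d c b / v\<^sup>2\<close> (\<open>rigidity_single\<close>).
\<close>

section \<open>Smooth functions of a complex variable\<close>

lemma frechet_derivative_cong_open:
  assumes "open U" "z \<in> U" "\<And>w. w \<in> U \<Longrightarrow> f w = g w"
  shows "frechet_derivative f (at z) = frechet_derivative g (at z)"
proof -
  have "(f has_derivative D) (at z) \<longleftrightarrow> (g has_derivative D) (at z)" for D
    using assms has_derivative_transform_within_open[of f D z UNIV U g]
      has_derivative_transform_within_open[of g D z UNIV U f] by auto
  then show ?thesis unfolding frechet_derivative_def by simp
qed

lemma pd_cong_open:
  assumes "open U" "z \<in> U" "\<And>w. w \<in> U \<Longrightarrow> f w = g w"
  shows "pd a f z = pd a g z"
  unfolding pd_def using frechet_derivative_cong_open[OF assms] by simp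

lemma differentiable_cong_open:
  fixes f g :: "'a::real_normed_vector \<Rightarrow> 'b::real_normed_vector"
  assumes "open U" "z \<in> U" "\<And>w. w \<in> U \<Longrightarrow> f w = g w" "f differentiable (at z)"
  shows "g differentiable (at z)"
  using assms has_derivative_transform_within_open[of f _ z UNIV U g]
  unfolding differentiable_def by blast

lemma pd_eq: "(f has_derivative D) (at z) \<Longrightarrow> pd a f z = D (if a = 1 then 1 else \<i>)"
  unfolding pd_def by (simp add: frechet_derivative_at[symmetric])

text \<open>\<open>Ck_on\<close> is defined by recursion over the partial derivatives, each a function on the whole
  plane. On an open set the derivatives see the values on that set alone, which is what allows the
  differentiation rules below to be used inside inductions on the order.\<close>

lemma Ck_on_cong:
  assumes "open U" "\<And>w. w \<in> U \<Longrightarrow> f w = g w" "Ck_on k f U"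
  shows "Ck_on k g U"
  using assms
proof (induction k arbitrary: f g)
  case 0
  then show ?case using continuous_on_cong[of U U f g] by auto
next
  case (Suc k)
  have "g differentiable (at z)" if "z \<in> U" for z
    using differentiable_cong_open[OF Suc.prems(1) that, of f g] Suc.prems that by auto
  moreover have "Ck_on k (pd a g) U" for a
    by (rule Suc.IH[OF Suc.prems(1), of "pd a f"])
      (use Suc.prems pd_cong_open[OF Suc.prems(1), of _ f g] in auto)
  ultimately show ?case by simp
qed

lemma Ck_on_Suc_imp: "Ck_on (Suc k) f U \<Longrightarrow> Ck_on k f U"
proof (induction k arbitrary: f)
  case 0
  then show ?case
    by (simp add: differentiable_imp_continuous_within continuous_at_imp_continuous_on)
next
  case (Suc k)
  then show ?case by (metis Ck_on.simps(2))
qed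

lemma Ck_on_mono: "Ck_on k f U \<Longrightarrow> V \<subseteq> U \<Longrightarrow> Ck_on k f V"
  by (induction k arbitrary: f) (auto intro: continuous_on_subset)

lemma Ck_on_const: "Ck_on k (\<lambda>z. c) U"
proof (induction k arbitrary: c)
  case (Suc k)
  have "pd a (\<lambda>z. c) = (\<lambda>z. 0)" for a
    using pd_eq[OF has_derivative_const] by fastforce
  then show ?case using Suc by simp
qed simp

lemma has_derivative_frechet:
  "f differentiable (at z) \<Longrightarrow> (f has_derivative frechet_derivative f (at z)) (at z)"
  by (simp add: frechet_derivative_works)

lemma pd_add:
  assumes "f differentiable (at z)" "g differentiable (at z)"
  shows "pd a (\<lambda>z. f z + g z) z = pd a f z + pd a g z"
  using pd_eq[OF has_derivative_add[OF assms[THEN has_derivative_frechet]]] by (simp add: pd_def)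

lemma pd_bounded_linear:
  assumes "bounded_linear h" "f differentiable (at z)"
  shows "pd a (\<lambda>z. h (f z)) z = h (pd a f z)"
  using pd_eq[OF bounded_linear.has_derivative[OF assms(1) assms(2)[THEN has_derivative_frechet]]]
  by (simp add: pd_def)

lemma pd_bilinear:
  assumes "bounded_bilinear h" "f differentiable (at z)" "g differentiable (at z)"
  shows "pd a (\<lambda>z. h (f z) (g z)) z = h (f z) (pd a g z) + h (pd a f z) (g z)"
  using pd_eq[OF bounded_bilinear.FDERIV[OF assms(1) assms(2,3)[THEN has_derivative_frechet]]]
  by (simp add: pd_def)

lemma Ck_on_add:
  assumes "open U" "Ck_on k f U" "Ck_on k g U"
  shows "Ck_on k (\<lambda>z. f z + g z) U"
  using assms
proof (induction k arbitrary: f g)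
  case 0
  then show ?case by (auto intro: continuous_intros)
next
  case (Suc k)
  have "Ck_on k (pd a (\<lambda>z. f z + g z)) U" for a
    by (rule Ck_on_cong[OF Suc.prems(1) _ Suc.IH[of "pd a f" "pd a g"]])
      (use Suc.prems in \<open>auto simp: pd_add\<close>)
  then show ?case using Suc.prems by auto
qed

lemma linear_differentiable:
  assumes "bounded_linear h" "f differentiable (at z)"
  shows "(\<lambda>z. h (f z)) differentiable (at z)"
  using bounded_linear.has_derivative[OF assms(1) assms(2)[THEN has_derivative_frechet]]
  by (auto simp: differentiable_def)

lemma Ck_on_bounded_linear:
  assumes "bounded_linear h" "open U" "Ck_on k f U"
  shows "Ck_on k (\<lambda>z. h (f z)) U"
  using assms
proof (induction k arbitrary: f)
  case 0
  then show ?case by (auto intro: bounded_linear.continuous_on)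
next
  case (Suc k)
  have "Ck_on k (pd a (\<lambda>z. h (f z))) U" for a
    by (rule Ck_on_cong[OF Suc.prems(2) _ Suc.IH[of "pd a f"]])
      (use Suc.prems in \<open>auto simp: pd_bounded_linear[OF assms(1)]\<close>)
  then show ?case using Suc.prems by (auto intro: linear_differentiable)
qed

lemma bilinear_differentiable:
  assumes "bounded_bilinear h" "f differentiable (at z)" "g differentiable (at z)"
  shows "(\<lambda>z. h (f z) (g z)) differentiable (at z)"
  using bounded_bilinear.FDERIV[OF assms(1) assms(2,3)[THEN has_derivative_frechet]]
  by (auto simp: differentiable_def)

lemma Ck_on_bilinear:
  assumes "bounded_bilinear h" "open U" "Ck_on k f U" "Ck_on k g U"
  shows "Ck_on k (\<lambda>z. h (f z) (g z)) U"
  using assms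
proof (induction k arbitrary: f g)
  case 0
  then show ?case by (auto intro: bounded_bilinear.continuous_on)
next
  case (Suc k)
  have "Ck_on k (pd a (\<lambda>z. h (f z) (g z))) U" for a
    by (rule Ck_on_cong[OF Suc.prems(2) _
        Ck_on_add[OF Suc.prems(2) Suc.IH[of f "pd a g"] Suc.IH[of "pd a f" g]]])
      (use Suc.prems Ck_on_Suc_imp[OF Suc.prems(3)] Ck_on_Suc_imp[OF Suc.prems(4)]
        in \<open>auto simp: pd_bilinear[OF assms(1)]\<close>)
  then show ?case using Suc.prems by (auto intro: bilinear_differentiable)
qed

lemma smooth_on_differentiable: "smooth_on f U \<Longrightarrow> z \<in> U \<Longrightarrow> f differentiable (at z)"
  unfolding smooth_on_def by (metis Ck_on.simps(2))

lemma smooth_on_pd: "smooth_on f U \<Longrightarrow> smooth_on (pd a f) U"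
  unfolding smooth_on_def by (metis Ck_on.simps(2))

lemma smooth_on_continuous: "smooth_on f U \<Longrightarrow> continuous_on U f"
  unfolding smooth_on_def by (metis Ck_on.simps(1))

lemma smooth_on_subset: "smooth_on f U \<Longrightarrow> V \<subseteq> U \<Longrightarrow> smooth_on f V"
  unfolding smooth_on_def by (metis Ck_on_mono)

lemma smooth_on_cong:
  "open U \<Longrightarrow> (\<And>w. w \<in> U \<Longrightarrow> f w = g w) \<Longrightarrow> smooth_on f U \<Longrightarrow> smooth_on g U"
  unfolding smooth_on_def by (metis Ck_on_cong)

lemma smooth_on_const: "smooth_on (\<lambda>z. c) U"
  unfolding smooth_on_def by (simp add: Ck_on_const)

lemma smooth_on_add:
  "open U \<Longrightarrow> smooth_on f U \<Longrightarrow> smooth_on g U \<Longrightarrow> smooth_on (\<lambda>z. f z + g z) U"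
  unfolding smooth_on_def by (simp add: Ck_on_add)

lemma smooth_on_linear:
  "bounded_linear h \<Longrightarrow> open U \<Longrightarrow> smooth_on f U \<Longrightarrow> smooth_on (\<lambda>z. h (f z)) U"
  unfolding smooth_on_def by (simp add: Ck_on_bounded_linear)

lemma smooth_on_mult:
  fixes f g :: "complex \<Rightarrow> 'a::real_normed_algebra"
  shows "open U \<Longrightarrow> smooth_on f U \<Longrightarrow> smooth_on g U \<Longrightarrow> smooth_on (\<lambda>z. f z * g z) U"
  unfolding smooth_on_def by (simp add: Ck_on_bilinear bounded_bilinear_mult)

lemma smooth_on_minus: "open U \<Longrightarrow> smooth_on f U \<Longrightarrow> smooth_on (\<lambda>z. - f z) U"
  by (rule smooth_on_linear[OF bounded_linear_minus[OF bounded_linear_ident]])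

lemma smooth_on_diff:
  "open U \<Longrightarrow> smooth_on f U \<Longrightarrow> smooth_on g U \<Longrightarrow> smooth_on (\<lambda>z. f z - g z) U"
  using smooth_on_add[of U f "\<lambda>z. - g z"] smooth_on_minus[of U g] by simp

lemma smooth_on_sum:
  "open U \<Longrightarrow> (\<And>i. i \<in> I \<Longrightarrow> smooth_on (f i) U) \<Longrightarrow> smooth_on (\<lambda>z. \<Sum>i\<in>I. f i z) U"
  by (induction I rule: infinite_finite_induct) (auto simp: smooth_on_const smooth_on_add)

lemma smooth_on_prod:
  fixes f :: "'i \<Rightarrow> complex \<Rightarrow> 'a::real_normed_field"
  shows "open U \<Longrightarrow> (\<And>i. i \<in> I \<Longrightarrow> smooth_on (f i) U) \<Longrightarrow> smooth_on (\<lambda>z. \<Prod>i\<in>I. f i z) U"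
  by (induction I rule: infinite_finite_induct) (auto simp: smooth_on_const smooth_on_mult)

lemma smooth_on_ident: "smooth_on (\<lambda>z. z) U"
proof -
  have "pd a (\<lambda>z. z) = (\<lambda>z. if a = 1 then 1 else \<i>)" for a
    using pd_eq[OF has_derivative_ident] by fastforce
  then have "Ck_on k (\<lambda>z. z) U" for k
    by (cases k) (auto simp: Ck_on_const)
  then show ?thesis unfolding smooth_on_def by simp
qed

lemma pd_inverse:
  fixes f :: "complex \<Rightarrow> 'a::real_normed_field"
  assumes "f differentiable (at z)" "f z \<noteq> 0"
  shows "pd a (\<lambda>z. inverse (f z)) z = - (inverse (f z) * inverse (f z) * pd a f z)"
  using pd_eq[OF Deriv.has_derivative_inverse[OF assms(2) has_derivative_frechet[OF assms(1)]], of a]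
  by (simp add: pd_def mult_ac)

lemma smooth_on_inverse:
  fixes f :: "complex \<Rightarrow> 'a::real_normed_field"
  assumes "open U" "smooth_on f U" "\<And>z. z \<in> U \<Longrightarrow> f z \<noteq> 0"
  shows "smooth_on (\<lambda>z. inverse (f z)) U"
proof -
  have "Ck_on k (\<lambda>z. inverse (f z)) U" for k
  proof (induction k)
    case 0
    then show ?case
      using assms smooth_on_continuous[OF assms(2)] by (auto intro!: continuous_intros)
  next
    case (Suc k)
    have "Ck_on k (pd a (\<lambda>z. inverse (f z))) U" for a
    proof (rule Ck_on_cong[OF assms(1)])
      show "Ck_on k (\<lambda>z. - (inverse (f z) * inverse (f z) * pd a f z)) U"
        using smooth_on_pd[OF assms(2)] Suc unfolding smooth_on_def
        by (intro Ck_on_bounded_linear[OF bounded_linear_minus[OF bounded_linear_ident]]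
            Ck_on_bilinear[OF bounded_bilinear_mult] assms(1)) auto
      show "- (inverse (f z) * inverse (f z) * pd a f z) = pd a (\<lambda>z. inverse (f z)) z"
        if "z \<in> U" for z
        using pd_inverse[of f z a] assms that smooth_on_differentiable by metis
    qed
    moreover have "(\<lambda>z. inverse (f z)) differentiable (at z)" if "z \<in> U" for z
      using that assms smooth_on_differentiable by (intro differentiable_inverse) auto
    ultimately show ?case by simp
  qed
  then show ?thesis unfolding smooth_on_def by simp
qed

text \<open>A conformal metric will be written \<open>|dz|\<^sup>2 / v\<^sup>2\<close>; recovering \<open>v\<close> from the density requires
  the smoothness of inverse square roots.\<close>

lemma pd_inverse_sqrt:
  fixes f :: "complex \<Rightarrow> real"
  assumes "f differentiable (at z)" "f z > 0"
  shows "pd a (\<lambda>z. inverse (sqrt (f z))) z = - ((inverse (sqrt (f z)))^3 * pd a f z / 2)"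
    and "(\<lambda>z. inverse (sqrt (f z))) differentiable (at z)"
proof -
  have 1: "((\<lambda>x. inverse (sqrt x)) has_real_derivative - ((inverse (sqrt (f z)))^3 / 2)) (at (f z))"
    using assms(2) by (auto intro!: derivative_eq_intros simp: power3_eq_cube power2_eq_square field_simps)
  have 2: "((\<lambda>z. inverse (sqrt (f z))) has_derivative
      (\<lambda>h. - ((inverse (sqrt (f z)))^3 / 2) * frechet_derivative f (at z) h)) (at z)"
    using has_derivative_compose[OF has_derivative_frechet[OF assms(1)]
        1[unfolded has_field_derivative_def]] by (simp add: mult_ac)
  show "pd a (\<lambda>z. inverse (sqrt (f z))) z = - ((inverse (sqrt (f z)))^3 * pd a f z / 2)"
    using pd_eq[OF 2, of a] by (simp add: pd_def)
  show "(\<lambda>z. inverse (sqrt (f z))) differentiable (at z)"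
    using 2 by (auto simp: differentiable_def)
qed

lemma smooth_on_inverse_sqrt:
  fixes f :: "complex \<Rightarrow> real"
  assumes "open U" "smooth_on f U" "\<And>z. z \<in> U \<Longrightarrow> f z > 0"
  shows "smooth_on (\<lambda>z. inverse (sqrt (f z))) U"
proof -
  have "Ck_on k (\<lambda>z. inverse (sqrt (f z))) U" for k
  proof (induction k)
    case 0
    then show ?case
      using assms(3) smooth_on_continuous[OF assms(2)] by (force intro!: continuous_intros)
  next
    case (Suc k)
    have "Ck_on k (pd a (\<lambda>z. inverse (sqrt (f z)))) U" for a
    proof (rule Ck_on_cong[OF assms(1)])
      show "Ck_on k (\<lambda>z. (- 1/2) * (inverse (sqrt (f z)) * inverse (sqrt (f z)) *
          inverse (sqrt (f z)) * pd a f z)) U"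
        using smooth_on_pd[OF assms(2)] Suc unfolding smooth_on_def
        by (intro Ck_on_bilinear[OF bounded_bilinear_mult] assms(1) Ck_on_const) auto
      show "(- 1/2) * (inverse (sqrt (f z)) * inverse (sqrt (f z)) *
          inverse (sqrt (f z)) * pd a f z) = pd a (\<lambda>z. inverse (sqrt (f z))) z"
        if "z \<in> U" for z
        using pd_inverse_sqrt(1)[OF smooth_on_differentiable[OF assms(2) that] assms(3)[OF that], of a]
        by (simp add: power3_eq_cube)
    qed
    moreover have "(\<lambda>z. inverse (sqrt (f z))) differentiable (at z)" if "z \<in> U" for z
      using that assms smooth_on_differentiable by (intro pd_inverse_sqrt(2)) auto
    ultimately show ?case by simp
  qed
  then show ?thesis unfolding smooth_on_def by simp
qed

section \<open>Symmetry of second derivatives\<close>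

lemma directional_has_derivative:
  fixes f :: "complex \<Rightarrow> real"
  assumes "f differentiable (at (p + of_real t * u))"
  shows "((\<lambda>t. f (p + of_real t * u)) has_real_derivative
     frechet_derivative f (at (p + of_real t * u)) u) (at t)"
proof -
  have 1: "((\<lambda>t. p + of_real t * u) has_derivative (\<lambda>h. of_real h * u)) (at t)"
    by (auto intro!: derivative_eq_intros)
  have 2: "linear (frechet_derivative f (at (p + of_real t * u)))"
    using assms linear_frechet_derivative by blast
  have 3: "frechet_derivative f (at (p + of_real t * u)) (of_real h * u) =
     h * frechet_derivative f (at (p + of_real t * u)) u" for h
    using linear_cmul[OF 2, of h u] by (simp add: scaleR_conv_of_real)
  have 4: "(*) c = (\<lambda>h. h * c)" for c :: real
    by (rule ext) (rule mult.commute)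
  show ?thesis
    unfolding has_field_derivative_def 4[of "frechet_derivative f (at (p + of_real t * u)) u"]
    using has_derivative_compose[OF 1 has_derivative_frechet[OF assms], unfolded 3] .
qed

text \<open>The mean value theorem applied once in each direction. Letting the step tend to zero in the
  two possible orders yields the equality of mixed derivatives.\<close>

lemma second_difference_mvt:
  fixes f :: "complex \<Rightarrow> real" and u v :: complex
  defines "g \<equiv> \<lambda>w. frechet_derivative f (at w) u"
  assumes "h > 0"
    and f: "\<And>s t. 0 \<le> s \<Longrightarrow> s \<le> h \<Longrightarrow> 0 \<le> t \<Longrightarrow> t \<le> h \<Longrightarrow>
      f differentiable (at (z + of_real s * u + of_real t * v))"
    and g: "\<And>s t. 0 \<le> s \<Longrightarrow> s \<le> h \<Longrightarrow> 0 \<le> t \<Longrightarrow> t \<le> h \<Longrightarrow>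
      g differentiable (at (z + of_real s * u + of_real t * v))"
  shows "\<exists>s t. 0 < s \<and> s < h \<and> 0 < t \<and> t < h \<and>
    f (z + of_real h * u + of_real h * v) - f (z + of_real h * u) - f (z + of_real h * v) + f z
    = h * h * frechet_derivative g (at (z + of_real s * u + of_real t * v)) v"
proof -
  define \<phi> where "\<phi> s = f ((z + of_real h * v) + of_real s * u) - f (z + of_real s * u)" for s
  have d\<phi>: "(\<phi> has_real_derivative g (z + of_real s * u + of_real h * v) - g (z + of_real s * u)) (at s)"
    if "0 \<le> s" "s \<le> h" for s
    unfolding \<phi>_def
    using directional_has_derivative[of f "z + of_real h * v" s u]
      directional_has_derivative[of f "z" s u] f[of s h] f[of s 0] that \<open>h > 0\<close>
    by (auto intro!: derivative_eq_intros simp: g_def add_ac)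
  obtain s where s: "0 < s" "s < h"
    "\<phi> h - \<phi> 0 = h * (g (z + of_real s * u + of_real h * v) - g (z + of_real s * u))"
    using MVT2[of 0 h \<phi> "\<lambda>s. g (z + of_real s * u + of_real h * v) - g (z + of_real s * u)"]
      d\<phi> \<open>h > 0\<close> by auto
  have dg: "((\<lambda>t. g ((z + of_real s * u) + of_real t * v)) has_real_derivative
      frechet_derivative g (at ((z + of_real s * u) + of_real t * v)) v) (at t)"
    if "0 \<le> t" "t \<le> h" for t
    by (rule directional_has_derivative) (use g[of s t] s that in auto)
  obtain t where t: "0 < t" "t < h"
    "g (z + of_real s * u + of_real h * v) - g (z + of_real s * u) =
      h * frechet_derivative g (at ((z + of_real s * u) + of_real t * v)) v"
    using MVT2[of 0 h "\<lambda>t. g ((z + of_real s * u) + of_real t * v)"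
        "\<lambda>t. frechet_derivative g (at ((z + of_real s * u) + of_real t * v)) v"] dg \<open>h > 0\<close> by auto
  show ?thesis
    using s t by (intro exI[of _ s] exI[of _ t]) (simp add: \<phi>_def add_ac)
qed

lemma pd_commute_real:
  fixes f :: "complex \<Rightarrow> real"
  assumes "open U" "smooth_on f U" "z \<in> U"
  shows "pd a (pd b f) z = pd b (pd a f) z"
proof (rule ccontr)
  define e where "e c = (if c = (1::2) then 1 else \<i>)" for c
  have ne: "norm (e c) = 1" for c by (simp add: e_def)
  have pde: "pd c h w = frechet_derivative h (at w) (e c)" for c w and h :: "complex \<Rightarrow> real"
    by (simp add: pd_def e_def)
  assume neq: "pd a (pd b f) z \<noteq> pd b (pd a f) z"
  define p q where "p = pd a (pd b f)" and "q = pd b (pd a f)"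
  have "continuous_on U p" "continuous_on U q"
    unfolding p_def q_def using assms by (auto intro: smooth_on_continuous smooth_on_pd)
  then have ct: "isCont p z" "isCont q z"
    using assms by (auto simp: continuous_on_eq_continuous_at)
  \<comment> \<open>Both mixed derivatives at points near \<open>z\<close> equal the same second difference quotient, so they
    cannot differ by a positive amount at \<open>z\<close>.\<close>
  define \<epsilon> where "\<epsilon> = \<bar>p z - q z\<bar> / 2"
  have "\<epsilon> > 0" using neq by (simp add: \<epsilon>_def p_def q_def)
  obtain d1 where d1: "d1 > 0" "\<And>w. dist w z < d1 \<Longrightarrow> dist (p w) (p z) < \<epsilon>"
    using ct(1) \<open>\<epsilon> > 0\<close> unfolding continuous_at_eps_delta by metis
  obtain d2 where d2: "d2 > 0" "\<And>w. dist w z < d2 \<Longrightarrow> dist (q w) (q z) < \<epsilon>"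
    using ct(2) \<open>\<epsilon> > 0\<close> unfolding continuous_at_eps_delta by metis
  obtain d3 where d3: "d3 > 0" "ball z d3 \<subseteq> U"
    using assms openE by blast
  define h where "h = min d1 (min d2 d3) / 3"
  have h: "h > 0" "3 * h \<le> d1" "3 * h \<le> d2" "3 * h \<le> d3"
    using d1 d2 d3 by (auto simp: h_def)
  have near: "dist (z + of_real s * e c + of_real t * e c') z < 3 * h"
    if "0 \<le> s" "s \<le> h" "0 \<le> t" "t \<le> h" for s t c c'
  proof -
    have "norm (of_real s * e c + of_real t * e c') \<le> s + t"
      using norm_triangle_ineq[of "of_real s * e c" "of_real t * e c'"] that by (simp add: norm_mult ne)
    then show ?thesis using that h by (simp add: dist_norm add.assoc)
  qed
  have inU: "z + of_real s * e c + of_real t * e c' \<in> U"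
    if "0 \<le> s" "s \<le> h" "0 \<le> t" "t \<le> h" for s t c c'
    using near[OF that, of c c'] d3 h by (auto simp: dist_commute)
  have fr: "frechet_derivative f (at w) (e c) = pd c f w" for c w by (simp add: pde)
  have step: "\<exists>w. dist w z < 3 * h \<and>
     f (z + of_real h * e c + of_real h * e c') - f (z + of_real h * e c) - f (z + of_real h * e c') + f z
     = h * h * pd c' (pd c f) w" for c c'
  proof -
    have "\<exists>s t. 0 < s \<and> s < h \<and> 0 < t \<and> t < h \<and>
      f (z + of_real h * e c + of_real h * e c') - f (z + of_real h * e c) - f (z + of_real h * e c') + f z
      = h * h * frechet_derivative (\<lambda>w. frechet_derivative f (at w) (e c)) (at (z + of_real s * e c + of_real t * e c')) (e c')"
      by (rule second_difference_mvt[OF h(1)])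
        (use inU smooth_on_differentiable[OF assms(2)]
          smooth_on_differentiable[OF smooth_on_pd[OF assms(2)], of _ c] in \<open>auto simp: fr\<close>)
    then obtain s t where st: "0 < s" "s < h" "0 < t" "t < h"
      "f (z + of_real h * e c + of_real h * e c') - f (z + of_real h * e c) - f (z + of_real h * e c') + f z
      = h * h * frechet_derivative (\<lambda>w. frechet_derivative f (at w) (e c)) (at (z + of_real s * e c + of_real t * e c')) (e c')"
      by (elim exE conjE) (rule that)
    have "dist (z + of_real s * e c + of_real t * e c') z < 3 * h"
      using near[of s t c c'] st by simp
    with st(5) show ?thesis unfolding fr pde[symmetric] by blast
  qed
  obtain w1 where w1: "dist w1 z < 3 * h" "f (z + of_real h * e b + of_real h * e a) - f (z + of_real h * e b) - f (z + of_real h * e a) + f z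
     = h * h * p w1" using step[of b a] by (auto simp: p_def)
  obtain w2 where w2: "dist w2 z < 3 * h" "f (z + of_real h * e a + of_real h * e b) - f (z + of_real h * e a) - f (z + of_real h * e b) + f z
     = h * h * q w2" using step[of a b] by (auto simp: q_def)
  have "h * h * p w1 = h * h * q w2" using w1(2) w2(2) by (simp add: algebra_simps)
  then have "p w1 = q w2" using h by simp
  moreover have "dist (p w1) (p z) < \<epsilon>" "dist (q w2) (q z) < \<epsilon>"
    using d1(2)[of w1] d2(2)[of w2] w1 w2 h by linarith+
  ultimately show False unfolding \<epsilon>_def dist_real_def by (auto simp: abs_if split: if_splits)
qed

lemma smooth_on_Re: "open U \<Longrightarrow> smooth_on f U \<Longrightarrow> smooth_on (\<lambda>z. Re (f z)) U"
  by (rule smooth_on_linear[OF bounded_linear_Re])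
lemma smooth_on_Im: "open U \<Longrightarrow> smooth_on f U \<Longrightarrow> smooth_on (\<lambda>z. Im (f z)) U"
  by (rule smooth_on_linear[OF bounded_linear_Im])
lemma smooth_on_cnj: "open U \<Longrightarrow> smooth_on f U \<Longrightarrow> smooth_on (\<lambda>z. cnj (f z)) U"
  by (rule smooth_on_linear[OF bounded_linear_cnj])
lemma smooth_on_of_real:
  "open U \<Longrightarrow> smooth_on f U \<Longrightarrow> smooth_on (\<lambda>z. complex_of_real (f z)) U"
  by (rule smooth_on_linear[OF bounded_linear_of_real])

lemma pd_commute:
  fixes f :: "complex \<Rightarrow> complex"
  assumes "open U" "smooth_on f U" "z \<in> U"
  shows "pd a (pd b f) z = pd b (pd a f) z"
proof -
  have *: "h (pd a (pd b f) z) = pd a (pd b (\<lambda>w. h (f w))) z" if "bounded_linear h" for h :: "complex \<Rightarrow> real" and a b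
  proof -
    have "pd a (pd b (\<lambda>w. h (f w))) z = pd a (\<lambda>w. h (pd b f w)) z"
      by (rule pd_cong_open[OF assms(1,3)])
        (use that assms smooth_on_differentiable[OF assms(2)] in \<open>auto simp: pd_bounded_linear[OF that]\<close>)
    also have "\<dots> = h (pd a (pd b f) z)"
      using that assms smooth_on_differentiable[OF smooth_on_pd[OF assms(2)]]
      by (auto simp: pd_bounded_linear[OF that])
    finally show ?thesis by simp
  qed
  show ?thesis
    using pd_commute_real[OF assms(1) smooth_on_Re[OF assms(1,2)] assms(3), of a b]
     pd_commute_real[OF assms(1) smooth_on_Im[OF assms(1,2)] assms(3), of a b]
    unfolding complex_eq_iff *[OF bounded_linear_Re] *[OF bounded_linear_Im] by simp
qed

section \<open>Matrix algebra\<close>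

lemma matrix_add_rdistrib': "(A + B) ** C = A ** C + B ** (C :: 'a::semiring_1^'n^'m)"
  by (vector matrix_matrix_mult_def sum.distrib[symmetric] distrib_right)

lemma matrix_diff_ldistrib: "A ** (B - C) = A ** B - A ** (C :: 'a::ring_1^'n^'m)"
  by (vector matrix_matrix_mult_def sum_subtractf[symmetric] right_diff_distrib)

lemma matrix_diff_rdistrib: "(A - B) ** C = A ** C - B ** (C :: 'a::ring_1^'n^'m)"
  by (vector matrix_matrix_mult_def sum_subtractf[symmetric] left_diff_distrib)

lemma matrix_minus_left: "(- A) ** B = - (A ** (B :: 'a::ring_1^'n^'m))"
  by (vector matrix_matrix_mult_def sum_negf[symmetric])

lemma matrix_minus_right: "A ** (- B) = - (A ** (B :: 'a::ring_1^'n^'m))"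
  by (vector matrix_matrix_mult_def sum_negf[symmetric])

lemma matrix_sum_left: "(\<Sum>i\<in>I. A i) ** B = (\<Sum>i\<in>I. A i ** (B :: 'a::semiring_1^'n^'m))"
  by (induction I rule: infinite_finite_induct) (auto simp: matrix_add_rdistrib')

lemma matrix_sum_right: "B ** (\<Sum>i\<in>I. A i) = (\<Sum>i\<in>I. B ** (A i :: 'a::semiring_1^'n^'m))"
  by (induction I rule: infinite_finite_induct) (auto simp: matrix_add_ldistrib)

lemmas mmult = matrix_mul_assoc[symmetric] matrix_add_ldistrib matrix_add_rdistrib'
  matrix_diff_ldistrib matrix_diff_rdistrib matrix_minus_left matrix_minus_right

lemma matrix_mult_ext: "A ** B = C \<Longrightarrow> A ** (B ** X) = C ** (X :: 'a::semiring_1^'n^'m)"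
  by (simp add: matrix_mul_assoc)

lemma mat_scalar: "mat c ** (A :: complex^'n^'m) = (\<chi> i j. c * A $ i $ j)"
proof -
  have "(\<Sum>k\<in>UNIV. (if i = k then c else 0) * A $ k $ j) = c * A $ i $ j" for i j
    using sum.delta'[of UNIV i "\<lambda>k. c * A $ k $ j"] by (simp add: if_distrib if_distribR cong: if_cong)
  then show ?thesis by (simp add: vec_eq_iff matrix_matrix_mult_def mat_def)
qed

lemma mat_scalar_right: "(A :: complex^'n^'m) ** mat c = (\<chi> i j. c * A $ i $ j)"
proof -
  have "(\<Sum>k\<in>UNIV. A $ i $ k * (if k = j then c else 0)) = c * A $ i $ j" for i j
    using sum.delta[of UNIV j "\<lambda>k. c * A $ i $ k"] by (simp add: if_distrib if_distribR mult.commute cong: if_cong)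
  then show ?thesis by (simp add: vec_eq_iff matrix_matrix_mult_def mat_def)
qed

lemma mat_commute: "(A :: complex^'n^'m) ** mat c = mat c ** A"
  by (simp add: mat_scalar mat_scalar_right)

lemma adj_adj [simp]: "adj (adj A) = A"
  by (simp add: adj_def vec_eq_iff)
lemma adj_mult: "adj (A ** B) = adj B ** adj A"
  by (simp add: adj_def vec_eq_iff matrix_matrix_mult_def mult.commute)
lemma adj_add: "adj (A + B) = adj A + adj B"
  by (simp add: adj_def vec_eq_iff)
lemma adj_diff: "adj (A - B) = adj A - adj B"
  by (simp add: adj_def vec_eq_iff)
lemma adj_zero [simp]: "adj 0 = 0"
  by (simp add: adj_def vec_eq_iff)
lemma adj_mat [simp]: "adj (mat c) = mat (cnj c)"
  by (simp add: adj_def vec_eq_iff mat_def)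
lemma adj_sum: "adj (\<Sum>i\<in>I. A i) = (\<Sum>i\<in>I. adj (A i))"
  by (induction I rule: infinite_finite_induct) (auto simp: adj_add)
lemma adj_eq_zero_iff [simp]: "adj A = 0 \<longleftrightarrow> A = 0"
  by (metis adj_adj adj_zero)

lemma trace_adj: "trace (adj A) = cnj (trace A)"
  by (simp add: trace_def adj_def)
lemma trace_zero [simp]: "trace (0 :: complex^'n^'n) = 0"
  by (simp add: trace_def)
lemma trace_minus: "trace (- A :: complex^'n^'n) = - trace A"
  by (simp add: trace_def sum_negf)
lemma trace_scalar: "trace (mat c ** A) = c * trace (A :: complex^'n^'n)"
  by (simp add: trace_def mat_scalar sum_distrib_left)

lemma trace_adj_mult_self: "trace (adj A ** A) = of_real ((norm A)\<^sup>2)"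
proof -
  have "(norm A)\<^sup>2 = (\<Sum>i\<in>UNIV. \<Sum>j\<in>UNIV. (cmod (A $ i $ j))\<^sup>2)"
    by (simp add: norm_vec_def L2_set_def sum_nonneg)
  moreover have "trace (adj A ** A) = (\<Sum>j\<in>UNIV. \<Sum>i\<in>UNIV. of_real ((cmod (A $ i $ j))\<^sup>2))"
    by (simp add: trace_def matrix_matrix_mult_def adj_def complex_norm_square mult.commute del: of_real_power)
  ultimately show ?thesis using sum.swap[of "\<lambda>i j. (cmod (A $ i $ j))\<^sup>2" UNIV UNIV] by simp
qed

lemma trace_mult_adj_self: "trace (A ** adj A) = of_real ((norm (A::complex^'n^'n))\<^sup>2)"
  by (metis trace_adj_mult_self trace_mul_sym)

lemma matrix_inv_works:
  fixes A :: "'a::field^'n^'n"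
  assumes "det A \<noteq> 0"
  shows "A ** matrix_inv A = mat 1" "matrix_inv A ** A = mat 1"
proof -
  have "\<exists>A'. A ** A' = mat 1 \<and> A' ** A = mat 1"
    using assms invertible_det_nz[of A] unfolding invertible_def by blast
  then have "A ** matrix_inv A = mat 1 \<and> matrix_inv A ** A = mat 1"
    unfolding matrix_inv_def by (rule someI_ex)
  then show "A ** matrix_inv A = mat 1" "matrix_inv A ** A = mat 1" by auto
qed

lemma matrix_inv_unique':
  fixes A :: "'a::field^'n^'n"
  assumes "A ** B = mat 1"
  shows "matrix_inv A = B"
proof -
  have "det A * det B = 1" using assms det_mul[of A B] by simp
  then have "det A \<noteq> 0" by auto
  then have "matrix_inv A ** (A ** B) = B"
    using matrix_inv_works(2)[of A] by (simp add: matrix_mul_assoc)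
  then show ?thesis using assms by simp
qed

text \<open>Cramer's rule; it makes the inverse of a smooth matrix function smooth.\<close>

lemma matrix_inv_entry:
  fixes A :: "'a::field^'n^'n"
  assumes "det A \<noteq> 0"
  shows "matrix_inv A $ i $ j = det (\<chi> a b. if b = i then (if a = j then 1 else 0) else A $ a $ b) / det A"
proof -
  have "A *v (matrix_inv A *v axis j 1) = axis j 1"
    using matrix_inv_works(1)[OF assms] by (simp add: matrix_vector_mul_assoc)
  from cramer[OF assms, THEN iffD1, OF this]
  have "(matrix_inv A *v axis j 1) $ i = det (\<chi> a b. if b = i then axis j 1 $ a else A $ a $ b) / det A"
    by simp
  moreover have "(matrix_inv A *v axis j 1) $ i = matrix_inv A $ i $ j"
    by (simp add: matrix_vector_mult_def axis_def if_distrib[of "(*) _"] cong: if_cong)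
  ultimately show ?thesis
    by (simp add: axis_def if_distrib cong: if_cong)
qed

lemma det_adj: "det (adj A) = cnj (det (A :: complex^'n^'n))"
proof -
  have "adj A = transpose (\<chi> i j. cnj (A $ i $ j))"
    by (simp add: adj_def transpose_def vec_eq_iff)
  then have "det (adj A) = det (\<chi> i j. cnj (A $ i $ j))" by simp
  also have "\<dots> = cnj (det A)" by (simp add: det_def)
  finally show ?thesis .
qed

section \<open>Wirtinger derivatives\<close>

text \<open>\<open>wd 1\<close> is \<open>\<partial>/\<partial>z\<close> and \<open>wd (-1)\<close> is the derivative by the conjugate variable, written \<open>\<partial>\<close> and
  \<open>\<partial>'\<close> in the comments. A common definition allows the rules of calculus, and the symmetry under
  conjugation, to be stated once.\<close>

definition wd :: "complex \<Rightarrow> (complex \<Rightarrow> complex) \<Rightarrow> complex \<Rightarrow> complex" where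
  "wd s f z = (pd 1 f z - s * \<i> * pd 2 f z) / 2"

lemma wd_eq: "(f has_derivative D) (at z) \<Longrightarrow> wd s f z = (D 1 - s * \<i> * D \<i>) / 2"
  by (simp add: wd_def pd_eq)

lemma frechet_derivative_pd:
  assumes "f differentiable (at z)"
  shows "frechet_derivative f (at z) v = Re v *\<^sub>R pd 1 f z + Im v *\<^sub>R pd 2 f z"
proof -
  let ?D = "frechet_derivative f (at z)"
  have l: "linear ?D" using assms linear_frechet_derivative by blast
  have "?D v = ?D (Re v *\<^sub>R 1 + Im v *\<^sub>R \<i>)"
    by (rule arg_cong[of _ _ ?D]) (simp add: complex_eq_iff)
  then show ?thesis by (simp add: linear_add[OF l] linear_cmul[OF l] pd_def)
qed

lemma frechet_derivative_wd:
  assumes "f differentiable (at z)"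
  shows "frechet_derivative f (at z) v = v * wd 1 f z + cnj v * wd (-1) f z"
  unfolding frechet_derivative_pd[OF assms] by (simp add: wd_def complex_eq_iff field_simps)

lemma wd_cong_open:
  "open U \<Longrightarrow> z \<in> U \<Longrightarrow> (\<And>w. w \<in> U \<Longrightarrow> f w = g w) \<Longrightarrow> wd s f z = wd s g z"
  unfolding wd_def using pd_cong_open[of U z f g 1] pd_cong_open[of U z f g 2] by simp

lemma wd_const [simp]: "wd s (\<lambda>z. c) z = 0"
  using wd_eq[OF has_derivative_const] by fastforce

lemma wd_ident: "wd s (\<lambda>z. z) z = (1 + s) / 2"
  using wd_eq[OF has_derivative_ident, of s z] by (simp add: mult.assoc)

lemma wd_add:
  "f differentiable (at z) \<Longrightarrow> g differentiable (at z) \<Longrightarrow>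
    wd s (\<lambda>z. f z + g z) z = wd s f z + wd s g z"
  by (simp add: wd_def pd_add field_simps)

lemma wd_mult:
  fixes f g :: "complex \<Rightarrow> complex"
  shows "f differentiable (at z) \<Longrightarrow> g differentiable (at z) \<Longrightarrow>
    wd s (\<lambda>z. f z * g z) z = f z * wd s g z + wd s f z * g z"
  by (simp add: wd_def pd_bilinear[OF bounded_bilinear_mult] field_simps)

lemma wd_cmult:
  fixes f :: "complex \<Rightarrow> complex"
  shows "f differentiable (at z) \<Longrightarrow> wd s (\<lambda>z. c * f z) z = c * wd s f z"
  using wd_mult[of "\<lambda>z. c" z f s] by simp

lemma wd_minus:
  fixes f :: "complex \<Rightarrow> complex"
  shows "f differentiable (at z) \<Longrightarrow> wd s (\<lambda>z. - f z) z = - wd s f z"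
  using wd_cmult[of f z s "-1"] by simp

lemma wd_diff:
  fixes f g :: "complex \<Rightarrow> complex"
  shows "f differentiable (at z) \<Longrightarrow> g differentiable (at z) \<Longrightarrow>
    wd s (\<lambda>z. f z - g z) z = wd s f z - wd s g z"
  using wd_add[of f z "\<lambda>z. - g z" s] wd_minus[of g z s] by simp

lemma wd_inverse:
  assumes "f differentiable (at z)" "f z \<noteq> 0"
  shows "wd s (\<lambda>z. inverse (f z)) z = - wd s f z / (f z)\<^sup>2"
  unfolding wd_def pd_inverse[OF assms]
  using assms(2) by (simp add: field_simps power2_eq_square)

lemma wd_sum:
  "(\<And>i. i \<in> I \<Longrightarrow> f i differentiable (at z)) \<Longrightarrow>
    wd s (\<lambda>z. \<Sum>i\<in>I. f i z) z = (\<Sum>i\<in>I. wd s (f i) z)"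
  by (induction I rule: infinite_finite_induct) (auto simp: wd_add)

lemma wd_prod:
  assumes "finite I" "\<And>i. i \<in> I \<Longrightarrow> f i differentiable (at z)"
  shows "wd s (\<lambda>z. \<Prod>i\<in>I. f i z) z = (\<Sum>i\<in>I. wd s (f i) z * (\<Prod>j\<in>I - {i}. f j z))
     \<and> (\<lambda>z. \<Prod>i\<in>I. f i z) differentiable (at z)"
  using assms
proof (induction I rule: finite_induct)
  case (insert i I)
  have eq: "insert i I - {a} = insert i (I - {a})" if "a \<in> I" for a
    using that insert by auto
  have "(\<Sum>a\<in>I. wd s (f a) z * prod (\<lambda>j. f j z) (insert i I - {a})) =
    f i z * (\<Sum>a\<in>I. wd s (f a) z * (\<Prod>j\<in>I - {a}. f j z))"
    unfolding sum_distrib_left by (rule sum.cong) (use insert in \<open>auto simp: eq mult_ac\<close>)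
  then show ?case using insert by (simp add: wd_mult insert_Diff_if mult_ac add_ac)
qed simp

lemma wd_cnj:
  "f differentiable (at z) \<Longrightarrow> wd s (\<lambda>z. cnj (f z)) z = cnj (wd (- cnj s) f z)"
  by (simp add: wd_def pd_bounded_linear[OF bounded_linear_cnj])

lemma differentiable_cnj: "f differentiable (at z) \<Longrightarrow> (\<lambda>z. cnj (f z)) differentiable (at z)"
  by (rule linear_differentiable[OF bounded_linear_cnj])

lemma smooth_on_wd:
  assumes "open U" "smooth_on f U"
  shows "smooth_on (wd s f) U"
proof -
  have "smooth_on (\<lambda>z. (1/2) * (pd 1 f z - s * \<i> * pd 2 f z)) U"
    by (intro smooth_on_mult smooth_on_diff smooth_on_const smooth_on_pd assms)
  then show ?thesis by (simp add: wd_def[abs_def])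
qed

lemma wd_wd:
  assumes "smooth_on f U" "z \<in> U"
  shows "wd s (wd t f) z = ((pd 1 (pd 1 f) z - s * t * pd 2 (pd 2 f) z) -
    \<i> * (t * pd 1 (pd 2 f) z + s * pd 2 (pd 1 f) z)) / 4"
proof -
  have d: "pd a f differentiable (at z)" for a
    using assms smooth_on_differentiable smooth_on_pd by blast
  have pd_wd: "pd a (wd t f) z = (pd a (pd 1 f) z - t * \<i> * pd a (pd 2 f) z) / 2" for a
  proof -
    have "((\<lambda>z. (pd 1 f z - t * \<i> * pd 2 f z) / 2) has_derivative
        (\<lambda>v. (frechet_derivative (pd 1 f) (at z) v - t * \<i> * frechet_derivative (pd 2 f) (at z) v) / 2)) (at z)"
      by (auto intro!: derivative_eq_intros has_derivative_frechet d)
    from pd_eq[OF this, of a] show ?thesis by (simp add: wd_def[abs_def] pd_def)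
  qed
  show ?thesis unfolding wd_def[of s "wd t f"] pd_wd by (simp add: field_simps)
qed

lemma wd_commute:
  assumes "open U" "smooth_on f U" "z \<in> U"
  shows "wd s (wd t f) z = wd t (wd s f) z"
  unfolding wd_wd[OF assms(2,3)] pd_commute[OF assms, of 2 1] by (simp add: field_simps)

lemma holomorphic_of_wd:
  assumes "open U" "\<And>z. z \<in> U \<Longrightarrow> f differentiable (at z)" "\<And>z. z \<in> U \<Longrightarrow> wd (-1) f z = 0"
  shows "f holomorphic_on U" "\<And>z. z \<in> U \<Longrightarrow> deriv f z = wd 1 f z"
proof -
  have "(f has_field_derivative wd 1 f z) (at z)" if "z \<in> U" for z
  proof -
    have "frechet_derivative f (at z) = (*) (wd 1 f z)"
      using frechet_derivative_wd[OF assms(2)[OF that]] assms(3)[OF that] by (auto simp: mult.commute)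
    then show ?thesis
      using has_derivative_frechet[OF assms(2)[OF that]] by (simp add: has_field_derivative_def)
  qed
  then show "f holomorphic_on U" "\<And>z. z \<in> U \<Longrightarrow> deriv f z = wd 1 f z"
    using assms(1) by (auto simp: holomorphic_on_open DERIV_imp_deriv)
qed

lemma wd_holomorphic:
  assumes "(f has_field_derivative D) (at z)"
  shows "wd (-1) f z = 0" "wd 1 f z = D"
  using wd_eq[OF assms[unfolded has_field_derivative_def], of 1]
    wd_eq[OF assms[unfolded has_field_derivative_def], of "-1"] by (simp_all add: mult_ac)

lemma wd_compose_holomorphic:
  assumes "(h has_field_derivative D) (at z)" "f differentiable (at (h z))"
  shows "wd 1 (\<lambda>w. f (h w)) z = wd 1 f (h z) * D"
    "wd (-1) (\<lambda>w. f (h w)) z = wd (-1) f (h z) * cnj D"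
    "(\<lambda>w. f (h w)) differentiable (at z)"
proof -
  have d: "((\<lambda>w. f (h w)) has_derivative (\<lambda>v. frechet_derivative f (at (h z)) (D * v))) (at z)"
    using has_derivative_compose[OF assms(1)[unfolded has_field_derivative_def]
       has_derivative_frechet[OF assms(2)]] .
  show "wd 1 (\<lambda>w. f (h w)) z = wd 1 f (h z) * D"
    "wd (-1) (\<lambda>w. f (h w)) z = wd (-1) f (h z) * cnj D"
    using wd_eq[OF d, of 1] wd_eq[OF d, of "-1"]
    by (simp_all add: frechet_derivative_wd[OF assms(2)] complex_eq_iff field_simps)
  show "(\<lambda>w. f (h w)) differentiable (at z)" using d by (auto simp: differentiable_def)
qed

lemma zero_derivative_constant:
  fixes f :: "complex \<Rightarrow> complex"
  assumes "open U" "connected U" "\<And>z. z \<in> U \<Longrightarrow> f differentiable (at z)"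
    "\<And>z. z \<in> U \<Longrightarrow> wd 1 f z = 0" "\<And>z. z \<in> U \<Longrightarrow> wd (-1) f z = 0" "x \<in> U" "y \<in> U"
  shows "f x = f y"
proof -
  have "(f has_derivative (\<lambda>v. 0)) (at z)" if "z \<in> U" for z
    using has_derivative_frechet[OF assms(3)[OF that]] frechet_derivative_wd[OF assms(3)[OF that]]
      assms(4,5)[OF that] by (metis (no_types, lifting) ext add.right_neutral mult_zero_right)
  then have d: "\<forall>z\<in>U - {}. (f has_derivative (\<lambda>v. 0)) (at z within U)"
    using has_derivative_at_withinI by blast
  have "continuous_on U f"
    using assms(3) differentiable_imp_continuous_within continuous_at_imp_continuous_on by blast
  then have "f constant_on U"
    using has_derivative_zero_connected_constant_on[OF assms(2,1) _ _ d] by simp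
  then show ?thesis using assms(6,7) unfolding constant_on_def by auto
qed

section \<open>Matrix-valued functions\<close>

text \<open>Calculus of matrix-valued functions is done entrywise, so that products, traces and
  determinants reduce to scalar rules.\<close>

definition msmooth :: "(complex \<Rightarrow> complex^'n^'m) \<Rightarrow> complex set \<Rightarrow> bool" where
  "msmooth F U \<longleftrightarrow> (\<forall>i j. smooth_on (\<lambda>z. F z $ i $ j) U)"

definition Dm :: "complex \<Rightarrow> (complex \<Rightarrow> complex^'n^'m) \<Rightarrow> complex \<Rightarrow> complex^'n^'m" where
  "Dm s F z = (\<chi> i j. wd s (\<lambda>w. F w $ i $ j) z)"

definition mdiff :: "(complex \<Rightarrow> complex^'n^'m) \<Rightarrow> complex \<Rightarrow> bool" where
  "mdiff F z \<longleftrightarrow> (\<forall>i j. (\<lambda>w. F w $ i $ j) differentiable (at z))"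

lemma msmooth_mdiff: "msmooth F U \<Longrightarrow> z \<in> U \<Longrightarrow> mdiff F z"
  unfolding msmooth_def mdiff_def using smooth_on_differentiable by blast

lemma msmooth_subset: "msmooth F U \<Longrightarrow> V \<subseteq> U \<Longrightarrow> msmooth F V"
  unfolding msmooth_def using smooth_on_subset by blast

lemma msmooth_const: "msmooth (\<lambda>z. A) U"
  by (simp add: msmooth_def smooth_on_const)
lemma msmooth_add: "open U \<Longrightarrow> msmooth F U \<Longrightarrow> msmooth G U \<Longrightarrow> msmooth (\<lambda>z. F z + G z) U"
  by (simp add: msmooth_def smooth_on_add)
lemma msmooth_diff: "open U \<Longrightarrow> msmooth F U \<Longrightarrow> msmooth G U \<Longrightarrow> msmooth (\<lambda>z. F z - G z) U"
  by (simp add: msmooth_def smooth_on_diff)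
lemma msmooth_sum: "open U \<Longrightarrow> (\<And>i. i \<in> I \<Longrightarrow> msmooth (F i) U) \<Longrightarrow> msmooth (\<lambda>z. \<Sum>i\<in>I. F i z) U"
  by (simp add: msmooth_def smooth_on_sum)
lemma msmooth_mult:
  "open U \<Longrightarrow> msmooth F U \<Longrightarrow> msmooth G U \<Longrightarrow> msmooth (\<lambda>z. F z ** G z) U"
  by (simp add: msmooth_def matrix_matrix_mult_def smooth_on_sum smooth_on_mult)
lemma msmooth_adj: "open U \<Longrightarrow> msmooth F U \<Longrightarrow> msmooth (\<lambda>z. adj (F z)) U"
  by (simp add: msmooth_def adj_def smooth_on_cnj)
lemma msmooth_Dm: "open U \<Longrightarrow> msmooth F U \<Longrightarrow> msmooth (Dm s F) U"
  by (simp add: msmooth_def Dm_def smooth_on_wd)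
lemma smooth_on_trace: "open U \<Longrightarrow> msmooth F U \<Longrightarrow> smooth_on (\<lambda>z. trace (F z)) U"
  by (simp add: msmooth_def trace_def smooth_on_sum)
lemma smooth_on_det: "open U \<Longrightarrow> msmooth F U \<Longrightarrow> smooth_on (\<lambda>z. det (F z)) U"
  unfolding det_def msmooth_def
  by (intro smooth_on_sum smooth_on_mult smooth_on_const smooth_on_prod) auto

lemma msmooth_inv:
  assumes "open U" "msmooth F U" "\<And>z. z \<in> U \<Longrightarrow> det (F z) \<noteq> 0"
  shows "msmooth (\<lambda>z. matrix_inv (F z)) U"
  unfolding msmooth_def
proof (intro allI)
  fix i j
  have "msmooth (\<lambda>z. \<chi> a b. if b = i then (if a = j then 1 else 0) else F z $ a $ b) U"
    unfolding msmooth_def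
  proof (intro allI)
    fix a b
    show "smooth_on (\<lambda>z. (\<chi> a b. if b = i then (if a = j then 1 else 0) else F z $ a $ b) $ a $ b) U"
      using assms(2) by (cases "b = i") (auto simp: msmooth_def smooth_on_const)
  qed
  then have "smooth_on (\<lambda>z. det (\<chi> a b. if b = i then (if a = j then 1 else 0) else F z $ a $ b) *
      inverse (det (F z))) U"
    by (intro smooth_on_mult smooth_on_det smooth_on_inverse assms)
  then show "smooth_on (\<lambda>z. matrix_inv (F z) $ i $ j) U"
    by (rule smooth_on_cong[OF assms(1), rotated])
      (use assms in \<open>auto simp: matrix_inv_entry divide_inverse\<close>)
qed

lemma Dm_cong_open:
  "open U \<Longrightarrow> z \<in> U \<Longrightarrow> (\<And>w. w \<in> U \<Longrightarrow> F w = G w) \<Longrightarrow> Dm s F z = Dm s G z"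
  unfolding Dm_def vec_eq_iff by (auto intro: wd_cong_open)
lemma Dm_const [simp]: "Dm s (\<lambda>z. A) z = 0"
  by (simp add: Dm_def vec_eq_iff)
lemma Dm_add: "mdiff F z \<Longrightarrow> mdiff G z \<Longrightarrow> Dm s (\<lambda>z. F z + G z) z = Dm s F z + Dm s G z"
  by (simp add: Dm_def mdiff_def vec_eq_iff wd_add)
lemma Dm_diff: "mdiff F z \<Longrightarrow> mdiff G z \<Longrightarrow> Dm s (\<lambda>z. F z - G z) z = Dm s F z - Dm s G z"
  by (simp add: Dm_def mdiff_def vec_eq_iff wd_diff)
lemma Dm_mult:
  "mdiff F z \<Longrightarrow> mdiff G z \<Longrightarrow> Dm s (\<lambda>z. F z ** G z) z = F z ** Dm s G z + Dm s F z ** G z"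
  by (simp add: Dm_def mdiff_def vec_eq_iff matrix_matrix_mult_def wd_sum wd_mult sum.distrib)
lemma Dm_adj: "mdiff F z \<Longrightarrow> Dm s (\<lambda>z. adj (F z)) z = adj (Dm (- cnj s) F z)"
  by (simp add: Dm_def mdiff_def vec_eq_iff adj_def wd_cnj)
lemma wd_trace: "mdiff F z \<Longrightarrow> wd s (\<lambda>z. trace (F z)) z = trace (Dm s F z)"
  by (simp add: Dm_def mdiff_def trace_def wd_sum)

lemma Dm_commute: "open U \<Longrightarrow> msmooth F U \<Longrightarrow> z \<in> U \<Longrightarrow> Dm s (Dm t F) z = Dm t (Dm s F) z"
  unfolding msmooth_def Dm_def vec_eq_iff using wd_commute by force

text \<open>Jacobi's formula at the identity: in the Leibniz expansion, a permutation other than the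
  identity moves at least two indices, so its product vanishes to second order.\<close>

lemma wd_det_at_identity:
  assumes "mdiff F z" "F z = mat 1"
  shows "wd s (\<lambda>z. det (F z)) z = trace (Dm s F z)"
proof -
  let ?P = "{p. p permutes (UNIV::'a set)}"
  have d: "(\<lambda>w. F w $ i $ j) differentiable (at z)" for i j
    using assms(1) unfolding mdiff_def by blast
  have dp: "(\<lambda>w. \<Prod>i\<in>UNIV. F w $ i $ p i) differentiable (at z)"
    "wd s (\<lambda>w. \<Prod>i\<in>UNIV. F w $ i $ p i) z =
      (\<Sum>i\<in>UNIV. wd s (\<lambda>w. F w $ i $ p i) z * (\<Prod>j\<in>UNIV - {i}. F z $ j $ p j))" for p
    using wd_prod[of UNIV "\<lambda>i w. F w $ i $ p i" z s] d by auto
  have zero: "wd s (\<lambda>w. \<Prod>i\<in>UNIV. F w $ i $ p i) z = 0" if perm: "p permutes UNIV" and nid: "p \<noteq> id" for p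
  proof -
    obtain a where a: "p a \<noteq> a" using nid by (auto simp: fun_eq_iff)
    have inj: "inj p" using permutes_inj[OF perm] by auto
    have "(\<Prod>j\<in>UNIV - {i}. F z $ j $ p j) = 0" for i
    proof (cases "i = a")
      case True
      have "p (p a) \<noteq> p a" using a inj by (simp add: inj_eq)
      then show ?thesis using True a assms(2)
        by (intro prod_zero) (auto intro!: bexI[of _ "p a"] simp: mat_def)
    next
      case False
      then show ?thesis using a assms(2)
        by (intro prod_zero) (auto intro!: bexI[of _ a] simp: mat_def)
    qed
    then show ?thesis unfolding dp(2) by (intro sum.neutral ballI) (simp only: mult_zero_right)
  qed
  have "wd s (\<lambda>z. det (F z)) z = (\<Sum>p\<in>?P. of_int (sign p) * wd s (\<lambda>w. \<Prod>i\<in>UNIV. F w $ i $ p i) z)"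
    unfolding det_def
    by (subst wd_sum) (auto intro!: sum.cong wd_cmult differentiable_mult dp(1))
  also have "\<dots> = (\<Sum>p\<in>{id}. of_int (sign p) * wd s (\<lambda>w. \<Prod>i\<in>UNIV. F w $ i $ p i) z)"
    by (rule sum.mono_neutral_right) (auto simp: zero permutes_id finite_permutations)
  also have "\<dots> = trace (Dm s F z)"
    by (simp add: dp sign_id Dm_def trace_def assms(2) mat_def)
  finally show ?thesis .
qed

lemma wd_det:
  assumes "mdiff F z" "det (F z) \<noteq> 0"
  shows "wd s (\<lambda>z. det (F z)) z = det (F z) * trace (matrix_inv (F z) ** Dm s F z)"
proof -
  let ?Y = "matrix_inv (F z)"
  have c: "mdiff (\<lambda>z. ?Y) z" by (simp add: mdiff_def)
  have eq: "det (F w) = det (F z) * det (?Y ** F w)" for w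
    using matrix_inv_works(1)[OF assms(2)] det_mul[of "F z" "?Y ** F w"] by (simp add: matrix_mul_assoc)
  have m: "mdiff (\<lambda>w. ?Y ** F w) z"
    unfolding mdiff_def matrix_matrix_mult_def
    using assms(1) by (auto intro!: differentiable_sum differentiable_mult simp: mdiff_def)
  have dd: "(\<lambda>w. det (?Y ** F w)) differentiable (at z)"
    unfolding det_def
    using m by (auto intro!: differentiable_sum differentiable_mult wd_prod[THEN conjunct2] simp: mdiff_def)
  have "wd s (\<lambda>w. det (F w)) z = det (F z) * wd s (\<lambda>w. det (?Y ** F w)) z"
    by (subst eq) (rule wd_cmult[OF dd])
  also have "wd s (\<lambda>w. det (?Y ** F w)) z = trace (?Y ** Dm s F z)"
    using wd_det_at_identity[OF m] matrix_inv_works(2)[OF assms(2)] Dm_mult[OF c assms(1)] by simp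
  finally show ?thesis .
qed

text \<open>Derivatives and smoothness of a matrix-valued function taken in the normed space of matrices
  agree with the entrywise notions.\<close>

lemma bounded_linear_entry: "bounded_linear (\<lambda>A :: 'a::real_normed_vector^'n^'m. A $ i $ j)"
  by (rule bounded_linear_compose[OF bounded_linear_vec_nth bounded_linear_vec_nth])

lemma smooth_on_msmooth: "open U \<Longrightarrow> smooth_on F U \<Longrightarrow> msmooth F U"
  unfolding msmooth_def by (auto intro: smooth_on_linear[OF bounded_linear_entry])

lemma pd_entry:
  fixes F :: "complex \<Rightarrow> complex^'n^'m"
  shows "F differentiable (at z) \<Longrightarrow> pd a F z $ i $ j = pd a (\<lambda>w. F w $ i $ j) z"
  by (rule pd_bounded_linear[OF bounded_linear_entry, symmetric])

lemma frechet_derivative_Dm: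
  fixes F :: "complex \<Rightarrow> complex^'n^'m"
  assumes "F differentiable (at z)"
  shows "frechet_derivative F (at z) v = mat v ** Dm 1 F z + mat (cnj v) ** Dm (-1) F z"
proof -
  have d: "((\<lambda>w. F w $ i $ j) has_derivative (\<lambda>v. frechet_derivative F (at z) v $ i $ j)) (at z)" for i j
    by (rule bounded_linear.has_derivative[OF bounded_linear_entry has_derivative_frechet[OF assms]])
  have "frechet_derivative F (at z) v $ i $ j = v * wd 1 (\<lambda>w. F w $ i $ j) z + cnj v * wd (-1) (\<lambda>w. F w $ i $ j) z" for i j
    using frechet_derivative_wd[of "\<lambda>w. F w $ i $ j" z v] d[of i j]
    by (metis differentiableI frechet_derivative_at)
  then show ?thesis by (simp add: vec_eq_iff mat_scalar Dm_def)
qed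

section \<open>Orthogonal projections\<close>

definition oproj :: "complex^'n^'n \<Rightarrow> bool" where
  "oproj P \<longleftrightarrow> P ** P = P \<and> adj P = P"

lemma herm_adj: "herm (A *v x) y = herm x (adj A *v y)"
proof -
  have "herm (A *v x) y = (\<Sum>i\<in>UNIV. \<Sum>j\<in>UNIV. A $ i $ j * x $ j * cnj (y $ i))"
    by (simp add: herm_def matrix_vector_mult_def sum_distrib_right)
  also have "\<dots> = (\<Sum>j\<in>UNIV. \<Sum>i\<in>UNIV. A $ i $ j * x $ j * cnj (y $ i))"
    by (rule sum.swap)
  also have "\<dots> = herm x (adj A *v y)"
    by (simp add: herm_def matrix_vector_mult_def adj_def sum_distrib_left mult_ac)
  finally show ?thesis .
qed

lemma herm_add_left: "herm (x + y) z = herm x z + herm y z"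
  by (simp add: herm_def sum.distrib distrib_right)
lemma herm_diff_left: "herm (x - y) z = herm x z - herm y z"
  by (simp add: herm_def sum_subtractf left_diff_distrib)
lemma herm_scale_left: "herm (c *s x) z = c * herm x z"
  by (simp add: herm_def sum_distrib_left mult_ac)
lemma herm_scale_right: "herm x (c *s z) = cnj c * herm x z"
  by (simp add: herm_def sum_distrib_left mult_ac)
lemma herm_sum_left: "herm (\<Sum>i\<in>I. f i) z = (\<Sum>i\<in>I. herm (f i) z)"
  by (induction I rule: infinite_finite_induct) (auto simp: herm_add_left, simp_all add: herm_def)
lemma herm_zero [simp]: "herm 0 x = 0" "herm x 0 = 0"
  by (simp_all add: herm_def)
lemma herm_cnj: "cnj (herm x y) = herm y x"
  by (simp add: herm_def mult.commute)
lemma herm_self: "herm x x = of_real ((norm x)\<^sup>2)"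
  by (simp add: herm_def norm_vec_def L2_set_def sum_nonneg complex_norm_square del: of_real_power)
lemma herm_self_eq_0: "herm x x = 0 \<longleftrightarrow> x = 0"
  by (simp add: herm_self)

lemma matrix_eq_iff_vec: "A = B \<longleftrightarrow> (\<forall>x. A *v x = B *v (x :: complex^'n))"
  using matrix_eq by blast

lemma oproj_range_iff:
  assumes "oproj P"
  shows "x \<in> range ((*v) P) \<longleftrightarrow> P *v x = x"
proof
  assume "x \<in> range ((*v) P)"
  then obtain y where "x = P *v y" by blast
  then show "P *v x = x" using assms by (simp add: oproj_def matrix_vector_mul_assoc)
next
  assume "P *v x = x"
  then show "x \<in> range ((*v) P)" by (metis rangeI)
qed

lemma oproj_unique:
  assumes "oproj P" "oproj Q" "range ((*v) P) = range ((*v) Q)"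
  shows "P = Q"
proof -
  have "Q ** P = P" "P ** Q = Q"
    unfolding matrix_eq_iff_vec matrix_vector_mul_assoc[symmetric]
    using oproj_range_iff[OF assms(1)] oproj_range_iff[OF assms(2)] assms(3) by blast+
  then show ?thesis
    using assms(1,2) adj_mult[of Q P] unfolding oproj_def by metis
qed

lemma proj_eqI:
  assumes "oproj P" "range ((*v) P) = L"
  shows "proj L = P"
  unfolding proj_def
  by (rule the_equality) (use assms oproj_unique in \<open>auto simp: oproj_def\<close>)

definition orthonormal_set :: "(complex^'n) set \<Rightarrow> bool" where
  "orthonormal_set B \<longleftrightarrow> (\<forall>x\<in>B. \<forall>y\<in>B. herm x y = (if x = y then 1 else 0))"

lemma orthonormal_coefficient:
  assumes "orthonormal_set B" "finite B" "b \<in> B"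
  shows "herm (\<Sum>x\<in>B. c x *s x) b = c b"
proof -
  have "herm (\<Sum>x\<in>B. c x *s x) b = (\<Sum>x\<in>B. c x * (if x = b then 1 else 0))"
    using assms by (auto simp: herm_sum_left herm_scale_left orthonormal_set_def intro!: sum.cong)
  also have "\<dots> = c b" using assms(2,3) by (simp add: if_distrib cong: if_cong)
  finally show ?thesis .
qed

lemma orthonormal_independent:
  assumes "orthonormal_set B"
  shows "vec.independent B"
  unfolding vec.independent_explicit_finite_subsets
proof (intro allI impI ballI)
  fix S u v
  assume *: "S \<subseteq> B" "finite S" "(\<Sum>v\<in>S. u v *s v) = 0" "v \<in> S"
  then have "orthonormal_set S" using assms by (simp add: orthonormal_set_def subset_iff)
  from orthonormal_coefficient[OF this *(2,4), of u] *(3) show "u v = 0" by simp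
qed

lemma orthonormal_finite:
  assumes "orthonormal_set B"
  shows "finite (B :: (complex^'n) set)" "card B \<le> CARD('n)"
proof -
  show "finite B" using orthonormal_independent[OF assms] vec.finiteI_independent by blast
  have "card B \<le> vec.dim (UNIV :: (complex^'n) set)"
    using orthonormal_independent[OF assms] by (intro vec.independent_card_le_dim) auto
  then show "card B \<le> CARD('n)" by (metis vec_dim_card)
qed

text \<open>An orthonormal subset of maximal cardinality spans: otherwise the component of a further
  vector orthogonal to the set, normalised, could be added.\<close>

lemma orthonormal_basis_exists:
  assumes "vec.subspace (L :: (complex^'n) set)"
  obtains B where "orthonormal_set B" "B \<subseteq> L" "vec.span B = L"
proof -
  let ?Q = "\<lambda>B. orthonormal_set B \<and> B \<subseteq> L"
  have "?Q {}" by (simp add: orthonormal_set_def)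
  moreover have "\<forall>B. ?Q B \<longrightarrow> card B \<le> CARD('n)" using orthonormal_finite by blast
  ultimately obtain B where B: "?Q B" "\<And>B'. ?Q B' \<Longrightarrow> card B' \<le> card B"
    using ex_has_greatest_nat[of ?Q "{}" card "CARD('n) + 1"] by (auto simp: less_Suc_eq_le)
  have fin: "finite B" using B orthonormal_finite by blast
  have sub: "vec.span B \<subseteq> L" using B assms vec.span_minimal by blast
  have "x \<in> vec.span B" if "x \<in> L" for x
  proof (rule ccontr)
    assume nx: "x \<notin> vec.span B"
    define y where "y = x - (\<Sum>b\<in>B. herm x b *s b)"
    have sB: "(\<Sum>b\<in>B. herm x b *s b) \<in> vec.span B"
      by (intro vec.span_sum vec.span_scale vec.span_base)
    have "y \<noteq> 0" using nx sB by (auto simp: y_def)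
    have yL: "y \<in> L" unfolding y_def using that sB sub assms by (intro vec.subspace_diff) auto
    have yb: "herm y b = 0" if "b \<in> B" for b
      using orthonormal_coefficient[of B b "\<lambda>b. herm x b"] B fin that by (simp add: y_def herm_diff_left)
    define e where "e = of_real (inverse (norm y)) *s y"
    have eL: "e \<in> L" unfolding e_def using yL assms by (intro vec.subspace_scale) auto
    have ee: "herm e e = 1"
    proof -
      have "herm e e = of_real (inverse (norm y)) * (of_real (inverse (norm y)) * herm y y)"
        unfolding e_def herm_scale_left herm_scale_right by simp
      then show ?thesis using \<open>y \<noteq> 0\<close> by (simp add: herm_self power2_eq_square field_simps)
    qed
    have eb: "herm e b = 0" "herm b e = 0" if "b \<in> B" for b
      using yb[OF that] herm_cnj[of y b] by (auto simp: e_def herm_scale_left herm_scale_right)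
    have "e \<notin> B" using eb ee by force
    have "?Q (insert e B)"
      using B eL ee eb \<open>e \<notin> B\<close> by (auto simp: orthonormal_set_def)
    from B(2)[OF this] show False using fin \<open>e \<notin> B\<close> by simp
  qed
  then show ?thesis using that[of B] B sub by blast
qed

lemma orthonormal_projection:
  assumes "orthonormal_set B"
  defines "P \<equiv> (\<chi> i j. \<Sum>b\<in>B. b $ i * cnj (b $ j))"
  shows "oproj P" "range ((*v) P) = vec.span B" "trace P = of_nat (card B)"
proof -
  have fin: "finite B" using assms orthonormal_finite by blast
  have Pv: "P *v x = (\<Sum>b\<in>B. herm x b *s b)" for x
  proof -
    have "(P *v x) $ i = (\<Sum>j\<in>UNIV. \<Sum>b\<in>B. b $ i * cnj (b $ j) * x $ j)" for i
      by (simp add: P_def matrix_vector_mult_def sum_distrib_right)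
    also have "\<dots> i = (\<Sum>b\<in>B. \<Sum>j\<in>UNIV. b $ i * cnj (b $ j) * x $ j)" for i
      by (rule sum.swap)
    also have "\<dots> i = (\<Sum>b\<in>B. herm x b *s b) $ i" for i
      by (simp add: herm_def sum_distrib_left mult_ac)
    finally show ?thesis by (simp add: vec_eq_iff)
  qed
  have fixed: "P *v b = b" if "b \<in> B" for b
  proof -
    have "P *v b = (\<Sum>x\<in>B. (if x = b then 1 else 0) *s x)"
      unfolding Pv using assms(1) that by (intro sum.cong) (auto simp: orthonormal_set_def)
    also have "\<dots> = (\<Sum>x\<in>B. if x = b then x else 0)" by (intro sum.cong) auto
    also have "\<dots> = b" using fin that by simp
    finally show ?thesis .
  qed
  have adjP: "adj P = P" by (simp add: P_def adj_def vec_eq_iff mult.commute)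
  have "P *v (P *v x) = P *v x" for x
  proof -
    have "P *v (P *v x) = (\<Sum>b\<in>B. herm x b *s (P *v b))"
      by (simp only: Pv[of x]) (simp add: vec.linear_sum[OF matrix_vector_mul_linear_gen] vec.linear_scale[OF matrix_vector_mul_linear_gen])
    also have "\<dots> = P *v x" unfolding Pv[of x] by (intro sum.cong) (auto simp: fixed)
    finally show ?thesis .
  qed
  then have "P ** P = P" by (simp add: matrix_eq_iff_vec matrix_vector_mul_assoc[symmetric])
  with adjP show "oproj P" by (simp add: oproj_def)
  have "vec.span B \<subseteq> range ((*v) P)"
  proof (rule vec.span_minimal)
    show "B \<subseteq> range ((*v) P)" using fixed by (metis rangeI subsetI)
    show "vec.subspace (range ((*v) P))"
      using vec.linear_subspace_image[OF matrix_vector_mul_linear_gen vec.subspace_UNIV] by auto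
  qed
  moreover have "P *v x \<in> vec.span B" for x
    unfolding Pv by (intro vec.span_sum vec.span_scale vec.span_base)
  ultimately show "range ((*v) P) = vec.span B" by auto
  have "trace P = (\<Sum>b\<in>B. \<Sum>i\<in>UNIV. b $ i * cnj (b $ i))"
    unfolding trace_def P_def by (simp add: sum.swap[of _ B])
  also have "\<dots> = (\<Sum>b\<in>B. 1)"
    using assms(1) by (intro sum.cong) (auto simp: orthonormal_set_def herm_def)
  finally show "trace P = of_nat (card B)" by simp
qed

text \<open>The definite description in \<open>proj\<close> is meaningful because the matrix \<open>\<Sum>\<^sub>b b b\<^sup>*\<close> over an
  orthonormal basis has the required properties.\<close>

lemma proj_works:
  assumes "vec.subspace L"
  shows "oproj (proj L)" "range ((*v) (proj L)) = L" "trace (proj L) = of_nat (vec.dim L)"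
proof -
  obtain B where B: "orthonormal_set B" "B \<subseteq> L" "vec.span B = L"
    using orthonormal_basis_exists[OF assms] .
  note P = orthonormal_projection[OF B(1)]
  have eq: "proj L = (\<chi> i j. \<Sum>b\<in>B. b $ i * cnj (b $ j))"
    using P B(3) by (intro proj_eqI) auto
  have "vec.dim L = card B"
    using vec.dim_span_eq_card_independent[OF orthonormal_independent[OF B(1)]] B(3) by simp
  then show "oproj (proj L)" "range ((*v) (proj L)) = L" "trace (proj L) = of_nat (vec.dim L)"
    using P B(3) unfolding eq by auto
qed

lemma subspace_range: "vec.subspace (range ((*v) (A :: complex^'n^'m)))"
  using vec.linear_subspace_image[OF matrix_vector_mul_linear_gen vec.subspace_UNIV] by auto

lemma oproj_trace_dim:
  assumes "oproj P"
  shows "trace P = of_nat (vec.dim (range ((*v) P)))"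
  using proj_works(3)[OF subspace_range[of P]] proj_eqI[OF assms refl] by simp

lemma oproj_0 [simp]: "oproj 0" and oproj_1 [simp]: "oproj (mat 1)"
  by (auto simp: oproj_def)

lemma oproj_complement: "oproj P \<Longrightarrow> oproj (mat 1 - P)"
  by (simp add: oproj_def adj_diff mmult)

lemma oproj_orth:
  assumes "oproj P"
  shows "orth (range ((*v) P)) = range ((*v) (mat 1 - P))"
proof -
  have "y \<in> orth (range ((*v) P)) \<longleftrightarrow> P *v y = 0" for y
  proof
    assume "y \<in> orth (range ((*v) P))"
    then have "herm (P *v (P *v y)) y = 0" by (auto simp: orth_def)
    then have "herm (P *v y) (P *v y) = 0" using assms by (simp add: herm_adj[of P "P *v y"] oproj_def)
    then show "P *v y = 0" by (simp add: herm_self_eq_0)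
  next
    assume "P *v y = 0"
    then show "y \<in> orth (range ((*v) P))" using assms by (auto simp: orth_def herm_adj oproj_def)
  qed
  moreover have "y \<in> range ((*v) (mat 1 - P)) \<longleftrightarrow> P *v y = 0" for y
    using oproj_range_iff[OF oproj_complement[OF assms], of y]
    by (simp add: matrix_vector_mult_diff_rdistrib)
  ultimately show ?thesis by blast
qed

lemma oproj_le_iff:
  assumes "oproj Q"
  shows "range ((*v) A) \<subseteq> range ((*v) Q) \<longleftrightarrow> Q ** A = A"
proof
  assume "range ((*v) A) \<subseteq> range ((*v) Q)"
  then show "Q ** A = A"
    unfolding matrix_eq_iff_vec matrix_vector_mul_assoc[symmetric]
    using oproj_range_iff[OF assms] by blast
next
  assume "Q ** A = A"
  then show "range ((*v) A) \<subseteq> range ((*v) Q)"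
    by (metis (no_types) image_subsetI matrix_vector_mul_assoc rangeI)
qed

lemma mat_vector_scale: "mat c *v x = c *s (x :: complex^'n)"
proof -
  have "(\<Sum>k\<in>UNIV. (if i = k then c else 0) * x $ k) = c * x $ i" for i
    using sum.delta'[of UNIV i "\<lambda>k. c * x $ k"] by (simp add: if_distrib if_distribR cong: if_cong)
  then show ?thesis by (simp add: vec_eq_iff matrix_vector_mult_def mat_def)
qed

section \<open>Two facts on determinants\<close>

lemma posdef_det_nz:
  fixes X :: "complex^'n^'n"
  assumes "t \<ge> 0"
  shows "det (mat 1 + mat (of_real t) ** (adj X ** X)) \<noteq> 0"
proof
  let ?G = "mat 1 + mat (of_real t) ** (adj X ** X)"
  assume "det ?G = 0"
  then have "\<not> invertible ?G" by (simp add: invertible_det_nz)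
  then obtain x where x: "?G *v x = 0" "x \<noteq> 0"
    by (auto simp: invertible_left_inverse matrix_left_invertible_ker)
  have "herm (?G *v x) x = herm x x + of_real t * herm (X *v x) (X *v x)"
    by (simp add: matrix_vector_mult_add_rdistrib herm_add_left matrix_vector_mul_assoc[symmetric]
        herm_adj[of "adj X"] herm_scale_left mat_vector_scale)
  then have "of_real ((norm x)\<^sup>2 + t * (norm (X *v x))\<^sup>2) = (0::complex)"
    using x by (simp add: herm_self)
  then have "(norm x)\<^sup>2 + t * (norm (X *v x))\<^sup>2 = 0" using of_real_eq_0_iff by blast
  then show False using x(2) assms
    by (metis add_nonneg_eq_0_iff mult_nonneg_nonneg norm_eq_zero power_eq_0_iff zero_le_power2)
qed


lemma wd_scalar_line:
  fixes N :: "complex^'n^'n"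
  shows "mdiff (\<lambda>z. A + mat z ** N) z" "Dm 1 (\<lambda>z. A + mat z ** N) z = N"
    "Dm (-1) (\<lambda>z. A + mat z ** N) z = 0"
proof -
  have d: "((\<lambda>z. (A + mat z ** N) $ i $ j) has_field_derivative N $ i $ j) (at z)" for i j
    by (auto simp: mat_scalar intro!: derivative_eq_intros)
  show "mdiff (\<lambda>z. A + mat z ** N) z"
    unfolding mdiff_def using d field_differentiable_imp_differentiable field_differentiable_def by blast
  show "Dm 1 (\<lambda>z. A + mat z ** N) z = N" "Dm (-1) (\<lambda>z. A + mat z ** N) z = 0"
    unfolding Dm_def vec_eq_iff using wd_holomorphic[OF d] by auto
qed

lemma holomorphic_det_line: "(\<lambda>z. det (A + mat z ** (N :: complex^'n^'n))) holomorphic_on U"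
  unfolding det_def mat_scalar by (auto intro!: holomorphic_intros)

text \<open>Along \<open>f(t) = det(1 + t X\<^sup>*X)\<close> the logarithmic derivative is \<open>tr((1 + t X\<^sup>*X)\<^sup>-\<^sup>1 X\<^sup>*X)\<close>, a
  sum of two nonnegative squares, so \<open>f\<close> increases from \<open>f(0) = 1\<close>.\<close>

lemma det_one_plus_gram_ge_1:
  fixes X :: "complex^'n^'n"
  shows "\<exists>r\<ge>1. det (mat 1 + adj X ** X) = of_real r"
proof -
  define N where "N = adj X ** X"
  define F where "F z = mat 1 + mat z ** N" for z :: complex
  define f where "f t = Re (det (F (of_real t)))" for t
  have adjN: "adj N = N" by (simp add: N_def adj_mult)
  have adjF: "adj (F (of_real t)) = F (of_real t)" for t
    by (simp add: F_def adj_add adj_mult adjN mat_commute)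
  have real: "det (F (of_real t)) = of_real (f t)" for t
    using det_adj[of "F (of_real t)"] unfolding adjF f_def by (metis complex_cnj_cancel_iff Reals_cnj_iff of_real_Re)
  have nz: "f t \<noteq> 0" if "t \<ge> 0" for t
    using posdef_det_nz[OF that, of X] real[of t] by (auto simp: F_def N_def)
  define r where "r t = (norm (X ** matrix_inv (F (of_real t))))\<^sup>2 +
     t * (norm (N ** matrix_inv (F (of_real t))))\<^sup>2" for t
  have tr: "trace (matrix_inv (F (of_real t)) ** N) = of_real (r t)" if "t \<ge> 0" for t
  proof -
    let ?F = "F (of_real t)" and ?S = "matrix_inv (F (of_real t))"
    have d: "det ?F \<noteq> 0" using nz[OF that] real[of t] by simp
    note inv = matrix_inv_works[OF d]
    have "?F ** adj ?S = mat 1" using inv(2) adj_mult[of ?S ?F] adjF[of t] by simp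
    then have adjS: "adj ?S = ?S" using matrix_inv_unique' by metis
    have "?S ** N = ?S ** (N ** (?F ** ?S))" by (simp add: inv)
    also have "\<dots> = ?S ** N ** ?S + mat (of_real t) ** (?S ** (N ** (N ** ?S)))"
      by (simp add: F_def mmult mat_commute) (simp add: matrix_mul_assoc mat_commute)
    also have "\<dots> = adj (X ** ?S) ** (X ** ?S) + mat (of_real t) ** (adj (N ** ?S) ** (N ** ?S))"
      by (simp add: adj_mult adjS adjN) (simp add: N_def matrix_mul_assoc)
    finally show ?thesis by (simp add: trace_add trace_scalar trace_adj_mult_self r_def)
  qed
  have hol: "(\<lambda>z. det (F z)) holomorphic_on UNIV"
    unfolding F_def by (rule holomorphic_det_line)
  have df: "(f has_real_derivative f t * r t) (at t)" if "t \<ge> 0" for t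
  proof -
    have d: "det (F (of_real t)) \<noteq> 0" using nz[OF that] real[of t] by simp
    have "((\<lambda>z. det (F z)) has_field_derivative deriv (\<lambda>z. det (F z)) (of_real t)) (at (of_real t))"
      using hol holomorphic_derivI by blast
    then have "((\<lambda>z. det (F z)) has_field_derivative det (F (of_real t)) * trace (matrix_inv (F (of_real t)) ** N)) (at (of_real t))"
      using wd_holomorphic(2)[of "\<lambda>z. det (F z)" _ "of_real t"] wd_det[of F "of_real t" 1] d
        wd_scalar_line[of "mat 1" N "of_real t"] by (simp add: F_def[abs_def])
    then have "((\<lambda>z. det (F z)) has_field_derivative of_real (f t * r t)) (at (of_real t))"
      using tr[OF that] real by simp
    from has_field_derivative_Re[OF has_vector_derivative_real_field[OF this]] show ?thesis
      by (simp add: f_def[abs_def])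
  qed
  have ct: "continuous_on {0..} f"
    using df by (intro continuous_at_imp_continuous_on) (auto intro: DERIV_isCont)
  have f0: "f 0 = 1" by (simp add: f_def F_def)
  have pos: "f t > 0" if "t \<ge> 0" for t
  proof (rule ccontr)
    assume "\<not> f t > 0"
    then have "\<exists>x. 0 \<le> x \<and> x \<le> t \<and> f x = 0"
      using that f0 continuous_on_subset[OF ct, of "{0..t}"] by (intro IVT2') auto
    then show False using nz by auto
  qed
  have "f 0 \<le> f 1"
  proof (rule DERIV_nonneg_imp_nondecreasing[of 0 1])
    show "\<exists>y. (f has_real_derivative y) (at x) \<and> 0 \<le> y" if "0 \<le> x" "x \<le> 1" for x
      using df[OF that(1)] pos[OF that(1)] that by (intro exI[of _ "f x * r x"]) (auto simp: r_def)
  qed simp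
  then have "f 1 \<ge> 1" by (simp add: f0)
  moreover have "det (mat 1 + adj X ** X) = of_real (f 1)" using real[of 1] by (simp add: F_def N_def)
  ultimately show ?thesis by blast
qed

text \<open>For invertible \<open>A\<close> the two matrices are conjugate. In general \<open>A\<close> is joined to the identity
  by a line on which both sides are holomorphic in the parameter and agree near the identity.\<close>

lemma det_one_minus_swap:
  fixes A B :: "complex^'n^'n"
  shows "det (mat 1 - A ** B) = det (mat 1 - B ** A)"
proof -
  define T where "T s = mat 1 + mat s ** (A - mat 1)" for s :: complex
  define h where "h s = det (mat 1 - T s ** B) - det (mat 1 - B ** T s)" for s
  have 1: "mat 1 - T s ** B = (mat 1 - B) + mat s ** (B - A ** B)" for s
    by (simp add: T_def mmult)
  have 2: "mat 1 - B ** T s = (mat 1 - B) + mat s ** (B - B ** A)" for s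
    by (simp add: T_def mmult mat_commute[of B]) (simp add: matrix_mul_assoc mat_commute)
  have hol: "h holomorphic_on UNIV" unfolding h_def[abs_def] 1 2
    by (intro holomorphic_on_diff holomorphic_det_line)
  have holT: "(\<lambda>s. det (T s)) holomorphic_on UNIV" unfolding T_def by (rule holomorphic_det_line)
  have zero: "h s = 0" if "det (T s) \<noteq> 0" for s
  proof -
    have "T s ** (mat 1 - B ** T s) = (mat 1 - T s ** B) ** T s"
      by (simp add: mmult)
    then have "det (T s) * det (mat 1 - B ** T s) = det (mat 1 - T s ** B) * det (T s)"
      by (metis det_mul)
    then show ?thesis using that by (simp add: h_def)
  qed
  have "isCont (\<lambda>s. det (T s)) 0"
    using holomorphic_on_imp_continuous_on[OF holT] continuous_on_eq_continuous_at by blast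
  moreover have "det (T 0) \<noteq> 0" by (simp add: T_def)
  ultimately obtain e where e: "e > 0" "\<And>s. dist 0 s < e \<Longrightarrow> det (T s) \<noteq> 0"
    using continuous_at_avoid[of 0 "\<lambda>s. det (T s)" 0] by blast
  have "h 1 = 0"
    by (rule analytic_continuation_open[of "ball 0 e" UNIV h "\<lambda>_. 0"])
      (use e hol zero in auto)
  moreover have "T 1 = A" by (simp add: T_def)
  ultimately show ?thesis by (simp add: h_def)
qed

section \<open>Conformal metrics of constant curvature on the sphere\<close>

lemma matrix_inv_mat: "r \<noteq> 0 \<Longrightarrow> matrix_inv (mat r :: real^2^2) = mat (1 / r)"
  by (rule matrix_inv_unique')
    (simp add: matrix_matrix_mult_def mat_def vec_eq_iff sum_2 forall_2)

text \<open>In terms of \<open>u = - d(log v)\<close> the Christoffel symbols are \<open>\<delta>\<^sub>b\<^sub>l u\<^sub>a + \<delta>\<^sub>a\<^sub>l u\<^sub>b - \<delta>\<^sub>a\<^sub>b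
  u\<^sub>l\<close>. Their quadratic terms cancel in the one component of the curvature tensor that enters,
  which leaves minus the divergence of \<open>u\<close>.\<close>

lemma gauss_curvature_conformal:
  fixes v :: "complex \<Rightarrow> real"
  assumes "smooth_on v UNIV" "\<And>z. v z > 0" "\<And>z. m z = mat (1 / (v z)\<^sup>2)"
  shows "gauss_curvature m z =
    v z * (pd 1 (pd 1 v) z + pd 2 (pd 2 v) z) - (pd 1 v z)\<^sup>2 - (pd 2 v z)\<^sup>2"
proof -
  define u where "u a z = - (pd a v z / v z)" for a z
  define \<delta> where "\<delta> a b = (if a = (b::2) then 1 else 0 :: real)" for a b
  have vn: "v z \<noteq> 0" for z using assms(2)[of z] by simp
  have dv: "v differentiable (at z)" "pd a v differentiable (at z)" for a z
    using assms(1) smooth_on_differentiable smooth_on_pd by blast+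
  have dI: "(\<lambda>w. inverse (v w)) differentiable (at z)" for z
    using dv vn by (intro differentiable_inverse) auto
  have pr: "pd a (\<lambda>w. inverse (v w) * inverse (v w)) z = 2 * u a z / (v z)\<^sup>2" for a z
    using pd_bilinear[OF bounded_bilinear_mult dI dI, of a z] pd_inverse[OF dv(1) vn, of a z]
    by (simp add: u_def field_simps power2_eq_square)
  have mm: "(\<lambda>w. m w $ b $ c) = (if b = c then (\<lambda>w. inverse (v w) * inverse (v w)) else (\<lambda>w. 0))" for b c
    by (auto simp: assms(3) mat_def power2_eq_square field_simps)
  have pm: "pd a (\<lambda>w. m w $ b $ c) z = 2 * \<delta> b c * u a z / (v z)\<^sup>2" for a b c z
  proof -
    have "pd a (\<lambda>w. 0::real) z = 0" using pd_eq[OF has_derivative_const] by fastforce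
    then show ?thesis unfolding mm using pr[of a z] by (simp add: \<delta>_def)
  qed
  have inv: "matrix_inv (m z) $ l $ c = \<delta> l c * (v z)\<^sup>2" for z l c
    using vn[of z] by (simp add: assms(3) matrix_inv_mat) (simp add: mat_def \<delta>_def)
  have ch: "christoffel m l a b = (\<lambda>z. \<delta> b l * u a z + \<delta> a l * u b z - \<delta> a b * u l z)" for l a b
  proof
    fix z
    have "christoffel m l a b z = (\<Sum>c\<in>UNIV. \<delta> l c * (\<delta> b c * u a z + \<delta> a c * u b z - \<delta> a b * u c z))"
      unfolding christoffel_def inv pm sum_divide_distrib
      using vn[of z] by (intro sum.cong refl) (simp add: field_simps)
    also have "\<dots> = \<delta> b l * u a z + \<delta> a l * u b z - \<delta> a b * u l z"
      using exhaust_2[of l] by (auto simp: sum_2 \<delta>_def)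
    finally show "christoffel m l a b z = \<delta> b l * u a z + \<delta> a l * u b z - \<delta> a b * u l z" .
  qed
  have du: "u a differentiable (at z)" for a z
    unfolding u_def by (intro differentiable_minus differentiable_divide dv vn)
  have pu: "pd b (u a) z = (pd a v z * pd b v z - pd b (pd a v) z * v z) / (v z)\<^sup>2" for a b z
  proof -
    have "u a = (\<lambda>z. - (pd a v z * inverse (v z)))" by (auto simp: u_def divide_inverse)
    then have "pd b (u a) z = - pd b (\<lambda>z. pd a v z * inverse (v z)) z"
      using pd_bounded_linear[OF bounded_linear_minus[OF bounded_linear_ident]
          bilinear_differentiable[OF bounded_bilinear_mult dv(2) dI]] by simp
    also have "\<dots> = - (pd a v z * - (inverse (v z) * inverse (v z) * pd b v z) + pd b (pd a v) z * inverse (v z))"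
      unfolding pd_bilinear[OF bounded_bilinear_mult dv(2) dI] pd_inverse[OF dv(1) vn] ..
    also have "\<dots> = (pd a v z * pd b v z - pd b (pd a v) z * v z) / (v z)\<^sup>2"
      using vn[of z] by (simp add: field_simps power2_eq_square)
    finally show ?thesis .
  qed
  have c1: "christoffel m 1 2 2 = (\<lambda>z. - u 1 z)" "christoffel m 1 1 2 = u 2"
    "christoffel m 1 1 1 = u 1" "christoffel m 2 2 2 = u 2" "christoffel m 2 1 2 = u 1"
    "christoffel m 1 2 1 = u 2"
    unfolding ch by (auto simp: \<delta>_def)
  have R: "riemann_tensor m 1 1 2 2 z = - (pd 1 (u 1) z + pd 2 (u 2) z)"
    unfolding riemann_tensor_def c1 sum_2
    using pd_bounded_linear[OF bounded_linear_minus[OF bounded_linear_ident] du, of 1 1 z] by simp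
  have "gauss_curvature m z = riemann_tensor m 1 1 2 2 z * (v z)\<^sup>2"
    unfolding gauss_curvature_def assms(3) sum_2 using vn[of z]
    by (simp add: det_2 mat_def field_simps power2_eq_square)
  also have "\<dots> = v z * (pd 1 (pd 1 v) z + pd 2 (pd 2 v) z) - (pd 1 v z)\<^sup>2 - (pd 2 v z)\<^sup>2"
    unfolding R pu using vn[of z] by (simp add: field_simps power2_eq_square)
  finally show ?thesis .
qed

text \<open>In Wirtinger derivatives the hypothesis is \<open>v \<partial>\<partial>'v - \<partial>v \<partial>'v = K/4\<close>. Applying \<open>\<partial>\<close> gives \<open>v
  \<partial>\<partial>\<partial>'v = \<partial>\<partial>v \<partial>'v\<close>, which says that \<open>T = \<partial>\<partial>v / v\<close> is holomorphic. The transformation of \<open>v\<close> under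
  inversion makes \<open>T dz\<^sup>2\<close> a quadratic differential on the sphere, and there is no such
  differential but zero. What remains is a real polynomial of degree one in \<open>z\<close> and in its
  conjugate; its leading coefficient is \<open>v' 0\<close>, hence positive, and one completes the square.\<close>

lemma constant_curvature_quadratic:
  fixes v v' :: "complex \<Rightarrow> real"
  assumes v: "smooth_on v UNIV" "\<And>z. v z > 0"
    and v': "smooth_on v' UNIV" "\<And>z. v' z > 0"
    and trans: "\<And>z. z \<noteq> 0 \<Longrightarrow> v z = (cmod z)\<^sup>2 * v' (1 / z)"
    and K: "\<And>z. v z * (pd 1 (pd 1 v) z + pd 2 (pd 2 v) z) - (pd 1 v z)\<^sup>2 - (pd 2 v z)\<^sup>2 = K"
  shows "\<exists>c e b. c > 0 \<and> b > 0 \<and> (\<forall>z. v z = c * (cmod (z - e))\<^sup>2 + b)"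
proof -
  define w where "w z = complex_of_real (v z)" for z
  define w' where "w' z = complex_of_real (v' z)" for z
  have sw: "smooth_on w UNIV" and sw': "smooth_on w' UNIV"
    unfolding w_def w'_def using v v' smooth_on_of_real by auto
  have wn: "w z \<noteq> 0" for z using v(2)[of z] by (simp add: w_def)
  have s: "smooth_on (wd s f) UNIV" if "smooth_on f UNIV" for s f
    using that smooth_on_wd by blast
  have d: "f differentiable (at z)" if "smooth_on f UNIV" for f :: "complex \<Rightarrow> complex" and z
    using that smooth_on_differentiable by blast
  have cm: "wd s (wd t f) z = wd t (wd s f) z" if "smooth_on f UNIV" for s t f z
    using wd_commute[OF open_UNIV that] by blast
  have pdw: "pd a w z = of_real (pd a v z)" "pd a (pd b w) z = of_real (pd a (pd b v) z)" for a b z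
  proof -
    have 1: "pd a (\<lambda>z. complex_of_real (f z)) z = of_real (pd a f z)" if "smooth_on f UNIV" for f a z
      using pd_bounded_linear[OF bounded_linear_of_real] smooth_on_differentiable[OF that] by blast
    have 2: "pd a w = (\<lambda>z. of_real (pd a v z))" for a
      unfolding w_def[abs_def] using 1[OF v(1)] by auto
    show "pd a w z = of_real (pd a v z)" "pd a (pd b w) z = of_real (pd a (pd b v) z)"
      unfolding 2 using 1[OF smooth_on_pd[OF v(1)]] by auto
  qed
  have real: "wd (- cnj s) w z = cnj (wd s w z)" for s z
    using pdw by (simp add: wd_def)
  have real': "wd (-1) w = (\<lambda>z. cnj (wd 1 w z))"
    using real[of 1] by auto
  note wdd = wd_wd[OF sw UNIV_I]
  have eqK: "w z * wd 1 (wd (-1) w) z - wd 1 w z * wd (-1) w z = of_real (K / 4)" for z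
  proof -
    have sym: "pd 1 (pd 2 w) z = pd 2 (pd 1 w) z" using pd_commute[OF open_UNIV sw] by blast
    have "w z * wd 1 (wd (-1) w) z - wd 1 w z * wd (-1) w z =
      (w z * (pd 1 (pd 1 w) z + pd 2 (pd 2 w) z) - (pd 1 w z)\<^sup>2 - (pd 2 w z)\<^sup>2) / 4"
      unfolding wdd sym by (simp add: wd_def field_simps power2_eq_square complex_eq_iff)
    also have "\<dots> = of_real (K / 4)" unfolding pdw w_def K[of z, symmetric] by simp
    finally show ?thesis .
  qed
  have key: "w z * wd 1 (wd 1 (wd (-1) w)) z = wd 1 (wd 1 w) z * wd (-1) w z" for z
  proof -
    have "wd 1 (\<lambda>z. w z * wd 1 (wd (-1) w) z - wd 1 w z * wd (-1) w z) z = 0"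
      unfolding eqK by simp
    moreover have "wd 1 (\<lambda>z. w z * wd 1 (wd (-1) w) z - wd 1 w z * wd (-1) w z) z =
      w z * wd 1 (wd 1 (wd (-1) w)) z + wd 1 w z * wd 1 (wd (-1) w) z -
      (wd 1 w z * wd 1 (wd (-1) w) z + wd 1 (wd 1 w) z * wd (-1) w z)"
      by (subst wd_diff) (auto simp: wd_mult d s sw bilinear_differentiable[OF bounded_bilinear_mult])
    ultimately show ?thesis by simp
  qed
  \<comment> \<open>The coefficient of the holomorphic quadratic differential.\<close>
  define T where "T z = wd 1 (wd 1 w) z * inverse (w z)" for z
  have sT: "smooth_on T UNIV" unfolding T_def
    by (intro smooth_on_mult smooth_on_inverse s sw wn open_UNIV)
  have dinv: "(\<lambda>z. inverse (w z)) differentiable (at z)" for z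
    by (intro d smooth_on_inverse sw wn open_UNIV)
  have T0: "wd (-1) T z = 0" for z
  proof -
    have "wd (-1) T z = wd 1 (wd 1 w) z * (- wd (-1) w z / (w z)\<^sup>2) + wd (-1) (wd 1 (wd 1 w)) z * inverse (w z)"
      unfolding T_def[abs_def]
      by (subst wd_mult) (auto simp: d s sw dinv wd_inverse wn)
    also have "wd (-1) (wd 1 (wd 1 w)) z = wd 1 (wd 1 (wd (-1) w)) z"
      using cm[OF s[OF sw], of "-1" 1 1 z] cm[OF sw, of "-1" 1] by (metis ext)
    finally show ?thesis using key[of z] wn[of z] by (simp add: field_simps power2_eq_square)
  qed
  have holT: "T holomorphic_on UNIV"
    by (rule holomorphic_of_wd) (auto intro: d sT T0)
  have weq: "w z = z * cnj z * w' (inverse z)" if "z \<noteq> 0" for z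
    unfolding w_def w'_def trans[OF that] using complex_norm_square[of z] by (simp add: inverse_eq_divide)
  have inv: "(inverse has_field_derivative - inverse (z\<^sup>2)) (at z)" if "z \<noteq> 0" for z :: complex
    using that by (auto intro!: derivative_eq_intros simp: power2_eq_square)
  have op: "open (- {0::complex})" by auto
  have did: "(\<lambda>z. z) differentiable (at z)" "(\<lambda>z. cnj z) differentiable (at z)" for z
    by (auto intro: differentiable_cnj)
  have wc: "wd 1 (\<lambda>z. cnj z) z = 0" "wd (-1) (\<lambda>z. cnj z) z = 1" for z
    using wd_cnj[OF did(1), of 1 z] wd_cnj[OF did(1), of "-1" z] wd_ident by auto
  have comp: "wd 1 (\<lambda>z. f (inverse z)) z = - wd 1 f (inverse z) / z\<^sup>2"
     "(\<lambda>z. f (inverse z)) differentiable (at z)" if "smooth_on f UNIV" "z \<noteq> 0" for f z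
    using wd_compose_holomorphic[OF inv[OF that(2)] d[OF that(1)]] that(2) by (auto simp: field_simps)
  have w1: "wd 1 w z = cnj z * w' (inverse z) - cnj z * inverse z * wd 1 w' (inverse z)" if "z \<noteq> 0" for z
  proof -
    have "wd 1 w z = wd 1 (\<lambda>z. z * cnj z * w' (inverse z)) z"
      by (rule wd_cong_open[OF op]) (use that weq in auto)
    also have "\<dots> = z * cnj z * (- wd 1 w' (inverse z) / z\<^sup>2) + cnj z * w' (inverse z)"
      by (subst wd_mult) (auto simp: comp[OF sw' that] wd_mult did wc wd_ident bilinear_differentiable[OF bounded_bilinear_mult])
    finally show ?thesis using that by (simp add: field_simps power2_eq_square)
  qed
  have w2: "wd 1 (wd 1 w) z = cnj z / z ^ 3 * wd 1 (wd 1 w') (inverse z)" if "z \<noteq> 0" for z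
  proof -
    have di: "(\<lambda>z. inverse z) differentiable (at z)" using that by (intro differentiable_inverse) auto
    have "wd 1 (wd 1 w) z = wd 1 (\<lambda>z. cnj z * w' (inverse z) - (cnj z * inverse z) * wd 1 w' (inverse z)) z"
      by (rule wd_cong_open[OF op]) (use that w1 in auto)
    also have "\<dots> = cnj z * (- wd 1 w' (inverse z) / z\<^sup>2) - (cnj z * inverse z * (- wd 1 (wd 1 w') (inverse z) / z\<^sup>2)
        + cnj z * (- 1 / z\<^sup>2) * wd 1 w' (inverse z))"
      using that
      by (subst wd_diff) (auto simp: wd_mult comp[OF sw' that] comp[OF s[OF sw'] that] did wc di wd_ident
          wd_inverse bilinear_differentiable[OF bounded_bilinear_mult])
    finally show ?thesis using that by (simp add: field_simps power2_eq_square power3_eq_cube)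
  qed
  have Tz: "T z = inverse z ^ 4 * (wd 1 (wd 1 w') (inverse z) * inverse (w' (inverse z)))" if "z \<noteq> 0" for z
  proof -
    have "w' (inverse z) \<noteq> 0" using v'(2)[of "inverse z"] by (simp add: w'_def)
    then show ?thesis unfolding T_def w2[OF that] weq[OF that] using that
      by (simp add: field_simps power3_eq_cube power4_eq_xxxx)
  qed
  have w'n: "w' z \<noteq> 0" for z using v'(2)[of z] by (simp add: w'_def)
  have lim: "((\<lambda>z. f (inverse z)) \<longlongrightarrow> f 0) at_infinity" if "smooth_on f UNIV" for f :: "complex \<Rightarrow> complex"
    using isCont_tendsto_compose[OF _ tendsto_inverse_0] smooth_on_continuous[OF that]
    by (metis continuous_on_eq_continuous_at open_UNIV UNIV_I)
  \<comment> \<open>A quadratic differential that is regular at infinity has a coefficient of order \<open>z\<^sup>-\<^sup>4\<close>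
    there.\<close>
  have limT: "(T \<longlongrightarrow> 0) at_infinity"
  proof -
    have "((\<lambda>z. inverse z ^ 4 * (wd 1 (wd 1 w') (inverse z) * inverse (w' (inverse z)))) \<longlongrightarrow>
        0 ^ 4 * (wd 1 (wd 1 w') 0 * inverse (w' 0))) at_infinity"
      by (intro tendsto_intros tendsto_inverse_0 lim s sw' w'n)
    then have "((\<lambda>z. inverse z ^ 4 * (wd 1 (wd 1 w') (inverse z) * inverse (w' (inverse z)))) \<longlongrightarrow> 0) at_infinity"
      by simp
    moreover have "\<forall>\<^sub>F z in at_infinity. inverse z ^ 4 * (wd 1 (wd 1 w') (inverse z) * inverse (w' (inverse z))) = T z"
      unfolding eventually_at_infinity using Tz by (intro exI[of _ 1]) (metis norm_zero not_one_le_zero)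
    ultimately show ?thesis by (rule Lim_transform_eventually)
  qed
  have T_zero: "T z = 0" for z using Liouville_weak_0[OF holT limT] .
  have wzz: "wd 1 (wd 1 w) z = 0" for z using T_zero[of z] wn[of z] by (simp add: T_def)
  have wzbzb: "wd (-1) (wd (-1) w) z = 0" for z
    unfolding real' using wzz wd_cnj[OF d[OF s[OF sw]], of "-1" 1 z] by simp
  \<comment> \<open>With both pure second derivatives zero, the mixed one is constant.\<close>
  define \<beta> where "\<beta> = wd (-1) (wd 1 w)"
  have sb: "smooth_on \<beta> UNIV" unfolding \<beta>_def by (intro s sw)
  have "wd 1 \<beta> z = 0" for z
  proof -
    have "wd 1 \<beta> z = wd (-1) (wd 1 (wd 1 w)) z"
      unfolding \<beta>_def by (rule cm[OF s[OF sw]])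
    also have "wd 1 (wd 1 w) = (\<lambda>_. 0)" using wzz by (rule ext)
    finally show ?thesis by simp
  qed
  moreover have "wd (-1) \<beta> z = 0" for z
  proof -
    have "wd (-1) (wd 1 w) = wd 1 (wd (-1) w)" by (rule ext) (rule cm[OF sw])
    then have "wd (-1) \<beta> z = wd (-1) (wd 1 (wd (-1) w)) z" unfolding \<beta>_def by simp
    also have "\<dots> = wd 1 (wd (-1) (wd (-1) w)) z" by (rule cm[OF s[OF sw]])
    also have "wd (-1) (wd (-1) w) = (\<lambda>_. 0)" using wzbzb by (rule ext)
    finally show ?thesis by simp
  qed
  ultimately have "\<beta> x = \<beta> y" for x y
    by (intro zero_derivative_constant[of UNIV \<beta> x y] open_UNIV connected_UNIV d sb UNIV_I) simp_all
  note \<beta>_const = this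
  define c0 where "c0 = \<beta> 0"
  have c0: "\<beta> z = c0" for z unfolding c0_def by (rule \<beta>_const)
  define c where "c = Re c0"
  have "\<beta> 0 = cnj (\<beta> 0)"
    unfolding \<beta>_def wdd pdw using pd_commute_real[OF open_UNIV v(1), of 0 1 2] by simp
  then have c: "c0 = of_real c" using c0 by (metis Reals_cnj_iff c_def of_real_Re)
  define f1 where "f1 z = wd 1 w z - of_real c * cnj z" for z
  have "f1 x = f1 y" for x y
    unfolding f1_def
    by (rule zero_derivative_constant[of UNIV])
      (use c0 in \<open>auto simp: d s sw did wd_diff wd_cmult wc wzz \<beta>_def[symmetric] c bilinear_differentiable[OF bounded_bilinear_mult]\<close>)
  then obtain b where b: "\<And>z. wd 1 w z = b + of_real c * cnj z" unfolding f1_def by (metis diff_add_cancel)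
  have b': "wd (-1) w z = cnj b + of_real c * z" for z unfolding real' b by simp
  define f2 where "f2 z = w z - (b * z + cnj b * cnj z + of_real c * (z * cnj z))" for z
  have "f2 x = f2 y" for x y
    unfolding f2_def
    by (rule zero_derivative_constant[of UNIV])
      (auto simp: d s sw did wd_diff wd_add wd_mult wc wd_ident b b' bilinear_differentiable[OF bounded_bilinear_mult])
  then obtain a where a: "\<And>z. w z = a + (b * z + cnj b * cnj z + of_real c * (z * cnj z))"
    unfolding f2_def by (metis diff_add_cancel)
  have "((\<lambda>z. w' (inverse z)) \<longlongrightarrow> of_real c) at_infinity"
  proof -
    have "((\<lambda>z. a * (inverse z * cnj (inverse z)) + (b * cnj (inverse z) + cnj b * inverse z + of_real c)) \<longlongrightarrow>
       a * (0 * cnj 0) + (b * cnj 0 + cnj b * 0 + of_real c)) at_infinity"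
      by (intro tendsto_intros tendsto_inverse_0)
    moreover have "\<forall>\<^sub>F z in at_infinity. a * (inverse z * cnj (inverse z)) + (b * cnj (inverse z) + cnj b * inverse z + of_real c) = w' (inverse z)"
      unfolding eventually_at_infinity
    proof (intro exI[of _ 1] allI impI)
      fix z :: complex assume "1 \<le> norm z"
      then have z: "z \<noteq> 0" by auto
      have "w' (inverse z) = w z / (z * cnj z)" using weq[OF z] z by simp
      then show "a * (inverse z * cnj (inverse z)) + (b * cnj (inverse z) + cnj b * inverse z + of_real c) = w' (inverse z)"
        unfolding a using z by (simp add: field_simps)
    qed
    ultimately show ?thesis by (simp add: Lim_transform_eventually)
  qed
  then have "of_real c = w' 0" using tendsto_unique[OF _ _ lim[OF sw']] trivial_limit_at_infinity by blast
  then have cpos: "c > 0" using v'(2)[of 0] by (simp add: w'_def)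
  define e where "e = - cnj b / of_real c"
  have quad: "w z = of_real c * ((z - e) * cnj (z - e)) + (a - of_real c * (e * cnj e))" for z
    unfolding a e_def using cpos by (simp add: field_simps)
  have we: "w e = a - of_real c * (e * cnj e)" using quad[of e] by simp
  have "v z = c * (cmod (z - e))\<^sup>2 + v e" for z
  proof -
    have "complex_of_real (v z) = of_real (c * (cmod (z - e))\<^sup>2 + v e)"
    proof -
      have "w z = of_real c * of_real ((cmod (z - e))\<^sup>2) + w e"
        unfolding complex_norm_square quad[of z] we ..
      then show ?thesis by (simp only: w_def of_real_add of_real_mult)
    qed
    then show ?thesis by (simp only: of_real_eq_iff)
  qed
  then show ?thesis using cpos v(2)[of e] by blast
qed

section \<open>The harmonic sequence in terms of projections\<close>

text \<open>The Gauss bundles are described by the second fundamental form off a discrete set only;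
  matrix identities found there extend to all points by continuity.\<close>

lemma msmooth_zero_off_sparse:
  assumes "msmooth F UNIV" "S sparse_in UNIV" "\<And>z. z \<notin> S \<Longrightarrow> F z = 0"
  shows "F z = 0"
proof -
  obtain B where B: "open B" "z \<in> B" "\<forall>y\<in>B. y \<noteq> z \<longrightarrow> y \<notin> S"
    using sparse_in_not_in[OF assms(2)] by blast
  have ev: "\<forall>\<^sub>F w in at z. F w = 0"
    unfolding eventually_at_topological using B assms(3) by blast
  have "F z $ i $ j = 0" for i j
  proof -
    have "((\<lambda>w. F w $ i $ j) \<longlongrightarrow> F z $ i $ j) (at z)"
      using assms(1) smooth_on_continuous unfolding msmooth_def
      by (metis UNIV_I continuous_on_def)
    moreover have "((\<lambda>w. F w $ i $ j) \<longlongrightarrow> 0) (at z)"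
      by (rule tendsto_eventually) (use ev in \<open>auto elim: eventually_mono\<close>)
    ultimately show ?thesis using tendsto_unique[OF at_neq_bot] by blast
  qed
  then show ?thesis by (simp add: vec_eq_iff)
qed

lemma Dm_adj_self:
  assumes "msmooth P UNIV" "\<And>z. adj (P z) = P z"
  shows "adj (Dm 1 P z) = Dm (-1) P z" "adj (Dm (-1) P z) = Dm 1 P z"
  using Dm_adj[OF msmooth_mdiff[OF assms(1)], of z 1] Dm_adj[OF msmooth_mdiff[OF assms(1)], of z "-1"] assms(2)
  by (auto)

text \<open>Differentiating \<open>P\<^sup>2 = P\<close> shows that the derivative of a projection exchanges its range and
  its kernel.\<close>

lemma Dm_idempotent:
  assumes "msmooth P UNIV" "\<And>z. P z ** P z = P z"
  shows "Dm s P z = P z ** Dm s P z + Dm s P z ** P z" "P z ** Dm s P z ** P z = 0"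
proof -
  have m: "mdiff P z" using assms(1) msmooth_mdiff by blast
  show 1: "Dm s P z = P z ** Dm s P z + Dm s P z ** P z"
  proof -
    have "(\<lambda>z. P z ** P z) = P" using assms(2) by auto
    then show ?thesis using Dm_mult[OF m m, of s] by (simp only:)
  qed
  have "P z ** Dm s P z = P z ** (P z ** Dm s P z + Dm s P z ** P z)"
    using arg_cong[OF 1, of "\<lambda>X. P z ** X"] .
  also have "\<dots> = P z ** Dm s P z + P z ** Dm s P z ** P z"
    by (simp add: matrix_add_ldistrib matrix_mul_assoc assms(2))
  finally show "P z ** Dm s P z ** P z = 0" by simp
qed

lemma vec_section_derivative:
  fixes s :: "complex \<Rightarrow> complex^'n"
  assumes "s differentiable (at z)"
  shows "dz s z $ i = wd 1 (\<lambda>w. s w $ i) z"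
proof -
  have "pd a s z $ i = pd a (\<lambda>w. s w $ i) z" for a
    using pd_bounded_linear[OF bounded_linear_vec_nth assms] by metis
  then show ?thesis by (simp add: dz_def wd_def)
qed

lemma bounded_linear_matrix_vec: "bounded_linear (\<lambda>A :: complex^'n^'m. A *v v)"
  by (rule linear_conv_bounded_linear[THEN iffD1])
    (auto intro!: linearI simp: matrix_vector_mult_add_rdistrib vec_eq_iff matrix_vector_mult_def
      scaleR_sum_right distrib_right sum.distrib)

lemma dz_matrix_vec:
  fixes P :: "complex \<Rightarrow> complex^'n^'m"
  assumes P: "mdiff P z" and s: "s differentiable (at z)" and Ps: "(\<lambda>w. P w *v s w) differentiable (at z)"
  shows "dz (\<lambda>w. P w *v s w) z = Dm 1 P z *v s z + P z *v dz s z"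
proof -
  have si: "(\<lambda>w. s w $ i) differentiable (at z)" for i
    by (rule linear_differentiable[OF bounded_linear_vec_nth s])
  have "dz (\<lambda>w. P w *v s w) z $ i = (Dm 1 P z *v s z + P z *v dz s z) $ i" for i
    unfolding vec_section_derivative[OF Ps]
    using P si by (simp add: matrix_vector_mult_def wd_sum wd_mult mdiff_def Dm_def
        bilinear_differentiable[OF bounded_bilinear_mult] vec_section_derivative[OF s] sum.distrib add.commute)
  then show ?thesis by (simp add: vec_eq_iff)
qed

text \<open>For a section \<open>s = P s\<close> one has \<open>\<partial>s = \<partial>P s + P \<partial>s\<close>, whose component orthogonal to the bundle
  is \<open>\<partial>P P s\<close>. Conversely each value is attained by a section of the form \<open>P v\<close> with \<open>v\<close> constant.\<close>

lemma A'_image_eq: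
  fixes L :: "complex \<Rightarrow> (complex^'n) set"
  defines "P \<equiv> (\<lambda>z. proj (L z))"
  assumes L: "\<And>z. vec.subspace (L z)" and sm: "smooth_on P UNIV"
  shows "A'_image L z = range ((*v) (Dm 1 P z ** P z))"
proof -
  have oP: "oproj (P z)" and rP: "range ((*v) (P z)) = L z" for z
    using proj_works[OF L] by (auto simp: P_def)
  have msm: "msmooth P UNIV" using smooth_on_msmooth[OF open_UNIV sm] .
  have md: "mdiff P z" using msmooth_mdiff[OF msm] by blast
  have PP: "P z ** P z = P z" for z using oP by (simp add: oproj_def)
  have orthP: "proj (orth (L z)) = mat 1 - P z"
    by (rule proj_eqI[OF oproj_complement[OF oP]]) (simp only: oproj_orth[OF oP, symmetric] rP)
  have PPP: "P z ** (Dm 1 P z ** P z) = 0"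
    using Dm_idempotent(2)[OF msm PP, of z 1] by (simp add: matrix_mul_assoc)
  have inL: "w \<in> L z \<longleftrightarrow> P z *v w = w" for w z using oproj_range_iff[OF oP] rP by blast
  show ?thesis
  proof
    show "A'_image L z \<subseteq> range ((*v) (Dm 1 P z ** P z))"
    proof
      fix x assume "x \<in> A'_image L z"
      then obtain s U where s: "x = A' L s z" "open U" "smooth_on s U" "\<And>w. w \<in> U \<Longrightarrow> s w \<in> L w" "z \<in> U"
        unfolding A'_image_def local_section_def by blast
      have sd: "s differentiable (at z)" using s smooth_on_differentiable by blast
      have eq: "s w = P w *v s w" if "w \<in> U" for w using s(4)[OF that] inL by simp
      have Psd: "(\<lambda>w. P w *v s w) differentiable (at z)"
        by (rule differentiable_cong_open[OF s(2,5) _ sd]) (use eq in auto)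
      have "pd a s z = pd a (\<lambda>w. P w *v s w) z" for a
        by (rule pd_cong_open[OF s(2,5)]) (use eq in auto)
      then have "dz s z = Dm 1 P z *v s z + P z *v dz s z"
        using dz_matrix_vec[OF md sd Psd] unfolding dz_def by simp
      then have "x = (mat 1 - P z) *v (Dm 1 P z *v (P z *v s z) + P z *v dz s z)"
        using eq[OF s(5)] unfolding s(1) A'_def orthP by simp
      also have "\<dots> = ((mat 1 - P z) ** Dm 1 P z ** P z) *v s z + ((mat 1 - P z) ** P z) *v dz s z"
        by (simp add: matrix_vector_right_distrib matrix_vector_mul_assoc matrix_mul_assoc)
      also have "\<dots> = (Dm 1 P z ** P z) *v s z"
        by (simp add: mmult PPP PP)
      finally show "x \<in> range ((*v) (Dm 1 P z ** P z))" by blast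
    qed
  next
    show "range ((*v) (Dm 1 P z ** P z)) \<subseteq> A'_image L z"
    proof
      fix x assume "x \<in> range ((*v) (Dm 1 P z ** P z))"
      then obtain v where v: "x = (Dm 1 P z ** P z) *v v" by blast
      define s where "s = (\<lambda>w. P w *v (P z *v v))"
      have ss: "smooth_on s UNIV"
        unfolding s_def by (rule smooth_on_linear[OF bounded_linear_matrix_vec open_UNIV sm])
      have sd: "s differentiable (at z)" using smooth_on_differentiable[OF ss] by blast
      have "dz (\<lambda>w. P z *v v) z = 0"
        unfolding dz_def pd_def by (simp add: frechet_derivative_const)
      then have "dz s z = Dm 1 P z *v (P z *v v)"
        using dz_matrix_vec[OF md, of "\<lambda>w. P z *v v"] sd unfolding s_def by simp
      then have "A' L s z = ((mat 1 - P z) ** Dm 1 P z ** P z) *v v"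
        unfolding A'_def orthP by (simp add: matrix_vector_mul_assoc matrix_mul_assoc)
      also have "\<dots> = x" unfolding v by (simp add: mmult PPP)
      finally have "A' L s z = x" .
      moreover have "local_section L UNIV s"
        unfolding local_section_def using ss inL by (auto simp: s_def matrix_vector_mul_assoc matrix_mul_assoc PP)
      ultimately show "x \<in> A'_image L z" unfolding A'_image_def by blast
    qed
  qed
qed

lemma range_mult_zero:
  assumes "range ((*v) A) = range ((*v) B)" "C ** B = (0 :: complex^'n^'n)"
  shows "C ** A = 0"
proof -
  have "C *v (A *v x) = 0" for x
  proof -
    obtain y where "A *v x = B *v y" using assms(1) by blast
    then show ?thesis using assms(2) by (simp add: matrix_vector_mul_assoc)
  qed
  then show ?thesis by (simp add: matrix_eq_iff_vec matrix_vector_mul_assoc[symmetric])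
qed

text \<open>The hypothesis \<open>\<partial>' R R = 0\<close> says that the range of \<open>R\<close> is a holomorphic subbundle: its
  sections of the form \<open>R s\<close>, with \<open>s\<close> a holomorphic vector function, have conjugate derivative
  inside the bundle. The last identity is the structure equation, obtained by differentiating \<open>\<partial>R
  R = \<partial>R\<close> and \<open>\<partial>' R R = 0\<close> and comparing.\<close>

lemma holomorphic_projection:
  fixes R :: "complex \<Rightarrow> complex^'n^'n"
  assumes sm: "msmooth R UNIV" and o: "\<And>z. oproj (R z)" and h: "\<And>z. Dm (-1) R z ** R z = 0"
  shows "R z ** Dm 1 R z = 0" "Dm 1 R z ** R z = Dm 1 R z" "R z ** Dm (-1) R z = Dm (-1) R z"
    "Dm (-1) (Dm 1 R) z = Dm 1 R z ** Dm (-1) R z - Dm (-1) R z ** Dm 1 R z"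
proof -
  have RR: "R z ** R z = R z" and aR: "adj (R z) = R z" for z using o by (auto simp: oproj_def)
  have aD: "adj (Dm 1 R z) = Dm (-1) R z" for z using Dm_adj_self[OF sm aR] by blast
  have 1: "R z ** Dm 1 R z = 0" for z
  proof -
    have "adj (R z ** Dm 1 R z) = 0" using h[of z] by (simp add: adj_mult aR aD)
    then show ?thesis by simp
  qed
  then show "R z ** Dm 1 R z = 0" .
  have 2: "Dm 1 R z ** R z = Dm 1 R z" for z
    using Dm_idempotent(1)[OF sm RR, of 1 z] 1[of z] by (metis add_0_left)
  then show "Dm 1 R z ** R z = Dm 1 R z" .
  show "R z ** Dm (-1) R z = Dm (-1) R z"
    using Dm_idempotent(1)[OF sm RR, of "-1" z] h[of z] by (metis add_0_right)
  have m: "mdiff R z" "mdiff (Dm s R) z" for s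
    using msmooth_mdiff[OF sm] msmooth_mdiff[OF msmooth_Dm[OF open_UNIV sm]] by auto
  have e2: "Dm (-1) (Dm 1 R) z = Dm 1 R z ** Dm (-1) R z + Dm (-1) (Dm 1 R) z ** R z"
  proof -
    have "(\<lambda>z. Dm 1 R z ** R z) = Dm 1 R" using 2 by auto
    then show ?thesis using Dm_mult[OF m(2)[of 1] m(1), of "-1"] by (simp only:)
  qed
  have "(\<lambda>z. Dm (-1) R z ** R z) = (\<lambda>z. 0)" using h by auto
  then have "Dm (-1) R z ** Dm 1 R z + Dm 1 (Dm (-1) R) z ** R z = 0"
    using Dm_mult[OF m(2)[of "-1"] m(1), of 1] by simp
  moreover have "Dm 1 (Dm (-1) R) z = Dm (-1) (Dm 1 R) z"
    by (rule Dm_commute[OF open_UNIV sm UNIV_I])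
  ultimately have "Dm (-1) (Dm 1 R) z ** R z = - (Dm (-1) R z ** Dm 1 R z)"
    by (simp add: add_eq_0_iff)
  then show "Dm (-1) (Dm 1 R) z = Dm 1 R z ** Dm (-1) R z - Dm (-1) R z ** Dm 1 R z"
    using e2 by simp
qed

text \<open>One step of the harmonic sequence: \<open>R0\<close> and \<open>R\<close> are consecutive osculating bundles, \<open>P\<close> is
  their difference and \<open>P'\<close> the next Gauss bundle. As \<open>\<partial>R\<close> annihilates \<open>R0\<close>, the Gauss bundle of
  \<open>P\<close> is generically the range of \<open>\<partial>R\<close>; this is orthogonal to \<open>R\<close>, and the structure equation
  shows that adjoining it produces a holomorphic bundle again.\<close>

lemma gauss_bundle_step:
  fixes R0 P P' :: "complex \<Rightarrow> complex^'n^'n"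
  defines "R \<equiv> \<lambda>z. R0 z + P z"
  assumes sm: "msmooth R0 UNIV" "msmooth P UNIV" "msmooth P' UNIV"
    and o: "\<And>z. oproj (R0 z)" "\<And>z. oproj (P z)" "\<And>z. oproj (P' z)"
    and ortho: "\<And>z. P z ** R0 z = 0"
    and h0: "\<And>z. Dm (-1) R0 z ** R0 z = 0"
    and h: "\<And>z. Dm (-1) R z ** R z = 0"
    and next0: "\<And>z. Dm 1 R0 z = P z ** Dm 1 R0 z"
    and gen: "S sparse_in UNIV" "\<And>z. z \<notin> S \<Longrightarrow> range ((*v) (P' z)) = range ((*v) (Dm 1 P z ** P z))"
  shows "\<And>z. Dm 1 R z = Dm 1 P z ** P z" "\<And>z. oproj (R z)" "\<And>z. P' z ** R z = 0"
    "\<And>z. Dm 1 R z = P' z ** Dm 1 R z"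
    "\<And>z. Dm (-1) (\<lambda>z. R z + P' z) z ** (R z + P' z) = 0"
proof -
  have PP: "P z ** P z = P z" "adj (P z) = P z" and R0R0: "R0 z ** R0 z = R0 z" "adj (R0 z) = R0 z"
    and P'P': "P' z ** P' z = P' z" "adj (P' z) = P' z" for z
    using o by (auto simp: oproj_def)
  have R0P: "R0 z ** P z = 0" for z
  proof -
    have "adj (R0 z ** P z) = 0" by (simp add: adj_mult PP R0R0 ortho)
    then show ?thesis by simp
  qed
  have smR: "msmooth R UNIV" unfolding R_def by (intro msmooth_add sm open_UNIV)
  show oR: "oproj (R z)" for z
    unfolding R_def oproj_def by (simp add: adj_add mmult PP R0R0 R0P ortho)
  have RR: "R z ** R z = R z" "adj (R z) = R z" for z using oR by (auto simp: oproj_def)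
  have md: "mdiff R0 z" "mdiff P z" "mdiff P' z" "mdiff R z" for z
    using sm smR msmooth_mdiff by blast+
  note H0 = holomorphic_projection[OF sm(1) o(1) h0]
  note H = holomorphic_projection[OF smR oR h]
  have R0zP: "Dm 1 R0 z ** P z = 0" for z
  proof -
    have "Dm 1 R0 z ** P z = Dm 1 R0 z ** (R0 z ** P z)" by (simp add: matrix_mul_assoc H0(2))
    then show ?thesis by (simp add: R0P)
  qed
  have Rz: "Dm 1 R z = Dm 1 R0 z + Dm 1 P z" for z
    unfolding R_def by (rule Dm_add[OF md(1,2)])
  \<comment> \<open>The derivative of \<open>R0\<close> takes values in \<open>P\<close>, hence does not leave \<open>R\<close>.\<close>
  have RzR0: "Dm 1 R z ** R0 z = 0" for z
  proof -
    have "R w ** R0 w = R0 w" for w by (simp add: R_def mmult R0R0 ortho)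
    then have "(\<lambda>z. R z ** R0 z) = R0" by auto
    then have "Dm 1 R0 z = R z ** Dm 1 R0 z + Dm 1 R z ** R0 z"
      using Dm_mult[OF md(4)[of z] md(1)[of z], of 1] by (simp only:)
    moreover have "R z ** Dm 1 R0 z = Dm 1 R0 z"
      unfolding R_def by (simp add: mmult H0(1) next0[symmetric])
    ultimately show ?thesis by simp
  qed
  have RzP: "Dm 1 R z ** P z = Dm 1 P z ** P z" for z
    unfolding Rz by (simp add: mmult R0zP)
  show A: "Dm 1 R z = Dm 1 P z ** P z" for z
  proof -
    have "Dm 1 R z = Dm 1 R z ** R z" by (simp add: H(2))
    also have "\<dots> = Dm 1 R z ** (R0 z + P z)" by (simp add: R_def)
    finally show ?thesis by (simp add: matrix_add_ldistrib RzP RzR0)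
  qed
  have AP: "Dm 1 R z ** P z = Dm 1 R z" for z
    unfolding A by (simp add: matrix_mul_assoc[symmetric] PP)
  have gen': "range ((*v) (P' z)) = range ((*v) (Dm 1 R z))" if "z \<notin> S" for z
    using gen(2)[OF that] by (simp add: A)
  have RP': "R z ** P' z = 0" for z
    by (rule msmooth_zero_off_sparse[OF _ gen(1)])
      (auto intro!: msmooth_mult smR sm range_mult_zero[OF gen'] H(1))
  show P'R: "P' z ** R z = 0" for z
  proof -
    have "adj (P' z ** R z) = 0" by (simp add: adj_mult RR P'P' RP')
    then show ?thesis by simp
  qed
  have P'A: "P' z ** Dm 1 R z - Dm 1 R z = 0" for z
  proof (rule msmooth_zero_off_sparse[OF _ gen(1)])
    show "msmooth (\<lambda>z. P' z ** Dm 1 R z - Dm 1 R z) UNIV"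
      by (intro msmooth_diff msmooth_mult msmooth_Dm smR sm open_UNIV)
    show "P' z ** Dm 1 R z - Dm 1 R z = 0" if "z \<notin> S" for z
      using oproj_le_iff[OF o(3), of "Dm 1 R z" z] gen'[OF that] by simp
  qed
  then show next': "Dm 1 R z = P' z ** Dm 1 R z" for z by simp
  \<comment> \<open>For holomorphy, \<open>\<partial>' R'\<close> has to annihilate \<open>R\<close> and \<open>P'\<close>; on the latter this follows from the
    range of \<open>\<partial>R\<close> at generic points.\<close>
  define R' where "R' = (\<lambda>z. R z + P' z)"
  have smR': "msmooth R' UNIV" unfolding R'_def by (intro msmooth_add smR sm open_UNIV)
  have mdR': "mdiff R' z" for z using smR' msmooth_mdiff by blast
  have P'P: "P' z ** P z = 0" for z
  proof -
    have "P z = R z ** P z" by (simp add: R_def mmult R0P PP)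
    then have "P' z ** P z = P' z ** R z ** P z" by (metis matrix_mul_assoc)
    then show ?thesis by (simp add: P'R)
  qed
  have aA: "adj (Dm 1 R z) = Dm (-1) R z" for z using Dm_adj_self[OF smR RR(2)] by blast
  have PRb: "P z ** Dm (-1) R z = Dm (-1) R z" for z
    using arg_cong[OF AP[of z], of adj] by (simp add: adj_mult PP aA)
  have R'P: "R' z ** P z = P z" for z
    by (simp add: R'_def R_def mmult R0P PP P'P)
  have R'Rb: "R' z ** Dm (-1) R z = Dm (-1) R z" for z
    by (metis PRb R'P matrix_mul_assoc)
  have R'Rz: "R' z ** Dm 1 R z = Dm 1 R z" for z
    by (simp add: R'_def mmult H(1) next'[symmetric])
  have R'R: "R' z ** R z = R z" for z by (simp add: R'_def mmult RR P'R)
  have 1: "Dm (-1) R' z ** R z = 0" for z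
  proof -
    have "(\<lambda>z. R' z ** R z) = R" using R'R by auto
    then show ?thesis using Dm_mult[OF mdR'[of z] md(4)[of z], of "-1"] R'Rb[of z] by simp
  qed
  have 2: "Dm (-1) R' z ** Dm 1 R z = 0" for z
  proof -
    have m: "mdiff (Dm 1 R) z" using msmooth_mdiff[OF msmooth_Dm[OF open_UNIV smR]] by blast
    have "R' z ** Dm (-1) (Dm 1 R) z = Dm (-1) (Dm 1 R) z"
      unfolding H(4) by (simp add: matrix_diff_ldistrib matrix_mul_assoc R'Rb R'Rz)
    moreover have "(\<lambda>z. R' z ** Dm 1 R z) = Dm 1 R" using R'Rz by auto
    ultimately show ?thesis using Dm_mult[OF mdR'[of z] m, of "-1"] by simp
  qed
  have 3: "Dm (-1) R' z ** P' z = 0" for z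
    by (rule msmooth_zero_off_sparse[OF _ gen(1)])
      (auto intro!: msmooth_mult msmooth_Dm smR' sm range_mult_zero[OF gen'] 2)
  show "Dm (-1) (\<lambda>z. R z + P' z) z ** (R z + P' z) = 0" for z
    unfolding R'_def[symmetric] using 1[of z] 3[of z] by (simp add: R'_def matrix_add_ldistrib)
qed

text \<open>The projections onto the bundles of a full harmonic sequence, in one coordinate. The partial
  sums project onto the osculating bundles; these are holomorphic, and differentiation leads from
  each into the next summand only.\<close>

locale harmonic_frame =
  fixes p :: nat and P :: "nat \<Rightarrow> complex \<Rightarrow> complex^'n^'n"
  assumes smooth: "j \<le> p \<Longrightarrow> msmooth (P j) UNIV"
    and oproj: "j \<le> p \<Longrightarrow> oproj (P j z)"
    and orthogonal: "i \<le> p \<Longrightarrow> j \<le> p \<Longrightarrow> i \<noteq> j \<Longrightarrow> P i z ** P j z = 0"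
    and complete: "(\<Sum>i\<le>p. P i z) = mat 1"
    and holomorphic: "j \<le> p \<Longrightarrow> Dm (-1) (\<lambda>z. \<Sum>i\<le>j. P i z) z ** (\<Sum>i\<le>j. P i z) = 0"
    and next_bundle: "j < p \<Longrightarrow>
      Dm 1 (\<lambda>z. \<Sum>i\<le>j. P i z) z = P (Suc j) z ** Dm 1 (\<lambda>z. \<Sum>i\<le>j. P i z) z"
    and second_fundamental: "j \<le> p \<Longrightarrow> Dm 1 (\<lambda>z. \<Sum>i\<le>j. P i z) z = Dm 1 (P j) z ** P j z"

lemma smooth_grass_map_proj:
  fixes \<psi> :: "riemann_sphere \<Rightarrow> (complex^'n) set"
  assumes "smooth_grass_map k \<psi>" "c \<in> charts"
  shows "vec.subspace (\<psi> x)" "vec.dim (\<psi> x) = k" "smooth_on (\<lambda>z. proj (\<psi> (c z))) UNIV"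
    "msmooth (\<lambda>z. proj (\<psi> (c z))) UNIV"
    "oproj (proj (\<psi> x))" "range ((*v) (proj (\<psi> x))) = \<psi> x" "trace (proj (\<psi> x)) = of_nat k"
  using assms proj_works[of "\<psi> x"] smooth_on_msmooth[OF open_UNIV, of "\<lambda>z. proj (\<psi> (c z))"]
  unfolding smooth_grass_map_def grassmannian_def by auto

text \<open>Induction along the sequence by \<open>gauss_bundle_step\<close>. Since the last Gauss bundle is zero,
  the last osculating bundle has vanishing derivative; its projection is constant, its range
  contains \<open>\<psi>\<^sub>0\<close>, and fullness makes it the whole space.\<close>

lemma harmonic_sequence_frame:
  fixes \<psi> :: "nat \<Rightarrow> riemann_sphere \<Rightarrow> (complex^'n) set"
  assumes hs: "harmonic_sequence p k \<psi>" and full: "linearly_full (\<psi> 0)" and c: "c \<in> charts"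
  shows "harmonic_frame p (\<lambda>j z. proj (\<psi> j (c z)))"
proof -
  have sg: "smooth_grass_map (k j) (\<psi> j)" if "j \<le> p" for j
    using hs that unfolding harmonic_sequence_def by auto
  define PP where "PP c j z = proj (\<psi> j (c z))" for c :: "complex \<Rightarrow> riemann_sphere" and j z
  define RR where "RR c j z = (\<Sum>i\<le>j. PP c i z)" for c j z
  have basic: "msmooth (PP c j) UNIV" "oproj (PP c j z)" if "j \<le> p" "c \<in> charts" for c j z
    using smooth_grass_map_proj[OF sg[OF that(1)] that(2)] unfolding PP_def by auto
  have smR: "msmooth (RR c j) UNIV" if "j \<le> p" "c \<in> charts" for j c
    unfolding RR_def[abs_def] using that by (intro msmooth_sum basic open_UNIV) auto
  have R_Suc: "RR c (Suc j) = (\<lambda>z. RR c j z + PP c (Suc j) z)" for c j by (simp add: RR_def[abs_def])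
  have img: "A'_image (\<psi> j \<circ> c) z = range ((*v) (Dm 1 (PP c j) z ** PP c j z))"
    if "j \<le> p" "c \<in> charts" for j c z
    using A'_image_eq[of "\<psi> j \<circ> c" z] smooth_grass_map_proj[OF sg[OF that(1)] that(2)]
    unfolding PP_def[abs_def] comp_def by blast
  have generic: "\<exists>S. S sparse_in UNIV \<and> (\<forall>z. z \<notin> S \<longrightarrow>
      range ((*v) (PP c (Suc j) z)) = range ((*v) (Dm 1 (PP c j) z ** PP c j z)))"
    if "j < p" "c \<in> charts" for j c
  proof -
    have fg: "first_gauss_bundle (\<psi> j) (\<psi> (Suc j))"
      using hs that unfolding harmonic_sequence_def by blast
    have r: "range ((*v) (PP c (Suc j) z)) = \<psi> (Suc j) (c z)" for z
      using smooth_grass_map_proj(6)[OF sg that(2)] that unfolding PP_def by auto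
    show ?thesis
      using fg that img[of j c] unfolding first_gauss_bundle_def r
      by (intro exI[of _ "{z. \<psi> (Suc j) (c z) \<noteq> A'_image (\<psi> j \<circ> c) z}"]) auto
  qed
  have last: "Dm 1 (PP c p) z ** PP c p z = 0" if "c \<in> charts" for c z
  proof -
    have "first_gauss_bundle (\<psi> p) (\<lambda>x. {0})"
      using hs unfolding harmonic_sequence_def by blast
    then have s: "{z. {0} \<noteq> A'_image (\<psi> p \<circ> c) z} sparse_in UNIV"
      using that unfolding first_gauss_bundle_def by auto
    show ?thesis
    proof (rule msmooth_zero_off_sparse[OF _ s])
      show "msmooth (\<lambda>z. Dm 1 (PP c p) z ** PP c p z) UNIV"
        by (intro msmooth_mult msmooth_Dm basic open_UNIV) (use that in auto)
      fix z assume "z \<notin> {z. {0} \<noteq> A'_image (\<psi> p \<circ> c) z}"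
      then have "range ((*v) (Dm 1 (PP c p) z ** PP c p z)) = {0}" using img[OF order.refl that, of z] by simp
      then have "(Dm 1 (PP c p) z ** PP c p z) *v x = 0 *v x" for x by (auto simp: set_eq_iff)
      then show "Dm 1 (PP c p) z ** PP c p z = 0" unfolding matrix_eq_iff_vec by blast
    qed
  qed
  \<comment> \<open>The Cauchy-Riemann condition \<open>d\<psi> \<circ> i = J \<circ> d\<psi>\<close>, restricted to the bundle, in terms of the
    projection.\<close>
  have hol0: "Dm (-1) (PP c 0) z ** PP c 0 z = 0" if "c \<in> charts" for c z
  proof -
    let ?P = "PP c 0" and ?L = "\<psi> 0 (c z)"
    have smf: "smooth_on ?P UNIV" using smooth_grass_map_proj(3)[OF sg that, of 0] unfolding PP_def[abs_def] by simp
    have d: "?P differentiable (at z)" using smooth_on_differentiable[OF smf] by blast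
    have pds: "grass_pd a (\<psi> 0 \<circ> c) z = pd a ?P z" for a
      by (simp add: grass_pd_def PP_def[abs_def] comp_def)
    have p1: "pd 1 ?P z = Dm 1 ?P z + Dm (-1) ?P z"
      using frechet_derivative_Dm[OF d, of 1] by (simp add: pd_def)
    have p2: "pd 2 ?P z = mat \<i> ** (Dm 1 ?P z - Dm (-1) ?P z)"
      using frechet_derivative_Dm[OF d, of \<i>] by (simp add: pd_def mat_scalar vec_eq_iff algebra_simps)
    have J: "pd 2 ?P z = grass_J ?L (pd 1 ?P z)"
    proof -
      have "grass_pd 2 (\<psi> 0 \<circ> c) z = grass_J (\<psi> 0 (c z)) (grass_pd 1 (\<psi> 0 \<circ> c) z)"
        using hs that unfolding harmonic_sequence_def holomorphic_grass_map_def by blast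
      then show ?thesis unfolding pds .
    qed
    have Pz: "proj ?L = ?P z" by (simp add: PP_def)
    have PPz: "?P z ** ?P z = ?P z" "adj (?P w) = ?P w" for w using basic(2)[of 0 c] that by (auto simp: oproj_def)
    have idm: "?P w ** ?P w = ?P w" for w using basic(2)[of 0 c] that by (auto simp: oproj_def)
    have sm0: "msmooth ?P UNIV" using basic(1) that by auto
    note D = Dm_idempotent[OF sm0 idm]
    define X where "X s = Dm s ?P z" for s
    have XP: "?P z ** (X s ** ?P z) = 0" for s using D(2)[of z s] by (simp add: X_def matrix_mul_assoc)
    have "mat \<i> ** ((X 1 - X (-1)) ** ?P z) = mat \<i> ** ((X 1 + X (-1)) ** ?P z)"
    proof -
      have "mat \<i> ** ((X 1 - X (-1)) ** ?P z) = pd 2 ?P z ** ?P z"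
        by (simp add: p2 X_def matrix_mul_assoc)
      also have "\<dots> = (mat \<i> ** ((mat 1 - ?P z) ** (X 1 + X (-1)) ** ?P z) - mat \<i> ** (?P z ** (X 1 + X (-1)) ** (mat 1 - ?P z))) ** ?P z"
        by (simp add: J grass_J_def Pz p1 X_def)
      also have "\<dots> = mat \<i> ** ((X 1 + X (-1)) ** ?P z)"
        by (simp add: mmult idm XP)
      finally show ?thesis .
    qed
    then have "(X 1 - X (-1)) ** ?P z = (X 1 + X (-1)) ** ?P z"
      by (simp add: mat_scalar vec_eq_iff)
    then have "X (-1) ** ?P z = - (X (-1) ** ?P z)"
      by (simp add: matrix_add_rdistrib' matrix_diff_rdistrib)
    then show ?thesis unfolding X_def by (simp add: eq_neg_iff_add_eq_0 vec_eq_iff)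
  qed
  \<comment> \<open>The properties of a frame as far as they involve the first bundles up to \<open>j\<close>.\<close>
  define Inv where "Inv c j \<longleftrightarrow>
     (\<forall>i\<le>j. \<forall>z. oproj (RR c i z) \<and> Dm (-1) (RR c i) z ** RR c i z = 0) \<and>
     (\<forall>i<j. \<forall>z. PP c (Suc i) z ** RR c i z = 0 \<and> Dm 1 (RR c i) z = PP c (Suc i) z ** Dm 1 (RR c i) z
        \<and> Dm 1 (RR c i) z = Dm 1 (PP c i) z ** PP c i z)" for c j
  have step: "Dm 1 (RR c j) z = Dm 1 (PP c j) z ** PP c j z" "P' z ** RR c j z = 0"
     "Dm 1 (RR c j) z = P' z ** Dm 1 (RR c j) z"
     "Dm (-1) (\<lambda>z. RR c j z + P' z) z ** (RR c j z + P' z) = 0"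
    if I: "Inv c j" and j: "j \<le> p" and c: "c \<in> charts" and P': "msmooth P' UNIV" "\<And>z. oproj (P' z)"
      and S: "S sparse_in UNIV" "\<And>z. z \<notin> S \<Longrightarrow> range ((*v) (P' z)) = range ((*v) (Dm 1 (PP c j) z ** PP c j z))"
    for c j S P' z
  proof -
    \<comment> \<open>The first bundle is preceded by the zero bundle.\<close>
    define R0 where "R0 = (case j of 0 \<Rightarrow> (\<lambda>z. 0) | Suc i \<Rightarrow> RR c i)"
    have R: "(\<lambda>z. R0 z + PP c j z) = RR c j"
      by (cases j) (auto simp: R0_def RR_def)
    have sm0: "msmooth R0 UNIV" using j c by (cases j) (auto simp: R0_def msmooth_const smR)
    have "oproj (R0 z) \<and> PP c j z ** R0 z = 0 \<and> Dm (-1) R0 z ** R0 z = 0 \<and> Dm 1 R0 z = PP c j z ** Dm 1 R0 z" for z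
    proof (cases j)
      case 0
      then show ?thesis by (simp add: R0_def)
    next
      case (Suc i)
      then have "R0 = RR c i" by (simp add: R0_def)
      then show ?thesis using I Suc unfolding Inv_def by (metis lessI le_SucI order.refl)
    qed
    then have R0: "oproj (R0 z)" "PP c j z ** R0 z = 0" "Dm (-1) R0 z ** R0 z = 0" "Dm 1 R0 z = PP c j z ** Dm 1 R0 z" for z
      by blast+
    have h: "Dm (-1) (\<lambda>z. R0 z + PP c j z) z ** (R0 z + PP c j z) = 0" for z
      using I R unfolding Inv_def by (metis order.refl)
    note st = gauss_bundle_step[OF sm0 basic(1)[OF j c] P'(1) R0(1) basic(2)[OF j c] P'(2) R0(2,3) h R0(4) S, unfolded R]
    have Rz: "R0 z + PP c j z = RR c j z" for z using fun_cong[OF R] .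
    show "Dm 1 (RR c j) z = Dm 1 (PP c j) z ** PP c j z" "P' z ** RR c j z = 0"
     "Dm 1 (RR c j) z = P' z ** Dm 1 (RR c j) z"
      using st(1,3,4)[of z] unfolding Rz by auto
    show "Dm (-1) (\<lambda>z. RR c j z + P' z) z ** (RR c j z + P' z) = 0"
      using st(5)[of z] unfolding Rz .
  qed
  have inv: "Inv c j" if jp: "j \<le> p" and cc: "c \<in> charts" for c j
    using jp
  proof (induction j)
    case 0
    have "RR c 0 = PP c 0" by (auto simp: RR_def)
    then show ?case using basic[of 0 c] hol0[OF cc] cc unfolding Inv_def by simp
  next
    case (Suc j)
    then have I: "Inv c j" and j: "j \<le> p" "j < p" by auto
    obtain S where S: "S sparse_in UNIV" "\<And>z. z \<notin> S \<Longrightarrow> range ((*v) (PP c (Suc j) z)) = range ((*v) (Dm 1 (PP c j) z ** PP c j z))"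
      using generic[OF j(2) cc] by blast
    note st = step[OF I j(1) cc basic(1)[OF Suc.prems cc] basic(2)[OF Suc.prems cc] S]
    have o: "oproj (RR c j z)" for z using I unfolding Inv_def by auto
    have o': "oproj (PP c (Suc j) z)" for z using basic Suc.prems cc by blast
    have adj0: "RR c j z ** PP c (Suc j) z = 0" for z
    proof -
      have "adj (RR c j z ** PP c (Suc j) z) = 0"
        using st(2)[of z] o[of z] o'[of z] by (simp add: adj_mult oproj_def)
      then show ?thesis by simp
    qed
    have oS: "oproj (RR c (Suc j) z)" for z
      using o[of z] o'[of z] st(2)[of z] adj0[of z] unfolding R_Suc oproj_def
      by (simp add: adj_add mmult)
    have hS: "Dm (-1) (RR c (Suc j)) z ** RR c (Suc j) z = 0" for z
      using st(4)[of z] unfolding R_Suc .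
    show ?case
      using I oS hS st(1-3) unfolding Inv_def le_Suc_eq less_Suc_eq by blast
  qed
  have Rfix: "RR c m z ** PP c i z = PP c i z" if "i \<le> m" "m \<le> p" "c \<in> charts" for c m i z
    using that(1,2)
  proof (induction m rule: dec_induct)
    case base
    have o: "PP c i z ** PP c i z = PP c i z" using basic(2)[of i c z] that base by (auto simp: oproj_def)
    show ?case
    proof (cases i)
      case 0
      then show ?thesis using o by (simp add: RR_def)
    next
      case (Suc i')
      have "PP c i z ** RR c i' z = 0" using inv[OF base that(3)] Suc unfolding Inv_def by auto
      then have "adj (PP c i z ** RR c i' z) = 0" by simp
      moreover have "oproj (RR c i' z)" "oproj (PP c i z)"
        using inv[OF base that(3)] Suc basic(2)[OF base that(3)] unfolding Inv_def by auto
      ultimately have "RR c i' z ** PP c i z = 0" by (simp add: adj_mult oproj_def)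
      then show ?thesis unfolding Suc R_Suc using o by (simp add: matrix_add_rdistrib' Suc)
    qed
  next
    case (step m)
    have "PP c (Suc m) z ** RR c m z = 0" using inv[OF step.prems that(3)] unfolding Inv_def by auto
    then have "PP c (Suc m) z ** (RR c m z ** PP c i z) = 0" by (simp add: matrix_mul_assoc)
    then show ?case using step unfolding R_Suc by (simp add: matrix_add_rdistrib')
  qed
  have ortho: "PP c j z ** PP c i z = 0" if "i < j" "j \<le> p" "c \<in> charts" for c i j z
  proof -
    obtain m where m: "j = Suc m" "i \<le> m" using \<open>i < j\<close> by (cases j) auto
    have "PP c j z ** RR c m z = 0" using inv[OF that(2,3)] m unfolding Inv_def by auto
    then have "PP c j z ** (RR c m z ** PP c i z) = 0" by (simp add: matrix_mul_assoc)
    then show ?thesis using Rfix[of i m c z] m that by simp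
  qed
  have ortho': "PP c i z ** PP c j z = 0" if "i < j" "j \<le> p" "c \<in> charts" for c i j z
  proof -
    have "adj (PP c i z ** PP c j z) = PP c j z ** PP c i z"
      using basic(2)[of i c z] basic(2)[of j c z] that by (simp add: adj_mult oproj_def)
    then show ?thesis using ortho[OF that] by (metis adj_eq_zero_iff)
  qed
  have Ap: "Dm 1 (RR c p) z = 0" if "c \<in> charts" for c z
    using step(1)[OF inv[OF order.refl that] order.refl that msmooth_const oproj_0, of "{}"] last[OF that] by simp
  have const: "RR c p z = RR c p w" if c: "c \<in> charts" for c z w
  proof -
    have sm: "msmooth (RR c p) UNIV" using smR c by blast
    have "adj (RR c p z) = RR c p z" for z using inv[OF order.refl c] unfolding Inv_def oproj_def by auto
    then have D: "Dm 1 (RR c p) z = 0" "Dm (-1) (RR c p) z = 0" for z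
      using Dm_adj_self(1)[OF sm, of z] Ap[OF c, of z] by auto
    have "RR c p z $ i $ j = RR c p w $ i $ j" for i j
      by (rule zero_derivative_constant[of UNIV "\<lambda>z. RR c p z $ i $ j"])
        (use D sm msmooth_mdiff[OF sm] in \<open>auto simp: Dm_def vec_eq_iff mdiff_def\<close>)
    then show ?thesis by (simp add: vec_eq_iff)
  qed
  \<comment> \<open>The constant value of the last osculating projection; fullness concerns the sphere, so both
    charts enter.\<close>
  define Q where "Q = RR chart_0 p 0"
  have c0: "chart_0 \<in> charts" "chart_inf \<in> charts" by (auto simp: charts_def)
  have oQ: "oproj Q" using inv[OF order.refl c0(1)] unfolding Inv_def Q_def by auto
  have Q0: "Q ** PP chart_0 0 z = PP chart_0 0 z" for z
    using Rfix[of 0 p chart_0 z] const[OF c0(1), of z 0] c0 unfolding Q_def by simp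
  have swap: "PP chart_inf j w = PP chart_0 j (1 / w)" if "w \<noteq> 0" for j w
    using that by (simp add: PP_def chart_inf_def chart_0_def)
  have Qinf: "Q ** PP chart_inf 0 0 - PP chart_inf 0 0 = 0"
  proof (rule msmooth_zero_off_sparse[of "\<lambda>w. Q ** PP chart_inf 0 w - PP chart_inf 0 w" "{0}"])
    show "msmooth (\<lambda>w. Q ** PP chart_inf 0 w - PP chart_inf 0 w) UNIV"
      by (intro msmooth_diff msmooth_mult msmooth_const basic open_UNIV c0) auto
  qed (auto simp: swap Q0)
  have "\<psi> 0 x \<subseteq> range ((*v) Q)" for x
  proof (cases x)
    case (Point z)
    then have "\<psi> 0 x = range ((*v) (PP chart_0 0 z))"
      using smooth_grass_map_proj(6)[OF sg c0(1), of 0 x] by (simp add: PP_def chart_0_def)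
    then show ?thesis using iffD2[OF oproj_le_iff[OF oQ] Q0] by (simp only:)
  next
    case Infinity
    then have "\<psi> 0 x = range ((*v) (PP chart_inf 0 0))"
      using smooth_grass_map_proj(6)[OF sg c0(1), of 0 x] by (simp add: PP_def chart_inf_def)
    moreover have "Q ** PP chart_inf 0 0 = PP chart_inf 0 0" using Qinf by simp
    ultimately show ?thesis using iffD2[OF oproj_le_iff[OF oQ]] by (simp only:)
  qed
  then have "range ((*v) Q) = UNIV"
    using full subspace_range[of Q] unfolding linearly_full_def by blast
  moreover have "range ((*v) (mat 1 :: complex^'n^'n)) = UNIV"
    by (metis matrix_vector_mul_lid surjI)
  ultimately have Q1: "Q = mat 1" using oproj_unique[OF oQ oproj_1] by simp
  have comp: "RR c p z = mat 1" for z
  proof (cases "c = chart_0")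
    case True
    then show ?thesis using const[OF c0(1), of z 0] Q1 unfolding Q_def by simp
  next
    case False
    then have ci: "c = chart_inf" using c by (auto simp: charts_def)
    have "RR c p z = RR chart_inf p 1" unfolding ci using const[OF c0(2)] .
    also have "\<dots> = RR chart_0 p 1" unfolding RR_def by (simp add: swap)
    also have "\<dots> = mat 1" using const[OF c0(1), of 1 0] Q1 unfolding Q_def by simp
    finally show ?thesis .
  qed
  have e: "(\<lambda>j z. proj (\<psi> j (c z))) = PP c" by (intro ext) (simp only: PP_def)
  have e2: "(\<lambda>z. \<Sum>i\<le>j. PP c i z) = RR c j" for j by (auto simp: RR_def)
  show ?thesis
    unfolding e
  proof
    fix j z assume j: "j \<le> p"
    show "msmooth (PP c j) UNIV" "oproj (PP c j z)" using basic j c by auto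
    show "Dm (-1) (\<lambda>z. \<Sum>i\<le>j. PP c i z) z ** (\<Sum>i\<le>j. PP c i z) = 0"
      using inv[OF j c] unfolding e2 Inv_def RR_def[symmetric] by auto
    show "Dm 1 (\<lambda>z. \<Sum>i\<le>j. PP c i z) z = Dm 1 (PP c j) z ** PP c j z"
    proof (cases "j < p")
      case True
      then show ?thesis using inv[OF order.refl c] unfolding e2 Inv_def by auto
    next
      case False
      then have "j = p" using j by simp
      then show ?thesis unfolding e2 using Ap[OF c] last[OF c] by simp
    qed
  next
    fix j z assume "j < p"
    then show "Dm 1 (\<lambda>z. \<Sum>i\<le>j. PP c i z) z = PP c (Suc j) z ** Dm 1 (\<lambda>z. \<Sum>i\<le>j. PP c i z) z"
      using inv[OF order.refl c] unfolding e2 Inv_def by blast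
  next
    fix i j z assume "i \<le> p" "j \<le> p" "i \<noteq> j"
    then show "PP c i z ** PP c j z = 0"
      using ortho[of i j c z] ortho'[of i j c z] ortho[of j i c z] ortho'[of j i c z] c by (cases "i < j") auto
  next
    fix z show "(\<Sum>i\<le>p. PP c i z) = mat 1" using comp[of z] unfolding RR_def .
  qed
qed

section \<open>Invariant metrics on the flag manifold\<close>

text \<open>A labelling \<open>\<beta>\<close> of the coordinates by \<open>0, \<dots>, p\<close> defines a coordinate flag. Its tangent space
  consists of the skew-Hermitian matrices without diagonal blocks, its isotropy group of the
  block-diagonal unitary matrices.\<close>

definition block_tangent :: "('n::finite \<Rightarrow> nat) \<Rightarrow> (complex^'n^'n) set" where
  "block_tangent \<beta> = {X. adj X = - X \<and> (\<forall>a b. \<beta> a = \<beta> b \<longrightarrow> X $ a $ b = 0)}"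

definition block_diagonal :: "('n::finite \<Rightarrow> nat) \<Rightarrow> (complex^'n^'n) set" where
  "block_diagonal \<beta> = {w. \<forall>a b. \<beta> a \<noteq> \<beta> b \<longrightarrow> w $ a $ b = 0}"

definition root_vector :: "'n::finite \<Rightarrow> 'n \<Rightarrow> complex \<Rightarrow> complex^'n^'n" where
  "root_vector a b x = (\<chi> i j. if i = a \<and> j = b then x else if i = b \<and> j = a then - cnj x else 0)"

lemma block_tangent_zero: "0 \<in> block_tangent \<beta>"
  by (simp add: block_tangent_def)

lemma block_tangent_add: "X \<in> block_tangent \<beta> \<Longrightarrow> Y \<in> block_tangent \<beta> \<Longrightarrow> X + Y \<in> block_tangent \<beta>"
  by (simp add: block_tangent_def adj_add)

lemma block_tangent_sum:
  "(\<And>s. s \<in> S \<Longrightarrow> F s \<in> block_tangent \<beta>) \<Longrightarrow> (\<Sum>s\<in>S. F s) \<in> block_tangent \<beta>"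
  by (induction S rule: infinite_finite_induct) (auto simp: block_tangent_zero block_tangent_add)

lemma root_vector_tangent:
  assumes "\<beta> a \<noteq> \<beta> b"
  shows "root_vector a b x \<in> block_tangent \<beta>"
proof -
  have "a \<noteq> b" using assms by auto
  then show ?thesis using assms
    by (auto simp: block_tangent_def root_vector_def adj_def vec_eq_iff)
qed

lemma diagonal_unitary:
  fixes d :: "'n::finite \<Rightarrow> complex"
  assumes "\<And>i. cmod (d i) = 1"
  defines "D \<equiv> (\<chi> i j. if i = j then d i else 0)"
  shows "D \<in> unitary_group" "D \<in> block_diagonal \<beta>" "(D ** X ** adj D) $ i $ j = d i * X $ i $ j * cnj (d j)"
proof -
  have 1: "d i * cnj (d i) = 1" for i
    using assms(1)[of i] complex_norm_square[of "d i"] by simp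
  have DX: "(D ** Y) $ i $ j = d i * Y $ i $ j" for Y :: "complex^'n^'n" and i j
    by (simp add: matrix_matrix_mult_def D_def if_distrib if_distribR cong: if_cong)
  have XD: "(Y ** adj D) $ i $ j = Y $ i $ j * cnj (d j)" for Y :: "complex^'n^'n" and i j
  proof -
    have "(Y ** adj D) $ i $ j = (\<Sum>k\<in>UNIV. if k = j then Y $ i $ k * cnj (d j) else 0)"
      unfolding matrix_matrix_mult_def adj_def D_def vec_lambda_beta by (rule sum.cong) auto
    then show ?thesis by simp
  qed
  show "(D ** X ** adj D) $ i $ j = d i * X $ i $ j * cnj (d j)" by (simp add: DX XD)
  have "D ** adj D = mat 1"
    by (simp add: vec_eq_iff DX) (simp add: adj_def D_def mat_def 1)
  then show "D \<in> unitary_group"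
    unfolding unitary_group_def using matrix_left_right_inverse by blast
  show "D \<in> block_diagonal \<beta>" by (auto simp: block_diagonal_def D_def)
qed

text \<open>The permutation matrix of an involution that preserves the blocks lies in the isotropy
  group.\<close>

lemma involution_unitary:
  fixes \<sigma> :: "'n::finite \<Rightarrow> 'n"
  assumes "\<And>i. \<sigma> (\<sigma> i) = i" "\<And>i. \<beta> (\<sigma> i) = \<beta> i"
  defines "W \<equiv> (\<chi> i j. if i = \<sigma> j then 1 else (0::complex))"
  shows "W \<in> unitary_group" "W \<in> block_diagonal \<beta>" "(W ** X ** adj W) $ i $ j = X $ (\<sigma> i) $ (\<sigma> j)"
proof -
  have eq: "i = \<sigma> k \<longleftrightarrow> k = \<sigma> i" for i k using assms(1) by metis
  have WX: "(W ** Y) $ i $ j = Y $ (\<sigma> i) $ j" for Y :: "complex^'n^'n" and i j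
  proof -
    have "(W ** Y) $ i $ j = (\<Sum>k\<in>UNIV. if k = \<sigma> i then Y $ k $ j else 0)"
      unfolding matrix_matrix_mult_def W_def vec_lambda_beta by (rule sum.cong) (auto simp: eq[of i])
    then show ?thesis by simp
  qed
  have XW: "(Y ** adj W) $ i $ j = Y $ i $ (\<sigma> j)" for Y :: "complex^'n^'n" and i j
  proof -
    have "(Y ** adj W) $ i $ j = (\<Sum>k\<in>UNIV. if k = \<sigma> j then Y $ i $ k else 0)"
      unfolding matrix_matrix_mult_def W_def adj_def vec_lambda_beta by (rule sum.cong) (auto simp: eq[of j])
    then show ?thesis by simp
  qed
  show "(W ** X ** adj W) $ i $ j = X $ (\<sigma> i) $ (\<sigma> j)" by (simp add: WX XW)
  have "W ** adj W = mat 1"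
    by (simp add: vec_eq_iff WX) (auto simp: adj_def W_def mat_def assms(1))
  then show "W \<in> unitary_group"
    unfolding unitary_group_def using matrix_left_right_inverse by blast
  show "W \<in> block_diagonal \<beta>" using assms(2) by (auto simp: block_diagonal_def W_def)
qed

text \<open>A form invariant under the isotropy group of the coordinate flag is a weighted sum of
  squares on tangent vectors that have entries in neighbouring blocks only. Those vectors are
  real-linear combinations of matrices \<open>root_vector a b x\<close>. A diagonal sign change that fixes one
  of two distinct such matrices and negates the other shows that they are orthogonal; a diagonal
  phase shows that the value on one of them depends on \<open>|x|\<close> alone; and a permutation inside the
  blocks shows that the weight depends on the pair of blocks alone.\<close>

lemma invariant_block_form:
  fixes \<beta> :: "'n::finite \<Rightarrow> nat" and G :: "complex^'n^'n \<Rightarrow> complex^'n^'n \<Rightarrow> real"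
  assumes sym: "\<And>X Y. X \<in> block_tangent \<beta> \<Longrightarrow> Y \<in> block_tangent \<beta> \<Longrightarrow> G X Y = G Y X"
    and lin: "\<And>X Y Z a b. X \<in> block_tangent \<beta> \<Longrightarrow> Y \<in> block_tangent \<beta> \<Longrightarrow> Z \<in> block_tangent \<beta> \<Longrightarrow>
       G (a *\<^sub>R X + b *\<^sub>R Y) Z = a * G X Z + b * G Y Z"
    and pos: "\<And>X. X \<in> block_tangent \<beta> \<Longrightarrow> X \<noteq> 0 \<Longrightarrow> 0 < G X X"
    and inv: "\<And>w X Y. w \<in> unitary_group \<Longrightarrow> w \<in> block_diagonal \<beta> \<Longrightarrow> X \<in> block_tangent \<beta> \<Longrightarrow>
       Y \<in> block_tangent \<beta> \<Longrightarrow> G (w ** X ** adj w) (w ** Y ** adj w) = G X Y"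
    and occupied: "\<And>l. l \<le> p \<Longrightarrow> \<exists>a. \<beta> a = l"
    and range: "\<And>a. \<beta> a \<le> p"
  shows "\<exists>\<mu>. (\<forall>l<p. 0 < \<mu> l) \<and> (\<forall>X\<in>block_tangent \<beta>.
     (\<forall>a b. X $ a $ b \<noteq> 0 \<longrightarrow> \<beta> a = Suc (\<beta> b) \<or> \<beta> b = Suc (\<beta> a)) \<longrightarrow>
     G X X = (\<Sum>l<p. \<mu> l * (\<Sum>a | \<beta> a = Suc l. \<Sum>b | \<beta> b = l. (cmod (X $ a $ b))\<^sup>2)))"
proof -
  let ?E = root_vector
  have lin0: "G 0 Z = 0" if "Z \<in> block_tangent \<beta>" for Z
    using lin[OF block_tangent_zero block_tangent_zero that, of 0 0] by simp
  have lin1: "G (X + Y) Z = G X Z + G Y Z"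
    if "X \<in> block_tangent \<beta>" "Y \<in> block_tangent \<beta>" "Z \<in> block_tangent \<beta>" for X Y Z
    using lin[OF that, of 1 1] by simp
  have lin2: "G (r *\<^sub>R X) Z = r * G X Z" if "X \<in> block_tangent \<beta>" "Z \<in> block_tangent \<beta>" for X Z r
    using lin[OF that(1) block_tangent_zero that(2), of r 0] by simp
  have linS: "G (\<Sum>s\<in>S. F s) Z = (\<Sum>s\<in>S. G (F s) Z)"
    if "\<And>s. s \<in> S \<Longrightarrow> F s \<in> block_tangent \<beta>" "Z \<in> block_tangent \<beta>" for S F Z
    using that by (induction S rule: infinite_finite_induct) (auto simp: lin0 lin1 block_tangent_sum)
  define S where "S = {(a, b). \<beta> a = Suc (\<beta> b)}"
  have ET: "?E a b x \<in> block_tangent \<beta>" if "(a, b) \<in> S" for a b x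
    using that by (intro root_vector_tangent) (auto simp: S_def)
  have off: "G (?E a b x) (?E c d y) = 0" if s: "(a, b) \<in> S" "(c, d) \<in> S" "(a, b) \<noteq> (c, d)" for a b c d x y
  proof -
    have "{a, b} \<noteq> {c, d}" using s by (auto simp: S_def doubleton_eq_iff)
    \<comment> \<open>Changing the sign of the coordinate \<open>e\<close> negates exactly one of the two matrices.\<close>
    then obtain e where e: "(e \<in> {a, b}) \<noteq> (e \<in> {c, d})" by blast
    define dd where "dd i = (if i = e then -1 else 1 :: complex)" for i
    have u: "cmod (dd i) = 1" for i by (simp add: dd_def)
    note D = diagonal_unitary[of dd, OF u]
    define D where "D = (\<chi> i j. if i = j then dd i else 0)"
    have ne: "a \<noteq> b" "c \<noteq> d" using s by (auto simp: S_def)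
    have 1: "D ** ?E a b x ** adj D = ?E a b (if e \<in> {a, b} then - x else x)"
      unfolding vec_eq_iff D_def D(3) using ne by (auto simp: root_vector_def dd_def)
    have 2: "D ** ?E c d y ** adj D = ?E c d (if e \<in> {c, d} then - y else y)"
      unfolding vec_eq_iff D_def D(3) using ne by (auto simp: root_vector_def dd_def)
    have neg: "?E a b (- x) = (-1) *\<^sub>R ?E a b x" for a b x
      by (auto simp: root_vector_def vec_eq_iff)
    have "G (D ** ?E a b x ** adj D) (D ** ?E c d y ** adj D) = G (?E a b x) (?E c d y)"
      using D(1,2) ET s unfolding D_def by (intro inv) auto
    moreover have "G (D ** ?E a b x ** adj D) (D ** ?E c d y ** adj D) = - G (?E a b x) (?E c d y)"
    proof (cases "e \<in> {a, b}")
      case True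
      then show ?thesis unfolding 1 2 using e lin2[OF ET[OF s(1)] ET[OF s(2)], of "-1"] by (simp add: neg)
    next
      case False
      then show ?thesis unfolding 1 2
        using e lin2[OF ET[OF s(2)] ET[OF s(1)], of "-1"] sym[OF ET[OF s(1)] ET[OF s(2)]]
          sym[OF ET[OF s(1), of x] ET[OF s(2), of "- y"]] by (simp add: neg)
    qed
    ultimately show ?thesis by simp
  qed
  have phase: "G (?E a b x) (?E a b x) = (cmod x)\<^sup>2 * G (?E a b 1) (?E a b 1)" if s: "(a, b) \<in> S" for a b x
  proof (cases "x = 0")
    case True
    then have "?E a b x = 0" by (auto simp: root_vector_def vec_eq_iff)
    then show ?thesis using True lin0[OF block_tangent_zero] by simp
  next
    case False
    define q r where "q = sgn x" and "r = complex_of_real (cmod x)"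
    define dd where "dd i = (if i = a then q else 1)" for i
    have u: "cmod (dd i) = 1" for i using False by (simp add: dd_def norm_sgn q_def)
    note D = diagonal_unitary[of dd, OF u]
    define D where "D = (\<chi> i j. if i = j then dd i else 0)"
    have ne: "a \<noteq> b" "b \<noteq> a" using s by (auto simp: S_def)
    have qr: "q * r = x" using False by (simp add: sgn_eq q_def r_def)
    have rq: "cnj r * cnj q = cnj x"
      using arg_cong[OF qr, of cnj] by (simp add: mult.commute)
    have 1: "D ** ?E a b (of_real (cmod x)) ** adj D = ?E a b x"
    proof -
      have "(D ** ?E a b r ** adj D) $ i $ j = ?E a b x $ i $ j" for i j
      proof -
        consider "i = a" "j = b" | "i = b" "j = a" | "\<not> (i = a \<and> j = b)" "\<not> (i = b \<and> j = a)" by blast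
        then show ?thesis
        proof cases
          case 1
          then show ?thesis unfolding D_def D(3) using ne by (simp only: root_vector_def dd_def vec_lambda_beta) (simp add: qr)
        next
          case 2
          then show ?thesis unfolding D_def D(3) using ne by (simp only: root_vector_def dd_def vec_lambda_beta) (simp add: rq)
        next
          case 3
          then have "?E a b y $ i $ j = 0" for y by (auto simp: root_vector_def)
          then show ?thesis unfolding D_def D(3) by simp
        qed
      qed
      then show ?thesis by (simp add: vec_eq_iff r_def)
    qed
    have 2: "?E a b (of_real (cmod x)) = cmod x *\<^sub>R ?E a b 1"
    proof -
      have "?E a b (of_real (cmod x)) $ i $ j = (cmod x *\<^sub>R ?E a b 1) $ i $ j" for i j
        unfolding vector_scaleR_component root_vector_def vec_lambda_beta by (simp add: scaleR_conv_of_real)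
      then show ?thesis by (simp add: vec_eq_iff)
    qed
    have "G (?E a b x) (?E a b x) = G (?E a b (of_real (cmod x))) (?E a b (of_real (cmod x)))"
      unfolding 1[symmetric] using D(1,2) ET s unfolding D_def by (intro inv) auto
    also have "\<dots> = cmod x * G (?E a b 1) (cmod x *\<^sub>R ?E a b 1)"
      unfolding 2 using lin2[OF ET[OF s] ET[OF s, of "of_real (cmod x)"], of "cmod x"] unfolding 2 .
    also have "G (?E a b 1) (cmod x *\<^sub>R ?E a b 1) = cmod x * G (?E a b 1) (?E a b 1)"
      using sym[OF ET[OF s, of 1] ET[OF s, of "of_real (cmod x)"]] lin2[OF ET[OF s] ET[OF s], of "cmod x"]
      unfolding 2 by simp
    finally show ?thesis by (simp add: power2_eq_square)
  qed
  have perm: "G (?E a b 1) (?E a b 1) = G (?E a' b' 1) (?E a' b' 1)"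
    if s: "(a, b) \<in> S" "(a', b') \<in> S" "\<beta> b = \<beta> b'" for a b a' b'
  proof -
    have \<beta>: "\<beta> a = \<beta> a'" "\<beta> a \<noteq> \<beta> b" using s by (auto simp: S_def)
    \<comment> \<open>The involution exchanging \<open>a\<close> with \<open>a'\<close> and \<open>b\<close> with \<open>b'\<close>; it may have fixed points.\<close>
    define \<sigma> where "\<sigma> i = (if i = a then a' else if i = a' then a else if i = b then b' else if i = b' then b else i)" for i
    have 1: "\<sigma> (\<sigma> i) = i" for i using \<beta> s(3) by (auto simp: \<sigma>_def)
    have 2: "\<beta> (\<sigma> i) = \<beta> i" for i using \<beta> s(3) by (auto simp: \<sigma>_def)
    note W = involution_unitary[of \<sigma> \<beta>, OF 1 2]
    define W where "W = (\<chi> i j. if i = \<sigma> j then 1 else (0::complex))"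
    have eq: "\<sigma> i = j \<longleftrightarrow> i = \<sigma> j" for i j using 1 by metis
    have \<sigma>: "\<sigma> a = a'" "\<sigma> b = b'" using \<beta> s(3) by (auto simp: \<sigma>_def)
    have "W ** ?E a b 1 ** adj W = ?E a' b' 1"
      unfolding vec_eq_iff W_def W(3) by (simp add: root_vector_def eq \<sigma>)
    then show ?thesis
      using inv[OF W(1,2) ET[OF s(1)] ET[OF s(1)], of 1 1] unfolding W_def by simp
  qed
  define rep where "rep l = (SOME s. s \<in> S \<and> \<beta> (snd s) = l)" for l
  have rep: "rep l \<in> S \<and> \<beta> (snd (rep l)) = l" if lp: "l < p" for l
  proof -
    obtain a b where "\<beta> a = Suc l" "\<beta> b = l" using occupied[of l] occupied[of "Suc l"] lp by auto
    then have "(a, b) \<in> S \<and> \<beta> (snd (a, b)) = l" by (simp add: S_def)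
    then show ?thesis unfolding rep_def by (rule someI)
  qed
  define \<mu> where "\<mu> l = (case rep l of (a, b) \<Rightarrow> G (?E a b 1) (?E a b 1))" for l
  have \<mu>: "G (?E a b 1) (?E a b 1) = \<mu> (\<beta> b)" if "(a, b) \<in> S" for a b
  proof -
    have "\<beta> b < p" using that range[of a] by (auto simp: S_def)
    then show ?thesis using rep[of "\<beta> b"] perm[OF that] unfolding \<mu>_def by (cases "rep (\<beta> b)") auto
  qed
  have mpos: "0 < \<mu> l" if "l < p" for l
  proof -
    obtain a b where ab: "rep l = (a, b)" by (cases "rep l")
    then have s: "(a, b) \<in> S" using rep[OF that] by auto
    have "?E a b 1 $ a $ b \<noteq> 0" by (simp add: root_vector_def)
    then have "?E a b 1 \<noteq> 0" by (metis zero_index)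
    then show ?thesis unfolding \<mu>_def ab using pos[OF ET[OF s]] by simp
  qed
  have form: "G X X = (\<Sum>l<p. \<mu> l * (\<Sum>a | \<beta> a = Suc l. \<Sum>b | \<beta> b = l. (cmod (X $ a $ b))\<^sup>2))"
    if X: "X \<in> block_tangent \<beta>" and supp: "\<And>a b. X $ a $ b \<noteq> 0 \<Longrightarrow> \<beta> a = Suc (\<beta> b) \<or> \<beta> b = Suc (\<beta> a)" for X
  proof -
    have fin: "finite S" by simp
    have skew: "X $ i $ j = - cnj (X $ j $ i)" for i j
    proof -
      have "adj X $ i $ j = (- X) $ i $ j" using X by (simp add: block_tangent_def)
      then show ?thesis by (simp add: adj_def)
    qed
    have dec: "X = (\<Sum>s\<in>S. ?E (fst s) (snd s) (X $ fst s $ snd s))"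
    proof -
      have "(\<Sum>s\<in>S. ?E (fst s) (snd s) (X $ fst s $ snd s)) $ i $ j = X $ i $ j" for i j
      proof -
        have "(\<Sum>s\<in>S. ?E (fst s) (snd s) (X $ fst s $ snd s)) $ i $ j =
          (\<Sum>s\<in>S. ?E (fst s) (snd s) (X $ fst s $ snd s) $ i $ j)" by simp
        also have "\<dots> = (\<Sum>s\<in>S. (if s = (i, j) then X $ i $ j else 0) + (if s = (j, i) then X $ i $ j else 0))"
        proof (rule sum.cong[OF refl])
          fix s assume "s \<in> S"
          moreover obtain a b where s: "s = (a, b)" by (cases s)
          ultimately have "a \<noteq> b" by (auto simp: S_def)
          then show "?E (fst s) (snd s) (X $ fst s $ snd s) $ i $ j =
              (if s = (i, j) then X $ i $ j else 0) + (if s = (j, i) then X $ i $ j else 0)"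
            unfolding s using skew[of b a, symmetric] by (auto simp: root_vector_def)
        qed
        also have "\<dots> = (if (i, j) \<in> S then X $ i $ j else 0) + (if (j, i) \<in> S then X $ i $ j else 0)"
          by (simp add: sum.distrib sum.delta fin)
        also have "\<dots> = X $ i $ j"
          using supp[of i j] by (auto simp: S_def)
        finally show ?thesis .
      qed
      then show ?thesis by (simp add: vec_eq_iff)
    qed
    let ?F = "\<lambda>s. ?E (fst s) (snd s) (X $ fst s $ snd s)"
    have FT: "?F s \<in> block_tangent \<beta>" if "s \<in> S" for s using ET[of "fst s" "snd s"] that by simp
    have "G X X = (\<Sum>s\<in>S. G (?F s) X)"
      by (subst (1) dec) (rule linS[OF FT X])
    also have "\<dots> = (\<Sum>s\<in>S. G (?F s) (?F s))"
    proof (rule sum.cong[OF refl])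
      fix s assume s: "s \<in> S"
      have "G (?F s) X = G X (?F s)" by (rule sym[OF FT[OF s] X])
      also have "\<dots> = (\<Sum>t\<in>S. G (?F t) (?F s))"
        by (subst (1) dec) (rule linS[OF FT FT[OF s]])
      also have "\<dots> = (\<Sum>t\<in>S. if t = s then G (?F s) (?F s) else 0)"
      proof (rule sum.cong[OF refl])
        fix t assume t: "t \<in> S"
        show "G (?F t) (?F s) = (if t = s then G (?F s) (?F s) else 0)"
          using off[of "fst t" "snd t" "fst s" "snd s"] s t by (simp add: prod_eq_iff)
      qed
      finally show "G (?F s) X = G (?F s) (?F s)" using s fin by simp
    qed
    also have "\<dots> = (\<Sum>s\<in>S. \<mu> (\<beta> (snd s)) * (cmod (X $ fst s $ snd s))\<^sup>2)"
      using phase \<mu> by (intro sum.cong refl) (auto simp: mult.commute)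
    also have "\<dots> = (\<Sum>l<p. \<Sum>s | s \<in> S \<and> \<beta> (snd s) = l. \<mu> (\<beta> (snd s)) * (cmod (X $ fst s $ snd s))\<^sup>2)"
    proof (rule sum.group[symmetric, OF fin finite_lessThan])
      show "(\<lambda>s. \<beta> (snd s)) ` S \<subseteq> {..<p}"
      proof clarsimp
        fix a b assume "(a, b) \<in> S"
        then show "\<beta> b < p" using range[of a] by (simp add: S_def)
      qed
    qed
    also have "\<dots> = (\<Sum>l<p. \<mu> l * (\<Sum>a | \<beta> a = Suc l. \<Sum>b | \<beta> b = l. (cmod (X $ a $ b))\<^sup>2))"
    proof (rule sum.cong[OF refl])
      fix l
      have eq: "{s. s \<in> S \<and> \<beta> (snd s) = l} = {a. \<beta> a = Suc l} \<times> {b. \<beta> b = l}"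
        by (auto simp: S_def)
      show "(\<Sum>s | s \<in> S \<and> \<beta> (snd s) = l. \<mu> (\<beta> (snd s)) * (cmod (X $ fst s $ snd s))\<^sup>2) =
        \<mu> l * (\<Sum>a | \<beta> a = Suc l. \<Sum>b | \<beta> b = l. (cmod (X $ a $ b))\<^sup>2)"
        unfolding eq sum.cartesian_product sum_distrib_left
        by (rule sum.cong) auto
    qed
    finally show ?thesis .
  qed
  show ?thesis using mpos form by blast
qed

definition coordinate_block :: "('n::finite \<Rightarrow> nat) \<Rightarrow> nat \<Rightarrow> complex^'n^'n" where
  "coordinate_block \<beta> j = (\<chi> a b. if a = b \<and> \<beta> a = j then 1 else 0)"

lemma coordinate_block_mult:
  "(coordinate_block \<beta> i ** X ** coordinate_block \<beta> j) $ a $ b =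
    (if \<beta> a = i \<and> \<beta> b = j then X $ a $ b else 0)"
proof -
  have 1: "(coordinate_block \<beta> i ** Y) $ a $ b = (if \<beta> a = i then Y $ a $ b else 0)" for Y :: "complex^'a^'a" and a b
  proof -
    have "(coordinate_block \<beta> i ** Y) $ a $ b = (\<Sum>k\<in>UNIV. if k = a then (if \<beta> a = i then Y $ a $ b else 0) else 0)"
      unfolding matrix_matrix_mult_def coordinate_block_def vec_lambda_beta by (rule sum.cong) auto
    then show ?thesis by simp
  qed
  have 2: "(Y ** coordinate_block \<beta> j) $ a $ b = (if \<beta> b = j then Y $ a $ b else 0)" for Y :: "complex^'a^'a" and a b
  proof -
    have "(Y ** coordinate_block \<beta> j) $ a $ b = (\<Sum>k\<in>UNIV. if k = b then (if \<beta> b = j then Y $ a $ b else 0) else 0)"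
      unfolding matrix_matrix_mult_def coordinate_block_def vec_lambda_beta by (rule sum.cong) auto
    then show ?thesis by simp
  qed
  show ?thesis by (simp add: 1 2)
qed

lemma unitary_group_D:
  assumes "u \<in> unitary_group"
  shows "u ** adj u = mat 1" "adj u ** u = mat 1" "u ** (adj u ** X) = X" "adj u ** (u ** X) = X"
  using assms by (auto simp: unitary_group_def matrix_mul_assoc)

lemma norm_unitary_mult:
  assumes "u \<in> unitary_group"
  shows "norm (u ** X ** adj u) = norm (X :: complex^'n^'n)"
proof -
  have "complex_of_real ((norm (u ** X ** adj u))\<^sup>2) = trace (u ** (adj X ** X) ** adj u)"
    unfolding trace_adj_mult_self[symmetric]
    by (simp add: adj_mult mmult unitary_group_D[OF assms])
  also have "\<dots> = of_real ((norm X)\<^sup>2)"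
    using trace_mul_sym[of "u ** (adj X ** X)" "adj u"]
    by (simp add: unitary_group_D[OF assms] trace_adj_mult_self)
  finally show ?thesis by (metis of_real_eq_iff norm_ge_zero power2_eq_imp_eq)
qed

lemma flag_bases:
  fixes L :: "nat \<Rightarrow> (complex^'n) set"
  assumes "L \<in> flag_manifold p k"
  obtains B where "\<And>j. j \<le> p \<Longrightarrow> orthonormal_set (B j)" "\<And>j. j \<le> p \<Longrightarrow> vec.span (B j) = L j"
    "\<And>j. j \<le> p \<Longrightarrow> card (B j) = k j" "\<And>i j x y. i \<le> p \<Longrightarrow> j \<le> p \<Longrightarrow> i \<noteq> j \<Longrightarrow> x \<in> B i \<Longrightarrow> y \<in> B j \<Longrightarrow> herm x y = 0"
    "card (\<Union>j\<le>p. B j) = CARD('n)" "\<And>i j. i \<le> p \<Longrightarrow> j \<le> p \<Longrightarrow> i \<noteq> j \<Longrightarrow> B i \<inter> B j = {}"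
proof -
  have g: "vec.subspace (L j)" "vec.dim (L j) = k j" if "j \<le> p" for j
    using assms that unfolding flag_manifold_def grassmannian_def by (auto simp: PiE_iff)
  have o: "L i \<subseteq> orth (L j)" if "i \<le> p" "j \<le> p" "i \<noteq> j" for i j
    using assms that unfolding flag_manifold_def by auto
  have sp: "vec.span (\<Union>j\<le>p. L j) = UNIV" using assms unfolding flag_manifold_def by auto
  have "\<exists>B. orthonormal_set B \<and> B \<subseteq> L j \<and> vec.span B = L j" if "j \<le> p" for j
    using orthonormal_basis_exists[OF g(1)[OF that]] by metis
  then obtain B where B: "\<And>j. j \<le> p \<Longrightarrow> orthonormal_set (B j)" "\<And>j. j \<le> p \<Longrightarrow> B j \<subseteq> L j"
    "\<And>j. j \<le> p \<Longrightarrow> vec.span (B j) = L j" by metis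
  have c: "card (B j) = k j" if "j \<le> p" for j
    using vec.dim_span_eq_card_independent[OF orthonormal_independent[OF B(1)[OF that]]] B(3)[OF that] g(2)[OF that] by simp
  have h: "herm x y = 0" if "i \<le> p" "j \<le> p" "i \<noteq> j" "x \<in> B i" "y \<in> B j" for i j x y
  proof -
    have "y \<in> orth (L i)" "x \<in> L i" using B(2) o[of j i] that by auto
    then show ?thesis unfolding orth_def by auto
  qed
  have dis: "B i \<inter> B j = {}" if "i \<le> p" "j \<le> p" "i \<noteq> j" for i j
  proof -
    have "herm x x = 1" if "x \<in> B i" for x using B(1)[OF \<open>i \<le> p\<close>] that by (simp add: orthonormal_set_def)
    then show ?thesis using h[OF that] by force
  qed
  let ?U = "\<Union>j\<le>p. B j"
  have on: "orthonormal_set ?U"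
    unfolding orthonormal_set_def
  proof (intro ballI)
    fix x y assume "x \<in> ?U" "y \<in> ?U"
    then obtain i j where ij: "i \<le> p" "j \<le> p" "x \<in> B i" "y \<in> B j" by auto
    show "herm x y = (if x = y then 1 else 0)"
    proof (cases "i = j")
      case True
      then show ?thesis using B(1)[OF ij(1)] ij by (auto simp: orthonormal_set_def)
    next
      case False
      then show ?thesis using h[OF ij(1,2)] ij dis[OF ij(1,2)] by auto
    qed
  qed
  have "(\<Union>j\<le>p. L j) \<subseteq> vec.span ?U"
    using B(3) vec.span_mono[of _ ?U] by (metis (no_types, lifting) UN_least UN_upper atMost_iff)
  then have "vec.span ?U = UNIV" using sp vec.span_minimal[OF _ vec.subspace_span] by blast
  then have "card ?U = CARD('n)"
    using vec.dim_span_eq_card_independent[OF orthonormal_independent[OF on]] vec_dim_card by metis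
  then show ?thesis using that[of B] B c h dis by blast
qed

text \<open>The ranks of the summands add up to the dimension. A labelling with these block sizes serves
  for all flags of the given type at once, which is what makes metrics at different flags
  comparable.\<close>

lemma block_labelling_exists:
  fixes L :: "nat \<Rightarrow> (complex^'n) set"
  assumes "L \<in> flag_manifold p k"
  obtains \<beta> :: "'n::finite \<Rightarrow> nat" where "\<And>i. \<beta> i \<le> p" "\<And>j. j \<le> p \<Longrightarrow> card {i. \<beta> i = j} = k j"
proof -
  obtain B where BB: "\<And>j. j \<le> p \<Longrightarrow> orthonormal_set (B j)" "\<And>j. j \<le> p \<Longrightarrow> vec.span (B j) = L j"
    "\<And>j. j \<le> p \<Longrightarrow> card (B j) = k j" "\<And>i j x y. i \<le> p \<Longrightarrow> j \<le> p \<Longrightarrow> i \<noteq> j \<Longrightarrow> x \<in> B i \<Longrightarrow> y \<in> B j \<Longrightarrow> herm x y = 0"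
    "card (\<Union>j\<le>p. B j) = CARD('n)" "\<And>i j. i \<le> p \<Longrightarrow> j \<le> p \<Longrightarrow> i \<noteq> j \<Longrightarrow> B i \<inter> B j = {}"
    using flag_bases[OF assms] by blast
  note B = BB(1,3,5,6)
  have fin: "finite (\<Union>j\<le>p. B j)" using B(1) orthonormal_finite by auto
  obtain h where h: "bij_betw h (UNIV :: 'n set) (\<Union>j\<le>p. B j)"
    using finite_same_card_bij[of "UNIV :: 'n set" "\<Union>j\<le>p. B j"] fin B(3) by auto
  have "\<exists>j. j \<le> p \<and> h i \<in> B j" for i using h unfolding bij_betw_def by blast
  then obtain \<beta> where \<beta>: "\<And>i. \<beta> i \<le> p" "\<And>i. h i \<in> B (\<beta> i)" by metis
  have "card {i. \<beta> i = j} = k j" if j: "j \<le> p" for j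
  proof -
    have "bij_betw h {i. \<beta> i = j} (B j)"
      unfolding bij_betw_def
    proof
      show "inj_on h {i. \<beta> i = j}" using h unfolding bij_betw_def by (meson inj_on_subset subset_UNIV)
      show "h ` {i. \<beta> i = j} = B j"
      proof
        show "h ` {i. \<beta> i = j} \<subseteq> B j" using \<beta>(2) by auto
        show "B j \<subseteq> h ` {i. \<beta> i = j}"
        proof
          fix x assume x: "x \<in> B j"
          then obtain i where i: "x = h i" using h j unfolding bij_betw_def by blast
          have "\<beta> i = j" using B(4)[OF \<beta>(1)[of i] j] \<beta>(2)[of i] x i by blast
          then show "x \<in> h ` {i. \<beta> i = j}" using i by blast
        qed
      qed
    qed
    then show ?thesis using bij_betw_same_card B(2)[OF j] by metis
  qed
  then show ?thesis using that \<beta>(1) by blast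
qed

text \<open>The unitary matrix whose columns are orthonormal bases of the summands carries the
  coordinate flag to the given one.\<close>

lemma adapted_frame:
  fixes L :: "nat \<Rightarrow> (complex^'n) set"
  assumes L: "L \<in> flag_manifold p k" and \<beta>: "\<And>i. \<beta> i \<le> p" "\<And>j. j \<le> p \<Longrightarrow> card {i. \<beta> i = j} = k j"
  obtains V where "V \<in> unitary_group" "\<And>j. j \<le> p \<Longrightarrow> proj (L j) = V ** coordinate_block \<beta> j ** adj V"
    "\<And>j. j \<le> p \<Longrightarrow> oproj (proj (L j))" "\<And>j. j \<le> p \<Longrightarrow> range ((*v) (proj (L j))) = L j"
proof -
  obtain B where BB: "\<And>j. j \<le> p \<Longrightarrow> orthonormal_set (B j)" "\<And>j. j \<le> p \<Longrightarrow> vec.span (B j) = L j"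
    "\<And>j. j \<le> p \<Longrightarrow> card (B j) = k j" "\<And>i j x y. i \<le> p \<Longrightarrow> j \<le> p \<Longrightarrow> i \<noteq> j \<Longrightarrow> x \<in> B i \<Longrightarrow> y \<in> B j \<Longrightarrow> herm x y = 0"
    "card (\<Union>j\<le>p. B j) = CARD('n)" "\<And>i j. i \<le> p \<Longrightarrow> j \<le> p \<Longrightarrow> i \<noteq> j \<Longrightarrow> B i \<inter> B j = {}"
    using flag_bases[OF L] by blast
  note B = BB(1-4)
  have "\<exists>h. bij_betw h {i. \<beta> i = j} (B j)" if "j \<le> p" for j
    using finite_same_card_bij[of "{i. \<beta> i = j}" "B j"] orthonormal_finite(1)[OF B(1)[OF that]] B(3)[OF that] \<beta>(2)[OF that] by auto
  then obtain h where h: "\<And>j. j \<le> p \<Longrightarrow> bij_betw (h j) {i. \<beta> i = j} (B j)" by metis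
  define v where "v i = h (\<beta> i) i" for i
  have vB: "v i \<in> B (\<beta> i)" for i using h[OF \<beta>(1)[of i]] unfolding v_def bij_betw_def by auto
  have vv: "herm (v i) (v j) = (if i = j then 1 else 0)" for i j
  proof (cases "\<beta> i = \<beta> j")
    case True
    have "v i = v j \<longleftrightarrow> i = j"
      using h[OF \<beta>(1)[of i]] True unfolding v_def bij_betw_def inj_on_def by auto
    then show ?thesis using B(1)[OF \<beta>(1)[of i]] vB[of i] vB[of j] True by (simp add: orthonormal_set_def)
  next
    case False
    then show ?thesis using B(4)[OF \<beta>(1) \<beta>(1) False vB vB] by auto
  qed
  define V where "V = (\<chi> a i. v i $ a)"
  have "adj V ** V = mat 1"
    unfolding vec_eq_iff
  proof (intro allI)
    fix i j
    have "(adj V ** V) $ i $ j = herm (v j) (v i)"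
      by (simp add: matrix_matrix_mult_def adj_def V_def herm_def mult.commute)
    then show "(adj V ** V) $ i $ j = mat 1 $ i $ j" by (simp add: vv mat_def)
  qed
  then have V: "V \<in> unitary_group"
    unfolding unitary_group_def using matrix_left_right_inverse by blast
  have sp: "vec.subspace (L j)" if "j \<le> p" for j using B(2)[OF that] vec.subspace_span by metis
  have P: "proj (L j) = V ** coordinate_block \<beta> j ** adj V" if j: "j \<le> p" for j
  proof -
    note Q = orthonormal_projection[OF B(1)[OF j]]
    have "V ** coordinate_block \<beta> j ** adj V = (\<chi> a b. \<Sum>x\<in>B j. x $ a * cnj (x $ b))"
      unfolding vec_eq_iff
    proof (intro allI)
      fix a b
      have Vc: "(V ** coordinate_block \<beta> j) $ a $ i = (if \<beta> i = j then v i $ a else 0)" for i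
      proof -
        have "(V ** coordinate_block \<beta> j) $ a $ i = (\<Sum>l\<in>UNIV. if l = i then (if \<beta> i = j then v i $ a else 0) else 0)"
          unfolding matrix_matrix_mult_def coordinate_block_def V_def vec_lambda_beta by (rule sum.cong) auto
        then show ?thesis by simp
      qed
      have "(V ** coordinate_block \<beta> j ** adj V) $ a $ b = (\<Sum>i\<in>UNIV. if \<beta> i = j then v i $ a * cnj (v i $ b) else 0)"
        unfolding matrix_matrix_mult_def[of "V ** coordinate_block \<beta> j"] vec_lambda_beta
        by (rule sum.cong) (auto simp: Vc, auto simp: adj_def V_def)
      also have "\<dots> = (\<Sum>i | \<beta> i = j. v i $ a * cnj (v i $ b))"
        using sum.inter_filter[of "UNIV :: 'n set" "\<lambda>i. v i $ a * cnj (v i $ b)" "\<lambda>i. \<beta> i = j"] by simp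
      also have "\<dots> = (\<Sum>i | \<beta> i = j. h j i $ a * cnj (h j i $ b))"
        by (rule sum.cong) (auto simp: v_def)
      also have "\<dots> = (\<Sum>x\<in>B j. x $ a * cnj (x $ b))"
        by (rule sum.reindex_bij_betw[OF h[OF j]])
      finally show "(V ** coordinate_block \<beta> j ** adj V) $ a $ b = (\<chi> a b. \<Sum>x\<in>B j. x $ a * cnj (x $ b)) $ a $ b" by simp
    qed
    then show ?thesis using proj_eqI[OF Q(1)] Q(2) B(2)[OF j] by simp
  qed
  show ?thesis
    by (rule that[OF V P]) (use proj_works[OF sp] in auto)
qed

text \<open>All flags of one type are translates of the coordinate flag, so invariance reduces the
  metric everywhere to a single form on \<open>block_tangent\<close>, which is in turn invariant under the
  isotropy group. The tangent vectors considered are the real superhorizontal ones, with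
  components between neighbouring summands.\<close>

lemma invariant_metric_form:
  fixes g :: "(nat \<Rightarrow> (complex^'n) set) \<Rightarrow> complex^'n^'n \<Rightarrow> complex^'n^'n \<Rightarrow> real"
  assumes g: "invariant_flag_metric p k g" and ne: "flag_manifold p k \<noteq> ({} :: (nat \<Rightarrow> (complex^'n) set) set)"
    and kpos: "\<And>j. j \<le> p \<Longrightarrow> 0 < k j"
  shows "\<exists>\<mu>. (\<forall>l<p. 0 < \<mu> l) \<and> (\<forall>L\<in>flag_manifold p k. \<forall>\<xi>\<in>flag_tangent p L.
     (\<forall>i\<le>p. \<forall>j\<le>p. i \<noteq> Suc j \<longrightarrow> j \<noteq> Suc i \<longrightarrow> proj (L i) ** \<xi> ** proj (L j) = 0) \<longrightarrow>
     g L \<xi> \<xi> = (\<Sum>l<p. \<mu> l * (norm (proj (L (Suc l)) ** \<xi> ** proj (L l)))\<^sup>2))"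
proof -
  obtain L1 :: "nat \<Rightarrow> (complex^'n) set" where L1: "L1 \<in> flag_manifold p k" using ne by blast
  obtain \<beta> :: "'n \<Rightarrow> nat" where \<beta>: "\<And>i. \<beta> i \<le> p" "\<And>j. j \<le> p \<Longrightarrow> card {i. \<beta> i = j} = k j"
    using block_labelling_exists[OF L1] by metis
  obtain V1 where V1: "V1 \<in> unitary_group" "\<And>j. j \<le> p \<Longrightarrow> proj (L1 j) = V1 ** coordinate_block \<beta> j ** adj V1"
    "\<And>j. j \<le> p \<Longrightarrow> oproj (proj (L1 j))" "\<And>j. j \<le> p \<Longrightarrow> range ((*v) (proj (L1 j))) = L1 j"
    using adapted_frame[OF L1 \<beta>] by metis
  define G where "G X Y = g L1 (V1 ** X ** adj V1) (V1 ** Y ** adj V1)" for X Y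
  have conj0: "V1 ** X ** adj V1 = 0 \<longleftrightarrow> X = 0" for X
  proof
    assume "V1 ** X ** adj V1 = 0"
    then have "adj V1 ** (V1 ** X ** adj V1) ** V1 = 0" by simp
    then show "X = 0" by (simp add: mmult unitary_group_D[OF V1(1)])
  qed simp
  have tangent: "u ** X ** adj u \<in> flag_tangent p L"
    if u: "u \<in> unitary_group" and P: "\<And>j. j \<le> p \<Longrightarrow> proj (L j) = u ** coordinate_block \<beta> j ** adj u" and X: "X \<in> block_tangent \<beta>" for u X L
  proof -
    have "coordinate_block \<beta> j ** (X ** coordinate_block \<beta> j) = 0" for j
      using X coordinate_block_mult[of \<beta> j X j] by (simp add: vec_eq_iff block_tangent_def matrix_mul_assoc)
    then have "coordinate_block \<beta> j ** (X ** (coordinate_block \<beta> j ** Z)) = 0" for j and Z :: "complex^'n^'n"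
      by (metis matrix_mul_assoc times0_left)
    then have "proj (L j) ** (u ** X ** adj u) ** proj (L j) = 0" if "j \<le> p" for j
      unfolding P[OF that] by (simp add: mmult unitary_group_D[OF u])
    moreover have "adj (u ** X ** adj u) = - (u ** X ** adj u)"
      using X by (simp add: block_tangent_def adj_mult mmult)
    ultimately show ?thesis by (simp add: flag_tangent_def)
  qed
  note t1 = tangent[OF V1(1,2)]
  \<comment> \<open>The unitary matrices \<open>V1 w u\<^sup>*\<close>, with \<open>w\<close> block-diagonal, are those that move \<open>L\<close> to the base
    flag \<open>L1\<close>.\<close>
  have action: "flag_action p (V1 ** w ** adj u) L = L1"
    if u: "u \<in> unitary_group" and L: "L \<in> flag_manifold p k" and P: "\<And>j. j \<le> p \<Longrightarrow> proj (L j) = u ** coordinate_block \<beta> j ** adj u"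
      "\<And>j. j \<le> p \<Longrightarrow> range ((*v) (proj (L j))) = L j"
      and w: "w \<in> unitary_group" "w \<in> block_diagonal \<beta>" for u w L
  proof
    fix j
    show "flag_action p (V1 ** w ** adj u) L j = L1 j"
    proof (cases "j \<le> p")
      case False
      have "L1 j = undefined" using L1 False unfolding flag_manifold_def by (auto simp: PiE_iff extensional_def)
      then show ?thesis using False by (simp add: flag_action_def)
    next
      case True
      let ?C = "coordinate_block \<beta> j"
      have comm: "w ** ?C = ?C ** w"
      proof -
        have "(w ** ?C) $ a $ b = (?C ** w) $ a $ b" for a b
        proof -
          have "(w ** ?C) $ a $ b = (\<Sum>l\<in>UNIV. if l = b then (if \<beta> b = j then w $ a $ b else 0) else 0)"
            unfolding matrix_matrix_mult_def coordinate_block_def vec_lambda_beta by (rule sum.cong) auto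
          moreover have "(?C ** w) $ a $ b = (\<Sum>l\<in>UNIV. if l = a then (if \<beta> a = j then w $ a $ b else 0) else 0)"
            unfolding matrix_matrix_mult_def coordinate_block_def vec_lambda_beta by (rule sum.cong) auto
          ultimately show ?thesis using w(2) by (auto simp: block_diagonal_def)
        qed
        then show ?thesis by (simp add: vec_eq_iff)
      qed
      have r: "range ((*v) (A ** B)) = range ((*v) A)" if "B \<in> unitary_group" for A B :: "complex^'n^'n"
      proof
        show "range ((*v) (A ** B)) \<subseteq> range ((*v) A)" by (auto simp: matrix_vector_mul_assoc[symmetric])
        have "A *v x = (A ** B) *v (adj B *v x)" for x
          using unitary_group_D(1)[OF that] by (simp add: matrix_vector_mul_assoc matrix_mul_assoc[symmetric])
        then show "range ((*v) A) \<subseteq> range ((*v) (A ** B))" by blast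
      qed
      have ua: "adj u \<in> unitary_group" "adj V1 \<in> unitary_group" using u V1(1) by (auto simp: unitary_group_def)
      have "flag_action p (V1 ** w ** adj u) L j = (*v) (V1 ** w ** adj u) ` range ((*v) (proj (L j)))"
        using True P(2) by (simp add: flag_action_def)
      also have "\<dots> = range ((*v) (V1 ** w ** adj u ** (u ** ?C ** adj u)))"
        unfolding P(1)[OF True] by (simp add: image_image matrix_vector_mul_assoc)
      also have "V1 ** w ** adj u ** (u ** ?C ** adj u) = (V1 ** ?C) ** w ** adj u"
        by (simp add: mmult unitary_group_D[OF u] matrix_mult_ext[OF comm])
      also have "range ((*v) \<dots>) = range ((*v) (V1 ** ?C ** adj V1))"
        using r[OF ua(1)] r[OF w(1)] r[OF ua(2)] by simp
      also have "\<dots> = L1 j" using V1(2,4)[OF True] by simp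
      finally show ?thesis .
    qed
  qed
  have uni_mult: "a ** b \<in> unitary_group" if "a \<in> unitary_group" "b \<in> unitary_group" for a b :: "complex^'n^'n"
    using that by (simp add: unitary_group_def adj_mult mmult unitary_group_D[OF that(1)] unitary_group_D[OF that(2)])
  have uni_adj: "adj a \<in> unitary_group" if "a \<in> unitary_group" for a :: "complex^'n^'n"
    using that by (auto simp: unitary_group_def)
  have uni_1: "mat 1 \<in> unitary_group" "mat 1 \<in> block_diagonal \<beta>"
    by (simp add: unitary_group_def) (simp add: block_diagonal_def mat_def)
  have transfer: "g L (u ** X ** adj u) (u ** Y ** adj u) = G (w ** X ** adj w) (w ** Y ** adj w)"
    if u: "u \<in> unitary_group" and L: "L \<in> flag_manifold p k" and P: "\<And>j. j \<le> p \<Longrightarrow> proj (L j) = u ** coordinate_block \<beta> j ** adj u"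
      "\<And>j. j \<le> p \<Longrightarrow> range ((*v) (proj (L j))) = L j"
      and w: "w \<in> unitary_group" "w \<in> block_diagonal \<beta>" and XY: "X \<in> block_tangent \<beta>" "Y \<in> block_tangent \<beta>" for u w L X Y
  proof -
    let ?u = "V1 ** w ** adj u"
    have "g (flag_action p ?u L) (?u ** (u ** X ** adj u) ** adj ?u) (?u ** (u ** Y ** adj u) ** adj ?u) = g L (u ** X ** adj u) (u ** Y ** adj u)"
      using g L tangent[OF u P(1) XY(1)] tangent[OF u P(1) XY(2)] uni_mult[OF uni_mult[OF V1(1) w(1)] uni_adj[OF u]]
      unfolding invariant_flag_metric_def by blast
    moreover have "?u ** (u ** X ** adj u) ** adj ?u = V1 ** (w ** X ** adj w) ** adj V1" for X
      by (simp add: adj_mult mmult unitary_group_D[OF u])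
    moreover have "flag_action p ?u L = L1" by (rule action[OF u L P w])
    ultimately show ?thesis unfolding G_def by simp
  qed
  have gL1: "\<And>\<xi> \<eta>. \<xi> \<in> flag_tangent p L1 \<Longrightarrow> \<eta> \<in> flag_tangent p L1 \<Longrightarrow> g L1 \<xi> \<eta> = g L1 \<eta> \<xi>"
     "\<And>\<xi> \<eta> \<zeta> a b. \<xi> \<in> flag_tangent p L1 \<Longrightarrow> \<eta> \<in> flag_tangent p L1 \<Longrightarrow> \<zeta> \<in> flag_tangent p L1 \<Longrightarrow>
       g L1 (a *\<^sub>R \<xi> + b *\<^sub>R \<eta>) \<zeta> = a * g L1 \<xi> \<zeta> + b * g L1 \<eta> \<zeta>"
     "\<And>\<xi>. \<xi> \<in> flag_tangent p L1 \<Longrightarrow> \<xi> \<noteq> 0 \<Longrightarrow> 0 < g L1 \<xi> \<xi>"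
    using g L1 unfolding invariant_flag_metric_def by blast+
  have lin: "V1 ** (a *\<^sub>R X + b *\<^sub>R Y) ** adj V1 = a *\<^sub>R (V1 ** X ** adj V1) + b *\<^sub>R (V1 ** Y ** adj V1)" for a b X Y
  proof -
    have "a *\<^sub>R X = mat (complex_of_real a) ** X" for a and X :: "complex^'n^'n"
      by (simp add: mat_scalar vec_eq_iff) (simp add: scaleR_conv_of_real)
    then show ?thesis by (simp add: mmult) (simp add: matrix_mul_assoc mat_commute)
  qed
  have "\<exists>\<mu>. (\<forall>l<p. 0 < \<mu> l) \<and> (\<forall>X\<in>block_tangent \<beta>.
     (\<forall>a b. X $ a $ b \<noteq> 0 \<longrightarrow> \<beta> a = Suc (\<beta> b) \<or> \<beta> b = Suc (\<beta> a)) \<longrightarrow>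
     G X X = (\<Sum>l<p. \<mu> l * (\<Sum>a | \<beta> a = Suc l. \<Sum>b | \<beta> b = l. (cmod (X $ a $ b))\<^sup>2)))"
  proof (rule invariant_block_form[of \<beta> G p])
    show "G X Y = G Y X" if "X \<in> block_tangent \<beta>" "Y \<in> block_tangent \<beta>" for X Y
      unfolding G_def by (rule gL1(1)[OF t1[OF _ that(1)] t1[OF _ that(2)]])
    show "G (a *\<^sub>R X + b *\<^sub>R Y) Z = a * G X Z + b * G Y Z"
      if "X \<in> block_tangent \<beta>" "Y \<in> block_tangent \<beta>" "Z \<in> block_tangent \<beta>" for X Y Z a b
      unfolding G_def lin by (rule gL1(2)[OF t1[OF _ that(1)] t1[OF _ that(2)] t1[OF _ that(3)]])
    show "0 < G X X" if "X \<in> block_tangent \<beta>" "X \<noteq> 0" for X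
      unfolding G_def by (rule gL1(3)[OF t1[OF _ that(1)]]) (simp_all add: conj0 that)
    show "G (w ** X ** adj w) (w ** Y ** adj w) = G X Y"
      if "w \<in> unitary_group" "w \<in> block_diagonal \<beta>" "X \<in> block_tangent \<beta>" "Y \<in> block_tangent \<beta>" for w X Y
      using transfer[OF V1(1) L1 V1(2,4) that] unfolding G_def by simp
    show "\<exists>a. \<beta> a = l" if "l \<le> p" for l
    proof -
      have "card {i. \<beta> i = l} \<noteq> 0" using \<beta>(2)[OF that] kpos[OF that] by simp
      then show ?thesis by (auto simp: card_eq_0_iff)
    qed
  qed (rule \<beta>(1))
  then obtain \<mu> where \<mu>: "\<And>l. l < p \<Longrightarrow> 0 < \<mu> l" "\<And>X. X \<in> block_tangent \<beta> \<Longrightarrow>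
     (\<forall>a b. X $ a $ b \<noteq> 0 \<longrightarrow> \<beta> a = Suc (\<beta> b) \<or> \<beta> b = Suc (\<beta> a)) \<Longrightarrow>
     G X X = (\<Sum>l<p. \<mu> l * (\<Sum>a | \<beta> a = Suc l. \<Sum>b | \<beta> b = l. (cmod (X $ a $ b))\<^sup>2))" by blast
  have "g L \<xi> \<xi> = (\<Sum>l<p. \<mu> l * (norm (proj (L (Suc l)) ** \<xi> ** proj (L l)))\<^sup>2)"
    if L: "L \<in> flag_manifold p k" and \<xi>: "\<xi> \<in> flag_tangent p L"
      and supp: "\<forall>i\<le>p. \<forall>j\<le>p. i \<noteq> Suc j \<longrightarrow> j \<noteq> Suc i \<longrightarrow> proj (L i) ** \<xi> ** proj (L j) = 0" for L \<xi>
  proof -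
    obtain u where u: "u \<in> unitary_group" "\<And>j. j \<le> p \<Longrightarrow> proj (L j) = u ** coordinate_block \<beta> j ** adj u"
      "\<And>j. j \<le> p \<Longrightarrow> range ((*v) (proj (L j))) = L j"
      using adapted_frame[OF L \<beta>] by metis
    define X where "X = adj u ** \<xi> ** u"
    have \<xi>X: "\<xi> = u ** X ** adj u" by (simp add: X_def mmult unitary_group_D[OF u(1)])
    have blk: "proj (L i) ** \<xi> ** proj (L j) = u ** (coordinate_block \<beta> i ** X ** coordinate_block \<beta> j) ** adj u"
      if "i \<le> p" "j \<le> p" for i j
      unfolding u(2)[OF that(1)] u(2)[OF that(2)] \<xi>X by (simp add: mmult unitary_group_D[OF u(1)])
    have blk0: "coordinate_block \<beta> i ** X ** coordinate_block \<beta> j = 0"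
      if "i \<le> p" "j \<le> p" "proj (L i) ** \<xi> ** proj (L j) = 0" for i j
    proof -
      have "adj u ** (u ** (coordinate_block \<beta> i ** X ** coordinate_block \<beta> j) ** adj u) ** u = 0"
        using that(3) unfolding blk[OF that(1,2)] by simp
      then show ?thesis by (simp add: mmult unitary_group_D[OF u(1)])
    qed
    have entry: "X $ a $ b = 0" if "proj (L (\<beta> a)) ** \<xi> ** proj (L (\<beta> b)) = 0" for a b
      using coordinate_block_mult[of \<beta> "\<beta> a" X "\<beta> b" a b] blk0[OF \<beta>(1) \<beta>(1) that] by simp
    have XT: "X \<in> block_tangent \<beta>"
    proof -
      have "adj X = - X" using \<xi> by (simp add: X_def adj_mult flag_tangent_def mmult)
      moreover have "X $ a $ b = 0" if "\<beta> a = \<beta> b" for a b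
        using \<xi> \<beta>(1)[of a] that by (intro entry) (auto simp: flag_tangent_def)
      ultimately show ?thesis by (simp add: block_tangent_def)
    qed
    have "g L \<xi> \<xi> = G (mat 1 ** X ** adj (mat 1)) (mat 1 ** X ** adj (mat 1))"
      unfolding \<xi>X by (rule transfer[OF u(1) L u(2,3) uni_1 XT XT])
    also have "\<dots> = (\<Sum>l<p. \<mu> l * (\<Sum>a | \<beta> a = Suc l. \<Sum>b | \<beta> b = l. (cmod (X $ a $ b))\<^sup>2))"
    proof -
      have "\<forall>a b. X $ a $ b \<noteq> 0 \<longrightarrow> \<beta> a = Suc (\<beta> b) \<or> \<beta> b = Suc (\<beta> a)"
        using entry supp \<beta>(1) by blast
      from \<mu>(2)[OF XT this] show ?thesis by simp
    qed
    also have "\<dots> = (\<Sum>l<p. \<mu> l * (norm (proj (L (Suc l)) ** \<xi> ** proj (L l)))\<^sup>2)"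
    proof (rule sum.cong[OF refl])
      fix l assume l: "l \<in> {..<p}"
      have "(norm (proj (L (Suc l)) ** \<xi> ** proj (L l)))\<^sup>2 = (norm (coordinate_block \<beta> (Suc l) ** X ** coordinate_block \<beta> l))\<^sup>2"
        using l by (subst blk) (auto simp: norm_unitary_mult[OF u(1)])
      also have "\<dots> = (\<Sum>a\<in>UNIV. \<Sum>b\<in>UNIV. (cmod (if \<beta> a = Suc l \<and> \<beta> b = l then X $ a $ b else 0))\<^sup>2)"
        by (simp add: norm_vec_def L2_set_def sum_nonneg coordinate_block_mult)
      also have "\<dots> = (\<Sum>a | \<beta> a = Suc l. \<Sum>b | \<beta> b = l. (cmod (X $ a $ b))\<^sup>2)"
      proof -
        have "(\<Sum>b\<in>UNIV. (cmod (if \<beta> a = Suc l \<and> \<beta> b = l then X $ a $ b else 0))\<^sup>2) =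
          (if \<beta> a = Suc l then (\<Sum>b | \<beta> b = l. (cmod (X $ a $ b))\<^sup>2) else 0)" for a
          using sum.inter_filter[of UNIV "\<lambda>b. (cmod (X $ a $ b))\<^sup>2" "\<lambda>b. \<beta> b = l"]
          by (auto simp: if_distrib[of cmod] if_distrib[of "\<lambda>x. x\<^sup>2"] cong: if_cong)
        then show ?thesis
          using sum.inter_filter[of UNIV "\<lambda>a. \<Sum>b | \<beta> b = l. (cmod (X $ a $ b))\<^sup>2" "\<lambda>a. \<beta> a = Suc l"] by simp
      qed
      finally show "\<mu> l * (\<Sum>a | \<beta> a = Suc l. \<Sum>b | \<beta> b = l. (cmod (X $ a $ b))\<^sup>2) = \<mu> l * (norm (proj (L (Suc l)) ** \<xi> ** proj (L l)))\<^sup>2"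
        by simp
    qed
    finally show ?thesis .
  qed
  then show ?thesis using \<mu>(1) by blast
qed

section \<open>Holomorphic bundles and their overlaps\<close>

locale holomorphic_bundle =
  fixes R :: "complex \<Rightarrow> complex^'n^'n"
  assumes smooth: "msmooth R UNIV"
    and oproj: "oproj (R z)"
    and holomorphic: "Dm (-1) R z ** R z = 0"
begin

lemma idem: "R z ** R z = R z" and selfadj: "adj (R z) = R z"
  using oproj[of z] by (auto simp: oproj_def)

lemmas derivs = holomorphic_projection[OF smooth oproj holomorphic]

lemma md: "mdiff R z" "mdiff (Dm s R) z"
  using msmooth_mdiff[OF smooth] msmooth_mdiff[OF msmooth_Dm[OF open_UNIV smooth]] by auto

lemma trace_const: "trace (R z) = trace (R w)"
proof -
  have aD: "adj (Dm 1 R z) = Dm (-1) R z" for z using Dm_adj_self[OF smooth selfadj] by blast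
  have 1: "trace (Dm 1 R z) = 0" for z
    using trace_mul_sym[of "Dm 1 R z" "R z"] by (simp add: derivs)
  have 2: "trace (Dm (-1) R z) = 0" for z
    using trace_adj[of "Dm 1 R z"] 1[of z] by (simp add: aD)
  show ?thesis
    by (rule zero_derivative_constant[of UNIV "\<lambda>z. trace (R z)"])
      (use 1 2 in \<open>auto simp: wd_trace md intro!: smooth_on_differentiable[OF smooth_on_trace[OF open_UNIV smooth]]\<close>)
qed

text \<open>The restriction of \<open>R(z)\<close> to the range of \<open>R(a)\<close>, compressed to that range and extended by
  the identity. Its determinant is the product of the squared cosines of the principal angles
  between the fibres at \<open>a\<close> and \<open>z\<close>. Where it does not vanish, \<open>oblique a z\<close> is the projection
  onto the fibre at \<open>z\<close> along the orthogonal complement of the fibre at \<open>a\<close>.\<close>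

definition W :: "complex \<Rightarrow> complex \<Rightarrow> complex^'n^'n" where
  "W a z = mat 1 - R a + R a ** R z ** R a"

definition overlap :: "complex \<Rightarrow> complex \<Rightarrow> complex" where
  "overlap a z = det (W a z)"

definition oblique :: "complex \<Rightarrow> complex \<Rightarrow> complex^'n^'n" where
  "oblique a z = R z ** R a ** matrix_inv (W a z)"

definition transversal :: "complex \<Rightarrow> complex set" where
  "transversal a = {z. overlap a z \<noteq> 0}"

lemma smooth_W: "msmooth (W a) UNIV"
  unfolding W_def[abs_def] by (intro msmooth_add msmooth_mult msmooth_const smooth open_UNIV)

lemma smooth_overlap: "smooth_on (overlap a) UNIV"
  unfolding overlap_def[abs_def] by (intro smooth_on_det smooth_W open_UNIV)

lemma continuous_overlap: "continuous_on UNIV (overlap a)"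
  using smooth_on_continuous[OF smooth_overlap] .

lemma open_transversal: "open (transversal a)"
proof -
  have "transversal a = overlap a -` (- {0})" by (auto simp: transversal_def)
  moreover have "open (overlap a -` (- {0}))"
    by (rule open_vimage[OF _ continuous_overlap]) auto
  ultimately show ?thesis by simp
qed

lemma W_self: "W a a = mat 1"
  by (simp add: W_def mmult idem)

lemma overlap_self: "overlap a a = 1"
  by (simp add: overlap_def W_self)

lemma self_transversal: "a \<in> transversal a"
  by (simp add: transversal_def overlap_self)

lemma W_R: "W a z ** R a = R a ** W a z" "W a z ** (mat 1 - R a) = mat 1 - R a"
  by (simp_all add: W_def mmult idem matrix_mult_ext[OF idem])

lemma oblique_props:
  assumes z: "z \<in> transversal a"
  shows "R a ** oblique a z = R a" "oblique a z ** R a = oblique a z"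
    "R z ** oblique a z = oblique a z" "oblique a z ** R z = R z"
    "R a ** matrix_inv (W a z) = matrix_inv (W a z) ** R a"
proof -
  let ?Y = "matrix_inv (W a z)"
  have "det (W a z) \<noteq> 0" using z by (simp add: transversal_def overlap_def)
  note Y = matrix_inv_works[OF this]
  have comm: "R a ** ?Y = ?Y ** R a"
  proof -
    have "?Y ** (W a z ** R a) ** ?Y = ?Y ** (R a ** W a z) ** ?Y" by (simp add: W_R)
    then show ?thesis by (metis Y matrix_mul_assoc matrix_mul_lid matrix_mul_rid)
  qed
  then show "R a ** ?Y = ?Y ** R a" .
  have Yc: "(mat 1 - R a) ** ?Y = mat 1 - R a"
  proof -
    have "?Y ** (W a z ** (mat 1 - R a)) = mat 1 - R a" by (simp add: matrix_mul_assoc Y)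
    then have "?Y ** (mat 1 - R a) = mat 1 - R a" by (simp add: W_R)
    then show ?thesis by (simp add: mmult comm)
  qed
  show 1: "R a ** oblique a z = R a"
  proof -
    have "R a ** oblique a z = (W a z - (mat 1 - R a)) ** ?Y"
      by (simp add: oblique_def W_def matrix_mul_assoc)
    also have "\<dots> = R a" unfolding matrix_diff_rdistrib[of "W a z" "mat 1 - R a"] Y Yc by simp
    finally show ?thesis .
  qed
  show 2: "oblique a z ** R a = oblique a z"
    unfolding oblique_def using comm idem by (metis matrix_mul_assoc)
  show 3: "R z ** oblique a z = oblique a z"
    unfolding oblique_def by (simp add: matrix_mul_assoc idem)
  have 4: "oblique a z ** (R z ** R a) = R z ** R a"
  proof -
    have "oblique a z ** (R z ** R a) = (oblique a z ** R a) ** (R z ** R a)" unfolding 2 ..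
    also have "\<dots> = oblique a z ** (W a z - (mat 1 - R a))"
      by (simp add: W_def matrix_mul_assoc)
    also have "\<dots> = oblique a z ** W a z - (oblique a z - oblique a z ** R a)"
      by (simp add: matrix_diff_ldistrib)
    also have "\<dots> = oblique a z ** W a z" unfolding 2 by simp
    also have "\<dots> = R z ** R a" unfolding oblique_def by (simp add: matrix_mul_assoc[symmetric] Y)
    finally show ?thesis .
  qed
  \<comment> \<open>The rank of the bundle is constant, so transversality makes \<open>R(z)\<close> map the fibre at \<open>a\<close> onto
    the fibre at \<open>z\<close>.\<close>
  have "range ((*v) (R z ** R a)) = range ((*v) (R z))"
  proof (rule vec.subspace_dim_equal)
    show "vec.subspace (range ((*v) (R z ** R a)))" "vec.subspace (range ((*v) (R z)))"
      by (rule subspace_range)+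
    show sub: "range ((*v) (R z ** R a)) \<subseteq> range ((*v) (R z))"
      by (auto simp: matrix_vector_mul_assoc[symmetric])
    have "of_nat (vec.dim (range ((*v) (R z)))) = (of_nat (vec.dim (range ((*v) (R a)))) :: complex)"
      using oproj_trace_dim[OF oproj] trace_const by metis
    then have d: "vec.dim (range ((*v) (R z))) = vec.dim (range ((*v) (R a)))" by simp
    have "range ((*v) (R a)) = (*v) (R a) ` range ((*v) (oblique a z ** (R z ** R a)))"
    proof -
      have "R a ** (oblique a z ** (R z ** R a)) = W a z ** R a"
        by (simp only: 4) (simp add: W_def mmult idem)
      moreover have "range ((*v) (W a z ** R a)) = range ((*v) (R a ** W a z))" by (simp add: W_R)
      moreover have "range ((*v) (R a ** W a z)) = range ((*v) (R a))"
      proof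
        show "range ((*v) (R a ** W a z)) \<subseteq> range ((*v) (R a))"
          by (auto simp: matrix_vector_mul_assoc[symmetric])
        have "R a *v x = (R a ** W a z) *v (?Y *v x)" for x
          by (simp add: matrix_vector_mul_assoc matrix_mul_assoc[symmetric] Y)
        then show "range ((*v) (R a)) \<subseteq> range ((*v) (R a ** W a z))" by blast
      qed
      ultimately show ?thesis by (simp add: image_image matrix_vector_mul_assoc)
    qed
    then have "vec.dim (range ((*v) (R a))) \<le> vec.dim (range ((*v) (R z ** R a)))"
      unfolding 4 by (metis matrix_vector_mul_linear_gen vec.dim_image_le)
    then show "vec.dim (range ((*v) (R z))) \<le> vec.dim (range ((*v) (R z ** R a)))" using d by simp
  qed
  then have r: "range ((*v) (R z)) = range ((*v) (R z ** R a))" ..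
  have "(oblique a z - mat 1) ** R z = 0"
    by (rule range_mult_zero[OF r]) (simp add: matrix_diff_rdistrib 4)
  then show "oblique a z ** R z = R z" by (simp add: matrix_diff_rdistrib)
qed

lemma smooth_oblique: "msmooth (oblique a) (transversal a)"
  unfolding oblique_def[abs_def]
  by (intro msmooth_mult msmooth_inv open_transversal msmooth_const msmooth_subset[OF smooth] msmooth_subset[OF smooth_W])
    (auto simp: transversal_def overlap_def)

text \<open>The kernel of the oblique projection is constant and its range is a holomorphic bundle;
  unlike the orthogonal projection, it is therefore holomorphic in \<open>z\<close>.\<close>

lemma oblique_holomorphic:
  assumes z: "z \<in> transversal a"
  shows "Dm (-1) (oblique a) z = 0" "R a ** Dm s (oblique a) z = 0"
proof -
  note mo = msmooth_mdiff[OF smooth_oblique z]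
  have mc: "mdiff (\<lambda>z. R a) z" by (simp add: mdiff_def)
  have const: "R a ** Dm s (oblique a) z = 0" for s
  proof -
    have "Dm s (\<lambda>z. R a ** oblique a z) z = Dm s (\<lambda>z. R a) z"
      by (rule Dm_cong_open[OF open_transversal z]) (simp add: oblique_props)
    then show ?thesis using Dm_mult[OF mc mo, of s] by simp
  qed
  then show "R a ** Dm s (oblique a) z = 0" .
  let ?P = "oblique a z" and ?Pb = "Dm (-1) (oblique a) z"
  have Rb: "Dm (-1) R z ** ?P = 0"
    using oblique_props(3)[OF z] holomorphic[of z] by (metis matrix_mul_assoc times0_left)
  have "Dm (-1) (\<lambda>z. R z ** oblique a z) z = Dm (-1) (oblique a) z"
    by (rule Dm_cong_open[OF open_transversal z]) (simp add: oblique_props)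
  then have 1: "R z ** ?Pb = ?Pb" using Dm_mult[OF md(1) mo, of "-1"] Rb by simp
  have "?Pb = ?P ** (R z ** ?Pb)" using oblique_props(4)[OF z] 1 by (metis matrix_mul_assoc)
  also have "\<dots> = (?P ** R a) ** ?Pb" unfolding 1 oblique_props(2)[OF z] ..
  also have "\<dots> = 0" using const by (simp add: matrix_mul_assoc[symmetric])
  finally show "Dm (-1) (oblique a) z = 0" .
qed

text \<open>In the holomorphic frame provided by the oblique projection, the overlap is the inverse of a
  Gram determinant.\<close>

lemma overlap_gram:
  assumes z: "z \<in> transversal a"
  shows "W a z ** (mat 1 - R a + adj (oblique a z) ** oblique a z) = mat 1"
    "overlap a z * det (mat 1 - R a + adj (oblique a z) ** oblique a z) = 1"
    "mat 1 - R a + adj (oblique a z) ** oblique a z = mat 1 + adj (oblique a z - R a) ** (oblique a z - R a)"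
proof -
  let ?P = "oblique a z"
  note P = oblique_props[OF z]
  have aP: "adj ?P ** R a = R a" "R a ** adj ?P = adj ?P" "R z ** adj ?P = R z" "adj ?P ** R z = adj ?P"
    using P(1-4)[THEN arg_cong, of adj] by (simp_all add: adj_mult selfadj)
  have e: "R a ** (R z ** (adj ?P ** ?P)) = R a"
  proof -
    have "R a ** (R z ** (adj ?P ** ?P)) = R a ** (R z ** adj ?P) ** ?P"
      by (simp add: matrix_mul_assoc)
    also have "\<dots> = R a" unfolding aP by (metis P(1,3) matrix_mul_assoc)
    finally show ?thesis .
  qed
  show 1: "W a z ** (mat 1 - R a + adj ?P ** ?P) = mat 1"
  proof -
    have "W a z ** (adj ?P ** ?P) = R a"
      unfolding W_def by (simp add: mmult matrix_mult_ext[OF aP(2)] e)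
    then show ?thesis by (simp add: matrix_add_ldistrib W_R)
  qed
  show "overlap a z * det (mat 1 - R a + adj ?P ** ?P) = 1"
    unfolding overlap_def det_mul[symmetric] 1 by simp
  show "mat 1 - R a + adj ?P ** ?P = mat 1 + adj (?P - R a) ** (?P - R a)"
    by (simp add: adj_diff selfadj mmult aP P idem)
qed

text \<open>By \<open>overlap_gram\<close> the overlap is the inverse of a determinant \<open>det(1 + X\<^sup>*X)\<close>, which is at
  least \<open>1\<close>.\<close>

lemma overlap_real:
  obtains r where "overlap a z = of_real r" "0 \<le> r" "r \<le> 1" "z \<in> transversal a \<longleftrightarrow> 0 < r"
proof (cases "z \<in> transversal a")
  case False
  then show ?thesis using that[of 0] by (simp add: transversal_def)
next
  case True
  obtain r where r: "r \<ge> 1" "det (mat 1 - R a + adj (oblique a z) ** oblique a z) = of_real r"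
    using det_one_plus_gram_ge_1[of "oblique a z - R a"] overlap_gram(3)[OF True] by auto
  have "overlap a z * of_real r = 1" using overlap_gram(2)[OF True] r by simp
  then have "overlap a z = of_real (1 / r)" using r by (simp add: field_simps)
  then show ?thesis using that[of "1 / r"] r True by simp
qed

text \<open>This is \<open>- \<partial> log\<close> of the overlap; the formula makes the vanishing of its jet at \<open>a\<close> visible.\<close>

definition potential_form :: "complex \<Rightarrow> complex \<Rightarrow> complex" where
  "potential_form a z = trace (R z ** Dm 1 (oblique a) z)"

lemma potential_form_eq:
  assumes z: "z \<in> transversal a"
  shows "potential_form a z = - trace (Dm 1 R z ** oblique a z)"
proof -
  let ?U = "transversal a"
  note mo = msmooth_mdiff[OF smooth_oblique z]
  have "Dm 1 (\<lambda>z. R z ** oblique a z) z = Dm 1 (oblique a) z"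
    by (rule Dm_cong_open[OF open_transversal z]) (simp add: oblique_props)
  then have "R z ** Dm 1 (oblique a) z + Dm 1 R z ** oblique a z = Dm 1 (oblique a) z"
    using Dm_mult[OF md(1) mo, of 1] by simp
  moreover have "trace (Dm 1 (oblique a) z) = 0"
  proof -
    have "trace (oblique a w) = trace (R a)" if "w \<in> ?U" for w
      using trace_mul_sym[of "R a" "oblique a w"] by (simp add: oblique_props[OF that])
    then have "wd 1 (\<lambda>w. trace (oblique a w)) z = wd 1 (\<lambda>w. trace (R a)) z"
      by (intro wd_cong_open[OF open_transversal z]) auto
    then show ?thesis using wd_trace[OF mo, of 1] by simp
  qed
  ultimately show ?thesis
    unfolding potential_form_def by (metis trace_add add_eq_0_iff2)
qed

lemma wd_overlap:
  assumes z: "z \<in> transversal a"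
  shows "wd 1 (overlap a) z = - overlap a z * potential_form a z"
proof -
  let ?Y = "matrix_inv (W a z)"
  have mW: "mdiff (W a) z" using msmooth_mdiff[OF smooth_W] by blast
  have d: "det (W a z) \<noteq> 0" using z by (simp add: transversal_def overlap_def)
  have mc: "mdiff (\<lambda>z. A) z" for A :: "complex^'n^'n" by (simp add: mdiff_def)
  have mRR: "mdiff (\<lambda>z. R a ** R z) z" "mdiff (\<lambda>z. R a ** R z ** R a) z"
    by (rule msmooth_mdiff[of _ UNIV], intro msmooth_mult msmooth_const smooth open_UNIV, simp)+
  have DW: "Dm 1 (W a) z = R a ** Dm 1 R z ** R a"
    unfolding W_def[abs_def]
    using Dm_add[OF mc[of "mat 1 - R a"] mRR(2), of 1] Dm_mult[OF mRR(1) mc[of "R a"], of 1] Dm_mult[OF mc[of "R a"] md(1)[of z], of 1] by simp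
  have "wd 1 (overlap a) z = overlap a z * trace (?Y ** (R a ** Dm 1 R z ** R a))"
    using wd_det[OF mW d, of 1] unfolding overlap_def[abs_def] DW .
  also have "trace (?Y ** (R a ** Dm 1 R z ** R a)) = trace ((Dm 1 R z ** R a) ** (?Y ** R a))"
    using trace_mul_sym[of "?Y ** R a" "Dm 1 R z ** R a"] by (simp add: matrix_mul_assoc)
  also have "(Dm 1 R z ** R a) ** (?Y ** R a) = Dm 1 R z ** (R z ** R a ** ?Y) ** R a"
    by (simp add: matrix_mul_assoc derivs)
  also have "\<dots> = Dm 1 R z ** oblique a z"
    unfolding oblique_def[symmetric] by (simp add: matrix_mul_assoc[symmetric] oblique_props[OF z])
  finally show ?thesis by (simp add: potential_form_eq[OF z])
qed

text \<open>So the negative logarithm of the overlap is a potential of the density \<open>|\<partial>R|\<^sup>2\<close>. The oblique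
  projection being holomorphic, only \<open>\<partial>R\<close> is differentiated, and the structure equation applies.\<close>

lemma wd_potential_form:
  assumes z: "z \<in> transversal a"
  shows "wd (-1) (potential_form a) z = of_real ((norm (Dm 1 R z))\<^sup>2)"
proof -
  note mo = msmooth_mdiff[OF smooth_oblique z]
  note P = oblique_props[OF z]
  have smt: "msmooth (\<lambda>z. Dm 1 R z ** oblique a z) (transversal a)"
    by (intro msmooth_mult msmooth_subset[OF msmooth_Dm[OF open_UNIV smooth]] smooth_oblique open_transversal) auto
  have aD: "adj (Dm 1 R z) = Dm (-1) R z" using Dm_adj_self[OF smooth selfadj] by blast
  have "wd (-1) (potential_form a) z = wd (-1) (\<lambda>z. - trace (Dm 1 R z ** oblique a z)) z"
    by (rule wd_cong_open[OF open_transversal z]) (simp add: potential_form_eq)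
  also have "\<dots> = - trace (Dm (-1) (\<lambda>z. Dm 1 R z ** oblique a z) z)"
    using wd_minus[OF smooth_on_differentiable[OF smooth_on_trace[OF open_transversal smt] z], of "-1"]
      wd_trace[OF msmooth_mdiff[OF smt z], of "-1"] by simp
  also have "Dm (-1) (\<lambda>z. Dm 1 R z ** oblique a z) z = Dm (-1) (Dm 1 R) z ** oblique a z"
    using Dm_mult[OF md(2) mo, of "-1"] oblique_holomorphic(1)[OF z] by simp
  also have "\<dots> = Dm 1 R z ** (Dm (-1) R z ** oblique a z) - Dm (-1) R z ** Dm 1 R z ** oblique a z"
    unfolding derivs(4) by (simp add: matrix_diff_rdistrib matrix_mul_assoc)
  also have "Dm (-1) R z ** oblique a z = 0"
    using P(3) holomorphic[of z] by (metis matrix_mul_assoc times0_left)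
  also have "trace (Dm 1 R z ** 0 - Dm (-1) R z ** Dm 1 R z ** oblique a z) = - trace (oblique a z ** (Dm (-1) R z ** Dm 1 R z))"
    using trace_mul_sym[of "Dm (-1) R z ** Dm 1 R z" "oblique a z"] by (simp add: trace_minus)
  also have "oblique a z ** (Dm (-1) R z ** Dm 1 R z) = adj (Dm 1 R z) ** Dm 1 R z"
    unfolding aD using P(4) derivs(3)[of z] by (metis matrix_mul_assoc)
  finally show ?thesis by (simp add: trace_adj_mult_self)
qed

end

section \<open>Functions with vanishing holomorphic jet\<close>

lemma wd_power_cong:
  assumes "open U" "a \<in> U" "\<And>z. z \<in> U \<Longrightarrow> f z = g z"
  shows "(wd 1 ^^ k) f a = (wd 1 ^^ k) g a"
  using assms
proof (induction k arbitrary: f g)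
  case (Suc k)
  have "(wd 1 ^^ k) (wd 1 f) a = (wd 1 ^^ k) (wd 1 g) a"
    by (rule Suc.IH[OF Suc.prems(1,2)]) (use wd_cong_open[OF Suc.prems(1)] Suc.prems(3) in blast)
  then show ?case by (simp add: funpow_Suc_right del: funpow.simps)
qed simp

text \<open>Potentials of one density differ by the real part of a holomorphic function. Demanding that
  the \<open>z\<close>-derivative of a potential be flat at a point leaves only an additive constant.\<close>

definition flat_at :: "complex set \<Rightarrow> complex \<Rightarrow> (complex \<Rightarrow> complex) \<Rightarrow> bool" where
  "flat_at U a f \<longleftrightarrow> smooth_on f U \<and> (\<forall>k. (wd 1 ^^ k) f a = 0)"

lemma wd_power_add:
  assumes "open U" "a \<in> U" "smooth_on f U" "smooth_on g U"
  shows "(wd 1 ^^ k) (\<lambda>z. f z + g z) a = (wd 1 ^^ k) f a + (wd 1 ^^ k) g a"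
  using assms
proof (induction k arbitrary: f g)
  case (Suc k)
  have "(wd 1 ^^ k) (wd 1 (\<lambda>z. f z + g z)) a = (wd 1 ^^ k) (\<lambda>z. wd 1 f z + wd 1 g z) a"
    by (rule wd_power_cong[OF Suc.prems(1,2)])
      (use Suc.prems smooth_on_differentiable in \<open>auto intro!: wd_add\<close>)
  also have "\<dots> = (wd 1 ^^ k) (wd 1 f) a + (wd 1 ^^ k) (wd 1 g) a"
    by (rule Suc.IH) (use Suc.prems smooth_on_wd in auto)
  finally show ?case by (simp add: funpow_Suc_right del: funpow.simps)
qed simp

lemma wd_power_cmult:
  assumes "open U" "a \<in> U" "smooth_on f U"
  shows "(wd 1 ^^ k) (\<lambda>z. c * f z) a = c * (wd 1 ^^ k) f a"
  using assms
proof (induction k arbitrary: f)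
  case (Suc k)
  have "(wd 1 ^^ k) (wd 1 (\<lambda>z. c * f z)) a = (wd 1 ^^ k) (\<lambda>z. c * wd 1 f z) a"
    by (rule wd_power_cong[OF Suc.prems(1,2)])
      (use Suc.prems smooth_on_differentiable in \<open>auto intro!: wd_cmult\<close>)
  also have "\<dots> = c * (wd 1 ^^ k) (wd 1 f) a"
    by (rule Suc.IH) (use Suc.prems smooth_on_wd in auto)
  finally show ?case by (simp add: funpow_Suc_right del: funpow.simps)
qed simp

lemma flat_at_add: "open U \<Longrightarrow> a \<in> U \<Longrightarrow> flat_at U a f \<Longrightarrow> flat_at U a g \<Longrightarrow> flat_at U a (\<lambda>z. f z + g z)"
  unfolding flat_at_def using wd_power_add[of U a f g] smooth_on_add[of U f g] by simp

lemma flat_at_cmult: "open U \<Longrightarrow> a \<in> U \<Longrightarrow> flat_at U a f \<Longrightarrow> flat_at U a (\<lambda>z. c * f z)"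
  unfolding flat_at_def using wd_power_cmult[of U a f _ c] smooth_on_mult[OF _ smooth_on_const, of U f c] by simp

lemma flat_at_zero: "flat_at U a (\<lambda>z. 0)"
proof -
  have "(wd 1 ^^ k) (\<lambda>z. 0) = (\<lambda>z. 0)" for k by (induction k) auto
  then show ?thesis by (simp add: flat_at_def smooth_on_const)
qed

lemma flat_at_sum:
  "open U \<Longrightarrow> a \<in> U \<Longrightarrow> (\<And>i. i \<in> I \<Longrightarrow> flat_at U a (f i)) \<Longrightarrow> flat_at U a (\<lambda>z. \<Sum>i\<in>I. f i z)"
  by (induction I rule: infinite_finite_induct) (auto intro: flat_at_add flat_at_zero)

lemma flat_at_subset: "V \<subseteq> U \<Longrightarrow> flat_at U a f \<Longrightarrow> flat_at V a f"
  unfolding flat_at_def using smooth_on_subset by blast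

text \<open>The factor is annihilated by \<open>\<partial>\<close>, so it survives in every \<open>z\<close>-derivative.\<close>

lemma flat_at_antiholomorphic_factor:
  assumes "open U" "a \<in> U" "smooth_on g U"
  shows "flat_at U a (\<lambda>z. cnj (a - z) * g z)"
proof -
  have sc: "smooth_on (\<lambda>z. cnj (a - z)) U"
    by (intro smooth_on_cnj smooth_on_diff smooth_on_const smooth_on_ident assms)
  have "(wd 1 ^^ k) (\<lambda>z. cnj (a - z) * g z) a = 0" for k
    using assms(3)
  proof (induction k arbitrary: g)
    case (Suc k)
    have "(wd 1 ^^ k) (wd 1 (\<lambda>z. cnj (a - z) * g z)) a = (wd 1 ^^ k) (\<lambda>z. cnj (a - z) * wd 1 g z) a"
    proof (rule wd_power_cong[OF assms(1,2)])
      fix z assume z: "z \<in> U"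
      have d: "(\<lambda>z. a - z) differentiable (at z)" by simp
      have "wd (-1) (\<lambda>z. a - z) z = 0" using wd_diff[of "\<lambda>z. a" z "\<lambda>z. z" "-1"] wd_ident by simp
      then have "wd 1 (\<lambda>z. cnj (a - z)) z = 0" using wd_cnj[OF d, of 1] by simp
      then show "wd 1 (\<lambda>z. cnj (a - z) * g z) z = cnj (a - z) * wd 1 g z"
        using wd_mult[OF smooth_on_differentiable[OF sc z] smooth_on_differentiable[OF Suc.prems z], of 1] by simp
    qed
    also have "\<dots> = 0" by (rule Suc.IH) (rule smooth_on_wd[OF assms(1) Suc.prems])
    finally show ?case by (simp add: funpow_Suc_right del: funpow.simps)
  qed simp
  then show ?thesis unfolding flat_at_def using smooth_on_mult[OF assms(1) sc assms(3)] by blast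
qed

context holomorphic_bundle
begin

text \<open>Traces of this shape vanish at \<open>a\<close>, and their \<open>z\<close>-derivatives are sums of traces of the same
  shape because \<open>\<partial>R = \<partial>R R\<close> and \<open>R(a)\<close> is constant.\<close>

lemma flat_at_trace:
  assumes U: "open U" "a \<in> U" and "msmooth C U" "msmooth B U" "\<And>z. z \<in> U \<Longrightarrow> R a ** B z = 0"
  shows "flat_at U a (\<lambda>z. trace (C z ** R z ** B z))"
proof -
  have sR: "msmooth R U" using msmooth_subset[OF smooth] by blast
  have st: "smooth_on (\<lambda>z. trace (C z ** R z ** B z)) U" if "msmooth C U" "msmooth B U" for C B
    by (intro smooth_on_trace msmooth_mult that sR U)
  have "(wd 1 ^^ k) (\<lambda>z. trace (C z ** R z ** B z)) a = 0" for k
    using assms(3-5)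
  proof (induction k arbitrary: C B)
    case 0
    then show ?case using U by (simp add: matrix_mul_assoc[symmetric])
  next
    case (Suc k)
    note sC = msmooth_Dm[OF U(1) Suc.prems(1), of 1] and sB = msmooth_Dm[OF U(1) Suc.prems(2), of 1]
    have sCR: "msmooth (\<lambda>z. C z ** Dm 1 R z) U"
      by (intro msmooth_mult msmooth_Dm Suc.prems sR U)
    have B': "R a ** Dm 1 B z = 0" if z: "z \<in> U" for z
    proof -
      have "Dm 1 (\<lambda>z. R a ** B z) z = Dm 1 (\<lambda>z. 0) z"
        by (rule Dm_cong_open[OF U(1) z]) (use Suc.prems in auto)
      moreover have "mdiff (\<lambda>z. R a) z" by (simp add: mdiff_def)
      ultimately show ?thesis using Dm_mult[of "\<lambda>z. R a" z B 1] msmooth_mdiff[OF Suc.prems(2) z] by simp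
    qed
    have "(wd 1 ^^ k) (wd 1 (\<lambda>z. trace (C z ** R z ** B z))) a =
      (wd 1 ^^ k) (\<lambda>z. trace (C z ** R z ** Dm 1 B z) + (trace ((C z ** Dm 1 R z) ** R z ** B z) + trace (Dm 1 C z ** R z ** B z))) a"
    proof (rule wd_power_cong[OF U])
      fix z assume z: "z \<in> U"
      note mC = msmooth_mdiff[OF Suc.prems(1) z] and mB = msmooth_mdiff[OF Suc.prems(2) z]
      have mCR: "mdiff (\<lambda>z. C z ** R z) z" "mdiff (\<lambda>z. C z ** R z ** B z) z"
        by (rule msmooth_mdiff[OF _ z], intro msmooth_mult Suc.prems sR U)+
      have "C z ** Dm 1 R z = (C z ** Dm 1 R z) ** R z"
        by (simp add: matrix_mul_assoc[symmetric] derivs)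
      then show "wd 1 (\<lambda>z. trace (C z ** R z ** B z)) z =
         trace (C z ** R z ** Dm 1 B z) + (trace ((C z ** Dm 1 R z) ** R z ** B z) + trace (Dm 1 C z ** R z ** B z))"
        unfolding wd_trace[OF mCR(2)] Dm_mult[OF mCR(1) mB] Dm_mult[OF mC md(1)]
        by (simp add: trace_add matrix_add_rdistrib')
    qed
    also have "\<dots> = (wd 1 ^^ k) (\<lambda>z. trace (C z ** R z ** Dm 1 B z)) a +
       ((wd 1 ^^ k) (\<lambda>z. trace ((C z ** Dm 1 R z) ** R z ** B z)) a + (wd 1 ^^ k) (\<lambda>z. trace (Dm 1 C z ** R z ** B z)) a)"
      by (subst wd_power_add[OF U], (intro st smooth_on_add U Suc.prems sB sC sCR)+,
          subst wd_power_add[OF U], (intro st Suc.prems sC sCR)+, rule refl)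
    also have "\<dots> = 0"
      using Suc.IH[OF Suc.prems(1) sB B'] Suc.IH[OF sCR Suc.prems(2,3)] Suc.IH[OF sC Suc.prems(2,3)] by simp
    finally show ?case by (simp add: funpow_Suc_right del: funpow.simps)
  qed
  then show ?thesis unfolding flat_at_def using st[OF assms(3,4)] by blast
qed

lemma flat_at_potential_form: "flat_at (transversal a) a (potential_form a)"
proof -
  have "flat_at (transversal a) a (\<lambda>z. trace (mat 1 ** R z ** Dm 1 (oblique a) z))"
    by (rule flat_at_trace[OF open_transversal self_transversal msmooth_const
          msmooth_Dm[OF open_transversal smooth_oblique]]) (rule oblique_holomorphic(2))
  then show ?thesis by (simp add: potential_form_def[abs_def])
qed

end

lemma deriv_power_wd:
  assumes "open U" "a \<in> U" "f holomorphic_on U"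
  shows "(deriv ^^ k) f a = (wd 1 ^^ k) f a"
  using assms
proof (induction k arbitrary: f)
  case (Suc k)
  have "(deriv ^^ k) (deriv f) a = (wd 1 ^^ k) (deriv f) a"
    by (rule Suc.IH) (use Suc.prems holomorphic_deriv in auto)
  also have "\<dots> = (wd 1 ^^ k) (wd 1 f) a"
    by (rule wd_power_cong[OF Suc.prems(1,2)])
      (use Suc.prems wd_holomorphic(2) holomorphic_derivI in metis)
  finally show ?case by (simp add: funpow_Suc_right del: funpow.simps)
qed simp

text \<open>All Taylor coefficients at \<open>a\<close> vanish.\<close>

lemma flat_holomorphic_zero:
  assumes "open U" "connected U" "a \<in> U" "flat_at U a f" "\<And>z. z \<in> U \<Longrightarrow> wd (-1) f z = 0" "z \<in> U"
  shows "f z = 0"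
proof -
  have hol: "f holomorphic_on U"
    using assms(1,4,5) by (intro holomorphic_of_wd(1)) (auto simp: flat_at_def intro: smooth_on_differentiable)
  show ?thesis
    by (rule holomorphic_fun_eq_0_on_connected[OF hol assms(1,2) _ assms(3,6)])
      (use deriv_power_wd[OF assms(1,3) hol] assms(4) in \<open>simp add: flat_at_def\<close>)
qed

section \<open>Rigidity of curvature densities\<close>

lemma wd_ln:
  fixes g :: "complex \<Rightarrow> real"
  assumes "g differentiable (at z)" "g z > 0"
  shows "wd s (\<lambda>z. of_real (ln (g z))) z = wd s (\<lambda>z. of_real (g z)) z / of_real (g z)"
    "(\<lambda>z. complex_of_real (ln (g z))) differentiable (at z)"
proof -
  have d: "((\<lambda>z. ln (g z)) has_derivative (\<lambda>h. inverse (g z) * frechet_derivative g (at z) h)) (at z)"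
    using has_derivative_compose[OF has_derivative_frechet[OF assms(1)]
        DERIV_ln[OF assms(2), unfolded has_field_derivative_def]] .
  then have dl: "(\<lambda>z. ln (g z)) differentiable (at z)" by (auto simp: differentiable_def)
  have "pd a (\<lambda>z. complex_of_real (ln (g z))) z = of_real (pd a g z) / of_real (g z)" for a
    using pd_bounded_linear[OF bounded_linear_of_real[where ?'a = complex] dl, of a] pd_eq[OF d, of a] by (simp add: pd_def divide_inverse mult.commute)
  moreover have "pd a (\<lambda>z. complex_of_real (g z)) z = of_real (pd a g z)" for a
    using pd_bounded_linear[OF bounded_linear_of_real[where ?'a = complex] assms(1)] by simp
  ultimately show "wd s (\<lambda>z. of_real (ln (g z))) z = wd s (\<lambda>z. of_real (g z)) z / of_real (g z)"
    using assms(2) by (simp add: wd_def field_simps)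
  show "(\<lambda>z. complex_of_real (ln (g z))) differentiable (at z)"
    by (rule linear_differentiable[OF bounded_linear_of_real dl])
qed

text \<open>\<open>radial c e b\<close> is the function \<open>v\<close> of the metric \<open>|dz|\<^sup>2 / v\<^sup>2\<close>, and \<open>polar\<close> is its
  polarisation, holomorphic in \<open>z\<close> and antiholomorphic in \<open>a\<close>.\<close>

definition radial :: "real \<Rightarrow> complex \<Rightarrow> real \<Rightarrow> complex \<Rightarrow> real" where
  "radial c e b z = c * (cmod (z - e))\<^sup>2 + b"

definition polar :: "real \<Rightarrow> complex \<Rightarrow> real \<Rightarrow> complex \<Rightarrow> complex \<Rightarrow> complex" where
  "polar c e b a z = of_real c * (z - e) * cnj (a - e) + of_real b"

lemma radial_of_real: "complex_of_real (radial c e b z) = of_real c * ((z - e) * cnj (z - e)) + of_real b"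
  by (simp add: radial_def complex_norm_square del: of_real_power)

lemma polar_self: "polar c e b z z = of_real (radial c e b z)"
  by (simp add: radial_of_real polar_def mult.assoc)

lemma radial_pos: "c > 0 \<Longrightarrow> b > 0 \<Longrightarrow> radial c e b z > 0"
  by (simp add: radial_def add_nonneg_pos)

lemma smooth_polar: "smooth_on (polar c e b a) UNIV"
  unfolding polar_def[abs_def]
  by (intro smooth_on_add smooth_on_mult smooth_on_diff smooth_on_const smooth_on_ident open_UNIV)

lemma smooth_radial: "smooth_on (\<lambda>z. complex_of_real (radial c e b z)) UNIV" "smooth_on (radial c e b) UNIV"
proof -
  show 1: "smooth_on (\<lambda>z. complex_of_real (radial c e b z)) UNIV"
    unfolding radial_of_real
    by (intro smooth_on_add smooth_on_mult smooth_on_diff smooth_on_const smooth_on_ident smooth_on_cnj open_UNIV)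
  show "smooth_on (radial c e b) UNIV"
    using smooth_on_Re[OF open_UNIV 1] by simp
qed

lemma differentiable_polar: "polar c e b a differentiable (at z)"
  "(\<lambda>z. complex_of_real (radial c e b z)) differentiable (at z)" "radial c e b differentiable (at z)"
  using smooth_on_differentiable[OF smooth_polar] smooth_on_differentiable[OF smooth_radial(1)]
    smooth_on_differentiable[OF smooth_radial(2)] by blast+

lemma wd_polar: "wd 1 (polar c e b a) z = of_real c * cnj (a - e)" "wd (-1) (polar c e b a) z = 0"
proof -
  have "((polar c e b a) has_field_derivative of_real c * cnj (a - e)) (at z)"
    unfolding polar_def[abs_def] by (auto intro!: derivative_eq_intros)
  then show "wd 1 (polar c e b a) z = of_real c * cnj (a - e)" "wd (-1) (polar c e b a) z = 0"
    using wd_holomorphic by blast+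
qed

lemma wd_radial:
  "wd 1 (\<lambda>z. complex_of_real (radial c e b z)) z = of_real c * cnj (z - e)"
  "wd (-1) (\<lambda>z. complex_of_real (radial c e b z)) z = of_real c * (z - e)"
proof -
  have d: "(\<lambda>z. z - e) differentiable (at z)" "(\<lambda>z. cnj (z - e)) differentiable (at z)"
    by (simp, rule differentiable_cnj) simp
  have w: "wd s (\<lambda>z. z - e) z = (1 + s) / 2" for s
    using wd_diff[of "\<lambda>z. z" z "\<lambda>z. e" s] wd_ident by simp
  have wc: "wd s (\<lambda>z. cnj (z - e)) z = (1 - s) / 2" if "cnj s = s" for s
    using wd_cnj[OF d(1), of s] w that by simp
  have "wd s (\<lambda>z. complex_of_real (radial c e b z)) z =
     of_real c * ((z - e) * ((1 - s) / 2) + (1 + s) / 2 * cnj (z - e))" if "cnj s = s" for s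
    unfolding radial_of_real
    by (subst wd_add, (intro bilinear_differentiable[OF bounded_bilinear_mult] d differentiable_const)+,
        subst wd_cmult, (intro bilinear_differentiable[OF bounded_bilinear_mult] d)+,
        subst wd_mult[OF d]) (simp add: w wc[OF that] del: complex_cnj_diff)
  from this[of 1] this[of "-1"] show
    "wd 1 (\<lambda>z. complex_of_real (radial c e b z)) z = of_real c * cnj (z - e)"
    "wd (-1) (\<lambda>z. complex_of_real (radial c e b z)) z = of_real c * (z - e)" by auto
qed

text \<open>This is \<open>\<partial> log\<close> of \<open>|V(a, z)|\<^sup>2 / (v(a) v(z))\<close>, the counterpart of \<open>potential_form\<close> for the
  model. It is written so as to exhibit the factor that makes it flat at \<open>a\<close>.\<close>

definition model_form :: "real \<Rightarrow> complex \<Rightarrow> real \<Rightarrow> complex \<Rightarrow> complex \<Rightarrow> complex" where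
  "model_form c e b a z = cnj (a - z) * (of_real (c * b) * inverse (polar c e b a z * of_real (radial c e b z)))"

lemma model_form_eq:
  assumes "c > 0" "b > 0" "polar c e b a z \<noteq> 0"
  shows "model_form c e b a z = of_real c * cnj (a - e) / polar c e b a z - of_real c * cnj (z - e) / of_real (radial c e b z)"
proof -
  have r: "complex_of_real (radial c e b z) \<noteq> 0" using radial_pos[OF assms(1,2), of e z] by simp
  have "of_real c * cnj (a - e) * of_real (radial c e b z) - of_real c * cnj (z - e) * polar c e b a z =
     cnj (a - z) * of_real (c * b)"
    unfolding radial_of_real polar_def by (simp add: algebra_simps)
  then show ?thesis unfolding model_form_def using assms(3) r by (simp add: field_simps)
qed

lemma wd_model_form:
  assumes "c > 0" "b > 0" "polar c e b a z \<noteq> 0"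
  shows "wd (-1) (model_form c e b a) z = - of_real (c * b / (radial c e b z)\<^sup>2)"
proof -
  let ?V = "polar c e b a" and ?v = "\<lambda>z. complex_of_real (radial c e b z)"
  have r: "?v z \<noteq> 0" using radial_pos[OF assms(1,2), of e z] by simp
  have dVv: "(\<lambda>z. ?V z * ?v z) differentiable (at z)"
    by (intro bilinear_differentiable[OF bounded_bilinear_mult] differentiable_polar)
  have dI: "(\<lambda>z. inverse (?V z * ?v z)) differentiable (at z)"
    by (intro differentiable_inverse dVv) (use assms r in auto)
  have da: "(\<lambda>z. cnj (a - z)) differentiable (at z)" by (intro differentiable_cnj) auto
  have wa: "wd (-1) (\<lambda>z. cnj (a - z)) z = -1"
    using wd_cnj[of "\<lambda>z. a - z" z "-1"] wd_diff[of "\<lambda>z. a" z "\<lambda>z. z" 1] wd_ident by simp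
  have "wd (-1) (model_form c e b a) z =
    cnj (a - z) * (of_real (c * b) * (- (?V z * (of_real c * (z - e))) / (?V z * ?v z)\<^sup>2)) - of_real (c * b) * inverse (?V z * ?v z)"
    unfolding model_form_def[abs_def]
    by (subst wd_mult[OF da], (intro bilinear_differentiable[OF bounded_bilinear_mult] dI differentiable_const),
        subst wd_cmult[OF dI], subst wd_inverse[OF dVv], use assms r in simp,
        subst wd_mult[OF differentiable_polar(1,2)]) (simp add: wd_polar wd_radial wa del: complex_cnj_diff)
  also have "\<dots> = - of_real (c * b) * (?v z + of_real c * cnj (a - z) * (z - e)) / (?V z * (?v z)\<^sup>2)"
    using assms(3) r by (simp add: field_simps power2_eq_square)
  also have "?v z + of_real c * cnj (a - z) * (z - e) = ?V z"
    unfolding radial_of_real polar_def by (simp add: algebra_simps)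
  finally show ?thesis using assms(3) r by simp
qed

lemma polar_nonzero_set:
  assumes "c > 0" "b > 0"
  shows "open {z. polar c e b a z \<noteq> 0}" "connected {z. polar c e b a z \<noteq> 0}"
proof -
  have ct: "continuous_on UNIV (polar c e b a)" using smooth_on_continuous[OF smooth_polar] .
  have "{z. polar c e b a z \<noteq> 0} = polar c e b a -` (- {0})" by auto
  then show "open {z. polar c e b a z \<noteq> 0}" using open_vimage[OF _ ct, of "- {0}"] by auto
  show "connected {z. polar c e b a z \<noteq> 0}"
  proof (cases "a = e")
    case True
    then have "{z. polar c e b a z \<noteq> 0} = UNIV" using assms by (auto simp: polar_def)
    then show ?thesis using connected_UNIV by metis
  next
    case False
    define z0 where "z0 = e - of_real b / (of_real c * cnj (a - e))"
    have "polar c e b a z = 0 \<longleftrightarrow> z = z0" for z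
    proof -
      have n: "of_real c * cnj (a - e) \<noteq> 0" using False assms by simp
      have "polar c e b a z = of_real c * cnj (a - e) * (z - z0)"
        unfolding polar_def z0_def using n by (simp add: field_simps)
      then show ?thesis using n by simp
    qed
    then have "{z. polar c e b a z \<noteq> 0} = - {z0}" by auto
    then show ?thesis using connected_punctured_universe[of z0] by simp
  qed
qed

abbreviation "overlap_of \<equiv> holomorphic_bundle.overlap"
abbreviation "transversal_of \<equiv> holomorphic_bundle.transversal"

text \<open>The logarithmic derivatives of \<open>\<Prod>\<^sub>j D\<^sub>j^\<mu>\<^sub>j\<close> and of \<open>(|V|\<^sup>2 / (v v))^\<kappa>\<close>, \<open>\<kappa> = 1/(c b)\<close>, have
  the same conjugate derivative and are both flat at \<open>a\<close>, so they agree on the component \<open>U0\<close> of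
  \<open>a\<close> in the set where all the functions are nonzero, and so do the two real functions themselves.
  As each \<open>D\<^sub>j\<close> is at most \<open>1\<close>, the identity bounds each of them from below. By continuity the
  bound persists on the closure of \<open>U0\<close>, where it keeps the overlaps from vanishing; hence \<open>U0\<close> is
  closed in the connected set \<open>V \<noteq> 0\<close> and equals it.\<close>

lemma overlap_lower_bound:
  fixes R :: "nat \<Rightarrow> complex \<Rightarrow> complex^'n^'n"
  assumes R: "\<And>j. j < p \<Longrightarrow> holomorphic_bundle (R j)" and \<mu>: "\<And>j. j < p \<Longrightarrow> \<mu> j > 0"
    and cb: "c > 0" "b > 0"
    and density: "\<And>z. (\<Sum>j<p. \<mu> j * (norm (Dm 1 (R j) z))\<^sup>2) = 1 / (radial c e b z)\<^sup>2"
    and nz: "polar c e b a z \<noteq> 0"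
    and j: "j < p"
  shows "z \<in> transversal_of (R j) a"
    and "exp (1 / (c * b) / \<mu> j * (ln ((cmod (polar c e b a z))\<^sup>2) - ln (radial c e b z) - ln (radial c e b a)))
      \<le> Re (overlap_of (R j) a z)"
proof -
  let ?V = "polar c e b a" and ?v = "radial c e b"
  define \<kappa> where "\<kappa> = 1 / (c * b)"
  have \<kappa>: "\<kappa> > 0" "\<kappa> * (c * b) = 1" using cb by (auto simp: \<kappa>_def)
  have vpos: "?v z > 0" for z using radial_pos[OF cb] .
  define ol where "ol j z = overlap_of (R j) a z" for j z
  define lh where "lh z = ln ((cmod (?V z))\<^sup>2) - ln (?v z) - ln (?v a)" for z
  define S where "S = {z. ?V z \<noteq> 0}"
  define U where "U = S \<inter> (\<Inter>j\<in>{..<p}. transversal_of (R j) a)"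
  define U0 where "U0 = connected_component_set U a"
  have S: "open S" "connected S" unfolding S_def using polar_nonzero_set[OF cb] by auto
  have opU: "open U" unfolding U_def
    using S(1) holomorphic_bundle.open_transversal[OF R] by (intro open_Int open_INT) auto
  have aU: "a \<in> U" unfolding U_def S_def
    using holomorphic_bundle.self_transversal[OF R] vpos[of a] by (auto simp: polar_self)
  have U0: "open U0" "connected U0" "a \<in> U0" "U0 \<subseteq> U"
    unfolding U0_def using opU aU connected_component_subset
    by (auto intro: open_connected_component simp del: mem_Collect_eq)
  have U0S: "U0 \<subseteq> S" using U0(4) by (auto simp: U_def)
  have U0T: "z \<in> transversal_of (R j) a" if "z \<in> U0" "j < p" for z j using U0(4) that by (auto simp: U_def)
  have V0: "?V z \<noteq> 0" if "z \<in> U0" for z using U0S that by (auto simp: S_def)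
  have v0: "complex_of_real (?v z) \<noteq> 0" for z using vpos[of z] by simp
  define \<Omega> where "\<Omega> z = (\<Sum>j<p. of_real (\<mu> j) * holomorphic_bundle.potential_form (R j) a z) + of_real \<kappa> * model_form c e b a z" for z
  have flat1: "flat_at U0 a (holomorphic_bundle.potential_form (R j) a)" if "j < p" for j
    using flat_at_subset[OF _ holomorphic_bundle.flat_at_potential_form[OF R[OF that]]] U0T that by blast
  have smg: "smooth_on (\<lambda>z. of_real (c * b) * inverse (?V z * complex_of_real (?v z))) U0"
    by (intro smooth_on_mult smooth_on_inverse smooth_on_const smooth_on_subset[OF smooth_polar]
        smooth_on_subset[OF smooth_radial(1)] U0(1)) (use V0 v0 in auto)
  have flat2: "flat_at U0 a (model_form c e b a)"
    unfolding model_form_def[abs_def] by (rule flat_at_antiholomorphic_factor[OF U0(1,3) smg])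
  have flat: "flat_at U0 a \<Omega>"
    unfolding \<Omega>_def[abs_def]
    by (intro flat_at_add flat_at_sum flat_at_cmult U0(1,3) flat2 flat1) auto
  have dpf: "holomorphic_bundle.potential_form (R j) a differentiable (at z)" if "z \<in> U0" "j < p" for j z
    using flat1[OF that(2)] smooth_on_differentiable that unfolding flat_at_def by blast
  have dmf: "model_form c e b a differentiable (at z)" if "z \<in> U0" for z
    using flat2 smooth_on_differentiable that unfolding flat_at_def by blast
  have dcm: "(\<lambda>z. k * f z) differentiable (at z)" if "f differentiable (at z)" for k z and f :: "complex \<Rightarrow> complex"
    by (intro bilinear_differentiable[OF bounded_bilinear_mult] that differentiable_const)
  have "wd (-1) \<Omega> z = 0" if z: "z \<in> U0" for z
  proof -
    have "wd (-1) \<Omega> z = (\<Sum>j<p. of_real (\<mu> j) * wd (-1) (holomorphic_bundle.potential_form (R j) a) z) + of_real \<kappa> * wd (-1) (model_form c e b a) z"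
    proof -
      have d1: "(\<lambda>z. \<Sum>j<p. of_real (\<mu> j) * holomorphic_bundle.potential_form (R j) a z) differentiable (at z)"
        by (intro differentiable_sum dcm dpf[OF z] finite_lessThan ballI) simp
      show ?thesis
        unfolding \<Omega>_def[abs_def]
        by (subst wd_add[OF d1 dcm[OF dmf[OF z]]], subst wd_sum, (intro dcm dpf[OF z], simp),
            subst wd_cmult[OF dmf[OF z]]) (simp add: wd_cmult[OF dpf[OF z]])
    qed
    also have "\<dots> = (\<Sum>j<p. of_real (\<mu> j) * of_real ((norm (Dm 1 (R j) z))\<^sup>2)) - of_real \<kappa> * of_real (c * b / (?v z)\<^sup>2)"
      using holomorphic_bundle.wd_potential_form[OF R U0T[OF z]] wd_model_form[OF cb V0[OF z]] by simp
    also have "\<dots> = of_real ((\<Sum>j<p. \<mu> j * (norm (Dm 1 (R j) z))\<^sup>2) - (\<kappa> * (c * b)) / (?v z)\<^sup>2)"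
      by simp
    also have "\<dots> = 0" unfolding density \<kappa>(2) by simp
    finally show ?thesis .
  qed
  then have \<Omega>0: "\<Omega> z = 0" if "z \<in> U0" for z
    using flat_holomorphic_zero[OF U0(1-3) flat _ that] by blast
  have ov: "\<exists>r. ol j z = of_real r \<and> 0 \<le> r \<and> r \<le> 1 \<and> (z \<in> transversal_of (R j) a \<longleftrightarrow> 0 < r)" if "j < p" for j z
    using holomorphic_bundle.overlap_real[OF R[OF that], of a z] unfolding ol_def by metis
  have oRe: "ol j z = of_real (Re (ol j z))" "0 \<le> Re (ol j z)" "Re (ol j z) \<le> 1"
    "z \<in> transversal_of (R j) a \<longleftrightarrow> 0 < Re (ol j z)" if "j < p" for j z
    using ov[OF that, of z] by auto
  have sm_o: "smooth_on (ol j) UNIV" if "j < p" for j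
    using holomorphic_bundle.smooth_overlap[OF R[OF that]] unfolding ol_def .
  have dRe: "(\<lambda>z. Re (ol j z)) differentiable (at z)" if "j < p" for j z
    using smooth_on_differentiable[OF smooth_on_Re[OF open_UNIV sm_o[OF that]]] by blast
  \<comment> \<open>The difference of the logarithms; being real, it is constant as soon as its \<open>z\<close>-derivative
    vanishes.\<close>
  define L where "L z = (\<Sum>j<p. of_real (\<mu> j) * complex_of_real (ln (Re (ol j z)))) -
     of_real \<kappa> * (complex_of_real (ln ((cmod (?V z))\<^sup>2)) - of_real (ln (?v z)) - of_real (ln (?v a)))" for z
  have Lreal: "cnj (L z) = L z" for z by (simp add: L_def)
  have VV: "(\<lambda>z. complex_of_real ((cmod (?V z))\<^sup>2)) = (\<lambda>z. ?V z * cnj (?V z))"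
    by (simp add: complex_norm_square del: of_real_power)
  have smVV: "smooth_on (\<lambda>z. (cmod (?V z))\<^sup>2) UNIV"
  proof -
    have "smooth_on (\<lambda>z. complex_of_real ((cmod (?V z))\<^sup>2)) UNIV"
      unfolding VV by (intro smooth_on_mult smooth_on_cnj smooth_polar open_UNIV)
    then show ?thesis using smooth_on_Re[OF open_UNIV] by fastforce
  qed
  have dL: "L differentiable (at z) \<and> wd 1 L z = 0" if z: "z \<in> U0" for z
  proof -
    have opos: "Re (ol j z) > 0" if "j < p" for j using oRe(4)[OF that] U0T[OF z that] by blast
    have l1: "wd 1 (\<lambda>z. complex_of_real (ln (Re (ol j z)))) z = - holomorphic_bundle.potential_form (R j) a z"
      "(\<lambda>z. complex_of_real (ln (Re (ol j z)))) differentiable (at z)" if "j < p" for j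
    proof -
      have "wd 1 (\<lambda>z. complex_of_real (Re (ol j z))) z = wd 1 (ol j) z"
        by (rule wd_cong_open[OF open_UNIV UNIV_I]) (use oRe(1)[OF that] in simp)
      also have "\<dots> = - ol j z * holomorphic_bundle.potential_form (R j) a z"
        using holomorphic_bundle.wd_overlap[OF R[OF that] U0T[OF z that]] unfolding ol_def[abs_def] .
      finally show "wd 1 (\<lambda>z. complex_of_real (ln (Re (ol j z)))) z = - holomorphic_bundle.potential_form (R j) a z"
        unfolding wd_ln(1)[OF dRe[OF that] opos[OF that]] using oRe(1)[OF that, of z] opos[OF that] by (metis less_irrefl minus_mult_left nonzero_mult_div_cancel_left of_real_eq_0_iff minus_divide_left)
      show "(\<lambda>z. complex_of_real (ln (Re (ol j z)))) differentiable (at z)"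
        by (rule wd_ln(2)[OF dRe[OF that] opos[OF that]])
    qed
    have VVpos: "(cmod (?V z))\<^sup>2 > 0" using V0[OF z] by simp
    have dVV: "(\<lambda>z. (cmod (?V z))\<^sup>2) differentiable (at z)" using smooth_on_differentiable[OF smVV] by blast
    have l2: "wd 1 (\<lambda>z. complex_of_real (ln ((cmod (?V z))\<^sup>2))) z = of_real c * cnj (a - e) / ?V z"
      "(\<lambda>z. complex_of_real (ln ((cmod (?V z))\<^sup>2))) differentiable (at z)"
    proof -
      have "wd 1 (\<lambda>z. complex_of_real ((cmod (?V z))\<^sup>2)) z = of_real c * cnj (a - e) * cnj (?V z)"
        unfolding VV wd_mult[OF differentiable_polar(1) differentiable_cnj[OF differentiable_polar(1)]]
          wd_cnj[OF differentiable_polar(1)] by (simp add: wd_polar)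
      moreover have "complex_of_real ((cmod (?V z))\<^sup>2) = ?V z * cnj (?V z)" using fun_cong[OF VV] .
      ultimately show "wd 1 (\<lambda>z. complex_of_real (ln ((cmod (?V z))\<^sup>2))) z = of_real c * cnj (a - e) / ?V z"
        unfolding wd_ln(1)[OF dVV VVpos] using V0[OF z] by simp
      show "(\<lambda>z. complex_of_real (ln ((cmod (?V z))\<^sup>2))) differentiable (at z)"
        by (rule wd_ln(2)[OF dVV VVpos])
    qed
    have l3: "wd 1 (\<lambda>z. complex_of_real (ln (?v z))) z = of_real c * cnj (z - e) / of_real (?v z)"
      "(\<lambda>z. complex_of_real (ln (?v z))) differentiable (at z)"
      using wd_ln[OF differentiable_polar(3) vpos] wd_radial(1) by auto
    have d1: "(\<lambda>z. \<Sum>j<p. of_real (\<mu> j) * complex_of_real (ln (Re (ol j z)))) differentiable (at z)"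
      by (intro differentiable_sum dcm l1(2) finite_lessThan ballI) simp
    have d2: "(\<lambda>z. complex_of_real (ln ((cmod (?V z))\<^sup>2)) - of_real (ln (?v z)) - of_real (ln (?v a))) differentiable (at z)"
      by (intro differentiable_diff l2 l3 differentiable_const)
    have "wd 1 L z = (\<Sum>j<p. of_real (\<mu> j) * wd 1 (\<lambda>z. complex_of_real (ln (Re (ol j z)))) z) - of_real \<kappa> *
       (wd 1 (\<lambda>z. complex_of_real (ln ((cmod (?V z))\<^sup>2))) z - wd 1 (\<lambda>z. complex_of_real (ln (?v z))) z)"
      unfolding L_def[abs_def]
      by (subst wd_diff[OF d1 dcm[OF d2]], subst wd_cmult[OF d2], subst wd_sum, (intro dcm l1(2), simp),
          subst wd_diff[OF differentiable_diff[OF l2(2) l3(2)] differentiable_const], subst wd_diff[OF l2(2) l3(2)])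
        (simp add: wd_cmult[OF l1(2)])
    also have "\<dots> = - \<Omega> z"
      unfolding \<Omega>_def model_form_eq[OF cb V0[OF z]] l2 l3 by (simp add: l1 sum_negf)
    finally have "wd 1 L z = 0" using \<Omega>0[OF z] by simp
    moreover have "L differentiable (at z)"
      unfolding L_def[abs_def] by (rule differentiable_diff[OF d1 dcm[OF d2]])
    ultimately show ?thesis by simp
  qed
  have L0: "L z = 0" if z: "z \<in> U0" for z
  proof -
    have "L z = L a"
    proof (rule zero_derivative_constant[OF U0(1,2) _ _ _ z U0(3)])
      fix w assume w: "w \<in> U0"
      show "L differentiable (at w)" "wd 1 L w = 0" using dL[OF w] by auto
      have "wd (-1) (\<lambda>z. cnj (L z)) w = cnj (wd 1 L w)"
        using wd_cnj[of L w "-1"] dL[OF w] by simp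
      then show "wd (-1) L w = 0" using dL[OF w] by (simp add: Lreal)
    qed
    also have "L a = 0"
      unfolding L_def ol_def using holomorphic_bundle.overlap_self[OF R] vpos[of a]
      by (simp add: polar_self ln_realpow)
    finally show ?thesis .
  qed
  have id: "(\<Sum>j<p. \<mu> j * ln (Re (ol j z))) = \<kappa> * lh z" if "z \<in> U0" for z
  proof -
    have "complex_of_real ((\<Sum>j<p. \<mu> j * ln (Re (ol j z))) - \<kappa> * lh z) = L z"
      by (simp add: L_def lh_def)
    then have "(\<Sum>j<p. \<mu> j * ln (Re (ol j z))) - \<kappa> * lh z = 0" using L0[OF that] by (simp only: of_real_eq_0_iff)
    then show ?thesis by simp
  qed
  have lower: "Re (ol j z) \<ge> exp (\<kappa> / \<mu> j * lh z)" if z: "z \<in> U0" and j: "j < p" for z j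
  proof -
    have ln0: "\<mu> i * ln (Re (ol i z)) \<le> 0" if "i < p" for i
      using oRe(3,4)[OF that, of z] U0T[OF z that] \<mu>[OF that] by (intro mult_nonneg_nonpos) auto
    have "\<kappa> * lh z = \<mu> j * ln (Re (ol j z)) + (\<Sum>i\<in>{..<p} - {j}. \<mu> i * ln (Re (ol i z)))"
      unfolding id[OF z, symmetric] using j by (simp add: sum.remove)
    also have "\<dots> \<le> \<mu> j * ln (Re (ol j z)) + 0"
      by (intro add_left_mono sum_nonpos) (use ln0 in auto)
    finally have "\<kappa> / \<mu> j * lh z \<le> ln (Re (ol j z))" using \<mu>[OF j] by (simp add: field_simps)
    moreover have "Re (ol j z) > 0" using oRe(4)[OF j] U0T[OF z j] by blast
    ultimately show ?thesis by (simp add: ln_ge_iff)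
  qed
  have ctv: "isCont (\<lambda>z. (cmod (?V z))\<^sup>2) z" "isCont ?v z" for z
    using smooth_on_continuous[OF smVV] smooth_on_continuous[OF smooth_radial(2)]
    by (auto simp: continuous_on_eq_continuous_at)
  have ctlh: "isCont lh z" if "z \<in> S" for z
    unfolding lh_def[abs_def] using that vpos[of z] by (intro continuous_intros ctv) (auto simp: S_def)
  have closed: "z \<in> U0" if z: "z \<in> S" "z \<in> closure U0" for z
  proof -
    obtain x where x: "\<And>n. x n \<in> U0" "x \<longlonglongrightarrow> z" using z(2) closure_sequential by blast
    have "z \<in> transversal_of (R j) a" if j: "j < p" for j
    proof -
      have "isCont (\<lambda>z. Re (ol j z)) z"
        using smooth_on_continuous[OF smooth_on_Re[OF open_UNIV sm_o[OF j]]] by (auto simp: continuous_on_eq_continuous_at)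
      then have l1: "(\<lambda>n. Re (ol j (x n))) \<longlonglongrightarrow> Re (ol j z)"
        using x(2) isCont_tendsto_compose by blast
      have "isCont (\<lambda>z. exp (\<kappa> / \<mu> j * lh z)) z" by (intro continuous_intros ctlh z)
      then have l2: "(\<lambda>n. exp (\<kappa> / \<mu> j * lh (x n))) \<longlonglongrightarrow> exp (\<kappa> / \<mu> j * lh z)"
        using x(2) isCont_tendsto_compose by blast
      have "exp (\<kappa> / \<mu> j * lh z) \<le> Re (ol j z)"
        by (rule LIMSEQ_le[OF l2 l1]) (use lower[OF x(1) j] in blast)
      then show ?thesis using oRe(4)[OF j, of z] exp_gt_zero[of "\<kappa> / \<mu> j * lh z"] by linarith
    qed
    then have zU: "z \<in> U" using z(1) by (auto simp: U_def)
    have "closedin (top_of_set U) U0" unfolding U0_def by (rule closedin_connected_component)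
    then obtain T where T: "closed T" "U0 = U \<inter> T" by (auto simp: closedin_closed)
    then have "closure U0 \<subseteq> T" by (intro closure_minimal) auto
    then show ?thesis using T zU z(2) by blast
  qed
  have "U0 = S"
  proof -
    have "openin (top_of_set S) U0" using U0(1) U0S by (simp add: openin_open_eq S(1))
    moreover have "closedin (top_of_set S) U0"
      unfolding closedin_closed using closed U0S closure_subset[of U0] by (intro exI[of _ "closure U0"]) auto
    ultimately show ?thesis using S(2) U0(3) unfolding connected_clopen by blast
  qed
  then have z: "z \<in> U0" using nz by (simp add: S_def)
  show "z \<in> transversal_of (R j) a" using U0T[OF z j] .
  show "exp (1 / (c * b) / \<mu> j * (ln ((cmod (polar c e b a z))\<^sup>2) - ln (radial c e b z) - ln (radial c e b a)))
      \<le> Re (overlap_of (R j) a z)"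
    using lower[OF z j] unfolding ol_def lh_def \<kappa>_def .
qed


context holomorphic_bundle
begin

text \<open>The Hermitian product of the holomorphic Pluecker vectors at \<open>z\<close> and \<open>w\<close>, normalised by
  having product \<open>1\<close> with the one at \<open>e\<close>.\<close>

definition polarized_gram :: "complex \<Rightarrow> complex \<Rightarrow> complex \<Rightarrow> complex" where
  "polarized_gram e w z = det (mat 1 - R e + adj (oblique e w) ** oblique e z)"

lemma polarized_gram_swap: "polarized_gram e z w = cnj (polarized_gram e w z)"
proof -
  have "mat 1 - R e + adj (oblique e z) ** oblique e w = adj (mat 1 - R e + adj (oblique e w) ** oblique e z)"
    by (simp add: adj_add adj_diff adj_mult selfadj)
  then show ?thesis unfolding polarized_gram_def by (metis det_adj)
qed

text \<open>The overlap is the squared modulus of the normalised Hermitian product of Pluecker vectors.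
  The proof expresses both projections by the oblique ones, moves a factor around the determinant
  by \<open>det_one_minus_swap\<close>, and recognises a product of two determinants.\<close>

lemma overlap_polarized:
  assumes z: "z \<in> transversal e" and w: "w \<in> transversal e"
  shows "overlap w z * polarized_gram e z z * polarized_gram e w w =
    polarized_gram e w z * cnj (polarized_gram e w z)"
proof -
  let ?E = "R e" and ?P = "oblique e z" and ?S = "oblique e w" and ?A = "W e z" and ?B = "W e w"
  note P = oblique_props[OF z] and S = oblique_props[OF w]
  have aP: "?E ** adj ?P = adj ?P" "R z ** adj ?P = R z"
    using P(2,4)[THEN arg_cong, of adj] by (simp_all add: adj_mult selfadj)
  have aS: "?E ** adj ?S = adj ?S" "R w ** adj ?S = R w"
    using S(2,4)[THEN arg_cong, of adj] by (simp_all add: adj_mult selfadj)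
  have dz: "det ?A \<noteq> 0" "det ?B \<noteq> 0" using z w by (auto simp: transversal_def overlap_def)
  have rep: "R z = oblique e z ** W e z ** adj (oblique e z)" if z: "z \<in> transversal e" for z
  proof -
    have d: "det (W e z) \<noteq> 0" using z by (auto simp: transversal_def overlap_def)
    have aP: "?E ** adj (oblique e z) = adj (oblique e z)" "R z ** adj (oblique e z) = R z"
      using oblique_props(2,4)[OF z, THEN arg_cong, of adj] by (simp_all add: adj_mult selfadj)
    have "oblique e z ** W e z = R z ** ?E"
      unfolding oblique_def by (simp add: matrix_mul_assoc[symmetric] matrix_inv_works[OF d])
    then have "oblique e z ** W e z ** adj (oblique e z) = R z ** (?E ** adj (oblique e z))"
      by (simp add: matrix_mul_assoc)
    then show ?thesis by (simp add: aP)
  qed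
  have cW: "(mat 1 - ?E) ** W e x = mat 1 - ?E" for x
    using W_R(2)[of e x] W_R(1)[of e x] by (simp add: mmult)
  have SSB: "adj ?S ** (?S ** ?B) = ?E"
  proof -
    have "(mat 1 - ?E + adj ?S ** ?S) ** ?B = mat 1"
      using overlap_gram(1)[OF w] matrix_left_right_inverse by blast
    then have "(mat 1 - ?E) ** ?B + adj ?S ** (?S ** ?B) = mat 1"
      by (simp add: matrix_add_rdistrib' matrix_mul_assoc)
    then show ?thesis by (simp add: cW algebra_simps)
  qed
  have Wwz: "W w z = mat 1 - (?S ** ?B) ** (adj ?S ** (mat 1 - R z) ** R w)"
  proof -
    have "(?S ** ?B) ** (adj ?S ** (mat 1 - R z) ** R w) = (?S ** ?B ** adj ?S) ** (mat 1 - R z) ** R w"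
      by (simp add: matrix_mul_assoc)
    also have "\<dots> = R w ** (mat 1 - R z) ** R w" unfolding rep[OF w, symmetric] ..
    finally show ?thesis by (simp add: W_def mmult idem)
  qed
  have "overlap w z = det (mat 1 - (adj ?S ** (mat 1 - R z) ** R w) ** (?S ** ?B))"
    unfolding overlap_def Wwz by (rule det_one_minus_swap)
  also have "(adj ?S ** (mat 1 - R z) ** R w) ** (?S ** ?B) = adj ?S ** ((mat 1 - R z) ** (?S ** ?B))"
    using S(3) by (metis matrix_mul_assoc)
  also have "\<dots> = ?E - adj ?S ** (?P ** (?A ** (adj ?P ** (?S ** ?B))))"
    unfolding matrix_diff_rdistrib matrix_diff_ldistrib matrix_mul_lid SSB
    by (subst rep[OF z]) (simp add: matrix_mul_assoc)
  also have "mat 1 - \<dots> = ((mat 1 - ?E + adj ?S ** ?P) ** ?A) ** ((mat 1 - ?E + adj ?P ** ?S) ** ?B)"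
  proof -
    have 1: "(mat 1 - ?E + adj ?S ** ?P) ** ?A = (mat 1 - ?E) + adj ?S ** (?P ** ?A)"
      by (simp add: matrix_add_rdistrib' cW matrix_mul_assoc)
    have 2: "(mat 1 - ?E + adj ?P ** ?S) ** ?B = (mat 1 - ?E) + adj ?P ** (?S ** ?B)"
      by (simp add: matrix_add_rdistrib' cW matrix_mul_assoc)
    have 3: "(mat 1 - ?E) ** (adj ?P ** X) = 0" for X :: "complex^'n^'n"
      by (simp add: matrix_mul_assoc matrix_diff_rdistrib aP)
    have 4: "?P ** (?A ** (mat 1 - ?E)) = 0"
      unfolding W_R(2) by (simp add: matrix_diff_ldistrib P)
    have 5: "(mat 1 - ?E) ** (mat 1 - ?E) = mat 1 - ?E" by (simp add: mmult idem)
    have "((mat 1 - ?E) + adj ?S ** (?P ** ?A)) ** ((mat 1 - ?E) + adj ?P ** (?S ** ?B)) =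
       (mat 1 - ?E) ** (mat 1 - ?E) + (mat 1 - ?E) ** (adj ?P ** (?S ** ?B)) +
       (adj ?S ** (?P ** (?A ** (mat 1 - ?E))) + adj ?S ** (?P ** (?A ** (adj ?P ** (?S ** ?B)))))"
      unfolding matrix_add_rdistrib' matrix_add_ldistrib by (simp only: matrix_mul_assoc add_ac)
    then show ?thesis unfolding 1 2 3 4 5 by simp
  qed
  finally have ov: "overlap w z = polarized_gram e w z * overlap e z * (polarized_gram e z w * overlap e w)"
    unfolding polarized_gram_def overlap_def det_mul .
  have n: "overlap e z * polarized_gram e z z = 1" "overlap e w * polarized_gram e w w = 1"
    using overlap_gram(2)[OF z] overlap_gram(2)[OF w] by (auto simp: polarized_gram_def)
  have "overlap w z * polarized_gram e z z * polarized_gram e w w =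
     polarized_gram e w z * polarized_gram e z w * (overlap e z * polarized_gram e z z) * (overlap e w * polarized_gram e w w)"
    unfolding ov by (simp add: mult_ac)
  then show ?thesis unfolding n polarized_gram_swap[of e z w] by simp
qed

lemma polarized_gram_holomorphic:
  assumes "transversal e = UNIV"
  shows "polarized_gram e w holomorphic_on UNIV"
proof -
  have "(\<lambda>z. oblique e z $ i $ j) holomorphic_on UNIV" for i j
  proof (rule holomorphic_of_wd(1))
    fix z
    show "(\<lambda>z. oblique e z $ i $ j) differentiable (at z)"
      using msmooth_mdiff[OF smooth_oblique, of z e] assms by (auto simp: mdiff_def)
    show "wd (-1) (\<lambda>z. oblique e z $ i $ j) z = 0"
      using oblique_holomorphic(1)[of z e] assms by (auto simp: Dm_def vec_eq_iff)
  qed simp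
  then show ?thesis
    unfolding polarized_gram_def[abs_def] det_def matrix_matrix_mult_def adj_def
    by (auto intro!: holomorphic_intros)
qed

end

lemma polynomial_single_root:
  fixes f :: "complex \<Rightarrow> complex"
  assumes "\<And>z. f z = (\<Sum>k\<le>N. a k * z ^ k)" "f e = 1" "\<And>z. f z = 0 \<Longrightarrow> z = r" "r \<noteq> e"
  shows "\<exists>d. \<forall>z. f z = ((z - r) / (e - r)) ^ d"
proof -
  define q where "q = (\<Sum>k\<le>N. monom (a k) k)"
  have pq: "poly q z = f z" for z by (simp add: q_def poly_sum poly_monom assms(1))
  have "q \<noteq> 0" using pq[of e] assms(2) by auto
  then obtain s where s: "q = [:- r, 1:] ^ order r q * s" "\<not> [:- r, 1:] dvd s"
    using order_decomp by blast
  have nz: "poly s z \<noteq> 0" for z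
  proof
    assume z: "poly s z = 0"
    then have "poly q z = 0" by (subst s(1)) simp
    then have "z = r" using assms(3) pq by auto
    then show False using z s(2) poly_eq_0_iff_dvd by blast
  qed
  have "degree s = 0"
  proof (rule ccontr)
    assume deg: "degree s \<noteq> 0"
    then have "coeff s (degree s) \<noteq> 0" by (metis degree_0 leading_coeff_0_iff)
    then have "coeff s 0 = 0 \<or> (\<exists>i\<in>{1..degree s}. coeff s i \<noteq> 0)" using deg by (intro disjI2 bexI[of _ "degree s"]) auto
    from fundamental_theorem_of_algebra[OF this] obtain z where "(\<Sum>i\<le>degree s. coeff s i * z ^ i) = 0" .
    then show False using nz[of z] by (simp add: poly_altdef)
  qed
  then obtain k where "s = [:k:]" using degree_eq_zeroE by blast
  then have k: "poly s z = k" for z by simp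
  have f: "f z = (z - r) ^ order r q * k" for z
    using pq[of z] by (subst (asm) s(1)) (simp add: k)
  then have "k = 1 / (e - r) ^ order r q" using assms(2,4) f[of e] by (simp add: field_simps)
  then show ?thesis using f by (auto simp: power_divide)
qed

text \<open>Based at the centre \<open>e\<close>, the oblique projection is defined on the whole plane, so \<open>q\<^sub>w =
  polarized_gram e w\<close> is entire. By \<open>overlap_polarized\<close> and \<open>D \<le> 1\<close> one has \<open>|q\<^sub>w(z)|\<^sup>2 \<le> \<rho>(z)
  \<rho>(w)\<close>, where \<open>\<rho>(z) = q\<^sub>z(z) = 1/D(e, z)\<close> grows polynomially by the lower bound; hence \<open>q\<^sub>w\<close> is a
  polynomial. Its zeros are zeros of \<open>V(w, \<cdot>)\<close>, so it is the power of \<open>V(w, \<cdot>)/b\<close> with some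
  exponent \<open>d(w)\<close>, and \<open>\<rho>(w) = (v(w)/b)^d(w)\<close>. Continuity makes the integer \<open>d(w)\<close> constant, and
  differentiating \<open>log D(e, \<cdot>)\<close> gives the density.\<close>

lemma rigidity_single:
  fixes R :: "complex \<Rightarrow> complex^'n^'n"
  assumes R: "holomorphic_bundle R" and cb: "c > 0" "b > 0"
    and trans: "\<And>a z. polar c e b a z \<noteq> 0 \<Longrightarrow> z \<in> transversal_of R a"
    and lower: "\<And>z. Re (overlap_of R e z) \<ge> (b / radial c e b z) ^ N"
  shows "\<exists>\<delta>\<ge>0. \<forall>z. (norm (Dm 1 R z))\<^sup>2 = \<delta> / (radial c e b z)\<^sup>2"
proof -
  interpret holomorphic_bundle R by (rule R)
  let ?v = "radial c e b"
  have vpos: "?v z > 0" for z using radial_pos[OF cb] .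
  have vb: "?v z \<ge> b" for z using cb by (simp add: radial_def)
  have tU: "transversal e = UNIV" using trans[of e] cb by (auto simp: polar_def)
  define q where "q = polarized_gram e"
  have oq: "overlap e z * q z z = 1" for z
    using overlap_gram(2)[of z e] tU by (simp add: q_def polarized_gram_def)
  have Q: "\<exists>r\<ge>1. q z z = of_real r \<and> r \<le> (?v z / b) ^ N" for z
  proof -
    obtain r where r: "overlap e z = of_real r" "0 \<le> r" "r \<le> 1" using overlap_real by metis
    have "r > 0" using oq[of z] r by (cases "r = 0") auto
    have "q z z = of_real (1 / r)" using oq[of z] r \<open>r > 0\<close> by (simp add: field_simps)
    moreover have "1 / r \<le> (?v z / b) ^ N"
    proof -
      have l: "(b / ?v z) ^ N \<le> r" using lower[of z] r by simp
      have "1 / r \<le> 1 / (b / ?v z) ^ N"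
        using l cb vpos[of z] by (intro divide_left_mono) (auto intro!: mult_pos_pos \<open>r > 0\<close>)
      then show ?thesis by (simp add: power_divide)
    qed
    ultimately show ?thesis using r \<open>r > 0\<close> by (intro exI[of _ "1 / r"]) auto
  qed
  define \<rho> where "\<rho> z = Re (q z z)" for z
  have \<rho>: "q z z = of_real (\<rho> z)" "\<rho> z \<ge> 1" "\<rho> z \<le> (?v z / b) ^ N" for z
    using Q[of z] by (auto simp: \<rho>_def)
  have main: "overlap w z * q z z * q w w = q w z * cnj (q w z)" for w z
    using overlap_polarized[of z e w] tU by (simp add: q_def)
  have bound: "(cmod (q w z))\<^sup>2 \<le> \<rho> z * \<rho> w" for w z
  proof -
    obtain r where r: "overlap w z = of_real r" "0 \<le> r" "r \<le> 1" using overlap_real by metis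
    have "complex_of_real ((cmod (q w z))\<^sup>2) = of_real (r * \<rho> z * \<rho> w)"
      using main[of w z] unfolding complex_norm_square r \<rho>(1) by simp
    then have "(cmod (q w z))\<^sup>2 = r * (\<rho> z * \<rho> w)" by (simp only: of_real_eq_iff mult.assoc)
    also have "\<dots> \<le> 1 * (\<rho> z * \<rho> w)"
      using r \<rho>(2)[of z] \<rho>(2)[of w] by (intro mult_right_mono mult_nonneg_nonneg) auto
    finally show ?thesis by simp
  qed
  have root: "polar c e b w z = 0" if "q w z = 0" for w z
  proof -
    have "overlap w z * of_real (\<rho> z) * of_real (\<rho> w) = 0" using main[of w z] that unfolding \<rho>(1) by simp
    then have "overlap w z = 0" using \<rho>(2)[of z] \<rho>(2)[of w] by auto
    then show ?thesis using trans[of w z] by (auto simp: transversal_def)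
  qed
  have hol: "q w holomorphic_on UNIV" for w unfolding q_def by (rule polarized_gram_holomorphic[OF tU])
  have qe: "q w e = 1" for w
  proof -
    have Pe: "oblique e e = R e" using matrix_inv_unique'[of "mat 1 :: complex^'n^'n" "mat 1"]
      by (simp add: oblique_def W_self idem)
    have "adj (oblique e w) ** R e = adj (R e ** oblique e w)" by (simp add: adj_mult selfadj)
    also have "\<dots> = R e" using oblique_props(1)[of w e] tU by (simp add: selfadj)
    finally show ?thesis by (simp add: q_def polarized_gram_def Pe)
  qed
  \<comment> \<open>The crude exponent \<open>2 N\<close> suffices for Liouville's theorem, and squares of both sides are
    compared.\<close>
  have growth: "\<exists>B. \<forall>z. 1 \<le> norm z \<longrightarrow> norm (q w z) \<le> B * norm z ^ (2 * N)" for w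
  proof -
    define C where "C = (c * (1 + cmod e)\<^sup>2 + b) / b"
    have C1: "C \<ge> 1" using cb by (simp add: C_def field_simps)
    have "norm (q w z) \<le> (C ^ N * (\<rho> w + 1)) * norm z ^ (2 * N)" if z: "1 \<le> norm z" for z
    proof -
      have "cmod (z - e) \<le> cmod z + cmod e" by (rule norm_triangle_ineq4)
      also have "\<dots> \<le> cmod z * (1 + cmod e)"
      proof -
        have "cmod e \<le> cmod z * cmod e" using mult_right_mono[OF z norm_ge_zero[of e]] by simp
        then show ?thesis by (simp add: distrib_left)
      qed
      finally have "(cmod (z - e))\<^sup>2 \<le> (cmod z * (1 + cmod e))\<^sup>2" by (rule power_mono) simp
      then have 1: "c * (cmod (z - e))\<^sup>2 \<le> c * (1 + cmod e)\<^sup>2 * (cmod z)\<^sup>2"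
        using cb by (simp add: power_mult_distrib mult_ac)
      have "b * 1 \<le> b * (cmod z)\<^sup>2" using cb z by (intro mult_left_mono) (auto simp: one_le_power)
      then have "?v z \<le> (c * (1 + cmod e)\<^sup>2 + b) * (cmod z)\<^sup>2" using 1 by (simp add: radial_def distrib_right)
      then have vz: "?v z / b \<le> C * (cmod z)\<^sup>2" using cb by (simp add: C_def field_simps)
      have "\<rho> z \<le> (C * (cmod z)\<^sup>2) ^ N"
        using \<rho>(3)[of z] power_mono[OF vz, of N] vpos[of z] cb by (meson divide_nonneg_pos less_imp_le order_trans)
      then have rz: "\<rho> z \<le> C ^ N * cmod z ^ (2 * N)" by (simp add: power_mult_distrib power_mult)
      let ?M = "C ^ N * cmod z ^ (2 * N)"
      have M1: "?M \<ge> 1" using rz \<rho>(2)[of z] by linarith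
      have s1: "(cmod (q w z))\<^sup>2 \<le> ?M * \<rho> w"
        using bound[of w z] rz \<rho>(2)[of w] by (meson mult_right_mono order_trans zero_le_one)
      have s2: "?M * \<rho> w \<le> (?M * ?M) * ((\<rho> w + 1) * (\<rho> w + 1))"
      proof (rule mult_mono)
        show "?M \<le> ?M * ?M" using M1 mult_left_mono[OF M1, of ?M] by simp
        show "\<rho> w \<le> (\<rho> w + 1) * (\<rho> w + 1)" using \<rho>(2)[of w] by (simp add: algebra_simps)
      qed (use M1 \<rho>(2)[of w] in auto)
      have s3: "(?M * ?M) * ((\<rho> w + 1) * (\<rho> w + 1)) = (?M * (\<rho> w + 1))\<^sup>2"
        by (simp add: power2_eq_square mult_ac)
      have "(cmod (q w z))\<^sup>2 \<le> (?M * (\<rho> w + 1))\<^sup>2"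
        using order_trans[OF s1 s2] unfolding s3 .
      then have "cmod (q w z) \<le> ?M * (\<rho> w + 1)"
        by (rule power2_le_imp_le) (use C1 \<rho>(2)[of w] in auto)
      then show ?thesis by (simp add: mult_ac)
    qed
    then show ?thesis by blast
  qed
  have form: "\<exists>d. \<forall>z. q w z = (polar c e b w z / of_real b) ^ d" if "w \<noteq> e" for w
  proof -
    obtain B where B: "\<And>z. 1 \<le> norm z \<Longrightarrow> norm (q w z) \<le> B * norm z ^ (2 * N)" using growth by blast
    have p: "q w z = (\<Sum>k\<le>2 * N. (deriv ^^ k) (q w) 0 / fact k * z ^ k)" for z
      using Liouville_polynomial[of "q w" 1 B "2 * N" z] hol B by blast
    define z0 where "z0 = e - of_real b / (of_real c * cnj (w - e))"
    have n: "of_real c * cnj (w - e) \<noteq> 0" "complex_of_real b \<noteq> 0" using that cb by auto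
    have pz: "polar c e b w z = of_real c * cnj (w - e) * (z - z0)" for z
      unfolding polar_def z0_def using n by (simp add: field_simps)
    have ez: "e - z0 = of_real b / (of_real c * cnj (w - e))" by (simp add: z0_def)
    have "z0 \<noteq> e" using ez n by auto
    moreover have "z = z0" if "q w z = 0" for z using root[OF that] pz[of z] n by simp
    ultimately obtain d where d: "\<And>z. q w z = ((z - z0) / (e - z0)) ^ d"
      using polynomial_single_root[of "q w" _ "2 * N" e z0, OF p qe] by blast
    have "(z - z0) / (e - z0) = polar c e b w z / of_real b" for z
      unfolding pz ez using n by (simp add: field_simps)
    then show ?thesis using d by auto
  qed
  then obtain d where d: "\<And>w z. w \<noteq> e \<Longrightarrow> q w z = (polar c e b w z / of_real b) ^ d w" by metis
  have \<rho>d: "\<rho> w = (?v w / b) ^ d w" if "w \<noteq> e" for w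
  proof -
    have "complex_of_real (\<rho> w) = of_real ((?v w / b) ^ d w)"
      using d[OF that, of w] unfolding \<rho>(1) polar_self by simp
    then show ?thesis by (simp only: of_real_eq_iff)
  qed
  \<comment> \<open>The exponent is \<open>ln \<rho> / ln (v/b)\<close> away from \<open>e\<close>, where the denominator vanishes; the
    punctured plane is still connected.\<close>
  have vgt: "?v w / b > 1" if "w \<noteq> e" for w using that cb by (simp add: radial_def)
  have ct\<rho>: "continuous_on UNIV \<rho>"
  proof -
    have "\<rho> = (\<lambda>z. Re (inverse (overlap e z)))"
    proof
      fix z show "\<rho> z = Re (inverse (overlap e z))" using oq[of z] unfolding \<rho>_def by (metis inverse_unique)
    qed
    moreover have "overlap e z \<noteq> 0" for z using oq[of z] by auto
    ultimately show ?thesis using continuous_on_Re[OF continuous_on_inverse[OF continuous_overlap[of e]]] by simp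
  qed
  have ctv: "continuous_on UNIV ?v" using smooth_on_continuous[OF smooth_radial(2)] .
  have ld: "ln (\<rho> w) / ln (?v w / b) = real (d w)" if "w \<noteq> e" for w
  proof -
    have "ln (?v w / b) > 0" using vgt[OF that] by simp
    moreover have "ln (\<rho> w) = real (d w) * ln (?v w / b)"
      unfolding \<rho>d[OF that] using vgt[OF that] by (simp add: ln_realpow)
    ultimately show ?thesis by simp
  qed
  have "(\<lambda>w. ln (\<rho> w) / ln (?v w / b)) constant_on (- {e})"
  proof (rule continuous_discrete_range_constant)
    show "connected (- {e})" by (rule connected_punctured_universe) simp
    show "continuous_on (- {e}) (\<lambda>w. ln (\<rho> w) / ln (?v w / b))"
    proof (intro continuous_intros continuous_on_subset[OF ct\<rho>] continuous_on_subset[OF ctv])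
      show "\<forall>w\<in>- {e}. \<rho> w \<noteq> 0" using \<rho>(2) by (metis not_one_le_zero)
      show "\<forall>w\<in>- {e}. b \<noteq> 0" using cb by auto
      show "\<forall>w\<in>- {e}. ?v w / b \<noteq> 0" using vgt by fastforce
      show "\<forall>w\<in>- {e}. ln (?v w / b) \<noteq> 0" using vgt by (fastforce simp: ln_eq_zero_iff)
    qed auto
    show "\<exists>\<epsilon>>0. \<forall>y. y \<in> - {e} \<and> ln (\<rho> y) / ln (?v y / b) \<noteq> ln (\<rho> x) / ln (?v x / b) \<longrightarrow>
        \<epsilon> \<le> norm (ln (\<rho> y) / ln (?v y / b) - ln (\<rho> x) / ln (?v x / b))" if "x \<in> - {e}" for x
    proof (intro exI[of _ 1] conjI allI impI)
      fix y assume y: "y \<in> - {e} \<and> ln (\<rho> y) / ln (?v y / b) \<noteq> ln (\<rho> x) / ln (?v x / b)"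
      then have "d y \<noteq> d x" using ld[of x] ld[of y] that by auto
      then have "\<bar>real (d y) - real (d x)\<bar> \<ge> 1" by linarith
      then show "1 \<le> norm (ln (\<rho> y) / ln (?v y / b) - ln (\<rho> x) / ln (?v x / b))"
        using ld[of x] ld[of y] that y by simp
    qed simp
  qed
  then have dconst: "d w = d (e + 1)" if "w \<noteq> e" for w
  proof -
    assume "(\<lambda>w. ln (\<rho> w) / ln (?v w / b)) constant_on (- {e})"
    then have eq: "ln (\<rho> w) / ln (?v w / b) = ln (\<rho> (e + 1)) / ln (?v (e + 1) / b)"
      using that unfolding constant_on_def by auto
    show ?thesis using eq ld[OF that] ld[of "e + 1"] by simp
  qed
  \<comment> \<open>The point \<open>e + 1\<close> stands for an arbitrary point other than \<open>e\<close>.\<close>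
  define k where "k = d (e + 1)"
  have \<rho>k: "\<rho> w = (?v w / b) ^ k" for w
  proof (cases "w = e")
    case True
    have "\<rho> e = 1" using qe[of e] by (simp add: \<rho>_def)
    then show ?thesis using True cb by (simp add: radial_def)
  next
    case False
    then show ?thesis using \<rho>d[OF False] dconst[OF False] by (simp only: k_def)
  qed
  have ov: "overlap e z = of_real b ^ k * inverse (of_real (?v z) ^ k)" for z
  proof -
    have "overlap e z * of_real ((?v z / b) ^ k) = 1" using oq[of z] unfolding \<rho>(1) \<rho>k .
    then have "overlap e z * (complex_of_real (?v z) ^ k / complex_of_real b ^ k) = 1"
      by (simp add: power_divide)
    moreover have solve: "x = B * inverse V" if "x * (V / B) = 1" for x V B :: complex
    proof -
      have "V \<noteq> 0" "B \<noteq> 0" using that by auto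
      then show ?thesis using that by (simp add: field_simps)
    qed
    ultimately show ?thesis by (intro solve) simp
  qed
  have vn: "complex_of_real (?v z) \<noteq> 0" for z using vpos[of z] by simp
  have pf: "potential_form e z = of_nat k * (of_real c * cnj (z - e) / of_real (?v z))" for z
  proof -
    have on: "overlap e z \<noteq> 0" using oq[of z] by auto
    have smk: "smooth_on (\<lambda>z. complex_of_real (?v z) ^ m) UNIV" for m
      by (induction m) (auto intro: smooth_on_const smooth_on_mult smooth_radial(1))
    have wk: "wd 1 (\<lambda>z. complex_of_real (?v z) ^ m) z = of_nat m * (of_real c * cnj (z - e)) * of_real (?v z) ^ m / of_real (?v z)" for m
    proof (induction m)
      case (Suc m)
      have "wd 1 (\<lambda>z. complex_of_real (?v z) * complex_of_real (?v z) ^ m) z =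
        of_real (?v z) * wd 1 (\<lambda>z. complex_of_real (?v z) ^ m) z + of_real c * cnj (z - e) * of_real (?v z) ^ m"
        by (subst wd_mult[OF differentiable_polar(2) smooth_on_differentiable[OF smk]]) (simp_all add: wd_radial del: complex_cnj_diff)
      then show ?case unfolding Suc using vn[of z] by (simp add: field_simps)
    qed simp
    have di: "(\<lambda>z. inverse (complex_of_real (?v z) ^ k)) differentiable (at z)"
      using smooth_on_differentiable[OF smk UNIV_I] vn by (intro differentiable_inverse) auto
    have "wd 1 (overlap e) z = of_real b ^ k * (- (of_nat k * (of_real c * cnj (z - e)) * of_real (?v z) ^ k / of_real (?v z)) / (of_real (?v z) ^ k)\<^sup>2)"
      unfolding ov[abs_def]
      by (subst wd_cmult[OF di], subst wd_inverse[OF smooth_on_differentiable[OF smk UNIV_I]]) (use vn wk in auto)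
    also have "\<dots> = - overlap e z * (of_nat k * (of_real c * cnj (z - e) / of_real (?v z)))"
      unfolding ov using vn[of z] by (simp add: field_simps power2_eq_square)
    finally have "- overlap e z * potential_form e z = - overlap e z * (of_nat k * (of_real c * cnj (z - e) / of_real (?v z)))"
      using wd_overlap[of z e] tU by simp
    then show ?thesis using on by (metis mult_left_cancel neg_equal_0_iff_equal)
  qed
  have "(norm (Dm 1 R z))\<^sup>2 = (real k * c * b) / (?v z)\<^sup>2" for z
  proof -
    have mf: "potential_form e z = of_nat k * (- model_form c e b e z)" for z
      unfolding pf using model_form_eq[OF cb, of e e z] cb by (simp add: polar_def)
    have sm: "smooth_on (model_form c e b e) UNIV"
      unfolding model_form_def[abs_def]
      by (intro smooth_on_mult smooth_on_cnj smooth_on_diff smooth_on_const smooth_on_ident smooth_on_inverse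
          smooth_polar smooth_radial(1) open_UNIV) (use vn cb in \<open>auto simp: polar_def\<close>)
    have "complex_of_real ((norm (Dm 1 R z))\<^sup>2) = wd (-1) (potential_form e) z"
      using wd_potential_form[of z e] tU by simp
    also have "\<dots> = wd (-1) (\<lambda>z. (- of_nat k) * model_form c e b e z) z"
      by (rule wd_cong_open[OF open_UNIV UNIV_I]) (simp add: mf)
    also have "\<dots> = (- of_nat k) * wd (-1) (model_form c e b e) z"
      by (rule wd_cmult[OF smooth_on_differentiable[OF sm UNIV_I]])
    also have "\<dots> = of_real ((real k * c * b) / (?v z)\<^sup>2)"
      using wd_model_form[OF cb, of e e z] cb by (simp add: polar_def)
    finally show ?thesis by (simp only: of_real_eq_iff)
  qed
  then show ?thesis using cb by (intro exI[of _ "real k * c * b"]) auto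
qed

text \<open>At the centre, \<open>overlap_lower_bound\<close> reads \<open>D\<^sub>j(e, z) \<ge> (b/v(z))^(\<kappa>/\<mu>\<^sub>j)\<close>; as \<open>b/v \<le> 1\<close>, the
  exponent may be replaced by an integer \<open>N\<close>, and the bundles can be treated one at a time.\<close>

lemma density_rigidity:
  fixes R :: "nat \<Rightarrow> complex \<Rightarrow> complex^'n^'n"
  assumes R: "\<And>j. j < p \<Longrightarrow> holomorphic_bundle (R j)" and \<mu>: "\<And>j. j < p \<Longrightarrow> \<mu> j > 0"
    and cb: "c > 0" "b > 0"
    and density: "\<And>z. (\<Sum>j<p. \<mu> j * (norm (Dm 1 (R j) z))\<^sup>2) = 1 / (radial c e b z)\<^sup>2"
    and j: "j < p"
  shows "\<exists>\<delta>\<ge>0. \<forall>z. (norm (Dm 1 (R j) z))\<^sup>2 = \<delta> / (radial c e b z)\<^sup>2"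
proof -
  note overlap = overlap_lower_bound[OF R \<mu> cb density]
  obtain N :: nat where N: "1 / (c * b) / \<mu> j \<le> real N" using real_arch_simple by blast
  show ?thesis
  proof (rule rigidity_single[OF R[OF j] cb])
    show "z \<in> transversal_of (R j) a" if "polar c e b a z \<noteq> 0" for a z
      by (rule overlap(1)) (use that j in auto)
    show "(b / radial c e b z) ^ N \<le> Re (overlap_of (R j) e z)" for z
    proof -
      let ?x = "b / radial c e b z"
      have v: "radial c e b z > 0" "radial c e b z \<ge> b"
        using radial_pos[OF cb] cb by (auto simp: radial_def)
      have x: "?x > 0" "ln ?x \<le> 0" using v cb by auto
      have "?x ^ N = exp (real N * ln ?x)"
        using x(1) by (simp add: exp_of_nat_mult)
      also have "\<dots> \<le> exp (1 / (c * b) / \<mu> j * ln ?x)"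
        using mult_right_mono_neg[OF N x(2)] by simp
      also have "ln ?x = ln ((cmod (polar c e b e z))\<^sup>2) - ln (radial c e b z) - ln (radial c e b e)"
        using cb v by (simp add: polar_def radial_def[of c e b e] ln_div ln_realpow)
      also have "exp (1 / (c * b) / \<mu> j * \<dots>) \<le> Re (overlap_of (R j) e z)"
        by (rule overlap(2)) (use j cb in \<open>auto simp: polar_def\<close>)
      finally show ?thesis .
    qed
  qed
qed

section \<open>The algebra of a harmonic frame\<close>

context harmonic_frame
begin

text \<open>\<open>R j\<close> projects onto the osculating bundle of order \<open>j\<close>, \<open>A j\<close> is the second fundamental form
  \<open>\<psi>\<^sub>j \<rightarrow> \<psi>\<^sub>j\<^sub>+\<^sub>1\<close>, and \<open>B j\<close> is the one arriving at \<open>\<psi>\<^sub>j\<close>, with the convention \<open>A\<^sub>-\<^sub>1 = 0\<close>.\<close>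

definition R :: "nat \<Rightarrow> complex \<Rightarrow> complex^'n^'n" where
  "R j z = (\<Sum>i\<le>j. P i z)"

definition A :: "nat \<Rightarrow> complex \<Rightarrow> complex^'n^'n" where
  "A j z = Dm 1 (R j) z"

definition B :: "nat \<Rightarrow> complex \<Rightarrow> complex^'n^'n" where
  "B j z = (case j of 0 \<Rightarrow> 0 | Suc i \<Rightarrow> A i z)"

lemma R_abs: "(\<lambda>z. \<Sum>i\<le>j. P i z) = R j"
  by (simp add: R_def[abs_def])

lemma PP: "j \<le> p \<Longrightarrow> P j z ** P j z = P j z" and Padj: "j \<le> p \<Longrightarrow> adj (P j z) = P j z"
  using oproj[of j z] by (auto simp: oproj_def)

lemma oproj_R: "j \<le> p \<Longrightarrow> oproj (R j z)"
proof -
  assume j: "j \<le> p"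
  have "R j z ** R j z = (\<Sum>i\<le>j. \<Sum>k\<le>j. P i z ** P k z)"
    unfolding R_def matrix_sum_left by (simp only: matrix_sum_right)
  also have "\<dots> = (\<Sum>i\<le>j. \<Sum>k\<le>j. if k = i then P i z else 0)"
    using j by (intro sum.cong refl) (auto simp: PP orthogonal)
  also have "\<dots> = R j z" by (simp add: R_def)
  finally have "R j z ** R j z = R j z" .
  moreover have "adj (R j z) = R j z"
    using j by (auto simp: R_def adj_sum Padj intro!: sum.cong)
  ultimately show ?thesis by (simp add: oproj_def)
qed

lemma osculating_bundle: "j \<le> p \<Longrightarrow> holomorphic_bundle (R j)"
proof
  fix z assume j: "j \<le> p"
  show "msmooth (R j) UNIV"
    unfolding R_def[abs_def] using j by (intro msmooth_sum smooth open_UNIV) auto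
  show "oproj (R j z)" by (rule oproj_R[OF j])
  show "Dm (-1) (R j) z ** R j z = 0"
    using holomorphic[OF j, of z] unfolding R_abs by (simp add: R_def)
qed

lemma A_eq: "j \<le> p \<Longrightarrow> A j z = Dm 1 (P j) z ** P j z"
  using second_fundamental[of j z] unfolding R_abs A_def .

lemma A_right: "j \<le> p \<Longrightarrow> A j z ** P j z = A j z"
  by (simp add: A_eq matrix_mul_assoc[symmetric] PP)

lemma A_last: "A p z = 0"
proof -
  have "R p = (\<lambda>z. mat 1)" using complete by (simp add: R_def[abs_def])
  then show ?thesis by (simp add: A_def)
qed

lemma A_left: "j < p \<Longrightarrow> P (Suc j) z ** A j z = A j z"
  using next_bundle[of j z] unfolding R_abs A_def by simp

lemma A_other_left:
  assumes "j \<le> p" "i \<le> p" "i \<noteq> Suc j"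
  shows "P i z ** A j z = 0"
proof (cases "j = p")
  case True
  then show ?thesis by (simp add: A_last)
next
  case False
  then have j: "j < p" using assms by simp
  then have "P i z ** P (Suc j) z = 0" using assms by (intro orthogonal) auto
  then show ?thesis using A_left[OF j, of z] by (metis matrix_mul_assoc times0_left)
qed

lemma A_other_right:
  assumes "j \<le> p" "i \<le> p" "i \<noteq> j"
  shows "A j z ** P i z = 0"
proof -
  have "P j z ** P i z = 0" using assms by (intro orthogonal) auto
  then show ?thesis using A_right[OF assms(1), of z] by (metis matrix_mul_assoc times0_right)
qed

lemma DP: "j \<le> p \<Longrightarrow> Dm 1 (P j) z = A j z - B j z"
proof (cases j)
  case 0
  have "R 0 = P 0" by (auto simp: R_def)
  then show ?thesis using 0 by (simp add: A_def B_def)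
next
  case (Suc i)
  assume j: "j \<le> p"
  have "R j = (\<lambda>z. R i z + P j z)" by (auto simp: R_def Suc)
  then have "A j z = A i z + Dm 1 (P j) z"
    using Dm_add[OF holomorphic_bundle.md(1)[OF osculating_bundle] msmooth_mdiff[OF smooth[OF j]], of i z 1] j Suc
    by (simp add: A_def)
  then show ?thesis by (simp add: B_def Suc)
qed

lemma frame_algebra:
  assumes j: "j \<le> p"
  shows "A j z ** P j z = A j z" "P j z ** A j z = 0" "P j z ** B j z = B j z" "B j z ** P j z = 0"
    "B j z ** A j z = 0"
proof -
  show "A j z ** P j z = A j z" "P j z ** A j z = 0" using A_right[OF j] A_other_left[OF j j] by auto
  show "P j z ** B j z = B j z" using j A_left by (cases j) (auto simp: B_def)
  show "B j z ** P j z = 0" using j A_other_right by (cases j) (auto simp: B_def)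
  show "B j z ** A j z = 0"
  proof (cases j)
    case (Suc i)
    have "B j z = A i z ** P i z" using A_right[of i z] j Suc by (simp add: B_def)
    moreover have "P i z ** A j z = 0" using A_other_left[of j i z] j Suc by simp
    ultimately show ?thesis by (metis matrix_mul_assoc times0_right)
  qed (simp add: B_def)
qed

lemma smooth_A: "j \<le> p \<Longrightarrow> msmooth (A j) UNIV"
  unfolding A_def[abs_def] using holomorphic_bundle.smooth[OF osculating_bundle] by (intro msmooth_Dm open_UNIV)

lemma smooth_B: "j \<le> p \<Longrightarrow> msmooth (B j) UNIV"
  unfolding B_def[abs_def] by (cases j) (auto simp: msmooth_const intro: smooth_A)

lemma DbA: "j \<le> p \<Longrightarrow> Dm (-1) (A j) z = A j z ** adj (A j z) - adj (A j z) ** A j z"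
proof -
  assume j: "j \<le> p"
  interpret holomorphic_bundle "R j" by (rule osculating_bundle[OF j])
  have "adj (Dm 1 (R j) z) = Dm (-1) (R j) z" using Dm_adj_self[OF smooth selfadj] by blast
  then show ?thesis using derivs(4)[of z] unfolding A_def[abs_def] by simp
qed

lemma DbB: "j \<le> p \<Longrightarrow> Dm (-1) (B j) z = B j z ** adj (B j z) - adj (B j z) ** B j z"
  by (cases j) (auto simp: B_def[abs_def] DbA)

end

section \<open>The bundles as maps into Grassmannians\<close>

lemma grass_h_add: "grass_h (X + Y) Z = grass_h X Z + grass_h Y Z" "grass_h Z (X + Y) = grass_h Z X + grass_h Z Y"
  by (simp_all add: grass_h_def mmult trace_add)
lemma grass_h_scaleR: "grass_h (r *\<^sub>R X) Z = r * grass_h X Z"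
proof -
  have "r *\<^sub>R X = mat (complex_of_real r) ** X"
    by (simp add: mat_scalar vec_eq_iff) (simp add: scaleR_conv_of_real)
  then show ?thesis by (simp add: grass_h_def matrix_mul_assoc[symmetric] trace_scalar)
qed
lemma grass_h_scalar: "grass_h (mat \<i> ** X) (mat \<i> ** Y) = - grass_h X Y"
  "grass_h X (mat \<i> ** Y) = Re (\<i> * trace (X ** Y)) / 2"
proof -
  have 1: "X ** (mat \<i> ** Y) = mat \<i> ** (X ** Y)" for X Y :: "complex^'n^'n"
    by (simp only: matrix_mul_assoc mat_commute[of X])
  show "grass_h (mat \<i> ** X) (mat \<i> ** Y) = - grass_h X Y"
    unfolding grass_h_def matrix_mul_assoc[symmetric] 1[of X Y] by (simp add: trace_scalar mult.assoc[symmetric])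
  show "grass_h X (mat \<i> ** Y) = Re (\<i> * trace (X ** Y)) / 2"
    by (simp add: grass_h_def 1 trace_scalar)
qed

text \<open>The relations between \<open>A\<close>, \<open>B\<close> and \<open>P\<close> are those of the forms leaving \<open>\<psi>\<^sub>j\<close> and arriving at
  it; \<open>\<xi>\<close> and \<open>\<eta>\<close> are the real derivatives of the projection in the directions \<open>x\<close> and \<open>y\<close>, \<open>J\<close> is
  the complex structure applied to \<open>\<xi>\<close>. Among the products of two of \<open>A\<close>, \<open>B\<close> and their adjoints,
  only those of a matrix with its own adjoint have a nonzero trace. The last claim is harmonicity:
  the commutators map \<open>\<psi>\<^sub>j\<close> and its complement to themselves.\<close>

lemma second_fundamental_algebra:
  fixes A B P :: "complex^'n^'n"
  assumes P: "adj P = P" and "A ** P = A" "P ** A = 0" "P ** B = B" "B ** P = 0" "B ** A = 0"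
  defines "X \<equiv> A - B" and "\<gamma> \<equiv> (norm A)\<^sup>2 + (norm B)\<^sup>2"
  defines "\<xi> \<equiv> X + adj X" and "\<eta> \<equiv> mat \<i> ** (X - adj X)"
  defines "J \<equiv> mat \<i> ** ((mat 1 - P) ** \<xi> ** P) - mat \<i> ** (P ** \<xi> ** (mat 1 - P))"
  shows "grass_h \<xi> \<xi> = \<gamma>" "grass_h \<eta> \<eta> = \<gamma>" "grass_h \<xi> \<eta> = 0" "grass_h \<eta> \<xi> = 0"
    "grass_h J J = \<gamma>" "grass_h J \<eta> = (norm A)\<^sup>2 - (norm B)\<^sup>2"
    "proj L = P \<Longrightarrow> grass_tangent_part L ((A ** adj A - adj A ** A) - (B ** adj B - adj B ** B)) = 0"
proof -
  note r = assms(2-6)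
  have a: "P ** adj A = adj A" "adj A ** P = 0" "adj B ** P = adj B" "P ** adj B = 0" "adj A ** adj B = 0"
    using r[THEN arg_cong, of adj] by (simp_all add: adj_mult P)
  have AA: "A ** A = 0" by (metis r(1,2) matrix_mul_assoc times0_right)
  have BB: "B ** B = 0" by (metis r(3,4) matrix_mul_assoc times0_left)
  have AB': "A ** adj B = 0" by (metis r(1) a(4) matrix_mul_assoc times0_right)
  have B'A: "adj B ** A = 0" by (metis a(3) r(2) matrix_mul_assoc times0_right)
  have A'B: "adj A ** B = 0" by (metis r(3) a(2) matrix_mul_assoc times0_left)
  have BA': "B ** adj A = 0" by (metis a(1) r(4) matrix_mul_assoc times0_left)
  have a2: "adj A ** adj A = 0" "adj B ** adj B = 0" using AA BB by (simp_all add: adj_mult[symmetric])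
  have tAB: "trace (A ** B) = 0" using trace_mul_sym[of A B] r(5) by simp
  have tB'A': "trace (adj B ** adj A) = 0" using trace_mul_sym[of "adj B" "adj A"] a(5) by simp
  note zero = r a AA BB AB' B'A A'B BA' a2
  have tX: "trace (X ** X) = 0" "trace (adj X ** adj X) = 0"
    "trace (X ** adj X) = of_real \<gamma>" "trace (adj X ** X) = of_real \<gamma>"
    unfolding X_def \<gamma>_def
    by (simp_all add: adj_diff mmult zero trace_add trace_sub trace_minus tAB tB'A' trace_adj_mult_self trace_mult_adj_self)
  show "grass_h \<xi> \<xi> = \<gamma>" unfolding \<xi>_def grass_h_def by (simp add: mmult trace_add tX)
  show "grass_h \<eta> \<eta> = \<gamma>" unfolding \<eta>_def grass_h_scalar(1) unfolding grass_h_def by (simp add: mmult trace_add trace_sub tX)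
  show 1: "grass_h \<xi> \<eta> = 0" unfolding \<xi>_def \<eta>_def grass_h_scalar by (simp add: mmult trace_add trace_sub tX)
  show "grass_h \<eta> \<xi> = 0" using 1 trace_mul_sym[of \<xi> \<eta>] by (simp add: grass_h_def)
  define Y where "Y = A - adj B"
  have J: "J = mat \<i> ** (Y - adj Y)"
    unfolding J_def \<xi>_def X_def Y_def by (simp add: adj_diff mmult zero)
  have tY: "trace (Y ** Y) = 0" "trace (adj Y ** adj Y) = 0"
    "trace (Y ** adj Y) = of_real \<gamma>" "trace (adj Y ** Y) = of_real \<gamma>"
    unfolding Y_def \<gamma>_def
    by (simp_all add: adj_diff mmult zero trace_add trace_sub trace_minus tAB tB'A' trace_adj_mult_self trace_mult_adj_self)
  show "grass_h J J = \<gamma>" unfolding J grass_h_scalar(1) unfolding grass_h_def by (simp add: mmult trace_add trace_sub tY)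
  show "grass_h J \<eta> = (norm A)\<^sup>2 - (norm B)\<^sup>2"
    unfolding J \<eta>_def grass_h_scalar(1) unfolding grass_h_def X_def Y_def
    by (simp add: adj_diff mmult zero trace_add trace_sub trace_minus tAB tB'A' trace_adj_mult_self trace_mult_adj_self)
      (simp add: field_simps)
  show "grass_tangent_part L ((A ** adj A - adj A ** A) - (B ** adj B - adj B ** B)) = 0" if L: "proj L = P"
  proof -
    have ext: "P ** (A ** Z) = 0" "P ** (B ** Z) = B ** Z" "P ** (adj A ** Z) = adj A ** Z" "P ** (adj B ** Z) = 0" for Z :: "complex^'n^'n"
      using zero by (simp_all add: matrix_mul_assoc)
    show ?thesis unfolding grass_tangent_part_def L by (simp add: mmult zero ext)
  qed
qed

lemma normal_part_add: "normal_part f z (\<xi> + \<eta>) = normal_part f z \<xi> + normal_part f z \<eta>"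
  by (simp add: normal_part_def sum_2 grass_h_add distrib_left scaleR_add_left)

lemma normal_part_zero: "normal_part f z 0 = 0"
  by (simp add: normal_part_def grass_h_def)

text \<open>The trace of the second fundamental form of a conformal map is governed by the Laplacian of
  the projection.\<close>

lemma laplacian_matrix:
  fixes F :: "complex \<Rightarrow> complex^'n^'n"
  assumes "smooth_on F UNIV"
  shows "pd 1 (pd 1 F) z + pd 2 (pd 2 F) z = 4 *\<^sub>R Dm (-1) (Dm 1 F) z"
proof -
  have d: "F differentiable (at w)" "pd a F differentiable (at w)" for a w
    using assms smooth_on_differentiable smooth_on_pd by blast+
  have sF: "smooth_on (\<lambda>w. F w $ i $ j) UNIV" for i j
    using smooth_on_linear[OF bounded_linear_entry open_UNIV assms] .
  have e: "pd a (pd a F) z $ i $ j = pd a (pd a (\<lambda>w. F w $ i $ j)) z" for a i j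
  proof -
    have "pd a (pd a F) z $ i $ j = pd a (\<lambda>w. pd a F w $ i $ j) z" by (rule pd_entry[OF d(2)])
    also have "(\<lambda>w. pd a F w $ i $ j) = pd a (\<lambda>w. F w $ i $ j)" using pd_entry[OF d(1)] by auto
    finally show ?thesis .
  qed
  have w: "pd 1 (pd 1 f) z + pd 2 (pd 2 f) z = 4 * wd (-1) (wd 1 f) z" if f: "smooth_on f UNIV" for f :: "complex \<Rightarrow> complex"
  proof -
    show ?thesis
      unfolding wd_wd[OF f UNIV_I] using pd_commute[OF open_UNIV f UNIV_I, of 1 2] by simp
  qed
  have "(pd 1 (pd 1 F) z + pd 2 (pd 2 F) z) $ i $ j = (4 *\<^sub>R Dm (-1) (Dm 1 F) z) $ i $ j" for i j
    using w[OF sF, of i j] by (simp add: e Dm_def) (simp add: scaleR_conv_of_real)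
  then show ?thesis by (simp add: vec_eq_iff)
qed

text \<open>If \<open>v\<close> belongs to \<open>\<rho>\<close>, then \<open>v / sqrt s\<close> belongs to \<open>s \<rho>\<close>, and the curvature is quadratic in
  \<open>v\<close>.\<close>

lemma gauss_curvature_scale:
  fixes \<rho> :: "complex \<Rightarrow> real"
  assumes sm: "smooth_on \<rho> UNIV" and pos: "\<And>z. \<rho> z > 0" and s: "s > 0"
    and m: "\<And>z. m z = mat (\<rho> z)" and m': "\<And>z. m' z = mat (s * \<rho> z)"
  shows "gauss_curvature m' z = gauss_curvature m z / s"
proof -
  define v where "v z = inverse (sqrt (\<rho> z))" for z
  define k where "k = inverse (sqrt s)"
  have k: "k > 0" "k\<^sup>2 = 1 / s" using s by (auto simp: k_def power_divide inverse_eq_divide)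
  have sv: "smooth_on v UNIV" unfolding v_def by (rule smooth_on_inverse_sqrt) (use sm pos in auto)
  have vpos: "v z > 0" for z using pos[of z] by (simp add: v_def)
  have vv: "1 / (v z)\<^sup>2 = \<rho> z" for z using pos[of z] by (simp add: v_def power_divide inverse_eq_divide)
  have skv: "smooth_on (\<lambda>z. k * v z) UNIV" by (intro smooth_on_mult smooth_on_const sv open_UNIV)
  have dk: "pd a (\<lambda>z. k * f z) z = k * pd a f z" if "smooth_on f UNIV" for f :: "complex \<Rightarrow> real" and a z
    using pd_bounded_linear[OF bounded_linear_mult_right smooth_on_differentiable[OF that]] by blast
  have dk1: "pd a (\<lambda>z. k * v z) = (\<lambda>z. k * pd a v z)" for a using dk[OF sv] by auto
  have dk2: "pd b (pd a (\<lambda>z. k * v z)) z = k * pd b (pd a v) z" for a b z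
    unfolding dk1 by (rule dk[OF smooth_on_pd[OF sv]])
  have e1: "gauss_curvature m z = v z * (pd 1 (pd 1 v) z + pd 2 (pd 2 v) z) - (pd 1 v z)\<^sup>2 - (pd 2 v z)\<^sup>2"
    by (rule gauss_curvature_conformal) (use sv vpos m vv in auto)
  have e2: "gauss_curvature m' z = (k * v z) * (k * pd 1 (pd 1 v) z + k * pd 2 (pd 2 v) z) - (k * pd 1 v z)\<^sup>2 - (k * pd 2 v z)\<^sup>2"
  proof -
    have "1 / (k * v z)\<^sup>2 = s * \<rho> z" for z using k s by (simp add: power_mult_distrib flip: vv)
    then have "m' z = mat (1 / (k * v z)\<^sup>2)" for z by (simp add: m')
    from gauss_curvature_conformal[OF skv _ this, of z] show ?thesis
      using vpos k unfolding dk2 unfolding dk1 by simp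
  qed
  have "gauss_curvature m' z = k\<^sup>2 * gauss_curvature m z"
    unfolding e1 e2 by (simp add: algebra_simps power2_eq_square)
  then show ?thesis by (simp add: k)
qed

lemma norm_mat_scalar: "norm (mat c ** (M :: complex^'n^'n)) = cmod c * norm M"
proof -
  have "(norm (mat c ** M))\<^sup>2 = (cmod c * norm M)\<^sup>2"
    by (simp add: norm_vec_def L2_set_def sum_nonneg mat_scalar norm_mult power_mult_distrib sum_distrib_left)
  then show ?thesis by (simp add: power2_eq_iff_nonneg)
qed

lemma grass_tangent_part_add:
  "grass_tangent_part L (X + Y) = grass_tangent_part L X + grass_tangent_part L Y"
  by (simp add: grass_tangent_part_def mmult)

context harmonic_frame
begin

text \<open>A map into the Grassmannian whose projections form one member of the frame.\<close>

context
  fixes j :: nat and f :: "complex \<Rightarrow> (complex^'n) set"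
  assumes j: "j \<le> p" and f: "\<And>z. proj (f z) = P j z" and sm: "smooth_on (P j) UNIV"
begin

lemma Db_P: "Dm (-1) (P j) z = adj (A j z - B j z)"
  using Dm_adj_self(1)[OF smooth[OF j] Padj[OF j], of z] DP[OF j, of z] by simp

lemma grass_pd_frame:
  "grass_pd 1 f z = (A j z - B j z) + adj (A j z - B j z)"
  "grass_pd 2 f z = mat \<i> ** ((A j z - B j z) - adj (A j z - B j z))"
proof -
  have d: "P j differentiable (at z)" using smooth_on_differentiable[OF sm] by blast
  have e: "(\<lambda>w. proj (f w)) = P j" using f by auto
  show "grass_pd 1 f z = (A j z - B j z) + adj (A j z - B j z)"
    unfolding grass_pd_def e pd_def frechet_derivative_Dm[OF d] by (simp add: Db_P DP[OF j])
  show "grass_pd 2 f z = mat \<i> ** ((A j z - B j z) - adj (A j z - B j z))"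
    unfolding grass_pd_def e pd_def frechet_derivative_Dm[OF d]
    by (simp add: Db_P DP[OF j] matrix_diff_ldistrib) (simp add: mat_scalar vec_eq_iff)
qed

lemmas frame_forms = second_fundamental_algebra[OF Padj[OF j] frame_algebra[OF j]]

definition energy :: "complex \<Rightarrow> real" where
  "energy z = (norm (A j z))\<^sup>2 + (norm (B j z))\<^sup>2"

lemma grass_induced_frame: "grass_induced f z = mat (energy z)"
proof -
  have "grass_induced f z $ a $ b = mat (energy z) $ a $ b" for a b
    using exhaust_2[of a] exhaust_2[of b] frame_forms(1-4)[of z]
    by (auto simp: grass_induced_def grass_pd_frame energy_def mat_def)
  then show ?thesis by (simp add: vec_eq_iff)
qed

lemma grass_immersion_frame:
  assumes "energy z > 0"
  shows "inj (frechet_derivative (\<lambda>w. proj (f w)) (at z))"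
proof -
  let ?D = "frechet_derivative (\<lambda>w. proj (f w)) (at z)"
  have e: "(\<lambda>w. proj (f w)) = P j" using f by auto
  have d: "P j differentiable (at z)" using smooth_on_differentiable[OF sm] by blast
  have dec: "?D v = Re v *\<^sub>R grass_pd 1 f z + Im v *\<^sub>R grass_pd 2 f z" for v
    unfolding grass_pd_def e by (rule frechet_derivative_pd[OF d])
  have h: "grass_h (grass_pd 1 f z) (grass_pd 1 f z) = energy z" "grass_h (grass_pd 2 f z) (grass_pd 2 f z) = energy z"
    "grass_h (grass_pd 1 f z) (grass_pd 2 f z) = 0" "grass_h (grass_pd 2 f z) (grass_pd 1 f z) = 0"
    unfolding grass_pd_frame frame_forms(1-4) energy_def by simp_all
  have "grass_h (?D v) \<zeta> = Re v * grass_h (grass_pd 1 f z) \<zeta> + Im v * grass_h (grass_pd 2 f z) \<zeta>" for v \<zeta>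
    unfolding dec by (simp only: grass_h_add(1) grass_h_scaleR)
  then have "grass_h (?D v) (grass_pd 1 f z) = Re v * energy z" "grass_h (?D v) (grass_pd 2 f z) = Im v * energy z" for v
    by (simp_all add: h)
  then show ?thesis
    using assms by (intro injI complex_eqI) (metis less_irrefl mult_right_cancel)+
qed

lemma mean_curvature_frame:
  assumes "energy z > 0"
  shows "mean_curvature_vector f z = 0"
proof -
  have e: "grass_pd a f = pd a (P j)" for a
    using f by (auto simp: grass_pd_def)
  have DD: "Dm (-1) (Dm 1 (P j)) z = (A j z ** adj (A j z) - adj (A j z) ** A j z) - (B j z ** adj (B j z) - adj (B j z) ** B j z)"
  proof -
    have "Dm 1 (P j) = (\<lambda>z. A j z - B j z)" using DP[OF j] by auto
    then show ?thesis
      using Dm_diff[OF msmooth_mdiff[OF smooth_A[OF j]] msmooth_mdiff[OF smooth_B[OF j]], of z "-1"]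
      by (simp add: DbA[OF j] DbB[OF j])
  qed
  have t: "grass_tangent_part (f z) (Dm (-1) (Dm 1 (P j)) z) = 0"
    using frame_forms(7)[of "f z" z] f[of z] unfolding DD by simp
  have "covariant_hessian f 1 1 z + covariant_hessian f 2 2 z = grass_tangent_part (f z) (4 *\<^sub>R Dm (-1) (Dm 1 (P j)) z)"
    unfolding covariant_hessian_def e grass_tangent_part_add[symmetric] laplacian_matrix[OF sm] ..
  also have "\<dots> = 0"
  proof -
    have "4 *\<^sub>R M = M + M + (M + M)" for M :: "complex^'n^'n"
      unfolding scaleR_2[symmetric] scaleR_scaleR by simp
    from this[of "Dm (-1) (Dm 1 (P j)) z"] show ?thesis by (simp only: grass_tangent_part_add t add_0)
  qed
  finally have "normal_part f z (covariant_hessian f 1 1 z) + normal_part f z (covariant_hessian f 2 2 z) = 0"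
    unfolding normal_part_add[symmetric] by (simp add: normal_part_zero)
  then have s: "second_fundamental_form f 1 1 z + second_fundamental_form f 2 2 z = 0"
    by (simp add: second_fundamental_form_def)
  have "mean_curvature_vector f z = (1 / 2) *\<^sub>R ((1 / energy z) *\<^sub>R (second_fundamental_form f 1 1 z + second_fundamental_form f 2 2 z))"
    using assms unfolding mean_curvature_vector_def grass_induced_frame
    by (simp add: matrix_inv_mat) (simp add: mat_def sum_2 scaleR_add_right)
  then show ?thesis by (simp add: s)
qed

lemma kahler_angle_frame:
  assumes "energy z > 0"
  shows "kahler_angle f z = arccos (((norm (A j z))\<^sup>2 - (norm (B j z))\<^sup>2) / energy z)"
proof -
  have s: "sqrt (energy z) * sqrt (energy z) = energy z" using assms by simp
  show ?thesis
    unfolding kahler_angle_def grass_angle_def grass_J_def f grass_pd_frame frame_forms(2,5,6) energy_def[symmetric] s ..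
qed

end

section \<open>The primitive lift\<close>
definition S :: "complex \<Rightarrow> complex^'n^'n" where
  "S z = (\<Sum>i\<le>p. A i z)"

lemma P_S_P:
  assumes "a \<le> p" "b \<le> p"
  shows "P a z ** S z ** P b z = (if a = Suc b then A b z else 0)"
proof -
  have "P a z ** S z ** P b z = (\<Sum>i\<le>p. P a z ** A i z ** P b z)"
    by (simp add: S_def matrix_sum_left matrix_sum_right)
  also have "\<dots> = (\<Sum>i\<le>p. if i = b then (if a = Suc b then A b z else 0) else 0)"
  proof (rule sum.cong[OF refl])
    fix i assume i: "i \<in> {..p}"
    show "P a z ** A i z ** P b z = (if i = b then (if a = Suc b then A b z else 0) else 0)"
    proof (cases "i = b")
      case True
      show ?thesis
      proof (cases "a = Suc b")
        case a: True
        then show ?thesis using True assms A_left[of b z] A_right[of b z] by simp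
      next
        case False
        then show ?thesis using True assms A_other_left[of b a z] by simp
      qed
    next
      case False
      then show ?thesis using A_other_right[of i b z] i assms by (simp add: matrix_mul_assoc[symmetric])
    qed
  qed
  finally show ?thesis using assms by simp
qed

text \<open>A map into the flag manifold given by the whole frame.\<close>

context
  fixes F :: "complex \<Rightarrow> nat \<Rightarrow> (complex^'n) set"
  assumes F: "\<And>z j. j \<le> p \<Longrightarrow> proj (F z j) = P j z" and sm: "\<And>j. j \<le> p \<Longrightarrow> smooth_on (P j) UNIV"
begin

text \<open>Only \<open>A\<^sub>i\<close> and the adjoint of \<open>A\<^sub>i\<^sub>-\<^sub>1\<close> leave the summand \<open>\<psi>\<^sub>i\<close>, so the lift is
  superhorizontal.\<close>

lemma flag_differential_frame:
  "flag_differential p F z v = mat v ** S z - mat (cnj v) ** adj (S z)"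
proof -
  have "flag_differential p F z v = (\<Sum>i\<le>p. \<Sum>j\<in>{..p} - {i}. mat v ** (P j z ** A i z) - mat (cnj v) ** (P j z ** adj (B i z)))"
    unfolding flag_differential_def
  proof (intro sum.cong refl)
    fix i j assume i: "i \<in> {..p}" and j: "j \<in> {..p} - {i}"
    have ip: "i \<le> p" using i by simp
    have e: "(\<lambda>w. proj (F w i)) = P i" using F ip by auto
    have d: "P i differentiable (at z)" using smooth_on_differentiable[OF sm[OF ip]] by blast
    note al = frame_algebra[OF ip, of z]
    have al': "adj (A i z) ** P i z = 0" "adj (B i z) ** P i z = adj (B i z)"
      using al(2,3)[THEN arg_cong, of adj] by (simp_all add: adj_mult Padj[OF ip])
    have "Dm (-1) (P i) z = adj (A i z - B i z)"
      using Dm_adj_self(1)[OF smooth[OF ip] Padj[OF ip], of z] DP[OF ip, of z] by simp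
    then have fd: "frechet_derivative (\<lambda>w. proj (F w i)) (at z) v = mat v ** (A i z - B i z) + mat (cnj v) ** adj (A i z - B i z)"
      unfolding e frechet_derivative_Dm[OF d] by (simp add: DP[OF ip])
    have "proj (F z j) ** frechet_derivative (\<lambda>w. proj (F w i)) (at z) v ** proj (F z i) =
      P j z ** (mat v ** ((A i z - B i z) ** P i z) + mat (cnj v) ** (adj (A i z - B i z) ** P i z))"
      using F i j unfolding fd by (simp add: matrix_mul_assoc matrix_add_ldistrib matrix_add_rdistrib')
    also have "\<dots> = P j z ** (mat v ** A i z - mat (cnj v) ** adj (B i z))"
      by (simp add: adj_diff matrix_diff_rdistrib al al' matrix_minus_right)
    also have "\<dots> = mat v ** (P j z ** A i z) - mat (cnj v) ** (P j z ** adj (B i z))"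
      by (simp add: matrix_diff_ldistrib matrix_mul_assoc mat_commute)
    finally show "proj (F z j) ** frechet_derivative (\<lambda>w. proj (F w i)) (at z) v ** proj (F z i) =
       mat v ** (P j z ** A i z) - mat (cnj v) ** (P j z ** adj (B i z))" .
  qed
  also have "\<dots> = (\<Sum>i\<le>p. mat v ** A i z - mat (cnj v) ** adj (B i z))"
  proof (rule sum.cong[OF refl])
    fix i assume i: "i \<in> {..p}"
    have ip: "i \<le> p" using i by simp
    note al = frame_algebra[OF ip, of z]
    have al': "P i z ** adj (B i z) = 0"
      using al(4)[THEN arg_cong, of adj] by (simp add: adj_mult Padj[OF ip])
    let ?T = "\<lambda>j. mat v ** (P j z ** A i z) - mat (cnj v) ** (P j z ** adj (B i z))"
    have "sum ?T {..p} = ?T i + sum ?T ({..p} - {i})" by (rule sum.remove) (use i in auto)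
    moreover have "?T i = 0" using al al' by simp
    moreover have "sum ?T {..p} = mat v ** ((\<Sum>j\<le>p. P j z) ** A i z) - mat (cnj v) ** ((\<Sum>j\<le>p. P j z) ** adj (B i z))"
      by (simp add: sum_subtractf matrix_sum_left matrix_sum_right)
    ultimately show "sum ?T ({..p} - {i}) = mat v ** A i z - mat (cnj v) ** adj (B i z)"
      by (simp add: complete)
  qed
  also have "\<dots> = mat v ** S z - mat (cnj v) ** adj (\<Sum>i\<le>p. B i z)"
    by (simp add: S_def sum_subtractf matrix_sum_right adj_sum)
  also have "(\<Sum>i\<le>p. B i z) = S z"
  proof -
    have "(\<Sum>i\<le>p. B i z) = (\<Sum>i<p. A i z)"
      unfolding sum.atMost_shift by (simp add: B_def)
    also have "\<dots> = S z" using A_last[of z] by (simp add: S_def lessThan_Suc_atMost[symmetric])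
    finally show ?thesis .
  qed
  finally show ?thesis .
qed

lemma flag_blocks:
  assumes "a \<le> p" "b \<le> p"
  shows "P a z ** flag_differential p F z v ** P b z =
    mat v ** (if a = Suc b then A b z else 0) - mat (cnj v) ** (if b = Suc a then adj (A a z) else 0)"
proof -
  have 1: "P a z ** adj (S z) ** P b z = (if b = Suc a then adj (A a z) else 0)"
  proof -
    have "P a z ** adj (S z) ** P b z = adj (P b z ** S z ** P a z)"
      using assms by (simp add: adj_mult Padj matrix_mul_assoc)
    then show ?thesis using P_S_P[OF assms(2,1)] by simp
  qed
  have "P a z ** flag_differential p F z v ** P b z = mat v ** (P a z ** S z ** P b z) - mat (cnj v) ** (P a z ** adj (S z) ** P b z)"
    unfolding flag_differential_frame
    by (simp add: matrix_diff_ldistrib matrix_diff_rdistrib matrix_mul_assoc mat_commute)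
  then show ?thesis unfolding 1 P_S_P[OF assms] .
qed

lemma flag_differential_tangent: "flag_differential p F z v \<in> flag_tangent p (F z)"
proof -
  have "adj (flag_differential p F z v) = - flag_differential p F z v"
    unfolding flag_differential_frame by (simp add: adj_diff adj_mult mat_commute)
  moreover have "proj (F z j) ** flag_differential p F z v ** proj (F z j) = 0" if "j \<le> p" for j
    using flag_blocks[OF that that, of z v] F[OF that] by simp
  ultimately show ?thesis by (simp add: flag_tangent_def)
qed

text \<open>On \<open>v S - cnj v S\<^sup>*\<close> the metric has the value \<open>|v|\<^sup>2 \<rho>\<close>; polarisation then shows that the
  induced metric is conformal.\<close>

lemma flag_induced_frame:
  assumes g: "invariant_flag_metric p k g" and L: "F z \<in> flag_manifold p k"
    and form: "\<And>\<xi>. \<xi> \<in> flag_tangent p (F z) \<Longrightarrow>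
     (\<forall>i\<le>p. \<forall>j\<le>p. i \<noteq> Suc j \<longrightarrow> j \<noteq> Suc i \<longrightarrow> proj (F z i) ** \<xi> ** proj (F z j) = 0) \<Longrightarrow>
     g (F z) \<xi> \<xi> = (\<Sum>l<p. \<mu> l * (norm (proj (F z (Suc l)) ** \<xi> ** proj (F z l)))\<^sup>2)"
  shows "flag_induced g p F z = mat (\<Sum>l<p. \<mu> l * (norm (A l z))\<^sup>2)"
proof -
  let ?\<xi> = "flag_differential p F z" and ?\<rho> = "\<Sum>l<p. \<mu> l * (norm (A l z))\<^sup>2"
  note T = flag_differential_tangent[of z]
  have q: "g (F z) (?\<xi> v) (?\<xi> v) = (cmod v)\<^sup>2 * ?\<rho>" for v
  proof -
    have "g (F z) (?\<xi> v) (?\<xi> v) = (\<Sum>l<p. \<mu> l * (norm (proj (F z (Suc l)) ** ?\<xi> v ** proj (F z l)))\<^sup>2)"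
      by (rule form[OF T]) (use flag_blocks F in auto)
    also have "\<dots> = (\<Sum>l<p. (cmod v)\<^sup>2 * (\<mu> l * (norm (A l z))\<^sup>2))"
      by (rule sum.cong) (auto simp: F flag_blocks norm_mat_scalar power_mult_distrib)
    finally show ?thesis by (simp add: sum_distrib_left)
  qed
  have sym: "g (F z) \<xi> \<eta> = g (F z) \<eta> \<xi>" and lin: "g (F z) (a *\<^sub>R \<xi> + b *\<^sub>R \<eta>) \<zeta> = a * g (F z) \<xi> \<zeta> + b * g (F z) \<eta> \<zeta>"
    if "\<xi> \<in> flag_tangent p (F z)" "\<eta> \<in> flag_tangent p (F z)" "\<zeta> \<in> flag_tangent p (F z)" for \<xi> \<eta> \<zeta> a b
    using g L that unfolding invariant_flag_metric_def by blast+
  have add: "?\<xi> (1 + \<i>) = 1 *\<^sub>R ?\<xi> 1 + 1 *\<^sub>R ?\<xi> \<i>"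
    unfolding flag_differential_frame by (simp add: mat_scalar vec_eq_iff algebra_simps)
  have "g (F z) (?\<xi> (1 + \<i>)) (?\<xi> (1 + \<i>)) = g (F z) (?\<xi> 1) (?\<xi> 1) + 2 * g (F z) (?\<xi> 1) (?\<xi> \<i>) + g (F z) (?\<xi> \<i>) (?\<xi> \<i>)"
  proof -
    have 1: "g (F z) (?\<xi> (1 + \<i>)) \<zeta> = g (F z) (?\<xi> 1) \<zeta> + g (F z) (?\<xi> \<i>) \<zeta>" if "\<zeta> \<in> flag_tangent p (F z)" for \<zeta>
      unfolding add using lin[OF T T that, of 1 1 1 \<i>] by simp
    have "g (F z) (?\<xi> (1 + \<i>)) (?\<xi> (1 + \<i>)) = g (F z) (?\<xi> (1 + \<i>)) (?\<xi> 1) + g (F z) (?\<xi> (1 + \<i>)) (?\<xi> \<i>)"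
      using 1[OF T, of "1 + \<i>"] sym[OF T[of 1] T[of "1 + \<i>"] T[of 1]] sym[OF T[of \<i>] T[of "1 + \<i>"] T[of 1]] by simp
    then show ?thesis using 1[OF T, of 1] 1[OF T, of \<i>] sym[OF T[of 1] T[of \<i>] T[of 1]] by simp
  qed
  then have off: "g (F z) (?\<xi> 1) (?\<xi> \<i>) = 0"
    unfolding q by (simp add: cmod_power2)
  then have off': "g (F z) (?\<xi> \<i>) (?\<xi> 1) = 0" using sym[OF T[of 1] T[of \<i>] T[of 1]] by simp
  have "flag_induced g p F z $ a $ b = mat ?\<rho> $ a $ b" for a b
    using exhaust_2[of a] exhaust_2[of b] off off' q[of 1] q[of \<i>]
    by (auto simp: flag_induced_def mat_def)
  then show ?thesis by (simp add: vec_eq_iff)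
qed

end

lemma in_flag_manifold:
  assumes "\<And>j. j \<le> p \<Longrightarrow> L j \<in> grassmannian (k j)" "\<And>j. j \<le> p \<Longrightarrow> proj (L j) = P j z"
  shows "(\<lambda>j\<in>{..p}. L j) \<in> flag_manifold p k"
proof -
  have r: "range ((*v) (P j z)) = L j" if "j \<le> p" for j
    using proj_works(2)[of "L j"] assms that unfolding grassmannian_def by auto
  have "L i \<subseteq> orth (L j)" if "i \<le> p" "j \<le> p" "i \<noteq> j" for i j
  proof -
    have "orth (L j) = range ((*v) (mat 1 - P j z))"
      using oproj_orth[OF oproj[OF that(2), of z]] r[OF that(2)] by simp
    moreover have "(mat 1 - P j z) ** P i z = P i z"
      using orthogonal[OF that(2,1), of z] that by (simp add: matrix_diff_rdistrib)
    ultimately show ?thesis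
      using oproj_le_iff[OF oproj_complement[OF oproj[OF that(2), of z]], of "P i z"] r[OF that(1)] by simp
  qed
  moreover have "vec.span (\<Union>j\<le>p. L j) = UNIV"
  proof -
    have "x \<in> vec.span (\<Union>j\<le>p. L j)" for x
    proof -
      have s: "(\<Sum>j\<in>I. M j) *v x = (\<Sum>j\<in>I. M j *v x)" if "finite I" for I and M :: "nat \<Rightarrow> complex^'n^'n"
        using that by (induction I rule: finite_induct) (auto simp: matrix_vector_mult_add_rdistrib)
      have "x = (\<Sum>j\<le>p. P j z *v x)" using s[of "{..p}" "\<lambda>j. P j z"] complete[of z] by simp
      also have "\<dots> \<in> vec.span (\<Union>j\<le>p. L j)"
      proof (intro vec.span_sum vec.span_base)
        fix j assume "j \<in> {..p}"
        then show "P j z *v x \<in> (\<Union>j\<le>p. L j)" using r[of j] by blast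
      qed
      finally show ?thesis .
    qed
    then show ?thesis by auto
  qed
  ultimately show ?thesis using assms(1) by (auto simp: flag_manifold_def)
qed

lemma smooth_density: "smooth_on (\<lambda>z. \<Sum>l<p. \<mu> l * (norm (A l z))\<^sup>2) UNIV"
proof -
  have "smooth_on (\<lambda>z. (norm (A l z))\<^sup>2) UNIV" if "l \<le> p" for l
  proof -
    have "smooth_on (\<lambda>z. Re (trace (adj (A l z) ** A l z))) UNIV"
      by (intro smooth_on_Re smooth_on_trace msmooth_mult msmooth_adj smooth_A[OF that] open_UNIV)
    then show ?thesis by (simp add: trace_adj_mult_self)
  qed
  then show ?thesis by (intro smooth_on_sum smooth_on_mult smooth_on_const open_UNIV) auto
qed

lemma continuous_norm_A: "l \<le> p \<Longrightarrow> continuous_on UNIV (\<lambda>z. (norm (A l z))\<^sup>2)"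
proof -
  assume l: "l \<le> p"
  have "smooth_on (\<lambda>z. Re (trace (adj (A l z) ** A l z))) UNIV"
    by (intro smooth_on_Re smooth_on_trace msmooth_mult msmooth_adj smooth_A[OF l] open_UNIV)
  then show ?thesis using smooth_on_continuous by (simp add: trace_adj_mult_self)
qed

end

text \<open>Both sides derive from the same bundle; the factor is \<open>|d(1/z)/dz|\<^sup>2\<close>.\<close>

lemma norm_A_inversion:
  assumes P: "harmonic_frame p P" and Q: "harmonic_frame p Q"
    and PQ: "\<And>j w. w \<noteq> 0 \<Longrightarrow> P j w = Q j (1 / w)" and j: "j \<le> p" and z: "z \<noteq> 0"
  shows "(norm (harmonic_frame.A P j z))\<^sup>2 = (norm (harmonic_frame.A Q j (1 / z)))\<^sup>2 / (cmod z) ^ 4"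
proof -
  interpret p: harmonic_frame p P by (rule P)
  interpret q: harmonic_frame p Q by (rule Q)
  have inv: "((\<lambda>w. 1 / w) has_field_derivative - (1 / z\<^sup>2)) (at z)"
    using z by (auto intro!: derivative_eq_intros simp: power2_eq_square)
  have op: "open (- {0::complex})" by auto
  have md: "mdiff (q.R j) (1 / z)"
    using holomorphic_bundle.md(1)[OF q.osculating_bundle[OF j]] by blast
  have "p.A j z = Dm 1 (\<lambda>w. q.R j (1 / w)) z"
    unfolding p.A_def
    by (rule Dm_cong_open[OF op]) (use z PQ in \<open>auto simp: p.R_def q.R_def\<close>)
  also have "\<dots> = mat (- (1 / z\<^sup>2)) ** q.A j (1 / z)"
  proof -
    have "wd 1 (\<lambda>w. q.R j (1 / w) $ i $ l) z = wd 1 (\<lambda>w. q.R j w $ i $ l) (1 / z) * - (1 / z\<^sup>2)" for i l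
      using wd_compose_holomorphic(1)[OF inv, of "\<lambda>w. q.R j w $ i $ l"] md by (simp add: mdiff_def)
    then show ?thesis by (simp add: q.A_def Dm_def mat_scalar vec_eq_iff)
  qed
  finally have "norm (p.A j z) = norm (q.A j (1 / z)) / (cmod z)\<^sup>2"
    by (simp add: norm_mat_scalar norm_divide norm_power)
  then show ?thesis by (simp add: power_divide flip: power_mult)
qed

text \<open>If \<open>A\<^sub>j\<close> vanished identically, the next Gauss bundle would be generically zero, against its
  positive rank.\<close>

lemma harmonic_sequence_nonzero:
  fixes \<psi> :: "nat \<Rightarrow> riemann_sphere \<Rightarrow> (complex^'n) set"
  assumes hs: "harmonic_sequence p k \<psi>" and full: "linearly_full (\<psi> 0)" and c: "c \<in> charts" and j: "j < p"
  shows "\<exists>z. harmonic_frame.A (\<lambda>j z. proj (\<psi> j (c z))) j z \<noteq> 0"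
proof (rule ccontr)
  interpret harmonic_frame p "\<lambda>j z. proj (\<psi> j (c z))" by (rule harmonic_sequence_frame[OF hs full c])
  assume "\<not> (\<exists>z. A j z \<noteq> 0)"
  then have A0: "Dm 1 (\<lambda>z. proj (\<psi> j (c z))) z ** proj (\<psi> j (c z)) = 0" for z using A_eq[of j z] j by simp
  have sg: "smooth_grass_map (k i) (\<psi> i)" "0 < k i" if "i \<le> p" for i
    using hs that unfolding harmonic_sequence_def by auto
  have fg: "first_gauss_bundle (\<psi> j) (\<psi> (Suc j))"
    using hs j unfolding harmonic_sequence_def by blast
  have img: "A'_image (\<psi> j \<circ> c) z = {0}" for z
    using A'_image_eq[of "\<psi> j \<circ> c" z] smooth_grass_map_proj[OF sg(1) c, of j] j A0[of z] by (auto simp: comp_def)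
  obtain S where S: "S sparse_in UNIV" "\<And>z. z \<notin> S \<Longrightarrow> \<psi> (Suc j) (c z) = {0}"
    using fg c img unfolding first_gauss_bundle_def by blast
  obtain N where N: "open N" "(0::complex) \<in> N" "\<forall>y\<in>N. y \<noteq> 0 \<longrightarrow> y \<notin> S"
    using sparse_in_not_in[OF S(1) UNIV_I] by metis
  have "\<exists>y\<in>N. y \<noteq> 0"
    using islimpt_UNIV[of "0::complex"] N unfolding islimpt_def by blast
  then obtain y where "\<psi> (Suc j) (c y) = {0}" using N S(2) by blast
  moreover have "vec.dim (\<psi> (Suc j) (c y)) = k (Suc j)"
    using smooth_grass_map_proj(2)[OF sg(1) c] j by simp
  ultimately have "k (Suc j) = 0" by simp
  then show False using sg(2)[of "Suc j"] j by simp
qed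

section \<open>Constant curvature of the primitive lift\<close>
theorem theorem3p1:
  fixes \<psi> :: "nat \<Rightarrow> riemann_sphere \<Rightarrow> (complex^'n) set"
    and k :: "nat \<Rightarrow> nat" and p :: nat
  assumes "harmonic_sequence p k \<psi>"
    and "linearly_full (\<psi> 0)"
    and "flag_immersion p (primitive_lift p \<psi>)"
    and "\<exists>g. invariant_flag_metric p k g \<and> flag_constant_curvature g p (primitive_lift p \<psi>)"
  shows "(\<forall>g. invariant_flag_metric p k g \<longrightarrow>
              flag_constant_curvature g p (primitive_lift p \<psi>)) \<and>
         (\<forall>j\<le>p. minimal_immersion (\<psi> j) \<and>
                grass_constant_curvature (\<psi> j) \<and>
                constant_kahler_angle (\<psi> j))"
proof -
  note hs = assms(1) and full = assms(2)
  define P where "P c j z = proj (\<psi> j (c z))" for c :: "complex \<Rightarrow> riemann_sphere" and j z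
  define F where "F c z = primitive_lift p \<psi> (c z)" for c :: "complex \<Rightarrow> riemann_sphere" and z
  have F_abs: "primitive_lift p \<psi> \<circ> c = F c" for c by (auto simp: F_def)
  have sg: "smooth_grass_map (k j) (\<psi> j)" "0 < k j" if "j \<le> p" for j
    using hs that unfolding harmonic_sequence_def by auto
  have frame: "harmonic_frame p (P c)" if "c \<in> charts" for c
    using harmonic_sequence_frame[OF hs full that] unfolding P_def[abs_def] .
  have smP: "smooth_on (P c j) UNIV" if "c \<in> charts" "j \<le> p" for c j
    using smooth_grass_map_proj(3)[OF sg(1)[OF that(2)] that(1)] unfolding P_def[abs_def] .
  have PF: "proj (F c z j) = P c j z" if "j \<le> p" for c j z
    using that by (simp add: F_def primitive_lift_def P_def)
  have memF: "F c z \<in> flag_manifold p k" if c: "c \<in> charts" for c z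
  proof -
    have "\<psi> j (c z) \<in> grassmannian (k j)" if "j \<le> p" for j
      using sg(1)[OF that] unfolding smooth_grass_map_def by blast
    then have "(\<lambda>j\<in>{..p}. \<psi> j (c z)) \<in> flag_manifold p k"
      by (intro harmonic_frame.in_flag_manifold[OF frame[OF c], of _ _ z]) (simp_all add: P_def)
    then show ?thesis by (simp add: F_def primitive_lift_def)
  qed
  have c0: "chart_0 \<in> charts" "chart_inf \<in> charts" by (auto simp: charts_def)
  \<comment> \<open>The densities \<open>\<gamma>\<^sub>j\<close> in either chart; every invariant metric induces a positive combination of
    them.\<close>
  define n where "n c j z = (norm (harmonic_frame.A (P c) j z))\<^sup>2" for c j z
  have induced: "\<exists>\<mu>. (\<forall>l<p. 0 < \<mu> l) \<and>
      (\<forall>c\<in>charts. \<forall>z. flag_induced g p (F c) z = mat (\<Sum>l<p. \<mu> l * n c l z))"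
    if g: "invariant_flag_metric p k g" for g
  proof -
    have "flag_manifold p k \<noteq> ({} :: (nat \<Rightarrow> (complex^'n) set) set)" using memF[OF c0(1)] by blast
    from invariant_metric_form[OF g this sg(2)] obtain \<mu> where \<mu>: "\<forall>l<p. 0 < \<mu> l"
      "\<And>L \<xi>. L \<in> flag_manifold p k \<Longrightarrow> \<xi> \<in> flag_tangent p L \<Longrightarrow>
         (\<forall>i\<le>p. \<forall>j\<le>p. i \<noteq> Suc j \<longrightarrow> j \<noteq> Suc i \<longrightarrow> proj (L i) ** \<xi> ** proj (L j) = 0) \<Longrightarrow>
         g L \<xi> \<xi> = (\<Sum>l<p. \<mu> l * (norm (proj (L (Suc l)) ** \<xi> ** proj (L l)))\<^sup>2)" by blast
    have "flag_induced g p (F c) z = mat (\<Sum>l<p. \<mu> l * n c l z)" if c: "c \<in> charts" for c z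
      unfolding n_def
      by (rule harmonic_frame.flag_induced_frame[OF frame[OF c] PF smP[OF c] g memF[OF c] \<mu>(2)[OF memF[OF c]]])
    then show ?thesis using \<mu>(1) by blast
  qed
  obtain g where g: "invariant_flag_metric p k g" "flag_constant_curvature g p (primitive_lift p \<psi>)"
    using assms(4) by blast
  obtain K where K: "\<And>c z. c \<in> charts \<Longrightarrow> gauss_curvature (flag_induced g p (F c)) z = K"
    using g(2) unfolding flag_constant_curvature_def F_abs by blast
  obtain \<mu> where \<mu>: "\<And>l. l < p \<Longrightarrow> 0 < \<mu> l"
    and ind: "\<And>c z. c \<in> charts \<Longrightarrow> flag_induced g p (F c) z = mat (\<Sum>l<p. \<mu> l * n c l z)"
    using induced[OF g(1)] by blast
  define \<rho> where "\<rho> c z = (\<Sum>l<p. \<mu> l * n c l z)" for c z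
  have ind\<rho>: "flag_induced g p (F c) z = mat (\<rho> c z)" if "c \<in> charts" for c z
    using ind[OF that] unfolding \<rho>_def .
  have sm\<rho>: "smooth_on (\<rho> c) UNIV" if "c \<in> charts" for c
    using harmonic_frame.smooth_density[OF frame[OF that]] unfolding \<rho>_def[abs_def] n_def .
  have \<rho>pos: "\<rho> c z > 0" if c: "c \<in> charts" for c z
  proof -
    let ?\<xi> = "flag_differential p (F c) z"
    have "inj ?\<xi>" using assms(3) c unfolding flag_immersion_def F_abs by blast
    moreover have "?\<xi> 0 = 0"
      using harmonic_frame.flag_differential_frame[OF frame[OF c] PF smP[OF c], of z 0] by simp
    ultimately have "?\<xi> 1 \<noteq> 0" by (metis inj_eq zero_neq_one)
    moreover have "?\<xi> 1 \<in> flag_tangent p (F c z)"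
      by (rule harmonic_frame.flag_differential_tangent[OF frame[OF c] PF smP[OF c]])
    ultimately have "0 < g (F c z) (?\<xi> 1) (?\<xi> 1)"
      using g(1) memF[OF c, of z] unfolding invariant_flag_metric_def by blast
    also have "\<dots> = flag_induced g p (F c) z $ 1 $ 1" by (simp add: flag_induced_def)
    also have "\<dots> = \<rho> c z" unfolding ind\<rho>[OF c] by (simp add: mat_def)
    finally show ?thesis .
  qed
  have p: "p > 0" using \<rho>pos[OF c0(1), of 0] by (cases p) (auto simp: \<rho>_def)
  define v where "v c z = inverse (sqrt (\<rho> c z))" for c z
  have smv: "smooth_on (v c) UNIV" and vpos: "\<And>z. v c z > 0" and v\<rho>: "\<And>z. 1 / (v c z)\<^sup>2 = \<rho> c z"
    if c: "c \<in> charts" for c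
  proof -
    show "smooth_on (v c) UNIV"
      unfolding v_def[abs_def] by (rule smooth_on_inverse_sqrt) (use sm\<rho>[OF c] \<rho>pos[OF c] in auto)
    show "v c z > 0" for z using \<rho>pos[OF c, of z] by (simp add: v_def)
    show "1 / (v c z)\<^sup>2 = \<rho> c z" for z
      using \<rho>pos[OF c, of z] by (simp add: v_def power_divide inverse_eq_divide)
  qed
  have Pinv: "P chart_0 j z = P chart_inf j (1 / z)" "P chart_inf j z = P chart_0 j (1 / z)" if "z \<noteq> 0" for j z
    using that by (simp_all add: P_def chart_0_def chart_inf_def)
  have n0: "n chart_0 j z = n chart_inf j (1 / z) / (cmod z) ^ 4"
    and ninf: "n chart_inf j z = n chart_0 j (1 / z) / (cmod z) ^ 4" if "z \<noteq> 0" "j \<le> p" for j z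
    unfolding n_def
    by (rule norm_A_inversion[OF frame[OF c0(1)] frame[OF c0(2)] Pinv(1) that(2,1)], assumption)
      (rule norm_A_inversion[OF frame[OF c0(2)] frame[OF c0(1)] Pinv(2) that(2,1)], assumption)
  have \<rho>0: "\<rho> chart_0 z = \<rho> chart_inf (1 / z) / (cmod z) ^ 4"
    and \<rho>inf: "\<rho> chart_inf z = \<rho> chart_0 (1 / z) / (cmod z) ^ 4" if "z \<noteq> 0" for z
    unfolding \<rho>_def sum_divide_distrib using n0[OF that] ninf[OF that] by (auto intro!: sum.cong)
  \<comment> \<open>The density scales by \<open>|z|\<^sup>-\<^sup>4\<close> under inversion, hence \<open>v\<close> by \<open>|z|\<^sup>2\<close>.\<close>
  have "\<exists>c e b. c > 0 \<and> b > 0 \<and> (\<forall>z. v chart_0 z = c * (cmod (z - e))\<^sup>2 + b)"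
  proof (rule constant_curvature_quadratic)
    show "v chart_0 z = (cmod z)\<^sup>2 * v chart_inf (1 / z)" if "z \<noteq> 0" for z
    proof -
      have "sqrt ((cmod z) ^ 4) = (cmod z)\<^sup>2" by (rule real_sqrt_unique) (simp_all flip: power_mult)
      then show ?thesis unfolding v_def \<rho>0[OF that] by (simp add: real_sqrt_divide) (simp add: divide_inverse)
    qed
    show "v chart_0 z * (pd 1 (pd 1 (v chart_0)) z + pd 2 (pd 2 (v chart_0)) z) -
        (pd 1 (v chart_0) z)\<^sup>2 - (pd 2 (v chart_0) z)\<^sup>2 = K" for z
      using gauss_curvature_conformal[OF smv[OF c0(1)] vpos[OF c0(1)], of "flag_induced g p (F chart_0)" z]
        ind\<rho>[OF c0(1)] v\<rho>[OF c0(1)] K[OF c0(1)] by simp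
  qed (use smv vpos c0 in auto)
  then obtain a e b where ab: "a > 0" "b > 0" and vr: "\<And>z. v chart_0 z = radial a e b z"
    by (auto simp: radial_def)
  have rad: "1 / (radial a e b z)\<^sup>2 = \<rho> chart_0 z" for z
    using v\<rho>[OF c0(1), of z] unfolding vr .
  have "\<exists>\<delta>\<ge>0. \<forall>z. (norm (Dm 1 (harmonic_frame.R (P chart_0) j) z))\<^sup>2 = \<delta> / (radial a e b z)\<^sup>2" if "j < p" for j
  proof (rule density_rigidity[where p = p and \<mu> = \<mu> and R = "harmonic_frame.R (P chart_0)"])
    show "holomorphic_bundle (harmonic_frame.R (P chart_0) j)" if "j < p" for j
      by (rule harmonic_frame.osculating_bundle[OF frame[OF c0(1)]]) (use that in simp)
    show "(\<Sum>j<p. \<mu> j * (norm (Dm 1 (harmonic_frame.R (P chart_0) j) z))\<^sup>2) = 1 / (radial a e b z)\<^sup>2" for z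
      unfolding rad \<rho>_def n_def harmonic_frame.A_def[OF frame[OF c0(1)]] ..
  qed (use \<mu> ab that in auto)
  then obtain \<delta> where \<delta>: "\<And>j. j < p \<Longrightarrow> \<delta> j \<ge> 0"
    "\<And>j z. j < p \<Longrightarrow> (norm (Dm 1 (harmonic_frame.R (P chart_0) j) z))\<^sup>2 = \<delta> j / (radial a e b z)\<^sup>2" by metis
  have proportional0: "n chart_0 j z = \<delta> j * \<rho> chart_0 z" if "j < p" for j z
    using \<delta>(2)[OF that, of z] rad[of z] unfolding n_def harmonic_frame.A_def[OF frame[OF c0(1)]]
    by (metis mult.right_neutral times_divide_eq_right)
  \<comment> \<open>Proportionality passes to the other chart by inversion, and to the point at infinity by
    continuity.\<close>
  have proportional: "n c j z = \<delta> j * \<rho> c z" if c: "c \<in> charts" and j: "j < p" for c j z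
  proof -
    have off: "n chart_inf j w = \<delta> j * \<rho> chart_inf w" if "w \<noteq> 0" for w
      using ninf[OF that, of j] \<rho>inf[OF that] proportional0[OF j, of "1 / w"] j by simp
    have "n chart_inf j 0 - \<delta> j * \<rho> chart_inf 0 = 0"
    proof -
      have "continuous_on UNIV (\<lambda>w. n chart_inf j w - \<delta> j * \<rho> chart_inf w)"
        using harmonic_frame.continuous_norm_A[OF frame[OF c0(2)], of j] smooth_on_continuous[OF sm\<rho>[OF c0(2)]] j
        unfolding n_def by (auto intro!: continuous_intros)
      then have "((\<lambda>w. n chart_inf j w - \<delta> j * \<rho> chart_inf w) \<longlongrightarrow> n chart_inf j 0 - \<delta> j * \<rho> chart_inf 0) (at 0)"
        by (simp add: continuous_on_eq_continuous_at isCont_def)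
      moreover have "((\<lambda>w. n chart_inf j w - \<delta> j * \<rho> chart_inf w) \<longlongrightarrow> 0) (at 0)"
        by (rule tendsto_eventually) (use off in \<open>auto simp: eventually_at_filter\<close>)
      ultimately show ?thesis using tendsto_unique[OF at_neq_bot] by blast
    qed
    then have "n chart_inf j w = \<delta> j * \<rho> chart_inf w" for w using off[of w] by (cases "w = 0") auto
    then show ?thesis using c proportional0[OF j] by (auto simp: charts_def)
  qed
  have \<delta>pos: "\<delta> j > 0" if j: "j < p" for j
  proof -
    obtain z where "harmonic_frame.A (P chart_0) j z \<noteq> 0"
      using harmonic_sequence_nonzero[OF hs full c0(1) j] unfolding P_def[abs_def] by blast
    then have "n chart_0 j z \<noteq> 0" by (simp add: n_def)
    then show ?thesis using proportional0[OF j, of z] \<delta>(1)[OF j] by (cases "\<delta> j = 0") auto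
  qed
  have curv: "gauss_curvature m z = K / s"
    if c: "c \<in> charts" and s: "s > 0" and m: "\<And>z. m z = mat (s * \<rho> c z)" for c s m z
    using gauss_curvature_scale[OF sm\<rho>[OF c] \<rho>pos[OF c] s ind\<rho>[OF c] m, of z] K[OF c] by simp
  have "flag_constant_curvature g' p (primitive_lift p \<psi>)" if g': "invariant_flag_metric p k g'" for g'
  proof -
    obtain \<mu>' where \<mu>': "\<And>l. l < p \<Longrightarrow> 0 < \<mu>' l"
      and ind': "\<And>c z. c \<in> charts \<Longrightarrow> flag_induced g' p (F c) z = mat (\<Sum>l<p. \<mu>' l * n c l z)"
      using induced[OF g'] by blast
    define s where "s = (\<Sum>l<p. \<mu>' l * \<delta> l)"
    have "s > 0" unfolding s_def using p \<mu>' \<delta>pos by (intro sum_pos) (auto simp: lessThan_empty_iff)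
    moreover have "flag_induced g' p (F c) z = mat (s * \<rho> c z)" if "c \<in> charts" for c z
      unfolding ind'[OF that] s_def sum_distrib_right
      by (rule arg_cong[of _ _ mat], rule sum.cong) (auto simp: proportional[OF that])
    ultimately have "gauss_curvature (flag_induced g' p (F c)) z = K / s" if "c \<in> charts" for c z
      using curv[OF that] that by blast
    then show ?thesis unfolding flag_constant_curvature_def F_abs by blast
  qed
  moreover have "minimal_immersion (\<psi> j) \<and> grass_constant_curvature (\<psi> j) \<and> constant_kahler_angle (\<psi> j)"
    if j: "j \<le> p" for j
  proof -
    \<comment> \<open>The shares of the outgoing and the incoming form at \<open>\<psi>\<^sub>j\<close>; at the two ends of the sequence
      one of them is absent.\<close>
    define \<alpha> where "\<alpha> = (if j < p then \<delta> j else 0)"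
    define \<beta> where "\<beta> = (case j of 0 \<Rightarrow> 0 | Suc i \<Rightarrow> \<delta> i)"
    have nonneg: "\<alpha> \<ge> 0" "\<beta> \<ge> 0" using \<delta>pos j by (auto simp: \<alpha>_def \<beta>_def less_imp_le split: nat.split)
    have s: "\<alpha> + \<beta> > 0"
    proof (cases "j < p")
      case True
      then show ?thesis using nonneg \<delta>pos by (simp add: \<alpha>_def add_pos_nonneg)
    next
      case False
      then obtain i where "j = Suc i" using p j by (cases j) auto
      then show ?thesis using nonneg \<delta>pos[of i] j by (simp add: \<beta>_def add_nonneg_pos)
    qed
    have nA: "(norm (harmonic_frame.A (P c) j z))\<^sup>2 = \<alpha> * \<rho> c z" if c: "c \<in> charts" for c z
    proof (cases "j < p")
      case True
      then show ?thesis using proportional[OF c True, of z] by (simp add: \<alpha>_def n_def)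
    next
      case False
      then show ?thesis using harmonic_frame.A_last[OF frame[OF c], of z] j by (simp add: \<alpha>_def)
    qed
    have nB: "(norm (harmonic_frame.B (P c) j z))\<^sup>2 = \<beta> * \<rho> c z" if c: "c \<in> charts" for c z
      using proportional[OF c, of "j - 1" z] j unfolding harmonic_frame.B_def[OF frame[OF c]]
      by (cases j) (auto simp: \<beta>_def n_def)
    have fr: "\<And>z. proj ((\<psi> j \<circ> c) z) = P c j z" for c by (simp add: P_def)
    have en: "harmonic_frame.energy (P c) j z = (\<alpha> + \<beta>) * \<rho> c z" if c: "c \<in> charts" for c z
      unfolding harmonic_frame.energy_def[OF frame[OF c] j fr smP[OF c j]] nA[OF c] nB[OF c] by (simp add: distrib_right)
    have epos: "harmonic_frame.energy (P c) j z > 0" if c: "c \<in> charts" for c z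
      unfolding en[OF c] using s \<rho>pos[OF c] by simp
    have gi: "grass_induced (\<psi> j \<circ> c) z = mat ((\<alpha> + \<beta>) * \<rho> c z)" if c: "c \<in> charts" for c z
      using harmonic_frame.grass_induced_frame[OF frame[OF c] j fr smP[OF c j]] unfolding en[OF c] .
    have imm: "grass_immersion (\<psi> j)"
      unfolding grass_immersion_def
    proof (intro ballI allI)
      fix c z assume c: "c \<in> charts"
      show "inj (frechet_derivative (\<lambda>w. proj (\<psi> j (c w))) (at z))"
        using harmonic_frame.grass_immersion_frame[OF frame[OF c] j fr smP[OF c j] epos[OF c]] by simp
    qed
    have "minimal_immersion (\<psi> j)"
      unfolding minimal_immersion_def
      using imm harmonic_frame.mean_curvature_frame[OF frame j fr smP[OF _ j] epos] by blast
    moreover have "grass_constant_curvature (\<psi> j)"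
      unfolding grass_constant_curvature_def using curv[OF _ s gi] by blast
    moreover have "constant_kahler_angle (\<psi> j)"
    proof -
      have "kahler_angle (\<psi> j \<circ> c) z = arccos ((\<alpha> - \<beta>) / (\<alpha> + \<beta>))" if c: "c \<in> charts" for c z
      proof -
        have "(\<alpha> * \<rho> c z - \<beta> * \<rho> c z) / ((\<alpha> + \<beta>) * \<rho> c z) = (\<alpha> - \<beta>) / (\<alpha> + \<beta>)"
          using \<rho>pos[OF c, of z] unfolding left_diff_distrib[symmetric] by simp
        then show ?thesis
          using harmonic_frame.kahler_angle_frame[OF frame[OF c] j fr smP[OF c j] epos[OF c], of z]
          unfolding en[OF c] nA[OF c] nB[OF c] by (simp add: comp_def)
      qed
      then show ?thesis
        unfolding constant_kahler_angle_def conformal_immersion_def using imm gi by blast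
    qed
    ultimately show ?thesis by blast
  qed
  ultimately show ?thesis by blast
qed

end
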